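(* Let $\Theta''=\{\theta=(\varsigma,q)\in\Theta_{(r)}:\ \tau_\varsigma(2)<1,\ \tau_\varsigma(q)<0\}$. For $\theta=(\varsigma,q)$ with $\varsigma=(\vec\beta,\vec r)$ and $\theta'=(\varsigma',q')$ with $\varsigma'=(\vec\gamma,\vec s)$ put $$\rho_{\theta,\theta'}=\sum_{l=1}^d\Big[\tfrac1{\beta_l}\big(\tfrac1{r_l}-\tfrac1q\big)\Big]\wedge\Big[\tfrac1{\gamma_l}\big(\tfrac1{s_l}-\tfrac1{q'}\big)\Big],$$ and for $\theta\in\Theta''$ let $\Theta''[\theta]=\{\theta'=(\varsigma',q')\in\Theta'':\ \mathfrak z(\theta')>\mathfrak z(\theta),\ \rho_{\theta,\theta'}\ge1,\ q'\le q\}$. For any $\theta\in\Theta''$, any $\theta'\in\Theta''[\theta]$, any $\alpha\in(\mathfrak z(\theta),\mathfrak z(\theta'))$, and any $\vartheta=(\theta,\bar\theta)$, $\vartheta'=(\theta',\bar\theta')$ with $\bar\theta,\bar\theta'\in\Theta_{(c)}$, $$\liminf_{n\to\infty}\inf_{\widetilde N_n}\Big\{n^{2\alpha}\,\mathcal R_n^2\big[\widetilde N_n,\mathcal F_{\vartheta'}\big]+\Big(\tfrac{\sqrt{\ln n}}{n}\Big)^{-2\mathfrak z(\theta)}\mathcal R_n^2\big[\widetilde N_n,\mathcal F_{\vartheta}\big]\Big\}>0,$$ where the infimum is over all estimators.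
   Context: Model. $d\ge1$; one observes $X_1,\dots,X_n$ i.i.d. random vectors in $\mathbb R^d$ with density $f$ with respect to Lebesgue measure; $\mathbb E_f$ is expectation under the law of $(X_1,\dots,X_n)$. The functional to be estimated is $\|f\|_2$. An estimator $\widetilde N_n$ is any measurable real function of $(X_1,\dots,X_n)$. For a class $\mathbb F$ of functions (always understood as the probability densities with finite $\mathbb L_2$-norm belonging to it) put $\mathcal R_n[\widetilde N_n,\mathbb F]=\sup_{f\in\mathbb F}\big(\mathbb E_f[\widetilde N_n-\|f\|_2]^2\big)^{1/2}$. Parameters and classes. $\Theta_{(r)}=(0,\infty)^d\times[1,\infty]^d\times[2,\infty]$ with elements $\theta=(\varsigma,q)$, $\varsigma=(\vec\beta,\vec r)$; $\Theta_{(c)}=(0,\infty)^d\times(0,\infty)$ with elements $\bar\theta=(\vec L,Q)$; $\vartheta=(\theta,\bar\theta)$ and $\mathcal F_\vartheta=\mathbb N_{\vec r,d}(\vec\beta,\vec L)\cap\mathbb B_q(Q)$. Here $\mathbb B_q(Q)=\{f:\mathbb R^d\to\mathbb R:\|f\|_q\le Q\}$. Let $(e_1,\dots,e_d)$ be the canonical basis, $\Delta_{u,j}G(x)=G(x+ue_j)-G(x)$ and $\Delta^k_{u,j}=\Delta_{u,j}\Delta^{k-1}_{u,j}$. The anisotropic Nikolskii class $\mathbb N_{\vec r,d}(\vec\beta,\vec L)$ is the set of $G:\mathbb R^d\to\mathbb R$ such that $\|G\|_{r_j}\le L_j$ for all $j$ and there exist natural numbers $k_j>\beta_j$ with $\|\Delta^{k_j}_{u,j}G\|_{r_j}\le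 L_j|u|^{\beta_j}$ for all $u\in\mathbb R$, $j=1,\dots,d$. Exponents. $\frac1\beta=\sum_j\frac1{\beta_j}$, $\frac1{\omega_\varsigma}=\sum_j\frac1{\beta_jr_j}$, $\tau_\varsigma(s)=1-\frac1{\omega_\varsigma}+\frac1{\beta s}$, $s\in[1,\infty]$. $\mathfrak z(\theta)=\frac12\wedge\frac1{\tau_\varsigma(1)}$ if $\tau_\varsigma(2)\ge1$; $\mathfrak z(\theta)=\frac{1-2/q}{2-2/q-\tau_\varsigma(q)}$ if $\tau_\varsigma(2)<1$, $\tau_\varsigma(q)<0$; $\mathfrak z(\theta)=\frac12\wedge\frac{\tau_\varsigma(2)}{\tau_\varsigma(1)}$ if $\tau_\varsigma(2)<1$, $\tau_\varsigma(q)\ge0$. The minimax rate on $\mathcal F_\vartheta$ is $n^{-\mathfrak z(\theta)}$. Standing convention: only classes are considered on which a rate-optimal estimator exists and the minimax risk is of exact order $n^{-\mathfrak z(\theta)}$ (in particular the class is non-empty). *)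

theory Defs
  imports "HOL-Probability.Probability"
begin

text \<open>
  Integrability indices range over subsets of $[1,\infty]$ and are of type \<^typ>\<open>ennreal\<close>;
  \<open>recip p\<close> is $1/p$, with $1/\infty = 0$.
  The coordinates $1,\dots,d$ are the elements of the finite index type \<open>'d\<close>.
\<close>

definition recip :: "ennreal \<Rightarrow> real" where
  "recip p = enn2real (1 / p)"

text \<open>The map $x \mapsto x^a$ on $[0,\infty]$; only meant for $a > 0$.\<close>

definition epowr :: "ennreal \<Rightarrow> real \<Rightarrow> ennreal" where
  "epowr x a = (if x = \<infinity> then \<infinity> else ennreal (enn2real x powr a))"

definition Lnorm :: "ennreal \<Rightarrow> (real ^ 'd \<Rightarrow> real) \<Rightarrow> ennreal" where
  "Lnorm p f =
     (if p = \<infinity> then esssup lborel (\<lambda>x. ennreal \<bar>f x\<bar>)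
      else epowr (\<integral>\<^sup>+x. ennreal (\<bar>f x\<bar> powr enn2real p) \<partial>lborel) (1 / enn2real p))"

definition L2norm :: "(real ^ 'd \<Rightarrow> real) \<Rightarrow> real" where
  "L2norm f = enn2real (Lnorm 2 f)"


definition diff_op :: "real \<Rightarrow> 'd \<Rightarrow> (real ^ 'd \<Rightarrow> real) \<Rightarrow> (real ^ 'd \<Rightarrow> real)" where
  "diff_op u j G = (\<lambda>x. G (x + u *\<^sub>R axis j 1) - G x)"

definition nikolskii ::
    "('d \<Rightarrow> ennreal) \<Rightarrow> ('d \<Rightarrow> real) \<Rightarrow> ('d \<Rightarrow> real) \<Rightarrow> (real ^ 'd \<Rightarrow> real) set" where
  "nikolskii r \<beta> L =
     {G \<in> borel_measurable borel.
        (\<forall>j. Lnorm (r j) G \<le> ennreal (L j)) \<and>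
        (\<exists>k :: 'd \<Rightarrow> nat. \<forall>j. \<beta> j < real (k j) \<and>
           (\<forall>u :: real. Lnorm (r j) ((diff_op u j ^^ k j) G) \<le> ennreal (L j * \<bar>u\<bar> powr \<beta> j)))}"

definition Lball :: "ennreal \<Rightarrow> real \<Rightarrow> (real ^ 'd \<Rightarrow> real) set" where
  "Lball q Q = {f \<in> borel_measurable borel. Lnorm q f \<le> ennreal Q}"

definition L2_densities :: "(real ^ 'd \<Rightarrow> real) set" where
  "L2_densities =
     {f \<in> borel_measurable borel.
        (\<forall>x. 0 \<le> f x) \<and> (\<integral>\<^sup>+x. ennreal (f x) \<partial>lborel) = 1 \<and> Lnorm 2 f < \<infinity>}"


text \<open>
  A smoothness parameter $\varsigma = (\vec\beta, \vec r)$, a class parameter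
  $\theta = (\varsigma, q)$, and radii $\bar\theta = (\vec L, Q)$.
\<close>

type_synonym 'd smoothness = "('d \<Rightarrow> real) \<times> ('d \<Rightarrow> ennreal)"
type_synonym 'd param = "'d smoothness \<times> ennreal"
type_synonym 'd radii = "('d \<Rightarrow> real) \<times> real"

definition Theta_r :: "'d::finite param set" where
  "Theta_r = {((\<beta>, r), q). (\<forall>j. 0 < \<beta> j) \<and> (\<forall>j. 1 \<le> r j) \<and> 2 \<le> q}"

definition Theta_c :: "'d::finite radii set" where
  "Theta_c = {(L, Q). (\<forall>j. 0 < L j) \<and> 0 < Q}"

fun class_F :: "'d::finite param \<times> 'd radii \<Rightarrow> (real ^ 'd \<Rightarrow> real) set" where
  "class_F (((\<beta>, r), q), (L, Q)) = nikolskii r \<beta> L \<inter> Lball q Q"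

fun inv_beta :: "'d::finite smoothness \<Rightarrow> real" where
  "inv_beta (\<beta>, r) = (\<Sum>j\<in>UNIV. 1 / \<beta> j)"

fun inv_omega :: "'d::finite smoothness \<Rightarrow> real" where
  "inv_omega (\<beta>, r) = (\<Sum>j\<in>UNIV. 1 / \<beta> j * recip (r j))"

definition tau :: "'d::finite smoothness \<Rightarrow> ennreal \<Rightarrow> real" where
  "tau \<sigma> s = 1 - inv_omega \<sigma> + inv_beta \<sigma> * recip s"

fun rate_exp :: "'d::finite param \<Rightarrow> real" where
  "rate_exp (\<sigma>, q) =
     (if tau \<sigma> 2 \<ge> 1 then min (1 / 2) (1 / tau \<sigma> 1)
      else if tau \<sigma> q < 0 then (1 - 2 * recip q) / (2 - 2 * recip q - tau \<sigma> q)
      else min (1 / 2) (tau \<sigma> 2 / tau \<sigma> 1))"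

definition Theta'' :: "'d::finite param set" where
  "Theta'' = {(\<sigma>, q) \<in> Theta_r. tau \<sigma> 2 < 1 \<and> tau \<sigma> q < 0}"

fun rho :: "'d::finite param \<Rightarrow> 'd param \<Rightarrow> real" where
  "rho ((\<beta>, r), q) ((\<gamma>, s), q') =
     (\<Sum>l\<in>UNIV. min (1 / \<beta> l * (recip (r l) - recip q)) (1 / \<gamma> l * (recip (s l) - recip q')))"

definition Theta''_at :: "'d::finite param \<Rightarrow> 'd param set" where
  "Theta''_at \<theta> =
     {\<theta>' \<in> Theta''. rate_exp \<theta>' > rate_exp \<theta> \<and> rho \<theta> \<theta>' \<ge> 1 \<and> snd \<theta>' \<le> snd \<theta>}"


text \<open>The observation $(X_1,\dots,X_n)$ is a function on the index set \<^term>\<open>{..<n}\<close>.\<close>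

definition sample_law :: "nat \<Rightarrow> (real ^ 'd \<Rightarrow> real) \<Rightarrow> (nat \<Rightarrow> real ^ 'd) measure" where
  "sample_law n f = (\<Pi>\<^sub>M i\<in>{..<n}. density lborel (\<lambda>x. ennreal (f x)))"

definition estimators :: "nat \<Rightarrow> ((nat \<Rightarrow> real ^ 'd) \<Rightarrow> real) set" where
  "estimators n = borel_measurable (\<Pi>\<^sub>M i\<in>{..<n}. (borel :: (real ^ 'd) measure))"

text \<open>
  The quadratic risk for the estimation of $\|f\|_2$, with values in $[0,\infty]$. As a
  function class always stands for the densities in it, the supremum runs over
  \<open>F \<inter> L2_densities\<close>.
\<close>

definition risk ::
    "nat \<Rightarrow> ((nat \<Rightarrow> real ^ 'd) \<Rightarrow> real) \<Rightarrow> (real ^ 'd \<Rightarrow> real) set \<Rightarrow> ennreal" where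
  "risk n N F =
     (SUP f \<in> F \<inter> L2_densities.
        epowr (\<integral>\<^sup>+X. ennreal ((N X - L2norm f)\<^sup>2) \<partial>sample_law n f) (1 / 2))"

text \<open>
  The classes under consideration: the minimax risk is of exact order $n^{-\mathfrak z(\theta)}$,
  and this order is attained by a sequence of estimators. The lower bound forces the class to
  contain a density, since the supremum of the empty set is \<^term>\<open>0 :: ennreal\<close>.
\<close>

definition has_minimax_rate :: "'d::finite param \<times> 'd radii \<Rightarrow> bool" where
  "has_minimax_rate v \<longleftrightarrow>
     (\<exists>N. (\<forall>n. N n \<in> estimators n) \<and>
        limsup (\<lambda>n. ennreal (real n powr rate_exp (fst v)) * risk n (N n) (class_F v)) < \<infinity>) \<and>
     0 < liminf (\<lambda>n. ennreal (real n powr rate_exp (fst v)) *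
                      (INF N\<in>estimators n. risk n N (class_F v)))"

end

(* Write b = 1/q and E = 1/omega - (1/beta) b, so that z(theta) = (1 - 2b) / (1 - 2b + E).

   If some r_j exceeded q, then the class would lie in a ball of L_p with p = r_j > q. A quadratic
   statistic whose kernel comes from smoothing over a hyperbolic cross of dyadic levels would then
   attain a rate strictly better than n^(-z(theta)), against the assumption on the minimax risk.
   Hence r_j <= q, and likewise s_j <= q'.

   In that case fix S in (0,1]. The null density, which lies in both classes, has height h of order
   S^(-b) on a box of volume S and is spread thinly elsewhere. It is perturbed by independent random
   signs times h times bumps that tile the box. The bumps have sides S^((1/r_l - 1/q) / beta_l), as
   large as the first class requires, and the box has sides S^(e_l / rho), where e_l is the l-th
   summand of rho; since rho >= 1, the bumps fit into the box, and the edge of the box is smooth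
   enough for both classes. The perturbation moves the L2-norm by order S^(1/2 - b), while the
   second moment of the likelihood ratio of the mixture is at most exp(c n^2 S^(1 - 2b + E)). With
   n^2 S^(1 - 2b + E) a small multiple of ln n this is a small power of n, which the ratio of the two
   normalizing factors absorbs as long as alpha > z(theta); the factor sqrt(ln n) in the rate is
   what remains of S^(1/2 - b). *)

theory Submission
  imports Defs "HOL-Real_Asymp.Real_Asymp"
begin

subsection \<open>Bounds for \<open>L\<^sub>p\<close>-norms\<close>

text \<open>The classes leave the order k_j of the difference open, and orders are unbounded within
  one class. The bias of the smoothing therefore rests on a comparison of differences whose constant
  does not grow with the order; it uses symmetric second differences, where the Fourier symbols
  sin^2 and cos^2 add up to 1. The hyperbolic cross answers the mixed norms: smoothness in direction
  l is measured in its own L_(r_l), but a piece that is a detail in several directions is small in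
  each of their norms, and interpolation to L_2 makes its size depend on the total level alone. In
  the lower bound the growing second moment means that the two laws need not be close in total
  variation; a pointwise inequality between the two weighted risks takes the place of that distance.
  Total mass 1 needs care at index 1: mass spread thinly is small in L_r only for r > 1, and for r_j
  = 1 the bound L_j >= 1 comes from the non-emptiness of the class. The hypothesis q' <= q makes the
  height S^(-1/q) admissible in the second class.\<close>

text \<open>Measurability and a real bound in one predicate: powers and roots are then taken of
  reals only, and the infinite and the finite index are handled through \<open>norm_le_top\<close>
  and \<open>norm_le_finite\<close>.\<close>

definition norm_le :: "ennreal \<Rightarrow> (real ^ 'd \<Rightarrow> real) \<Rightarrow> real \<Rightarrow> bool" where
  "norm_le r f B \<longleftrightarrow> f \<in> borel_measurable borel \<and> Lnorm r f \<le> ennreal B"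

lemma epowr_le_iff:
  assumes "0 < a" "0 \<le> B"
  shows "epowr x a \<le> ennreal B \<longleftrightarrow> x \<le> ennreal (B powr (1 / a))"
proof (cases x)
  case (real y)
  have "y powr a \<le> B \<longleftrightarrow> y \<le> B powr (1 / a)"
  proof
    assume "y powr a \<le> B"
    then have "(y powr a) powr (1 / a) \<le> B powr (1 / a)"
      using assms by (intro powr_mono2) auto
    then show "y \<le> B powr (1 / a)" using assms real by (simp add: powr_powr)
  next
    assume "y \<le> B powr (1 / a)"
    then have "y powr a \<le> (B powr (1 / a)) powr a"
      using assms real by (intro powr_mono2) auto
    then show "y powr a \<le> B" using assms real by (simp add: powr_powr)
  qed
  then show ?thesis using real assms by (simp add: epowr_def)
qed (use assms in \<open>auto simp: epowr_def top_unique\<close>)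

lemma ge_one_finite_cases:
  assumes "1 \<le> (r :: ennreal)"
  obtains "r = \<top>" | "r \<noteq> \<top>" "1 \<le> enn2real r"
proof (cases r)
  case (real x)
  then show ?thesis using assms that(2) ennreal_le_iff[of x 1] ennreal_1
    by (metis enn2real_ennreal ennreal_ge_1 ennreal_neq_top infinity_ennreal_def)
qed (use that(1) in auto)

lemma recip_top [simp]: "recip \<top> = 0"
  by (auto simp: recip_def)

lemma recip_finite:
  assumes "1 \<le> r" "r \<noteq> \<top>"
  shows "recip r = 1 / enn2real r"
proof -
  obtain x where x: "r = ennreal x" "0 \<le> x" using assms(2) by (cases r) auto
  then have "1 \<le> x" using assms(1) by simp
  then have "1 / r = ennreal (1 / x)"
    using x divide_ennreal[of 1 x] by simp
  then show ?thesis using x by (simp add: recip_def)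
qed

lemma recip_nonneg: "0 \<le> recip r"
  by (simp add: recip_def)

lemma recip_le_one:
  assumes "1 \<le> r"
  shows "recip r \<le> 1"
  using assms by (rule ge_one_finite_cases) (use assms in \<open>auto simp: recip_finite\<close>)

lemma recip_antimono:
  assumes "1 \<le> r" "r \<le> s"
  shows "recip s \<le> recip r"
proof (cases "s = \<top>")
  case False
  then have "r \<noteq> \<top>" "s < \<top>" using assms by (auto simp: top_unique less_top)
  moreover have "1 \<le> s" using assms by simp
  moreover have "enn2real r \<le> enn2real s" using assms False
    by (intro enn2real_mono) (auto simp: less_top)
  moreover have "1 \<le> enn2real r" using assms(1) \<open>r \<noteq> \<top>\<close> by (auto elim: ge_one_finite_cases)
  ultimately show ?thesis using assms by (auto simp: recip_finite intro!: divide_left_mono)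
qed (auto simp: recip_nonneg)

lemma recip_strict_antimono:
  assumes "1 \<le> r" "r < s"
  shows "recip s < recip r"
proof -
  have r: "r \<noteq> \<top>" using assms(2) by auto
  have r1: "1 \<le> enn2real r" using assms(1) r by (auto elim: ge_one_finite_cases)
  show ?thesis
  proof (cases "s = \<top>")
    case True
    then show ?thesis using r r1 assms by (simp add: recip_finite)
  next
    case False
    have "enn2real r < enn2real s" using assms(2) r False
      by (metis enn2real_less_iff ennreal_enn2real_if infinity_ennreal_def le_zero_eq less_top zero_le)
    then show ?thesis using r r1 assms False
      by (auto simp: recip_finite intro!: divide_strict_left_mono)
  qed
qed

lemma norm_le_top:
  assumes "0 \<le> B"
  shows "norm_le \<top> f B \<longleftrightarrow> f \<in> borel_measurable borel \<and> (AE x in lborel. \<bar>f x\<bar> \<le> B)"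
proof (cases "f \<in> borel_measurable borel")
  case True
  then have m: "(\<lambda>x. ennreal \<bar>f x\<bar>) \<in> borel_measurable lborel" by simp
  have "esssup lborel (\<lambda>x. ennreal \<bar>f x\<bar>) \<le> ennreal B \<longleftrightarrow> (AE x in lborel. ennreal \<bar>f x\<bar> \<le> ennreal B)"
  proof
    assume *: "esssup lborel (\<lambda>x. ennreal \<bar>f x\<bar>) \<le> ennreal B"
    have "AE x in lborel. ennreal \<bar>f x\<bar> \<le> esssup lborel (\<lambda>x. ennreal \<bar>f x\<bar>)" by (rule esssup_AE)
    then show "AE x in lborel. ennreal \<bar>f x\<bar> \<le> ennreal B" by eventually_elim (use * in auto)
  qed (rule esssup_I[OF m])
  then show ?thesis using assms True by (simp add: norm_le_def Lnorm_def)
qed (simp add: norm_le_def)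

lemma norm_le_finite:
  assumes "0 \<le> B" "1 \<le> r" "r \<noteq> \<top>"
  shows "norm_le r f B \<longleftrightarrow> f \<in> borel_measurable borel \<and>
    (\<integral>\<^sup>+x. ennreal (\<bar>f x\<bar> powr enn2real r) \<partial>lborel) \<le> ennreal (B powr enn2real r)"
proof -
  have "1 \<le> enn2real r" using assms by (auto elim: ge_one_finite_cases)
  then show ?thesis using assms by (simp add: norm_le_def Lnorm_def epowr_le_iff)
qed

lemma norm_le_measurable: "norm_le r f B \<Longrightarrow> f \<in> borel_measurable borel"
  by (simp add: norm_le_def)

lemma norm_le_weaken: "norm_le r f B \<Longrightarrow> B \<le> B' \<Longrightarrow> norm_le r f B'"
  unfolding norm_le_def by (auto intro: order_trans ennreal_leI)

lemma norm_le_mono_AE: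
  assumes "1 \<le> r" "0 \<le> B" "norm_le r g B" "f \<in> borel_measurable borel"
    and le: "AE x in lborel. \<bar>f x\<bar> \<le> \<bar>g x\<bar>"
  shows "norm_le r f B"
  using assms(1)
proof (cases rule: ge_one_finite_cases)
  case 1
  have "AE x in lborel. \<bar>g x\<bar> \<le> B" using assms(3) 1 by (simp add: norm_le_top[OF assms(2)])
  with le have "AE x in lborel. \<bar>f x\<bar> \<le> B" by eventually_elim auto
  then show ?thesis using assms 1 by (simp add: norm_le_top)
next
  case 2
  have "(\<integral>\<^sup>+x. ennreal (\<bar>f x\<bar> powr enn2real r) \<partial>lborel) \<le> (\<integral>\<^sup>+x. ennreal (\<bar>g x\<bar> powr enn2real r) \<partial>lborel)"
    proof (rule nn_integral_mono_AE, use le in eventually_elim)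
    case (elim x)
    then show ?case using 2 by (intro ennreal_leI powr_mono2) auto
  qed
  also have "\<dots> \<le> ennreal (B powr enn2real r)"
    using assms(3) 2 assms by (simp add: norm_le_finite)
  finally show ?thesis using assms 2 by (simp add: norm_le_finite)
qed

lemma norm_le_cmult:
  assumes "1 \<le> r" "0 \<le> B" "norm_le r f B"
  shows "norm_le r (\<lambda>x. c * f x) (\<bar>c\<bar> * B)"
  using assms(1)
proof (cases rule: ge_one_finite_cases)
  case 1
  then have "AE x in lborel. \<bar>f x\<bar> \<le> B" using assms(3) by (simp add: norm_le_top[OF assms(2)])
  then have "AE x in lborel. \<bar>c * f x\<bar> \<le> \<bar>c\<bar> * B"
    by eventually_elim (simp add: abs_mult mult_left_mono)
  then show ?thesis using assms norm_le_measurable[OF assms(3)] 1 by (simp add: norm_le_top)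
next
  case 2
  have [measurable]: "f \<in> borel_measurable borel" by (rule norm_le_measurable[OF assms(3)])
  have "(\<integral>\<^sup>+x. ennreal (\<bar>c * f x\<bar> powr enn2real r) \<partial>lborel)
      = ennreal (\<bar>c\<bar> powr enn2real r) * (\<integral>\<^sup>+x. ennreal (\<bar>f x\<bar> powr enn2real r) \<partial>lborel)"
    by (subst nn_integral_cmult[symmetric]) (auto simp: abs_mult powr_mult ennreal_mult')
  also have "\<dots> \<le> ennreal (\<bar>c\<bar> powr enn2real r) * ennreal (B powr enn2real r)"
    using assms 2 by (intro mult_left_mono) (auto simp: norm_le_finite)
  also have "\<dots> = ennreal ((\<bar>c\<bar> * B) powr enn2real r)"
    using assms by (simp add: ennreal_mult'[symmetric] powr_mult)
  finally show ?thesis using assms 2 by (simp add: norm_le_finite)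
qed

text \<open>In the interior this is convexity of the power; at a zero argument the claim shrinks to
  w^p <= w for a weight w in [0, 1].\<close>

lemma powr_convex_combination:
  fixes a b u v p :: real
  assumes "1 \<le> p" "0 \<le> a" "0 \<le> b" "0 \<le> u" "0 \<le> v" "u + v = 1"
  shows "(u * a + v * b) powr p \<le> u * a powr p + v * b powr p"
proof -
  have *: "(w * c) powr p \<le> w * c powr p" if "0 \<le> w" "w \<le> 1" "0 \<le> c" for w c :: real
  proof -
    have "w powr p \<le> w powr 1" using that assms(1) by (intro powr_mono') auto
    then show ?thesis using that by (simp add: powr_mult mult_right_mono)
  qed
  consider "a = 0" | "b = 0" | "0 < a" "0 < b" using assms by linarith
  then show ?thesis
  proof cases
    case 3
    have "u = 1 - v" using assms by simp
    then show ?thesis using convex_onD[OF powr_convex[OF assms(1)], of v a b] assms 3 unfolding \<open>u = 1 - v\<close> by simp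
  qed (use assms *[of u a] *[of v b] in auto)
qed

text \<open>Minkowski's inequality: f / A and g / B are averaged with the weights A / (A + B) and B
  / (A + B), and the power is convex. Positive bounds permit the division;
  \<open>norm_le_closed\<close> lifts this restriction afterwards.\<close>

lemma norm_le_add_pos:
  assumes r: "1 \<le> r" and A: "0 < A" and B: "0 < B" and f: "norm_le r f A" and g: "norm_le r g B"
  shows "norm_le r (\<lambda>x. f x + g x) (A + B)"
  using r
proof (cases rule: ge_one_finite_cases)
  case 1
  have "AE x in lborel. \<bar>f x\<bar> \<le> A" "AE x in lborel. \<bar>g x\<bar> \<le> B"
    using f g A B 1 by (simp_all add: norm_le_top)
  then have "AE x in lborel. \<bar>f x + g x\<bar> \<le> A + B" by eventually_elim auto
  then show ?thesis using A B norm_le_measurable[OF f] norm_le_measurable[OF g] 1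
    by (simp add: norm_le_top)
next
  case 2
  define p where "p = enn2real r"
  have p: "1 \<le> p" using 2 by (simp add: p_def)
  have [measurable]: "f \<in> borel_measurable borel" "g \<in> borel_measurable borel"
    using f g by (auto intro: norm_le_measurable)
  have If: "(\<integral>\<^sup>+x. ennreal (\<bar>f x\<bar> powr p) \<partial>lborel) \<le> ennreal (A powr p)"
    and Ig: "(\<integral>\<^sup>+x. ennreal (\<bar>g x\<bar> powr p) \<partial>lborel) \<le> ennreal (B powr p)"
    using f g A B r 2 by (auto simp: norm_le_finite p_def)
  \<comment> \<open>Chosen so that u A^p + v B^p = (A + B)^p.\<close>
  define u v where "u = (A + B) powr p * (A / (A + B)) / A powr p"
    and "v = (A + B) powr p * (B / (A + B)) / B powr p"
  have uv: "0 \<le> u" "0 \<le> v" using A B by (auto simp: u_def v_def)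
  have pt: "\<bar>f x + g x\<bar> powr p \<le> u * \<bar>f x\<bar> powr p + v * \<bar>g x\<bar> powr p" for x
  proof -
    have "\<bar>f x + g x\<bar> powr p \<le> (\<bar>f x\<bar> + \<bar>g x\<bar>) powr p" using p by (intro powr_mono2) auto
    also have "\<bar>f x\<bar> + \<bar>g x\<bar> = (A + B) * (A / (A + B) * (\<bar>f x\<bar> / A) + B / (A + B) * (\<bar>g x\<bar> / B))"
    proof -
      have "(A + B) * (A / (A + B) * (\<bar>f x\<bar> / A) + B / (A + B) * (\<bar>g x\<bar> / B))
          = (A + B) / (A + B) * (A / A) * \<bar>f x\<bar> + (A + B) / (A + B) * (B / B) * \<bar>g x\<bar>"
        by (simp add: distrib_left)
      then show ?thesis using A B by simp
    qed
    also have "\<dots> powr p = (A + B) powr p * (A / (A + B) * (\<bar>f x\<bar> / A) + B / (A + B) * (\<bar>g x\<bar> / B)) powr p"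
      using A B by (subst powr_mult) auto
    also have "\<dots> \<le> (A + B) powr p * (A / (A + B) * (\<bar>f x\<bar> / A) powr p + B / (A + B) * (\<bar>g x\<bar> / B) powr p)"
      using A B p by (intro mult_left_mono powr_convex_combination) (auto simp: add_divide_distrib[symmetric])
    also have "\<dots> = u * \<bar>f x\<bar> powr p + v * \<bar>g x\<bar> powr p"
      using A B by (simp add: u_def v_def powr_divide distrib_left)
    finally show ?thesis .
  qed
  have "(\<integral>\<^sup>+x. ennreal (\<bar>f x + g x\<bar> powr p) \<partial>lborel)
      \<le> (\<integral>\<^sup>+x. ennreal u * ennreal (\<bar>f x\<bar> powr p) + ennreal v * ennreal (\<bar>g x\<bar> powr p) \<partial>lborel)"
    using pt uv by (intro nn_integral_mono) (simp flip: ennreal_mult' ennreal_plus)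
  also have "\<dots> = ennreal u * (\<integral>\<^sup>+x. ennreal (\<bar>f x\<bar> powr p) \<partial>lborel)
      + ennreal v * (\<integral>\<^sup>+x. ennreal (\<bar>g x\<bar> powr p) \<partial>lborel)"
    by (simp add: nn_integral_add nn_integral_cmult)
  also have "\<dots> \<le> ennreal u * ennreal (A powr p) + ennreal v * ennreal (B powr p)"
    by (intro add_mono mult_left_mono If Ig) auto
  also have "\<dots> = ennreal (u * A powr p + v * B powr p)"
    using uv by (simp flip: ennreal_mult' ennreal_plus)
  also have "u * A powr p + v * B powr p = (A + B) powr p"
    using A B by (simp add: u_def v_def add_divide_distrib[symmetric] distrib_left[symmetric])
  finally show ?thesis using A B r 2 by (simp add: norm_le_finite p_def)
qed

lemma norm_le_closed:
  assumes "0 \<le> B" "\<And>e. 0 < e \<Longrightarrow> norm_le r f (B + e)"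
  shows "norm_le r f B"
proof -
  have "Lnorm r f \<le> ennreal B + ennreal e" if "0 < e" for e
  proof -
    have "Lnorm r f \<le> ennreal (B + e)" using assms(2)[OF that] by (simp add: norm_le_def)
    also have "\<dots> = ennreal B + ennreal e" using assms(1) that by simp
    finally show ?thesis .
  qed
  then have "Lnorm r f \<le> ennreal B" by (rule ennreal_le_epsilon)
  moreover have "f \<in> borel_measurable borel" using assms(2)[of 1] by (simp add: norm_le_def)
  ultimately show ?thesis by (simp add: norm_le_def)
qed

lemma norm_le_add:
  assumes "1 \<le> r" "0 \<le> A" "0 \<le> B" "norm_le r f A" "norm_le r g B"
  shows "norm_le r (\<lambda>x. f x + g x) (A + B)"
proof (rule norm_le_closed)
  show "0 \<le> A + B" using assms by simp
  fix e :: real assume "0 < e"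
  then have "norm_le r (\<lambda>x. f x + g x) ((A + e / 2) + (B + e / 2))"
    using assms by (intro norm_le_add_pos) (auto intro: norm_le_weaken)
  then show "norm_le r (\<lambda>x. f x + g x) (A + B + e)" by (simp add: algebra_simps)
qed

lemma norm_le_zero:
  assumes "1 \<le> r" "0 \<le> B"
  shows "norm_le r (\<lambda>x. 0) B"
  using assms(1) by (rule ge_one_finite_cases) (use assms in \<open>auto simp: norm_le_top norm_le_finite\<close>)

lemma norm_le_sum:
  assumes "1 \<le> r" "finite I" "\<And>i. i \<in> I \<Longrightarrow> 0 \<le> B i" "\<And>i. i \<in> I \<Longrightarrow> norm_le r (f i) (B i)"
  shows "norm_le r (\<lambda>x. \<Sum>i\<in>I. f i x) (\<Sum>i\<in>I. B i)"
  using assms(2-)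
proof (induction I)
  case empty
  then show ?case using assms(1) by (simp add: norm_le_zero)
next
  case (insert i I)
  then show ?case using norm_le_add[OF assms(1), of "B i" "sum B I" "f i" "\<lambda>x. \<Sum>i\<in>I. f i x"]
    by (auto simp: sum_nonneg)
qed

lemma nn_integral_lborel_shift:
  fixes f :: "real ^ 'd \<Rightarrow> ennreal"
  assumes "f \<in> borel_measurable borel"
  shows "(\<integral>\<^sup>+x. f (x + c) \<partial>lborel) = (\<integral>\<^sup>+x. f x \<partial>lborel)"
proof -
  have "(\<integral>\<^sup>+x. f x \<partial>lborel) = (\<integral>\<^sup>+x. f x \<partial>distr lborel borel ((+) c))"
    by (simp add: lborel_distr_plus)
  also have "\<dots> = (\<integral>\<^sup>+x. f (c + x) \<partial>lborel)"
    using assms by (subst nn_integral_distr) auto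
  finally show ?thesis by (simp add: add.commute)
qed

lemma AE_lborel_shift:
  fixes P :: "real ^ 'd \<Rightarrow> bool"
  assumes "AE x in lborel. P x" and [measurable]: "Measurable.pred borel P"
  shows "AE x in lborel. P (x + c)"
proof -
  have "AE x in distr lborel borel ((+) c). P x" using assms(1) by (subst lborel_distr_plus)
  then show ?thesis by (subst (asm) AE_distr_iff) (auto simp: add.commute)
qed

lemma norm_le_shift:
  assumes "1 \<le> r" "0 \<le> B" "norm_le r f B"
  shows "norm_le r (\<lambda>x. f (x + c)) B"
  using assms(1)
proof (cases rule: ge_one_finite_cases)
  case 1
  have [measurable]: "f \<in> borel_measurable borel" by (rule norm_le_measurable[OF assms(3)])
  have "AE x in lborel. \<bar>f (x + c)\<bar> \<le> B"
    by (rule AE_lborel_shift) (use assms 1 in \<open>auto simp: norm_le_top\<close>)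
  then show ?thesis using assms 1 by (simp add: norm_le_top)
next
  case 2
  have [measurable]: "f \<in> borel_measurable borel" by (rule norm_le_measurable[OF assms(3)])
  show ?thesis using assms 2
    by (simp add: norm_le_finite nn_integral_lborel_shift[of "\<lambda>x. ennreal (\<bar>f x\<bar> powr enn2real r)"])
qed

lemma weighted_arith_geo_mean:
  fixes h w :: "'i \<Rightarrow> real"
  assumes "finite I" "\<And>i. i \<in> I \<Longrightarrow> 0 < h i" "\<And>i. i \<in> I \<Longrightarrow> 0 \<le> w i" "sum w I = 1"
  shows "(\<Prod>i\<in>I. h i powr w i) \<le> (\<Sum>i\<in>I. w i * h i)"
proof -
  have "exp (\<Sum>i\<in>I. w i *\<^sub>R ln (h i)) \<le> (\<Sum>i\<in>I. w i * exp (ln (h i)))"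
    using assms by (intro convex_on_sum[OF _ _ exp_convex]) auto
  moreover have "exp (\<Sum>i\<in>I. w i *\<^sub>R ln (h i)) = (\<Prod>i\<in>I. h i powr w i)"
  proof (subst exp_sum[OF assms(1)], rule prod.cong)
    fix i assume "i \<in> I"
    then have "0 < h i" using assms by auto
    then show "exp (w i *\<^sub>R ln (h i)) = h i powr w i" by (simp add: powr_def)
  qed simp
  ultimately show ?thesis using assms by simp
qed

text \<open>Hoelder's inequality for a single function, with all norms interpolated at once.
  Pointwise, |g|^2 / P^2 is the product of the (|g| / B_i)^(2 w_i). The factors with infinite index
  are at most 1 almost everywhere, and the weighted mean inequality turns the others into multiples
  of (|g| / B_i)^(r_i), whose integrals are at most 1.\<close>

lemma norm_le_interpolation:
  fixes g :: "real ^ 'd \<Rightarrow> real" and r :: "'i \<Rightarrow> ennreal"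
  assumes I: "finite I" and r: "\<And>i. i \<in> I \<Longrightarrow> 1 \<le> r i" and B: "\<And>i. i \<in> I \<Longrightarrow> 0 < B i"
    and g: "\<And>i. i \<in> I \<Longrightarrow> norm_le (r i) g (B i)"
    and w: "\<And>i. i \<in> I \<Longrightarrow> 0 \<le> w i" and w1: "sum w I = 1"
    and w2: "(\<Sum>i\<in>I. w i * recip (r i)) = 1 / 2"
  shows "norm_le 2 g (\<Prod>i\<in>I. B i powr w i)"
proof -
  define F where "F = {i \<in> I. r i \<noteq> \<top>}"
  define p where "p i = enn2real (r i)" for i
  have F: "finite F" "F \<subseteq> I" using I by (auto simp: F_def)
  have p: "1 \<le> p i" "recip (r i) = 1 / p i" if "i \<in> F" for i
    using that r[of i] by (auto simp: F_def p_def recip_finite elim: ge_one_finite_cases)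
  \<comment> \<open>By \<open>w2\<close> these numbers add up to 1 over the finite indices, so they
    can serve as weights in the mean inequality.\<close>
  define u where "u i = 2 * w i / p i" for i
  have u0: "0 \<le> u i" if "i \<in> F" for i using p[OF that] w[of i] that F by (auto simp: u_def)
  have "(\<Sum>i\<in>I. w i * recip (r i)) = (\<Sum>i\<in>F. w i * recip (r i))"
    using I by (intro sum.mono_neutral_right) (auto simp: F_def)
  also have "\<dots> = (\<Sum>i\<in>F. u i / 2)" using p by (intro sum.cong) (auto simp: u_def)
  finally have u1: "sum u F = 1" using w2 by (simp add: sum_divide_distrib[symmetric])
  define P where "P = (\<Prod>i\<in>I. B i powr w i)"
  have "I \<noteq> {}" using w1 by auto
  then obtain i0 where "i0 \<in> I" by auto
  then have [measurable]: "g \<in> borel_measurable borel" using g by (auto intro: norm_le_measurable)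
  have P: "0 < P" unfolding P_def using B by (intro prod_pos) (metis powr_gt_zero order_less_irrefl)
  have "AE x in lborel. \<bar>g x\<bar> \<le> B i" if "i \<in> I - F" for i
    using g[of i] that norm_le_top[of "B i" g] B[of i] by (auto simp: F_def)
  then have "AE x in lborel. \<forall>i\<in>I - F. \<bar>g x\<bar> \<le> B i" using I by (intro AE_finite_allI) auto
  then have pt: "AE x in lborel. \<bar>g x\<bar> powr 2 \<le> P\<^sup>2 * (\<Sum>i\<in>F. u i * (\<bar>g x\<bar> / B i) powr p i)"
  proof eventually_elim
    case (elim x)
    show ?case
    proof (cases "g x = 0")
      case True
      then show ?thesis using u0 by (auto intro!: mult_nonneg_nonneg sum_nonneg)
    next
      case False
      then have gx: "0 < \<bar>g x\<bar>" by simp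
      have "\<bar>g x\<bar> powr 2 / P\<^sup>2 = (\<Prod>i\<in>I. (\<bar>g x\<bar> / B i) powr (2 * w i))"
      proof -
        have "(\<Prod>i\<in>I. (\<bar>g x\<bar> / B i) powr (2 * w i)) = (\<Prod>i\<in>I. \<bar>g x\<bar> powr (2 * w i) / (B i powr w i)\<^sup>2)"
          using B gx by (intro prod.cong) (auto simp: powr_divide less_imp_le powr_powr[symmetric] mult.commute
             simp flip: powr_numeral)
        also have "\<dots> = (\<Prod>i\<in>I. \<bar>g x\<bar> powr (2 * w i)) / P\<^sup>2"
          by (simp add: prod_dividef prod_power_distrib P_def)
        also have "(\<Prod>i\<in>I. \<bar>g x\<bar> powr (2 * w i)) = \<bar>g x\<bar> powr (\<Sum>i\<in>I. 2 * w i)"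
          using gx I by (simp add: powr_sum)
        also have "(\<Sum>i\<in>I. 2 * w i) = 2" using w1 by (simp add: sum_distrib_left[symmetric])
        finally show ?thesis by simp
      qed
      also have "\<dots> = (\<Prod>i\<in>F. (\<bar>g x\<bar> / B i) powr (2 * w i)) * (\<Prod>i\<in>I - F. (\<bar>g x\<bar> / B i) powr (2 * w i))"
        using I F by (subst prod.subset_diff[of F I]) (auto simp: mult.commute)
      also have "\<dots> \<le> (\<Prod>i\<in>F. (\<bar>g x\<bar> / B i) powr (2 * w i)) * 1"
        using elim B w gx
        by (intro mult_left_mono prod_le_1 prod_nonneg) (auto intro!: powr_le1 simp: less_imp_le)
      also have "(\<Prod>i\<in>F. (\<bar>g x\<bar> / B i) powr (2 * w i)) = (\<Prod>i\<in>F. ((\<bar>g x\<bar> / B i) powr p i) powr u i)"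
        using p by (intro prod.cong) (auto simp: powr_powr u_def dest!: p(1))
      also have "\<dots> \<le> (\<Sum>i\<in>F. u i * (\<bar>g x\<bar> / B i) powr p i)"
        using F u0 u1 gx B by (intro weighted_arith_geo_mean) (auto dest!: B[OF subsetD[OF F(2)]])
      finally show ?thesis using P by (simp add: field_simps)
    qed
  qed
  have "(\<integral>\<^sup>+x. ennreal (\<bar>g x\<bar> powr 2) \<partial>lborel)
      \<le> (\<integral>\<^sup>+x. ennreal (P\<^sup>2) * (\<Sum>i\<in>F. ennreal (u i) * ennreal ((\<bar>g x\<bar> / B i) powr p i)) \<partial>lborel)"
  proof (rule nn_integral_mono_AE, use pt in eventually_elim)
    case (elim x)
    have "ennreal (P\<^sup>2) * (\<Sum>i\<in>F. ennreal (u i) * ennreal ((\<bar>g x\<bar> / B i) powr p i))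
        = ennreal (P\<^sup>2 * (\<Sum>i\<in>F. u i * (\<bar>g x\<bar> / B i) powr p i))"
      using u0 by (subst ennreal_mult) (auto intro!: sum_nonneg simp: ennreal_mult' simp flip: sum_ennreal)
    then show ?case using elim by (simp add: ennreal_leI)
  qed
  also have "\<dots> = ennreal (P\<^sup>2) * (\<Sum>i\<in>F. ennreal (u i) * (\<integral>\<^sup>+x. ennreal ((\<bar>g x\<bar> / B i) powr p i) \<partial>lborel))"
    by (simp add: nn_integral_cmult nn_integral_sum)
  also have "\<dots> \<le> ennreal (P\<^sup>2) * (\<Sum>i\<in>F. ennreal (u i) * 1)"
  proof (intro mult_left_mono sum_mono)
    fix i assume i: "i \<in> F"
    then have Bi: "0 < B i" and pi: "1 \<le> p i" using B F p by auto
    have "norm_le (r i) (\<lambda>x. 1 / B i * g x) (\<bar>1 / B i\<bar> * B i)"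
      using i g[of i] r[of i] Bi by (intro norm_le_cmult) (auto simp: F_def)
    then have "norm_le (r i) (\<lambda>x. g x / B i) 1" using Bi by simp
    then have "(\<integral>\<^sup>+x. ennreal (\<bar>g x / B i\<bar> powr p i) \<partial>lborel) \<le> ennreal (1 powr p i)"
      using i r[of i] norm_le_finite[of 1 "r i" "\<lambda>x. g x / B i"] by (auto simp: F_def p_def)
    then show "(\<integral>\<^sup>+x. ennreal ((\<bar>g x\<bar> / B i) powr p i) \<partial>lborel) \<le> 1"
      using Bi by simp
  qed auto
  also have "\<dots> = ennreal (P\<^sup>2)" using u0 u1 by (simp)
  finally have "(\<integral>\<^sup>+x. ennreal (\<bar>g x\<bar> powr 2) \<partial>lborel) \<le> ennreal (P\<^sup>2)" .
  then have "norm_le 2 g P" using P by (simp add: norm_le_finite)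
  then show ?thesis by (simp add: P_def)
qed

lemma norm_le_bounded_support:
  assumes r: "1 \<le> r" and c: "0 \<le> c" and V: "0 \<le> V" and [measurable]: "f \<in> borel_measurable borel" "A \<in> sets borel"
    and A: "emeasure lborel A \<le> ennreal V" and f: "\<And>x. \<bar>f x\<bar> \<le> c * indicator A x"
  shows "norm_le r f (c * V powr recip r)"
  using r
proof (cases rule: ge_one_finite_cases)
  case 1
  show ?thesis
  proof (cases "V = 0")
    \<comment> \<open>\<open>0 powr 0\<close> is 0, so for V = 0 the bound claims that f vanishes
      almost everywhere; it does, since A is a null set.\<close>
    case True
    then have "AE x in lborel. x \<notin> A" using A by (intro AE_not_in) auto
    then have "AE x in lborel. \<bar>f x\<bar> \<le> 0" by eventually_elim (use f in \<open>auto split: split_indicator\<close>, metis abs_le_zero_iff indicator_simps(2) mult_zero_right)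
    then show ?thesis using 1 True by (simp add: norm_le_top)
  next
    case False
    have "\<bar>f x\<bar> \<le> c" for x using f[of x] c by (auto split: split_indicator_asm)
    then show ?thesis using 1 c False by (simp add: norm_le_top)
  qed
next
  case 2
  define p where "p = enn2real r"
  have p: "1 \<le> p" using 2 by (simp add: p_def)
  have "(\<integral>\<^sup>+x. ennreal (\<bar>f x\<bar> powr p) \<partial>lborel) \<le> (\<integral>\<^sup>+x. ennreal (c powr p) * indicator A x \<partial>lborel)"
  proof (rule nn_integral_mono)
    fix x
    show "ennreal (\<bar>f x\<bar> powr p) \<le> ennreal (c powr p) * indicator A x"
      using f[of x] p by (auto split: split_indicator_asm intro!: powr_mono2)
  qed
  also have "\<dots> = ennreal (c powr p) * emeasure lborel A" by (subst nn_integral_cmult_indicator) auto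
  also have "\<dots> \<le> ennreal (c powr p) * ennreal V" by (intro mult_left_mono A) auto
  also have "\<dots> = ennreal ((c * V powr recip r) powr p)"
    using r 2 p c V by (simp add: powr_mult powr_powr recip_finite p_def flip: ennreal_mult')
  finally show ?thesis using r 2 c by (simp add: norm_le_finite p_def)
qed

subsection \<open>Comparison of differences of different orders\<close>

text \<open>In Fourier terms this is multiplication by sin^2(t / 2), where t is the phase of a shift
  by v, and the identity minus it is multiplication by cos^2(t / 2). The division by 4 is what makes
  the two symbols add up to 1.\<close>

definition sdiff :: "real ^ 'd \<Rightarrow> (real ^ 'd \<Rightarrow> real) \<Rightarrow> real ^ 'd \<Rightarrow> real" where
  "sdiff v f = (\<lambda>x. (2 * f x - f (x + v) - f (x - v)) / 4)"

text \<open>Polynomials in the operator \<open>sdiff v\<close>. The assignment is multiplicative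
  (\<open>sdiff_poly_mult\<close>), so identities between polynomials in one variable become
  identities between operators.\<close>

definition sdiff_poly :: "real ^ 'd \<Rightarrow> real poly \<Rightarrow> (real ^ 'd \<Rightarrow> real) \<Rightarrow> real ^ 'd \<Rightarrow> real" where
  "sdiff_poly v p f = (\<lambda>x. \<Sum>i\<le>degree p. coeff p i * (sdiff v ^^ i) f x)"

lemma sdiff_poly_degree_le:
  assumes "degree p \<le> n"
  shows "sdiff_poly v p f x = (\<Sum>i\<le>n. coeff p i * (sdiff v ^^ i) f x)"
  unfolding sdiff_poly_def
  by (rule sum.mono_neutral_left) (use assms in \<open>auto simp: coeff_eq_0\<close>)

lemma sdiff_poly_add: "sdiff_poly v (p + q) f = (\<lambda>x. sdiff_poly v p f x + sdiff_poly v q f x)"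
proof
  fix x
  define n where "n = max (degree p) (degree q)"
  have "degree p \<le> n" "degree q \<le> n" "degree (p + q) \<le> n"
    using degree_add_le_max[of p q] by (auto simp: n_def)
  then show "sdiff_poly v (p + q) f x = sdiff_poly v p f x + sdiff_poly v q f x"
    by (simp add: sdiff_poly_degree_le[of _ n] sum.distrib distrib_right)
qed

lemma sdiff_poly_smult: "sdiff_poly v (Polynomial.smult c p) f = (\<lambda>x. c * sdiff_poly v p f x)"
proof
  fix x
  show "sdiff_poly v (Polynomial.smult c p) f x = c * sdiff_poly v p f x"
    using degree_smult_le[of c p]
    by (simp add: sdiff_poly_degree_le[of _ "degree p"] sum_distrib_left mult.assoc)
qed

lemma sdiff_sum: "sdiff v (\<lambda>x. \<Sum>i\<in>I. c i * F i x) = (\<lambda>x. \<Sum>i\<in>I. c i * sdiff v (F i) x)"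
  by (rule ext) (simp add: sdiff_def sum_distrib_left sum_subtractf[symmetric] sum_divide_distrib
      right_diff_distrib mult_ac diff_divide_distrib)

lemma sdiff_poly_pCons:
  "sdiff_poly v (pCons a p) f = (\<lambda>x. a * f x + sdiff v (sdiff_poly v p f) x)"
proof
  fix x
  have "degree (pCons a p) \<le> Suc (degree p)" by (simp add: degree_pCons_le)
  then have "sdiff_poly v (pCons a p) f x
      = (\<Sum>i\<le>Suc (degree p). coeff (pCons a p) i * (sdiff v ^^ i) f x)"
    by (rule sdiff_poly_degree_le)
  also have "\<dots> = a * f x + (\<Sum>i\<le>degree p. coeff p i * sdiff v ((sdiff v ^^ i) f) x)"
    by (subst sum.atMost_Suc_shift) simp
  finally show "sdiff_poly v (pCons a p) f x = a * f x + sdiff v (sdiff_poly v p f) x"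
    unfolding sdiff_poly_def by (simp add: sdiff_sum)
qed

lemma sdiff_poly_mult: "sdiff_poly v (p * q) f = sdiff_poly v p (sdiff_poly v q f)"
proof (induction p)
  case 0
  show ?case by (simp add: sdiff_poly_def)
next
  case (pCons a p)
  have "sdiff_poly v (pCons a p * q) f = sdiff_poly v (Polynomial.smult a q + pCons 0 (p * q)) f"
    by (simp only: mult_pCons_left)
  then show ?case using pCons.IH
    by (simp add: sdiff_poly_add sdiff_poly_smult sdiff_poly_pCons)
qed

lemma sdiff_poly_1: "sdiff_poly v 1 f = f"
  by (simp add: sdiff_poly_def)

lemma sdiff_poly_monom: "sdiff_poly v [:0, 1:] f = sdiff v f"
  by (simp add: sdiff_poly_pCons) (simp add: sdiff_poly_def sdiff_def)

lemma sdiff_poly_one_minus: "sdiff_poly v [:1, -1:] f = (\<lambda>x. f x - sdiff v f x)"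
  by (rule ext, simp add: sdiff_poly_pCons) (simp add: sdiff_poly_def sdiff_def field_simps)

lemma sdiff_poly_power: "sdiff_poly v (p ^ n) f = (sdiff_poly v p ^^ n) f"
  by (induction n) (simp_all add: sdiff_poly_1 sdiff_poly_mult)

lemma sdiff_poly_sum:
  "finite I \<Longrightarrow> sdiff_poly v (\<Sum>i\<in>I. p i) f = (\<lambda>x. \<Sum>i\<in>I. sdiff_poly v (p i) f x)"
proof (induction I rule: finite_induct)
  case empty
  show ?case by (simp add: sdiff_poly_def)
qed (simp add: sdiff_poly_add)

text \<open>Both operators combine the translates by 0, v and -v with absolute weights 1/2, 1/4,
  1/4. The weights add up to 1, so both are contractions in every norm, and arbitrary powers cost
  nothing.\<close>

lemma norm_le_sdiff:
  assumes r: "1 \<le> r" and B: "0 \<le> B" and f: "norm_le r f B"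
  shows "norm_le r (sdiff v f) B" "norm_le r (\<lambda>x. f x - sdiff v f x) B"
proof -
  have s: "norm_le r (\<lambda>x. f (x + c)) B" for c by (rule norm_le_shift[OF r B f])
  have m: "norm_le r (\<lambda>x. 1 / 2 * f x) (\<bar>1 / 2\<bar> * B)" by (rule norm_le_cmult[OF r B f])
  have e: "norm_le r (\<lambda>x. (1 / 2 * f x + a * f (x + v)) + a * f (x + - v)) (((\<bar>1 / 2\<bar> * B) + \<bar>a\<bar> * B) + \<bar>a\<bar> * B)" for a
    using B by (intro norm_le_add r norm_le_cmult s m) auto
  have "sdiff v f = (\<lambda>x. (1 / 2 * f x + (- 1 / 4) * f (x + v)) + (- 1 / 4) * f (x + - v))"
    by (rule ext) (simp add: sdiff_def field_simps)
  then show "norm_le r (sdiff v f) B" using e[of "- 1 / 4"] by simp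
  have "(\<lambda>x. f x - sdiff v f x) = (\<lambda>x. (1 / 2 * f x + (1 / 4) * f (x + v)) + (1 / 4) * f (x + - v))"
    by (rule ext) (simp add: sdiff_def field_simps)
  then show "norm_le r (\<lambda>x. f x - sdiff v f x) B" using e[of "1 / 4"] by simp
qed

lemma norm_le_sdiff_poly_power:
  assumes r: "1 \<le> r" and B: "0 \<le> B" and f: "norm_le r f B" and p: "p = [:0, 1:] \<or> p = [:1, -1:]"
  shows "norm_le r (sdiff_poly v (p ^ n) f) B"
proof (induction n)
  case 0
  then show ?case using f by (simp add: sdiff_poly_1)
next
  case (Suc n)
  then show ?case using p norm_le_sdiff[OF r B, of _ v]
    by (auto simp: sdiff_poly_mult sdiff_poly_monom sdiff_poly_one_minus)
qed

text \<open>An explicit Bezout relation. In Bernoulli trials with success probability a and failure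
  probability b, the first summand is the probability that n + 1 successes come before m failures,
  the second that of the opposite event. All coefficients are positive, so their sum controls the
  operators built from them.\<close>

lemma bezout_powers:
  fixes a b :: "'a :: comm_ring_1"
  assumes ab: "a + b = 1" and m: "0 < m"
  shows "a ^ Suc n * (\<Sum>i<m. of_nat ((n + i) choose i) * b ^ i) +
         b ^ m * (\<Sum>i<Suc n. of_nat ((m - 1 + i) choose i) * a ^ i) = 1"
proof (induction n)
  case 0
  have "a = 1 - b" using ab by (simp add: algebra_simps)
  then have "a * (\<Sum>i<m. b ^ i) = 1 - b ^ m" by (simp add: one_diff_power_eq)
  then show ?case by simp
next
  case (Suc n)
  define s where "s n = (\<Sum>i<m. of_nat ((n + i) choose i) * b ^ i)" for n
  \<comment> \<open>Multiplication by 1 - b = a lowers the upper index by Pascal's rule; only the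
    last term of the truncated series is left over.\<close>
  have rec: "(1 - b) * (\<Sum>i<M. of_nat ((Suc n + i) choose i) * b ^ i)
      = (\<Sum>i<M. of_nat ((n + i) choose i) * b ^ i) - of_nat ((n + M) choose (M - 1)) * b ^ M" if "0 < M" for M
    using that
  proof (induction M rule: nat_induct_non_zero)
    case (Suc M)
    have "((Suc n + M) choose M) = ((n + M) choose M) + ((n + M) choose (M - 1))"
      using Suc.hyps by (cases M) auto
    then have *: "of_nat ((Suc n + M) choose M) = (of_nat ((n + M) choose M) + of_nat ((n + M) choose (M - 1)) :: 'a)"
      by simp
    have "(1 - b) * (\<Sum>i<Suc M. of_nat ((Suc n + i) choose i) * b ^ i)
        = (\<Sum>i<M. of_nat ((n + i) choose i) * b ^ i) - of_nat ((n + M) choose (M - 1)) * b ^ M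
          + of_nat ((Suc n + M) choose M) * b ^ M - of_nat ((Suc n + M) choose M) * b ^ Suc M"
      using Suc.IH by (simp add: algebra_simps)
    also have "\<dots> = (\<Sum>i<Suc M. of_nat ((n + i) choose i) * b ^ i) - of_nat ((n + Suc M) choose (Suc M - 1)) * b ^ Suc M"
    proof -
      have "(of_nat (Suc (M + n) choose M) :: 'a) = of_nat ((M + n) choose M) + of_nat ((M + n) choose (M - Suc 0))"
        using * by (simp add: add.commute)
      then show ?thesis by (simp add: algebra_simps)
    qed
    finally show ?case .
  qed (simp add: algebra_simps)
  have a: "a = 1 - b" using ab by (simp add: algebra_simps)
  have "a ^ Suc (Suc n) * s (Suc n) = a ^ Suc n * ((1 - b) * s (Suc n))" by (simp add: a mult_ac)
  also have "\<dots> = a ^ Suc n * s n - of_nat ((n + m) choose (m - 1)) * b ^ m * a ^ Suc n"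
    unfolding s_def rec[OF m] by (simp add: algebra_simps)
  finally have 1: "a ^ Suc (Suc n) * s (Suc n)
      = a ^ Suc n * s n - of_nat ((n + m) choose (m - 1)) * b ^ m * a ^ Suc n" .
  have "((n + m) choose (m - 1)) = ((m - 1 + Suc n) choose Suc n)"
    using binomial_symmetric[of "m - 1" "n + m"] m by (simp add: add.commute)
  then have "a ^ Suc (Suc n) * s (Suc n)
      + b ^ m * (\<Sum>i<Suc (Suc n). of_nat ((m - 1 + i) choose i) * a ^ i)
      = a ^ Suc n * s n + b ^ m * (\<Sum>i<Suc n. of_nat ((m - 1 + i) choose i) * a ^ i)"
    unfolding 1 by (simp only: sum.lessThan_Suc[of _ "Suc n"] distrib_left) (simp add: mult_ac)
  then show ?case using Suc.IH unfolding s_def by simp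
qed

text \<open>The double angle formula: the product of the symbols sin^2 and cos^2 is a quarter of the
  sin^2 that belongs to the double step.\<close>

lemma sdiff_double: "sdiff_poly v ([:0, 1:] * [:1, -1:]) f = (\<lambda>x. 1 / 4 * sdiff (2 *\<^sub>R v) f x)"
proof -
  have "sdiff v (\<lambda>x. f x - sdiff v f x) x = 1 / 4 * sdiff (2 *\<^sub>R v) f x" for x
  proof -
    have [simp]: "x + v + v = x + 2 *\<^sub>R v" "x - v - v = x - 2 *\<^sub>R v" "x - v + v = x"
      by (simp_all add: scaleR_2)
    show ?thesis unfolding sdiff_def by (simp add: diff_divide_distrib add_divide_distrib)
  qed
  then show ?thesis by (subst sdiff_poly_mult) (auto simp: sdiff_poly_monom sdiff_poly_one_minus)
qed

lemma sdiff_cmult: "sdiff v (\<lambda>x. c * f x) = (\<lambda>x. c * sdiff v f x)"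
  by (rule ext) (simp add: sdiff_def algebra_simps)

lemma sdiff_double_power:
  "sdiff_poly v ([:0, 1:] ^ k * [:1, -1:] ^ k) f = (\<lambda>x. (1 / 4) ^ k * (sdiff (2 *\<^sub>R v) ^^ k) f x)"
proof (induction k)
  case 0
  then show ?case by (simp add: sdiff_poly_1)
next
  case (Suc k)
  have "[:0, 1:] ^ Suc k * [:1, -1:] ^ Suc k = ([:0, 1:] * [:1, -1:]) * ([:0, 1:] ^ k * [:1, -1:] ^ k :: real poly)"
    by (simp only: power_Suc mult_ac)
  then have "sdiff_poly v ([:0, 1:] ^ Suc k * [:1, -1:] ^ Suc k) f
      = (\<lambda>x. 1 / 4 * sdiff (2 *\<^sub>R v) (sdiff_poly v ([:0, 1:] ^ k * [:1, -1:] ^ k) f) x)"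
    by (simp only: sdiff_poly_mult[of v "[:0, 1:] * [:1, -1:]"] sdiff_double)
  then show ?case by (simp add: Suc.IH sdiff_cmult)
qed

text \<open>Multiplying the Bezout relation by a^k gives a^k = S(b) a^(2k) + S(a) (a b)^k. The first
  operator is controlled by the difference of twice the order; the second is a difference of the
  same order with twice the step and carries the factor 4^(-k) of the double angle formula.\<close>

lemma norm_le_sdiff_halving:
  fixes f :: "real ^ 'd \<Rightarrow> real"
  assumes r: "1 \<le> r" and k: "0 < k" and A: "0 \<le> A" and E: "0 \<le> E"
    and fA: "norm_le r ((sdiff v ^^ (2 * k)) f) A" and fE: "norm_le r ((sdiff (2 *\<^sub>R v) ^^ k) f) E"
  shows "norm_le r ((sdiff v ^^ k) f) (real ((2 * k - 1) choose (k - 1)) * (A + (1 / 4) ^ k * E))"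
proof -
  define a b :: "real poly" where "a = [:0, 1:]" and "b = [:1, -1:]"
  define S where "S = (\<lambda>y :: real poly. \<Sum>i<k. of_nat ((k - 1 + i) choose i) * y ^ i)"
  have op: "(sdiff v ^^ n) f = sdiff_poly v (a ^ n) f" for n f
  proof -
    have "sdiff_poly v a = sdiff v" by (rule ext) (simp add: a_def sdiff_poly_monom)
    then show ?thesis by (simp add: sdiff_poly_power)
  qed
  have "a ^ k * S b + b ^ k * S a = 1"
    using bezout_powers[of a b k "k - 1"] k by (simp add: a_def b_def S_def one_pCons)
  then have "a ^ k = a ^ k * (a ^ k * S b + b ^ k * S a)" by simp
  also have "\<dots> = S b * (a ^ k * a ^ k) + S a * (a ^ k * b ^ k)"
    by (simp only: distrib_left mult_ac)
  also have "a ^ k * a ^ k = a ^ (2 * k)" by (simp add: mult_2 power_add)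
  finally have eq: "(sdiff v ^^ k) f = (\<lambda>x. sdiff_poly v (S b * a ^ (2 * k)) f x + sdiff_poly v (S a * (a ^ k * b ^ k)) f x)"
    by (simp add: op sdiff_poly_add[symmetric])
  have S: "norm_le r (sdiff_poly v (S y) g) (real ((2 * k - 1) choose (k - 1)) * D)"
    if "norm_le r g D" "0 \<le> D" "y = a \<or> y = b" for y g D
  proof -
    have term_eq: "of_nat c * y ^ i = Polynomial.smult (of_nat c) (y ^ i)" for c i
      by (simp add: of_nat_poly)
    have "norm_le r (\<lambda>x. \<Sum>i<k. of_nat ((k - 1 + i) choose i) * sdiff_poly v (y ^ i) g x)
        (\<Sum>i<k. \<bar>of_nat ((k - 1 + i) choose i)\<bar> * D)"
      using that by (intro norm_le_sum r norm_le_cmult norm_le_sdiff_poly_power) (auto simp: a_def b_def)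
    \<comment> \<open>The coefficients are positive and the powers are contractions, so the norm of
      the operator is at most the sum of the coefficients; the hockey stick identity evaluates
      it.\<close>
    moreover have "(\<Sum>i<k. real ((k - 1 + i) choose i)) = real ((2 * k - 1) choose (k - 1))"
    proof -
      have "(\<Sum>i<k. (k - 1 + i) choose i) = (\<Sum>i\<le>k - 1. (k - 1 + i) choose i)"
        using k by (intro sum.cong) auto
      also have "\<dots> = Suc (k - 1 + (k - 1)) choose (k - 1)" by (rule sum_choose_lower)
      also have "Suc (k - 1 + (k - 1)) = 2 * k - 1" using k by simp
      finally show ?thesis by (simp flip: of_nat_sum)
    qed
    ultimately show ?thesis
      by (simp add: S_def sdiff_poly_sum term_eq sdiff_poly_smult sum_distrib_right[symmetric])
  qed
  have "norm_le r (sdiff_poly v (S b * a ^ (2 * k)) f) (real ((2 * k - 1) choose (k - 1)) * A)"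
    using S[OF fA A] by (simp add: sdiff_poly_mult op)
  moreover have "norm_le r (sdiff_poly v (S a * (a ^ k * b ^ k)) f) (real ((2 * k - 1) choose (k - 1)) * ((1 / 4) ^ k * E))"
  proof -
    have "norm_le r (\<lambda>x. (1 / 4) ^ k * (sdiff (2 *\<^sub>R v) ^^ k) f x) (\<bar>(1 / 4) ^ k\<bar> * E)"
      by (intro norm_le_cmult r E fE)
    then have "norm_le r (sdiff_poly v (S a) (\<lambda>x. (1 / 4) ^ k * (sdiff (2 *\<^sub>R v) ^^ k) f x))
        (real ((2 * k - 1) choose (k - 1)) * (\<bar>(1 / 4) ^ k\<bar> * E))" using E by (intro S) auto
    then show ?thesis
      by (simp add: sdiff_poly_mult[of v "S a"] sdiff_double_power[folded a_def b_def])
  qed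
  ultimately have "norm_le r ((sdiff v ^^ k) f) (real ((2 * k - 1) choose (k - 1)) * A
      + real ((2 * k - 1) choose (k - 1)) * ((1 / 4) ^ k * E))"
    unfolding eq using A E by (intro norm_le_add r) auto
  then show ?thesis by (simp add: distrib_left)
qed

section \<open>Descent from an arbitrary order to a fixed one\<close>

lemma norm_le_limit:
  assumes "0 \<le> B" "\<And>n. norm_le r f (B + e n)" "e \<longlonglongrightarrow> 0"
  shows "norm_le r f B"
proof (rule norm_le_closed[OF assms(1)])
  fix d :: real assume "0 < d"
  with assms(3) have "eventually (\<lambda>n. e n < d) sequentially" by (rule order_tendstoD)
  then obtain n where "e n < d" by (auto simp: eventually_sequentially)
  then show "norm_le r f (B + d)" using norm_le_weaken[OF assms(2)[of n], of "B + d"] by simp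
qed

lemma norm_le_sdiff_power:
  assumes r: "1 \<le> r" and B: "0 \<le> B" and f: "norm_le r f B"
  shows "norm_le r ((sdiff v ^^ n) f) B"
  by (induction n) (auto simp: f intro: norm_le_sdiff[OF r B])

text \<open>The factor (1/4)^k makes A the constant of the ordinary difference of order 2 k, which
  is (-4)^k times a translate of the k-th power of \<open>sdiff\<close>
  (\<open>diff_op_even_power\<close>).\<close>

definition sdiff_smooth :: "ennreal \<Rightarrow> real \<Rightarrow> real ^ 'd \<Rightarrow> (real ^ 'd \<Rightarrow> real) \<Rightarrow> nat \<Rightarrow> real \<Rightarrow> bool" where
  "sdiff_smooth r \<beta> e f k A \<longleftrightarrow> (\<forall>u. norm_le r ((sdiff (u *\<^sub>R e) ^^ k) f) ((1 / 4) ^ k * A * \<bar>u\<bar> powr \<beta>))"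

lemma sdiff_smooth_weaken:
  assumes "sdiff_smooth r \<beta> e f k A" "A \<le> A'"
  shows "sdiff_smooth r \<beta> e f k A'"
  unfolding sdiff_smooth_def
proof
  fix u
  have "norm_le r ((sdiff (u *\<^sub>R e) ^^ k) f) ((1 / 4) ^ k * A * \<bar>u\<bar> powr \<beta>)"
    using assms(1) by (simp add: sdiff_smooth_def)
  then show "norm_le r ((sdiff (u *\<^sub>R e) ^^ k) f) ((1 / 4) ^ k * A' * \<bar>u\<bar> powr \<beta>)"
    by (rule norm_le_weaken) (intro mult_right_mono mult_left_mono assms(2), auto)
qed

text \<open>A further application is a mere contraction, while the normalisation demands a gain of
  1/4; the constant pays the difference.\<close>

lemma sdiff_smooth_raise:
  assumes "1 \<le> r" "0 \<le> A" "sdiff_smooth r \<beta> e f k A"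
  shows "sdiff_smooth r \<beta> e f (k + i) (4 ^ i * A)"
proof (induction i)
  case (Suc i)
  show ?case unfolding sdiff_smooth_def
  proof
    fix u
    have "norm_le r ((sdiff (u *\<^sub>R e) ^^ (k + i)) f) ((1 / 4) ^ (k + i) * (4 ^ i * A) * \<bar>u\<bar> powr \<beta>)"
      using Suc.IH by (simp add: sdiff_smooth_def)
    then have "norm_le r (sdiff (u *\<^sub>R e) ((sdiff (u *\<^sub>R e) ^^ (k + i)) f)) ((1 / 4) ^ (k + i) * (4 ^ i * A) * \<bar>u\<bar> powr \<beta>)"
      using assms by (intro norm_le_sdiff) auto
    then show "norm_le r ((sdiff (u *\<^sub>R e) ^^ (k + Suc i)) f) ((1 / 4) ^ (k + Suc i) * (4 ^ Suc i * A) * \<bar>u\<bar> powr \<beta>)"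
      by simp
  qed
qed (use assms in simp)

text \<open>The halving inequality bounds the power k at step u by the power 2 k at step u and the
  power k at step 2 u. Iterated towards larger steps, each round contributes the factor \<eta>
  2^\<beta> <= 1/2, so the main terms form a geometric series bounded by 2. The remainder \<eta>^I B
  tends to 0, so B does not enter the constant.\<close>

lemma sdiff_smooth_halve:
  assumes r: "1 \<le> r" and k: "0 < k" and A: "0 \<le> A" and B: "0 \<le> B" and f: "norm_le r f B" and \<beta>: "0 < \<beta>"
    and smooth: "sdiff_smooth r \<beta> e f (2 * k) A"
    and \<eta>: "\<eta> = real ((2 * k - 1) choose (k - 1)) * (1 / 4) ^ k" "\<eta> * 2 powr \<beta> \<le> 1 / 2"
  shows "sdiff_smooth r \<beta> e f k (2 * \<eta> * A)"
proof -
  have \<eta>0: "0 \<le> \<eta>" by (simp add: \<eta>(1))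
  have "1 \<le> 2 powr \<beta>" using \<beta> by (intro ge_one_powr_ge_zero) auto
  then have "\<eta> * 1 \<le> \<eta> * 2 powr \<beta>" using \<eta>0 by (intro mult_left_mono)
  then have \<eta>2: "\<eta> \<le> 1 / 2" using \<eta>(2) by simp
  define s where "s I = (\<Sum>i<I. (\<eta> * 2 powr \<beta>) ^ i)" for I :: nat
  have s0: "0 \<le> s I" for I using \<eta>0 by (auto simp: s_def intro!: sum_nonneg)
  have s2: "s I \<le> 2" for I
  proof -
    have "s I \<le> (\<Sum>i<I. (1 / 2) ^ i)" unfolding s_def using \<eta> \<eta>0 by (intro sum_mono power_mono) auto
    also have "\<dots> = 2 - 2 * (1 / 2) ^ I" by (simp add: sum_gp_strict)
    also have "\<dots> \<le> 2" by simp
    finally show ?thesis .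
  qed
  have iter: "norm_le r ((sdiff (u *\<^sub>R e) ^^ k) f) (\<eta> * (1 / 4) ^ k * A * \<bar>u\<bar> powr \<beta> * s I + \<eta> ^ I * B)" for I u
  proof (induction I arbitrary: u)
    case 0
    show ?case using norm_le_sdiff_power[OF r B f] by (simp add: s_def)
  next
    case (Suc I)
    define E where "E = \<eta> * (1 / 4) ^ k * A * \<bar>2 * u\<bar> powr \<beta> * s I + \<eta> ^ I * B"
    have E: "norm_le r ((sdiff (2 *\<^sub>R (u *\<^sub>R e)) ^^ k) f) E"
      using Suc.IH[of "2 * u"] by (simp add: E_def)
    have E0: "0 \<le> E" using A B s0[of I] \<eta>0 by (simp add: E_def)
    have "norm_le r ((sdiff (u *\<^sub>R e) ^^ (2 * k)) f) ((1 / 4) ^ (2 * k) * A * \<bar>u\<bar> powr \<beta>)"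
      using smooth by (simp add: sdiff_smooth_def)
    from norm_le_sdiff_halving[OF r k _ E0 this E] A
    have "norm_le r ((sdiff (u *\<^sub>R e) ^^ k) f) (real ((2 * k - 1) choose (k - 1)) *
       ((1 / 4) ^ (2 * k) * A * \<bar>u\<bar> powr \<beta> + (1 / 4) ^ k * E))" by simp
    moreover have "real ((2 * k - 1) choose (k - 1)) *
       ((1 / 4) ^ (2 * k) * A * \<bar>u\<bar> powr \<beta> + (1 / 4) ^ k * E) = \<eta> * ((1 / 4) ^ k * A * \<bar>u\<bar> powr \<beta> + E)"
    proof -
      have "(1 / 4 :: real) ^ (2 * k) = (1 / 4) ^ k * (1 / 4) ^ k" by (simp only: mult_2 power_add)
      then show ?thesis unfolding \<eta>(1) by (simp only: distrib_left mult_ac)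
    qed
    moreover have "\<dots> = \<eta> * (1 / 4) ^ k * A * \<bar>u\<bar> powr \<beta> * (1 + \<eta> * 2 powr \<beta> * s I) + \<eta> ^ Suc I * B"
      by (simp add: E_def abs_mult powr_mult algebra_simps)
    moreover have "1 + \<eta> * 2 powr \<beta> * s I = s (Suc I)"
      unfolding s_def by (subst sum.lessThan_Suc_shift) (simp add: sum_distrib_left)
    ultimately show ?case by simp
  qed
  show ?thesis unfolding sdiff_smooth_def
  proof
    fix u
    define X where "X = \<eta> * (1 / 4) ^ k * A * \<bar>u\<bar> powr \<beta>"
    have X0: "0 \<le> X" using \<eta>0 A by (simp add: X_def)
    show "norm_le r ((sdiff (u *\<^sub>R e) ^^ k) f) ((1 / 4) ^ k * (2 * \<eta> * A) * \<bar>u\<bar> powr \<beta>)"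
    proof (rule norm_le_limit)
      fix I
      have "X * s I \<le> X * 2" using X0 s2 by (intro mult_left_mono)
      then show "norm_le r ((sdiff (u *\<^sub>R e) ^^ k) f) ((1 / 4) ^ k * (2 * \<eta> * A) * \<bar>u\<bar> powr \<beta> + \<eta> ^ I * B)"
        using norm_le_weaken[OF iter[of u I]] by (simp add: X_def algebra_simps)
    next
      have "(\<lambda>I. \<eta> ^ I * B) \<longlonglongrightarrow> 0 * B" using \<eta>0 \<eta>2 by (intro tendsto_mult LIMSEQ_realpow_zero) auto
      then show "(\<lambda>I. \<eta> ^ I * B) \<longlonglongrightarrow> 0" by simp
    qed (use A \<eta>0 in auto)
  qed
qed

text \<open>The ratio of consecutive left-hand sides is 4 (2k + 1) (2k + 3) / (k + 1)^2 <= 16. Hence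
  the central binomial coefficient divided by 4^k tends to 0, which is what makes the halving of a
  high order profitable.\<close>

lemma central_binomial_upper: "(real ((2 * k) choose k))\<^sup>2 * (2 * k + 1) \<le> 16 ^ k"
proof (induction k)
  case (Suc k)
  have eq: "real (Suc k) * real ((2 * Suc k) choose Suc k) = 2 * real (2 * k + 1) * real ((2 * k) choose k)"
  proof -
    have 1: "Suc k * ((2 * Suc k) choose Suc k) = (2 * Suc k) * ((2 * k + 1) choose k)"
      using Suc_times_binomial_eq[of "2 * k + 1" k] by (simp add: mult.commute)
    have 2: "Suc k * ((2 * k + 1) choose k) = (2 * k + 1) * ((2 * k) choose k)"
    proof -
      have "Suc k * ((2 * k + 1) choose Suc k) = (2 * k + 1) * ((2 * k) choose k)"
        using Suc_times_binomial_eq[of "2 * k" k] by (simp add: mult.commute)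
      moreover have "((2 * k + 1) choose Suc k) = ((2 * k + 1) choose k)"
        using binomial_symmetric[of k "2 * k + 1"] by simp
      ultimately show ?thesis by simp
    qed
    have "Suc k * ((2 * Suc k) choose Suc k) = 2 * ((2 * k + 1) * ((2 * k) choose k))"
      unfolding 1 2[symmetric] by simp
    then show ?thesis by (metis (mono_tags, lifting) mult.assoc of_nat_mult of_nat_numeral)
  qed
  define x where "x = real ((2 * k) choose k)"
  define y where "y = real ((2 * Suc k) choose Suc k)"
  have y: "y = 2 * real (2 * k + 1) * x / real (Suc k)" using eq by (simp add: x_def y_def field_simps)
  have "y\<^sup>2 * real (2 * Suc k + 1) = (x\<^sup>2 * (2 * k + 1)) * (4 * real (2 * k + 1) * real (2 * k + 3) / (real (Suc k))\<^sup>2)"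
    unfolding y by (simp add: power2_eq_square field_simps)
  also have "\<dots> \<le> 16 ^ k * 16"
  proof (intro mult_mono)
    show "4 * real (2 * k + 1) * real (2 * k + 3) / (real (Suc k))\<^sup>2 \<le> 16"
    proof -
      have "0 < (real (Suc k))\<^sup>2" by simp
      moreover have "4 * real (2 * k + 1) * real (2 * k + 3) \<le> 16 * (real (Suc k))\<^sup>2"
        by (simp add: algebra_simps power2_eq_square)
      ultimately show ?thesis by (simp only: pos_divide_le_eq)
    qed
  qed (use Suc.IH in \<open>auto simp: x_def\<close>)
  finally show ?case by (simp add: y_def mult.commute)
qed simp

lemma central_binomial_small:
  assumes "0 < (e :: real)"
  obtains k1 where "0 < k1" "\<And>k. k1 \<le> k \<Longrightarrow> real ((2 * k - 1) choose (k - 1)) * (1 / 4) ^ k \<le> e"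
proof -
  obtain k0 where k0: "1 / e\<^sup>2 < real k0" using reals_Archimedean2 by blast
  show ?thesis
  proof (rule that[of "Suc k0"])
    fix k assume k: "Suc k0 \<le> k"
    define x where "x = real ((2 * k) choose k) * (1 / 4) ^ k"
    have x0: "0 \<le> x" by (simp add: x_def)
    have "((4 :: real) ^ k)\<^sup>2 = 16 ^ k" by (simp flip: power_mult power_mult_distrib add: power2_eq_square)
    then have "x\<^sup>2 * (2 * k + 1) \<le> 1"
      using central_binomial_upper[of k] by (simp add: x_def power_mult_distrib power_divide)
    moreover have "1 / e\<^sup>2 \<le> 2 * k + 1" using k0 k by linarith
    ultimately have "x\<^sup>2 * (1 / e\<^sup>2) \<le> 1"
      by (meson mult_left_mono order_trans zero_le_power2)
    then have "x\<^sup>2 \<le> e\<^sup>2" using assms by (simp add: field_simps)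
    then have "x \<le> e" using assms x0 by (simp add: power2_le_iff_abs_le)
    have "((2 * k - 1) choose (k - 1)) \<le> ((2 * k) choose k)"
      using k by (cases k) auto
    then have "real ((2 * k - 1) choose (k - 1)) * (1 / 4) ^ k \<le> x"
      unfolding x_def by (intro mult_right_mono) auto
    with \<open>x \<le> e\<close> show "real ((2 * k - 1) choose (k - 1)) * (1 / 4) ^ k \<le> e" by simp
  qed simp
qed

text \<open>A large order K is rounded up to an even order 2 k at the price of a factor 4 and then
  halved at the gain 2 \<eta> <= 1/4; the bound 1/8 in \<open>small\<close> is chosen so that such a
  round loses nothing. A constant is paid only once, when the order has fallen to at most 2 k1 and
  is raised to exactly this number.\<close>

lemma sdiff_smooth_descend:
  assumes r: "1 \<le> r" and A: "0 \<le> A" and B: "0 \<le> B" and f: "norm_le r f B" and \<beta>: "0 < \<beta>" and k1: "0 < k1"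
    and small: "\<And>k. k1 \<le> k \<Longrightarrow> real ((2 * k - 1) choose (k - 1)) * (1 / 4) ^ k \<le> min (1 / 8) (1 / 2 / 2 powr \<beta>)"
  shows "sdiff_smooth r \<beta> e f K A \<Longrightarrow> sdiff_smooth r \<beta> e f (2 * k1) (4 ^ (2 * k1) * A)"
proof (induction K rule: less_induct)
  case (less K)
  show ?case
  proof (cases "K \<le> 2 * k1")
    case True
    have "sdiff_smooth r \<beta> e f (K + (2 * k1 - K)) (4 ^ (2 * k1 - K) * A)"
      by (rule sdiff_smooth_raise[OF r A less.prems])
    then have "sdiff_smooth r \<beta> e f (2 * k1) (4 ^ (2 * k1 - K) * A)" using True by simp
    moreover have "4 ^ (2 * k1 - K) * A \<le> 4 ^ (2 * k1) * A" using A by (intro mult_right_mono power_increasing) auto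
    ultimately show ?thesis by (rule sdiff_smooth_weaken)
  next
    case False
    define k where "k = (K + 1) div 2"
    have k: "k1 \<le> k" "k < K" "K = 2 * k \<or> Suc K = 2 * k" using False k1 by (auto simp: k_def)
    define \<eta> where "\<eta> = real ((2 * k - 1) choose (k - 1)) * (1 / 4) ^ k"
    have \<eta>: "0 \<le> \<eta>" "\<eta> \<le> 1 / 8" "\<eta> * 2 powr \<beta> \<le> 1 / 2"
      using small[OF k(1)] by (auto simp: \<eta>_def field_simps)
    have "sdiff_smooth r \<beta> e f (2 * k) (4 * A)"
    proof -
      have "sdiff_smooth r \<beta> e f (K + (2 * k - K)) (4 ^ (2 * k - K) * A)"
        by (rule sdiff_smooth_raise[OF r A less.prems])
      then have "sdiff_smooth r \<beta> e f (2 * k) (4 ^ (2 * k - K) * A)" using k by auto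
      moreover have "4 ^ (2 * k - K) * A \<le> 4 ^ 1 * A" using A k by (intro mult_right_mono power_increasing) auto
      ultimately show ?thesis by (metis sdiff_smooth_weaken power_one_right)
    qed
    then have "sdiff_smooth r \<beta> e f k (2 * \<eta> * (4 * A))"
      using k k1 A B r f \<beta> \<eta> by (intro sdiff_smooth_halve) (auto simp: \<eta>_def)
    moreover have "2 * \<eta> * (4 * A) \<le> A" using \<eta> A mult_right_mono[of "8 * \<eta>" 1 A] by simp
    ultimately have "sdiff_smooth r \<beta> e f k A" by (rule sdiff_smooth_weaken)
    then show ?thesis by (rule less.IH[OF k(2)])
  qed
qed

text \<open>Two forward differences are -4 times a symmetric one that is centred one step to the
  right.\<close>

lemma diff_op_even_power:
  fixes f :: "real ^ 'd \<Rightarrow> real"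
  shows "(diff_op u j ^^ (2 * k)) f x = (- 4) ^ k * (sdiff (u *\<^sub>R axis j 1) ^^ k) f (x + (real k * u) *\<^sub>R axis j 1)"
proof (induction k arbitrary: x)
  case (Suc k)
  define e :: "real ^ 'd" where "e = axis j 1"
  define g where "g = (sdiff (u *\<^sub>R e) ^^ k) f"
  define G where "G = (diff_op u j ^^ (2 * k)) f"
  have G: "G y = (- 4) ^ k * g (y + (real k * u) *\<^sub>R e)" for y
    using Suc.IH by (simp add: G_def g_def e_def)
  have "(diff_op u j ^^ (2 * Suc k)) f x = G (x + u *\<^sub>R e + u *\<^sub>R e) - 2 * G (x + u *\<^sub>R e) + G x"
    by (simp add: diff_op_def G_def e_def)
  also have "\<dots> = (- 4) ^ Suc k * sdiff (u *\<^sub>R e) g (x + (real (Suc k) * u) *\<^sub>R e)"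
  proof -
    have e1: "x + u *\<^sub>R e + u *\<^sub>R e + (real k * u) *\<^sub>R e = x + (real (Suc k) * u) *\<^sub>R e + u *\<^sub>R e"
      "x + u *\<^sub>R e + (real k * u) *\<^sub>R e = x + (real (Suc k) * u) *\<^sub>R e"
      "x + (real k * u) *\<^sub>R e = x + (real (Suc k) * u) *\<^sub>R e - u *\<^sub>R e"
      by (simp_all add: algebra_simps)
    show ?thesis unfolding G e1(1,2) unfolding e1(3)
      by (simp add: sdiff_def algebra_simps)
  qed
  finally show ?case by (simp add: g_def e_def)
qed simp

lemma norm_le_diff_op:
  assumes "1 \<le> r" "0 \<le> B" "norm_le r f B"
  shows "norm_le r (diff_op u j f) (2 * B)"
proof -
  have "norm_le r (\<lambda>x. f (x + u *\<^sub>R axis j 1) + (- 1) * f x) (B + \<bar>- 1\<bar> * B)"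
    using assms by (intro norm_le_add norm_le_shift norm_le_cmult) auto
  then show ?thesis by (simp add: diff_op_def)
qed

lemma norm_le_diff_op_power:
  assumes "1 \<le> r" "0 \<le> B" "norm_le r f B"
  shows "norm_le r ((diff_op u j ^^ k) f) (2 ^ k * B)"
proof (induction k)
  case (Suc k)
  then show ?case using norm_le_diff_op[OF assms(1) _ Suc.IH, of u j] assms by (simp add: mult.assoc)
qed (use assms in simp)

text \<open>The constant does not depend on the order \<open>K\<close> of the given difference: each halving of a large
  order loses at most a factor 1, because the central binomial coefficients are of smaller order
  than the powers of 4.\<close>

lemma uniform_marchaud:
  assumes \<beta>: "0 < \<beta>"
  obtains m C where "0 < C" "0 < m"
    "\<And>(f :: real ^ 'd \<Rightarrow> real) r j A B K u. \<lbrakk>1 \<le> r; 0 \<le> A; 0 \<le> B; norm_le r f B;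
       \<And>u. norm_le r ((diff_op u j ^^ K) f) (A * \<bar>u\<bar> powr \<beta>)\<rbrakk>
       \<Longrightarrow> norm_le r ((diff_op u j ^^ m) f) (C * A * \<bar>u\<bar> powr \<beta>)"
proof -
  have "0 < min (1 / 8) (1 / 2 / 2 powr \<beta>)" by simp
  then obtain k1 where k1: "0 < k1" and small:
    "\<And>k. k1 \<le> k \<Longrightarrow> real ((2 * k - 1) choose (k - 1)) * (1 / 4) ^ k \<le> min (1 / 8) (1 / 2 / 2 powr \<beta>)"
    using central_binomial_small by metis
  show thesis
  \<comment> \<open>The power 2 k1 of the symmetric difference is a difference of order 4 k1. The
    constant collects the factor 4^(2 k1) of the descent, generously rounded to 2^(8 k1), and a
    factor 2 for making K even.\<close>
  proof (rule that[of "2 ^ (8 * k1 + 1)" "2 * (2 * k1)"])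
    fix f :: "real ^ 'd \<Rightarrow> real" and r j A B K u
    assume r: "1 \<le> r" and A: "0 \<le> A" and B: "0 \<le> B" and f: "norm_le r f B"
      and smooth: "\<And>u. norm_le r ((diff_op u j ^^ K) f) (A * \<bar>u\<bar> powr \<beta>)"
    define e :: "real ^ 'd" where "e = axis j 1"
    define k where "k = (K + 1) div 2"
    have k: "K = 2 * k \<or> Suc K = 2 * k" by (auto simp: k_def)
    have even: "norm_le r ((diff_op u j ^^ (2 * k)) f) (2 * A * \<bar>u\<bar> powr \<beta>)" for u
      using k
    proof
      assume "K = 2 * k"
      then show ?thesis using smooth[of u] A by (auto intro: norm_le_weaken simp: mult_right_mono)
    next
      assume "Suc K = 2 * k"
      then show ?thesis using norm_le_diff_op[OF r _ smooth[of u], of u j] A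
        by (metis comp_apply funpow.simps(2) mult.assoc mult_nonneg_nonneg powr_ge_zero)
    qed
    have "sdiff_smooth r \<beta> e f k (2 * A)" unfolding sdiff_smooth_def
    proof
      fix u
      have "norm_le r (\<lambda>x. (- 1 / 4) ^ k * (diff_op u j ^^ (2 * k)) f (x + - ((real k * u) *\<^sub>R e)))
          (\<bar>(- 1 / 4) ^ k\<bar> * (2 * A * \<bar>u\<bar> powr \<beta>))"
        using A by (intro norm_le_cmult norm_le_shift r even) auto
      moreover have "(- 1 / 4) ^ k * (diff_op u j ^^ (2 * k)) f (x + - ((real k * u) *\<^sub>R e))
          = (sdiff (u *\<^sub>R e) ^^ k) f x" for x
        by (simp add: diff_op_even_power e_def flip: power_mult_distrib)
      ultimately show "norm_le r ((sdiff (u *\<^sub>R e) ^^ k) f) ((1 / 4) ^ k * (2 * A) * \<bar>u\<bar> powr \<beta>)"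
        by (simp add: power_abs mult.assoc)
    qed
    then have "sdiff_smooth r \<beta> e f (2 * k1) (4 ^ (2 * k1) * (2 * A))"
      using sdiff_smooth_descend[OF r _ B f \<beta> k1 small, of "2 * A" e k] A by simp
    then have "norm_le r ((sdiff (u *\<^sub>R e) ^^ (2 * k1)) f) ((1 / 4) ^ (2 * k1) * (4 ^ (2 * k1) * (2 * A)) * \<bar>u\<bar> powr \<beta>)"
      by (simp add: sdiff_smooth_def)
    then have "norm_le r (\<lambda>x. (- 4) ^ (2 * k1) * (sdiff (u *\<^sub>R e) ^^ (2 * k1)) f (x + (real (2 * k1) * u) *\<^sub>R e))
        (\<bar>(- 4) ^ (2 * k1)\<bar> * ((1 / 4) ^ (2 * k1) * (4 ^ (2 * k1) * (2 * A)) * \<bar>u\<bar> powr \<beta>))"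
      using A by (intro norm_le_cmult norm_le_shift r) auto
    moreover have "(\<lambda>x. (- 4) ^ (2 * k1) * (sdiff (u *\<^sub>R e) ^^ (2 * k1)) f (x + (real (2 * k1) * u) *\<^sub>R e))
        = (diff_op u j ^^ (2 * (2 * k1))) f"
      by (rule ext, subst diff_op_even_power) (simp add: e_def)
    moreover have "\<bar>(- 4) ^ (2 * k1)\<bar> * ((1 / 4) ^ (2 * k1) * (4 ^ (2 * k1) * (2 * A)) * \<bar>u\<bar> powr \<beta>)
        \<le> 2 ^ (8 * k1 + 1) * A * \<bar>u\<bar> powr \<beta>"
    proof -
      have "(4 :: real) ^ (2 * k1) \<le> 2 ^ (8 * k1)"
        by (simp add: power_mult power_mono)
      then have "(4 :: real) ^ (2 * k1) * (2 * (A * \<bar>u\<bar> powr \<beta>)) \<le> 2 ^ (8 * k1) * (2 * (A * \<bar>u\<bar> powr \<beta>))"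
        using A by (intro mult_right_mono) auto
      then show ?thesis by (simp add: power_abs power_divide mult_ac)
    qed
    ultimately show "norm_le r ((diff_op u j ^^ (2 * (2 * k1))) f) (2 ^ (8 * k1 + 1) * A * \<bar>u\<bar> powr \<beta>)"
      by (auto intro: norm_le_weaken)
  qed (use k1 in auto)
qed

subsection \<open>Approximation on the hyperbolic cross\<close>

text \<open>Such operators commute with all differences, hence with the smoothing and detail
  operators of every coordinate. Each coordinate can therefore be treated without spoiling the
  bounds that hold in the others.\<close>

definition shift_linear :: "((real ^ 'd \<Rightarrow> real) \<Rightarrow> (real ^ 'd \<Rightarrow> real)) \<Rightarrow> bool" where
  "shift_linear T \<longleftrightarrow> (\<forall>f g a b. T (\<lambda>x. a * f x + b * g x) = (\<lambda>x. a * T f x + b * T g x)) \<and>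
     (\<forall>f v. T (\<lambda>x. f (x + v)) = (\<lambda>x. T f (x + v)))"

lemma shift_linear_combination:
  "shift_linear T \<Longrightarrow> T (\<lambda>x. a * f x + b * g x) = (\<lambda>x. a * T f x + b * T g x)"
  by (simp add: shift_linear_def)

lemma shift_linear_shift: "shift_linear T \<Longrightarrow> T (\<lambda>x. f (x + v)) = (\<lambda>x. T f (x + v))"
  by (simp add: shift_linear_def)

lemma shift_linear_diff: "shift_linear T \<Longrightarrow> T (\<lambda>x. f x - g x) = (\<lambda>x. T f x - T g x)"
  using shift_linear_combination[of T 1 f "- 1" g] by simp

lemma shift_linear_id: "shift_linear (\<lambda>f. f)"
  by (simp add: shift_linear_def)

lemma shift_linear_comp: "shift_linear S \<Longrightarrow> shift_linear T \<Longrightarrow> shift_linear (\<lambda>f. S (T f))"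
  by (simp add: shift_linear_def)

lemma shift_linear_lincomb:
  assumes "shift_linear S" "shift_linear T"
  shows "shift_linear (\<lambda>f x. a * S f x + b * T f x)"
  unfolding shift_linear_def
proof (intro conjI allI)
  show "(\<lambda>x. a * S (\<lambda>x. f (x + v)) x + b * T (\<lambda>x. f (x + v)) x) = (\<lambda>x. a * S f (x + v) + b * T f (x + v))" for f v
    by (simp only: shift_linear_shift[OF assms(1)] shift_linear_shift[OF assms(2)])
qed (simp add: shift_linear_combination[OF assms(1)] shift_linear_combination[OF assms(2)] algebra_simps)

lemma shift_linear_sum:
  assumes "\<And>i. i \<in> I \<Longrightarrow> shift_linear (T i)"
  shows "shift_linear (\<lambda>f x. \<Sum>i\<in>I. T i f x)"
  using assms
proof (induction I rule: infinite_finite_induct)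
  case (insert i I)
  then show ?case using shift_linear_lincomb[of "T i" "\<lambda>f x. \<Sum>i\<in>I. T i f x" 1 1] by simp
qed (simp_all add: shift_linear_def)

lemma shift_linear_diff_op: "shift_linear (diff_op u j)"
  by (simp add: shift_linear_def diff_op_def algebra_simps)

lemma shift_linear_diff_op_power: "shift_linear (diff_op u j ^^ k)"
proof (induction k)
  case (Suc k)
  then show ?case using shift_linear_comp[OF shift_linear_diff_op[of u j]] by (simp add: comp_def)
qed (simp add: shift_linear_id id_def)

lemma shift_linear_commute_diff_op:
  assumes "shift_linear T"
  shows "T (diff_op u j f) = diff_op u j (T f)"
  unfolding diff_op_def
  using shift_linear_diff[OF assms, of "\<lambda>x. f (x + u *\<^sub>R axis j 1)" f] shift_linear_shift[OF assms, of f "u *\<^sub>R axis j 1"]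
  by simp

lemma shift_linear_commute_diff_op_power:
  assumes "shift_linear T"
  shows "T ((diff_op u j ^^ k) f) = (diff_op u j ^^ k) (T f)"
  by (induction k) (simp_all add: shift_linear_commute_diff_op[OF assms])

text \<open>The sign removes the unshifted term, which leaves a combination of the translates by 1,
  ..., m times s_j / 2^i along coordinate j; the error is an m-th difference. The parameter s is
  later averaged over the unit cube, which turns translates into a bounded kernel.\<close>

definition smooth_op :: "'d \<Rightarrow> nat \<Rightarrow> nat \<Rightarrow> real ^ 'd \<Rightarrow> (real ^ 'd \<Rightarrow> real) \<Rightarrow> real ^ 'd \<Rightarrow> real" where
  "smooth_op j m i s f = (\<lambda>x. f x - (- 1) ^ m * (diff_op (s $ j / 2 ^ i) j ^^ m) f x)"

definition detail_op :: "'d \<Rightarrow> nat \<Rightarrow> nat \<Rightarrow> real ^ 'd \<Rightarrow> (real ^ 'd \<Rightarrow> real) \<Rightarrow> real ^ 'd \<Rightarrow> real" where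
  "detail_op j m i s f =
     (if i = 0 then smooth_op j m 0 s f else (\<lambda>x. smooth_op j m i s f x - smooth_op j m (i - 1) s f x))"

text \<open>The sum over the hyperbolic cross of all products of detail operators whose levels add up
  to at most \<open>J\<close>.\<close>

fun cross_op :: "('d \<Rightarrow> nat) \<Rightarrow> 'd list \<Rightarrow> nat \<Rightarrow> real ^ 'd \<Rightarrow> (real ^ 'd \<Rightarrow> real) \<Rightarrow> real ^ 'd \<Rightarrow> real" where
  "cross_op m [] J s f = f"
| "cross_op m (j # ds) J s f = (\<lambda>x. \<Sum>i\<le>J. detail_op j (m j) i s (cross_op m ds (J - i) s f) x)"

lemma shift_linear_smooth_op: "shift_linear (smooth_op j m i s)"
  using shift_linear_lincomb[OF shift_linear_id shift_linear_diff_op_power, of 1 "- ((- 1) ^ m)"]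
  by (simp add: smooth_op_def[abs_def])

lemma shift_linear_detail_op: "shift_linear (detail_op j m i s)"
  using shift_linear_lincomb[OF shift_linear_smooth_op shift_linear_smooth_op, of 1 j m i s "- 1" j m "i - 1" s]
    shift_linear_smooth_op[of j m 0 s]
  by (cases "i = 0") (simp_all add: detail_op_def[abs_def])

lemma commute_smooth_op:
  assumes "shift_linear T"
  shows "T (smooth_op j m i s f) = smooth_op j m i s (T f)"
  using shift_linear_combination[OF assms, of 1 f "- ((- 1) ^ m)" "(diff_op (s $ j / 2 ^ i) j ^^ m) f"]
  by (simp add: smooth_op_def shift_linear_commute_diff_op_power[OF assms])

lemma commute_detail_op:
  assumes "shift_linear T"
  shows "T (detail_op j m i s f) = detail_op j m i s (T f)"
  by (simp add: detail_op_def commute_smooth_op[OF assms] shift_linear_diff[OF assms])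

lemma shift_linear_cross_op: "shift_linear (cross_op m ds J s)"
proof (induction ds arbitrary: J)
  case (Cons j ds)
  have "shift_linear (\<lambda>f x. \<Sum>i\<in>{..J}. detail_op j (m j) i s (cross_op m ds (J - i) s f) x)"
    by (intro shift_linear_sum shift_linear_comp[OF shift_linear_detail_op Cons.IH])
  then show ?case by (simp add: cross_op.simps(2)[abs_def])
qed (simp add: shift_linear_id cross_op.simps(1)[abs_def])

lemma sum_detail_op: "(\<Sum>i\<le>J. detail_op j m i s f x) = smooth_op j m J s f x"
  by (induction J) (simp_all add: detail_op_def)

text \<open>The details of coordinate j telescope, and the operators of the other coordinates
  commute with them. A detail of level i leaves the budget J - i to the remaining
  coordinates.\<close>

lemma cross_op_Cons_error:
  "f x - cross_op m (j # ds) J s f x = (f x - smooth_op j (m j) J s f x) +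
     (\<Sum>i\<le>J. detail_op j (m j) i s f x - cross_op m ds (J - i) s (detail_op j (m j) i s f) x)"
  by (simp add: sum_subtractf sum_detail_op commute_detail_op[OF shift_linear_cross_op])

section \<open>Norm bounds on the hyperbolic cross\<close>

lemma norm_le_diff:
  assumes "1 \<le> r" "0 \<le> A" "0 \<le> B" "norm_le r f A" "norm_le r g B"
  shows "norm_le r (\<lambda>x. f x - g x) (A + B)"
proof -
  have "norm_le r (\<lambda>x. - 1 * g x) (\<bar>- 1\<bar> * B)" by (rule norm_le_cmult[OF assms(1,3,5)])
  then have "norm_le r (\<lambda>x. - 1 * g x) B" by simp
  from norm_le_add[OF assms(1-4) this] show ?thesis by simp
qed

lemma norm_le_smooth_op:
  assumes "1 \<le> r" "0 \<le> B" "norm_le r f B"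
  shows "norm_le r (smooth_op j m i s f) ((1 + 2 ^ m) * B)"
proof -
  have "norm_le r (\<lambda>x. f x - (- 1) ^ m * (diff_op (s $ j / 2 ^ i) j ^^ m) f x) (B + \<bar>(- 1) ^ m\<bar> * (2 ^ m * B))"
    using assms by (intro norm_le_diff norm_le_cmult norm_le_diff_op_power) auto
  then show ?thesis by (simp add: smooth_op_def power_abs algebra_simps)
qed

lemma norm_le_detail_op:
  assumes "1 \<le> r" "0 \<le> B" "norm_le r f B"
  shows "norm_le r (detail_op j m i s f) (2 * (1 + 2 ^ m) * B)"
proof (cases "i = 0")
  case True
  have "norm_le r (detail_op j m i s f) ((1 + 2 ^ m) * B)"
    using norm_le_smooth_op[OF assms, of j m 0 s] True by (simp add: detail_op_def)
  moreover have "(1 + 2 ^ m) * B \<le> 2 * (1 + 2 ^ m) * B"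
    using assms(2) by (intro mult_right_mono) auto
  ultimately show ?thesis by (rule norm_le_weaken)
next
  case False
  have "norm_le r (\<lambda>x. smooth_op j m i s f x - smooth_op j m (i - 1) s f x) ((1 + 2 ^ m) * B + (1 + 2 ^ m) * B)"
    using assms by (intro norm_le_diff norm_le_smooth_op) auto
  then show ?thesis using False by (simp add: detail_op_def algebra_simps)
qed

lemma norm_le_smooth_op_error:
  assumes r: "1 \<le> r" and A: "0 \<le> A" and \<beta>: "0 < \<beta>" and s: "0 \<le> s $ j" "s $ j \<le> 1"
    and f: "\<And>u. norm_le r ((diff_op u j ^^ m) f) (A * \<bar>u\<bar> powr \<beta>)"
  shows "norm_le r (\<lambda>x. f x - smooth_op j m i s f x) (A * 2 powr (- \<beta> * i))"
proof -
  have "norm_le r (\<lambda>x. (- 1) ^ m * (diff_op (s $ j / 2 ^ i) j ^^ m) f x) (\<bar>(- 1) ^ m\<bar> * (A * \<bar>s $ j / 2 ^ i\<bar> powr \<beta>))"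
    using A by (intro norm_le_cmult r f) auto
  then have "norm_le r (\<lambda>x. f x - smooth_op j m i s f x) (A * \<bar>s $ j / 2 ^ i\<bar> powr \<beta>)"
    by (simp add: smooth_op_def power_abs)
  moreover have "\<bar>s $ j / 2 ^ i\<bar> powr \<beta> \<le> 2 powr (- \<beta> * i)"
  proof -
    have "\<bar>s $ j / 2 ^ i\<bar> powr \<beta> \<le> (1 / 2 ^ i) powr \<beta>"
      using s \<beta> by (intro powr_mono2) (auto simp: divide_right_mono)
    also have "(1 / 2 ^ i :: real) = 2 powr (- real i)" by (simp add: powr_minus powr_realpow field_simps)
    finally show ?thesis by (simp add: powr_powr mult.commute)
  qed
  ultimately show ?thesis using A by (auto intro: norm_le_weaken mult_left_mono)
qed

text \<open>A detail is the difference of two consecutive smoothing errors, the coarser of which is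
  larger by 2^\<beta>. At level 0 there is no coarser one, and plain boundedness supplies the other
  half of the constant.\<close>

lemma norm_le_detail_op_smooth:
  assumes r: "1 \<le> r" and A: "0 \<le> A" and \<beta>: "0 < \<beta>" and s: "0 \<le> s $ j" "s $ j \<le> 1" and f0: "norm_le r f A"
    and f: "\<And>u. norm_le r ((diff_op u j ^^ m) f) (A * \<bar>u\<bar> powr \<beta>)"
  shows "norm_le r (detail_op j m i s f) (((1 + 2 ^ m) + (1 + 2 powr \<beta>)) * A * 2 powr (- \<beta> * i))"
proof (cases "i = 0")
  case True
  have "norm_le r (detail_op j m i s f) ((1 + 2 ^ m) * A)"
    using norm_le_smooth_op[OF r A f0, of j m 0 s] True by (simp add: detail_op_def)
  moreover have "(1 + 2 ^ m) * A \<le> ((1 + 2 ^ m) + (1 + 2 powr \<beta>)) * A"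
    using A by (intro mult_right_mono) auto
  ultimately show ?thesis using True by (auto intro: norm_le_weaken)
next
  case False
  note e = norm_le_smooth_op_error[OF r A \<beta> s f]
  have "norm_le r (\<lambda>x. (f x - smooth_op j m (i - 1) s f x) - (f x - smooth_op j m i s f x))
      (A * 2 powr (- \<beta> * real (i - 1)) + A * 2 powr (- \<beta> * real i))"
    using A by (intro norm_le_diff r e) auto
  moreover have "- \<beta> * real (i - 1) = \<beta> + - \<beta> * real i"
    using False by (simp add: of_nat_diff algebra_simps)
  then have "2 powr (- \<beta> * real (i - 1)) = 2 powr \<beta> * 2 powr (- \<beta> * real i)" by (simp only: powr_add)
  ultimately have "norm_le r (detail_op j m i s f) ((1 + 2 powr \<beta>) * A * 2 powr (- \<beta> * real i))"
    using False by (simp add: detail_op_def algebra_simps)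
  then show ?thesis
    by (rule norm_le_weaken) (use A in \<open>intro mult_right_mono; simp\<close>)
qed

text \<open>The invariant of the recursion over the coordinates. D holds the coordinates still to be
  treated, with their smoothness; \<iota> l is the level of the detail already taken in direction l,
  worth a gain of 2^(-\<beta>_l \<iota>_l) in the norm of that direction; the bound in L_p is merely
  preserved.\<close>

definition cross_class :: "('d::finite \<Rightarrow> real) \<Rightarrow> ('d \<Rightarrow> ennreal) \<Rightarrow> ennreal \<Rightarrow> ('d \<Rightarrow> nat) \<Rightarrow> 'd set \<Rightarrow> ('d \<Rightarrow> nat)
    \<Rightarrow> real \<Rightarrow> (real ^ 'd \<Rightarrow> real) \<Rightarrow> bool" where
  "cross_class \<beta> r p m D \<iota> A g \<longleftrightarrow> norm_le p g A \<and>
     (\<forall>l. norm_le (r l) g (A * 2 powr (- \<beta> l * \<iota> l))) \<and>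
     (\<forall>l\<in>D. \<iota> l = 0 \<and> (\<forall>u. norm_le (r l) ((diff_op u l ^^ m l) g) (A * \<bar>u\<bar> powr \<beta> l)))"

context
  fixes \<beta> :: "'d::finite \<Rightarrow> real" and r :: "'d \<Rightarrow> ennreal" and p :: ennreal and m :: "'d \<Rightarrow> nat" and \<kappa> :: real
  assumes \<beta>: "\<And>l. 0 < \<beta> l" and r: "\<And>l. 1 \<le> r l" and p: "1 \<le> p"
    and \<kappa>: "0 \<le> \<kappa>" "\<kappa> * (\<Sum>l\<in>UNIV. 1 / \<beta> l) \<le> 1"
      "\<kappa> * (\<Sum>l\<in>UNIV. 1 / \<beta> l * recip (r l)) + (1 - \<kappa> * (\<Sum>l\<in>UNIV. 1 / \<beta> l)) * recip p = 1 / 2"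
begin

text \<open>Interpolation with weight \<kappa> / \<beta>_l on L_(r_l) and the remaining weight on
  L_p: the exponents \<beta>_l cancel, so the gain depends on the levels only through their sum.
  This is why the levels are cut off along a hyperbolic cross. The extra index \<open>None\<close>
  stands for p.\<close>

lemma norm_le_2_cross:
  assumes A: "0 < A" and g: "norm_le p g A" "\<And>l. norm_le (r l) g (A * 2 powr (- \<beta> l * \<iota> l))"
  shows "norm_le 2 g (A * 2 powr (- \<kappa> * (\<Sum>l\<in>UNIV. real (\<iota> l))))"
proof -
  define R where "R = case_option p r"
  define w where "w = case_option (1 - \<kappa> * (\<Sum>l\<in>UNIV. 1 / \<beta> l)) (\<lambda>l. \<kappa> / \<beta> l)"
  define B where "B = case_option A (\<lambda>l. A * 2 powr (- \<beta> l * \<iota> l))"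
  have sum_option: "(\<Sum>i\<in>UNIV. h i) = h None + (\<Sum>l\<in>UNIV. h (Some l))" for h :: "'d option \<Rightarrow> real"
    by (simp add: UNIV_option_conv sum.reindex)
  have prod_option: "(\<Prod>i\<in>UNIV. h i) = h None * (\<Prod>l\<in>UNIV. h (Some l))" for h :: "'d option \<Rightarrow> real"
    by (simp add: UNIV_option_conv prod.reindex)
  have "norm_le 2 g (\<Prod>i\<in>UNIV. B i powr w i)"
  proof (rule norm_le_interpolation[where r = R])
    show "sum w UNIV = 1" by (simp add: sum_option w_def sum_distrib_left)
    show "(\<Sum>i\<in>UNIV. w i * recip (R i)) = 1 / 2"
      using \<kappa>(3) by (simp add: sum_option w_def R_def sum_distrib_left)
    show "1 \<le> R i" "0 < B i" "0 \<le> w i" "norm_le (R i) g (B i)" for i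
      using p r A g \<kappa> \<beta> by (auto simp: R_def B_def w_def less_imp_le split: option.splits)
  qed simp
  also have "(\<Prod>i\<in>UNIV. B i powr w i)
      = A powr (1 - \<kappa> * (\<Sum>l\<in>UNIV. 1 / \<beta> l)) * (\<Prod>l\<in>UNIV. A powr (\<kappa> / \<beta> l) * 2 powr (- \<kappa> * \<iota> l))"
  proof -
    have "(A * 2 powr (- \<beta> l * \<iota> l)) powr (\<kappa> / \<beta> l) = A powr (\<kappa> / \<beta> l) * 2 powr (- \<kappa> * \<iota> l)" for l
    proof -
      have "- \<beta> l * \<iota> l * (\<kappa> / \<beta> l) = - \<kappa> * \<iota> l" using \<beta>[of l] by simp
      then show ?thesis using A by (simp add: powr_mult powr_powr)
    qed
    then show ?thesis by (simp add: prod_option B_def w_def)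
  qed
  also have "\<dots> = A powr ((1 - \<kappa> * (\<Sum>l\<in>UNIV. 1 / \<beta> l)) + (\<Sum>l\<in>UNIV. \<kappa> / \<beta> l)) * 2 powr (\<Sum>l\<in>UNIV. - \<kappa> * \<iota> l)"
    using A by (simp add: prod.distrib powr_sum powr_add)
  also have "\<dots> = A * 2 powr (- \<kappa> * (\<Sum>l\<in>UNIV. real (\<iota> l)))"
    using A by (simp add: sum_distrib_left sum_negf)
  finally show ?thesis .
qed

text \<open>Coordinate j trades its smoothness for a gain at level i. The other bounds survive
  because the detail operator is bounded in every norm and commutes with the differences.\<close>

lemma cross_class_detail_op:
  assumes g: "cross_class \<beta> r p m (insert j D) \<iota> A g" and A: "0 < A" and j: "j \<notin> D"
    and s: "0 \<le> s $ j" "s $ j \<le> 1"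
  shows "cross_class \<beta> r p m D (\<iota>(j := i)) ((2 * (1 + 2 ^ m j) + (1 + 2 powr \<beta> j)) * A) (detail_op j (m j) i s g)"
proof -
  define c :: real where "c = 2 * (1 + 2 ^ m j)"
  define C where "C = c + (1 + 2 powr \<beta> j)"
  have cC: "0 \<le> c" "c \<le> C" "(1 + 2 ^ m j) + (1 + 2 powr \<beta> j) \<le> C" by (simp_all add: c_def C_def)
  have C: "norm_le q (detail_op j (m j) i s h) (C * X)" if "1 \<le> q" "0 \<le> X" "norm_le q h X" for q h X
  proof (rule norm_le_weaken)
    show "norm_le q (detail_op j (m j) i s h) (c * X)"
      unfolding c_def by (rule norm_le_detail_op[OF that])
    show "c * X \<le> C * X" using cC(2) that(2) by (rule mult_right_mono)
  qed
  have j1: "\<iota> j = 0" "norm_le (r j) g A" "\<And>u. norm_le (r j) ((diff_op u j ^^ m j) g) (A * \<bar>u\<bar> powr \<beta> j)"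
    using g by (auto simp: cross_class_def dest: spec[of _ j])
  have "norm_le p (detail_op j (m j) i s g) (C * A)"
    using g A p by (intro C) (auto simp: cross_class_def)
  moreover have "norm_le (r l) (detail_op j (m j) i s g) (C * A * 2 powr (- \<beta> l * (\<iota>(j := i)) l))" for l
  proof (cases "l = j")
    case True
    have "norm_le (r j) (detail_op j (m j) i s g) (((1 + 2 ^ m j) + (1 + 2 powr \<beta> j)) * A * 2 powr (- \<beta> j * i))"
      using A \<beta> r s j1 by (intro norm_le_detail_op_smooth) auto
    moreover have "((1 + 2 ^ m j) + (1 + 2 powr \<beta> j)) * A * 2 powr (- \<beta> j * i) \<le> C * A * 2 powr (- \<beta> j * i)"
      using cC A by (intro mult_right_mono) auto
    ultimately show ?thesis using True by (auto intro: norm_le_weaken)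
  next
    case False
    have "norm_le (r l) (detail_op j (m j) i s g) (C * (A * 2 powr (- \<beta> l * \<iota> l)))"
      using g A r by (intro C) (auto simp: cross_class_def)
    then show ?thesis using False by (simp add: mult.assoc)
  qed
  moreover have "norm_le (r l) ((diff_op u l ^^ m l) (detail_op j (m j) i s g)) (C * A * \<bar>u\<bar> powr \<beta> l)" if "l \<in> D" for l u
  proof -
    have "norm_le (r l) (detail_op j (m j) i s ((diff_op u l ^^ m l) g)) (C * (A * \<bar>u\<bar> powr \<beta> l))"
      using g A r that by (intro C) (auto simp: cross_class_def)
    then show ?thesis
      by (simp add: shift_linear_commute_diff_op_power[OF shift_linear_detail_op] mult.assoc)
  qed
  ultimately show ?thesis using g j by (auto simp: cross_class_def C_def c_def)
qed

text \<open>In the splitting of \<open>cross_op_Cons_error\<close>, the detail of level i leaves an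
  error governed by i + (J - i) = J. All summands thus have the same bound, and each coordinate
  costs a factor J + 1 instead of a convergent series.\<close>

lemma cross_op_error:
  assumes "distinct ds"
  obtains C where "0 < C" "\<And>J \<iota> A g s. \<lbrakk>cross_class \<beta> r p m (set ds) \<iota> A g; 0 < A;
      \<And>j. 0 \<le> s $ j; \<And>j. s $ j \<le> 1\<rbrakk> \<Longrightarrow>
     norm_le 2 (\<lambda>x. g x - cross_op m ds J s g x)
       (C * (real J + 1) ^ length ds * A * 2 powr (- \<kappa> * (real J + (\<Sum>l\<in>UNIV. real (\<iota> l)))))"
  using assms
proof (induction ds arbitrary: thesis)
  case Nil
  show ?case
  proof (rule Nil(1)[of 1])
    fix J \<iota> A and s :: "real ^ 'd" and g :: "real ^ 'd \<Rightarrow> real" assume "0 < (A :: real)"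
    then show "norm_le 2 (\<lambda>x. g x - cross_op m [] J s g x)
       (1 * (real J + 1) ^ length ([] :: 'd list) * A * 2 powr (- \<kappa> * (real J + (\<Sum>l\<in>UNIV. real (\<iota> l)))))"
      by (simp add: norm_le_zero)
  qed simp
next
  case (Cons j ds)
  obtain C where C: "0 < C" and IH: "\<And>J \<iota> A g s. \<lbrakk>cross_class \<beta> r p m (set ds) \<iota> A g; 0 < A;
      \<And>j. 0 \<le> s $ j; \<And>j. s $ j \<le> 1\<rbrakk> \<Longrightarrow>
     norm_le 2 (\<lambda>x. g x - cross_op m ds J s g x)
       (C * (real J + 1) ^ length ds * A * 2 powr (- \<kappa> * (real J + (\<Sum>l\<in>UNIV. real (\<iota> l)))))"
    using Cons.IH Cons.prems(2) by auto
  define E where "E = 2 * (1 + 2 ^ m j) + (1 + 2 powr \<beta> j)"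
  have "0 < (2 :: real) ^ m j" "0 < 2 powr \<beta> j" by simp_all
  then have E: "1 \<le> E" "2 ^ m j \<le> E" by (simp_all add: E_def add_nonneg_nonneg)
  show ?case
  proof (rule Cons.prems(1)[of "E + C * E"])
    show "0 < E + C * E" using C E by (simp add: add_pos_pos)
    fix J \<iota> A and s :: "real ^ 'd" and g :: "real ^ 'd \<Rightarrow> real"
    assume g: "cross_class \<beta> r p m (set (j # ds)) \<iota> A g" and A: "0 < A"
      and s: "\<And>j. 0 \<le> s $ j" "\<And>j. s $ j \<le> 1"
    define T where "T = 2 powr (- \<kappa> * (real J + (\<Sum>l\<in>UNIV. real (\<iota> l))))"
    have j1: "\<iota> j = 0" using g by (simp add: cross_class_def)
    have \<iota>sum: "(\<Sum>l\<in>UNIV. real ((\<iota>(j := i)) l)) = real i + (\<Sum>l\<in>UNIV. real (\<iota> l))" for i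
    proof -
      have "(\<Sum>l\<in>UNIV. real ((\<iota>(j := i)) l)) = real i + (\<Sum>l\<in>UNIV - {j}. real (\<iota> l))"
        by (subst sum.remove[of UNIV j]) (auto intro!: sum.cong)
      moreover have "(\<Sum>l\<in>UNIV. real (\<iota> l)) = (\<Sum>l\<in>UNIV - {j}. real (\<iota> l))"
        by (subst sum.remove[of UNIV j]) (auto simp: j1)
      ultimately show ?thesis by simp
    qed
    \<comment> \<open>The smoothing error of coordinate j behaves like a detail of level J, so it is
      interpolated with the levels \<open>\<iota>(j := J)\<close>.\<close>
    have first: "norm_le 2 (\<lambda>x. g x - smooth_op j (m j) J s g x) (E * A * T)"
    proof -
      define h where "h = (\<lambda>x. g x - smooth_op j (m j) J s g x)"
      have h_eq: "h = (\<lambda>x. (- 1) ^ m j * (diff_op (s $ j / 2 ^ J) j ^^ m j) g x)" by (simp add: h_def smooth_op_def)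
      have h: "norm_le q h (E * X)" if "1 \<le> q" "0 \<le> X" "norm_le q g X" for q X
      proof -
        have "norm_le q h (\<bar>(- 1) ^ m j\<bar> * (2 ^ m j * X))"
          unfolding h_eq using that by (intro norm_le_cmult norm_le_diff_op_power) auto
        then show ?thesis using that E by (auto simp: power_abs intro: norm_le_weaken mult_right_mono)
      qed
      have "norm_le 2 h (E * A * 2 powr (- \<kappa> * (\<Sum>l\<in>UNIV. real ((\<iota>(j := J)) l))))"
      proof (rule norm_le_2_cross)
        show "norm_le p h (E * A)" using g A p by (intro h) (auto simp: cross_class_def)
        fix l
        show "norm_le (r l) h (E * A * 2 powr (- \<beta> l * real ((\<iota>(j := J)) l)))"
        proof (cases "l = j")
          case True
          have "norm_le (r j) h (A * 2 powr (- \<beta> j * J))"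
            unfolding h_def using g A r \<beta> s by (intro norm_le_smooth_op_error) (auto simp: cross_class_def)
          moreover have "1 * A * 2 powr (- \<beta> j * J) \<le> E * A * 2 powr (- \<beta> j * J)"
            using E A by (intro mult_right_mono) auto
          ultimately show ?thesis using True by (auto intro: norm_le_weaken)
        next
          case False
          have "norm_le (r l) h (E * (A * 2 powr (- \<beta> l * \<iota> l)))"
            using g A r by (intro h) (auto simp: cross_class_def)
          then show ?thesis using False by (simp add: mult.assoc)
        qed
      qed (use E A in simp)
      then show ?thesis by (simp only: h_def \<iota>sum T_def)
    qed
    have details: "norm_le 2 (\<lambda>x. detail_op j (m j) i s g x - cross_op m ds (J - i) s (detail_op j (m j) i s g) x)
        (C * (real J + 1) ^ length ds * (E * A) * T)" if "i \<le> J" for i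
    proof -
      have "cross_class \<beta> r p m (set ds) (\<iota>(j := i)) (E * A) (detail_op j (m j) i s g)"
        unfolding E_def using g A s Cons.prems by (intro cross_class_detail_op) auto
      then have "norm_le 2 (\<lambda>x. detail_op j (m j) i s g x - cross_op m ds (J - i) s (detail_op j (m j) i s g) x)
       (C * (real (J - i) + 1) ^ length ds * (E * A) *
         2 powr (- \<kappa> * (real (J - i) + (\<Sum>l\<in>UNIV. real ((\<iota>(j := i)) l)))))"
        by (rule IH) (use E A s in auto)
      moreover have "2 powr (- \<kappa> * (real (J - i) + (\<Sum>l\<in>UNIV. real ((\<iota>(j := i)) l)))) = T"
        unfolding T_def \<iota>sum using that by (simp add: of_nat_diff algebra_simps)
      moreover have "C * (real (J - i) + 1) ^ length ds * (E * A) * T \<le> C * (real J + 1) ^ length ds * (E * A) * T"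
        using C E A by (intro mult_right_mono mult_left_mono power_mono) (auto simp: T_def)
      ultimately show ?thesis by (auto intro: norm_le_weaken)
    qed
    have "norm_le 2 (\<lambda>x. (g x - smooth_op j (m j) J s g x) + (\<Sum>i\<le>J. detail_op j (m j) i s g x
        - cross_op m ds (J - i) s (detail_op j (m j) i s g) x))
        (E * A * T + (\<Sum>i\<le>J. C * (real J + 1) ^ length ds * (E * A) * T))"
      using C E A by (intro norm_le_add norm_le_sum first details) (auto simp: T_def intro!: sum_nonneg)
    then have *: "norm_le 2 (\<lambda>x. g x - cross_op m (j # ds) J s g x)
        (E * A * T + (\<Sum>i\<le>J. C * (real J + 1) ^ length ds * (E * A) * T))"
      by (simp only: cross_op_Cons_error)
    have "E * A * T * 1 \<le> E * A * T * (real J + 1) ^ length (j # ds)"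
      using E A by (intro mult_left_mono one_le_power) (auto simp: T_def)
    then have "E * A * T + (\<Sum>i\<le>J. C * (real J + 1) ^ length ds * (E * A) * T)
        \<le> (E + C * E) * (real J + 1) ^ length (j # ds) * A * T"
      by (simp add: algebra_simps)
    then show "norm_le 2 (\<lambda>x. g x - cross_op m (j # ds) J s g x) ((E + C * E) * (real J + 1) ^ length (j # ds) * A
        * 2 powr (- \<kappa> * (real J + (\<Sum>l\<in>UNIV. real (\<iota> l)))))"
      using * unfolding T_def by (rule norm_le_weaken[rotated])
  qed
qed

end

section \<open>The cross operator as a combination of translates\<close>

text \<open>Here w bounds the total weight of the translates, and v bounds from below the product of
  the shift lengths, that is, the volume over which a translate is spread when s is averaged over
  the unit cube.\<close>

inductive shift_op :: "'d set \<Rightarrow> real \<Rightarrow> real \<Rightarrow> (real ^ 'd \<Rightarrow> (real ^ 'd \<Rightarrow> real) \<Rightarrow> real ^ 'd \<Rightarrow> real) \<Rightarrow> bool"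
  for D :: "'d set" and v :: real where
  single: "\<lbrakk>\<And>j. j \<in> D \<Longrightarrow> 0 < l j; \<And>j. j \<notin> D \<Longrightarrow> l j = 0; v \<le> (\<Prod>j\<in>D. l j); \<bar>c\<bar> \<le> w\<rbrakk>
     \<Longrightarrow> shift_op D v w (\<lambda>s f x. c * f (x + (\<chi> j. l j * s $ j)))"
| add: "shift_op D v w1 P \<Longrightarrow> shift_op D v w2 Q \<Longrightarrow> shift_op D v (w1 + w2) (\<lambda>s f x. P s f x + Q s f x)"

lemma shift_op_weaken: "shift_op D v w P \<Longrightarrow> w \<le> w' \<Longrightarrow> v' \<le> v \<Longrightarrow> shift_op D v' w' P"
proof (induction arbitrary: w' rule: shift_op.induct)
  case (add w1 P w2 Q)
  then have "shift_op D v' (w1 + (w' - w1)) (\<lambda>s f x. P s f x + Q s f x)"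
    by (intro shift_op.add) auto
  then show ?case by simp
qed (auto intro!: shift_op.single)

lemma shift_op_cmult: "shift_op D v w P \<Longrightarrow> shift_op D v (\<bar>a\<bar> * w) (\<lambda>s f x. a * P s f x)"
proof (induction rule: shift_op.induct)
  case (single l c w)
  then have "shift_op D v (\<bar>a\<bar> * w) (\<lambda>s f x. (a * c) * f (x + (\<chi> j. l j * s $ j)))"
    by (intro shift_op.single) (auto simp: abs_mult mult_left_mono)
  then show ?case by (simp add: mult.assoc)
next
  case (add w1 P w2 Q)
  then show ?case using shift_op.add[OF add.IH] by (simp add: distrib_left)
qed

lemma shift_op_sum:
  assumes "finite I" "I \<noteq> {}" "\<And>i. i \<in> I \<Longrightarrow> shift_op D v (w i) (P i)"
  shows "shift_op D v (\<Sum>i\<in>I. w i) (\<lambda>s f x. \<Sum>i\<in>I. P i s f x)"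
  using assms
proof (induction rule: finite_ne_induct)
  case (insert i I)
  then show ?case using shift_op.add[of D v "w i" "P i"] by simp
qed simp

text \<open>The two operators shift different coordinates, so the vectors of shift lengths add, and
  their products over the coordinates multiply.\<close>

lemma shift_op_comp:
  assumes A: "shift_op {j} v1 w1 A" and P: "shift_op D v2 w2 P" and j: "j \<notin> D" and D: "finite D"
    and v: "0 \<le> v1" "0 \<le> v2"
  shows "shift_op (insert j D) (v1 * v2) (w1 * w2) (\<lambda>s f. A s (P s f))"
  using A
proof (induction rule: shift_op.induct)
  case (single l c w)
  note l = single
  then have w: "0 \<le> w" by simp
  from P show ?case
  proof (induction rule: shift_op.induct)
    case (single l' c' w')
    define k where "k = (\<lambda>i. l i + l' i)"
    have "shift_op (insert j D) (v1 * v2) (w * w') (\<lambda>s f x. (c * c') * f (x + (\<chi> i. k i * s $ i)))"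
    proof (rule shift_op.single)
      show "0 < k i" if "i \<in> insert j D" for i
        using that l single j by (cases "i = j") (auto simp: k_def)
      show "k i = 0" if "i \<notin> insert j D" for i
        using that l single by (auto simp: k_def)
      have "v1 * v2 \<le> l j * (\<Prod>i\<in>D. l' i)"
        using l single v by (intro mult_mono) (auto intro: less_imp_le)
      also have "l j = k j" using single j by (simp add: k_def)
      also have "(\<Prod>i\<in>D. l' i) = (\<Prod>i\<in>D. k i)"
      proof (rule prod.cong)
        fix i assume "i \<in> D"
        then have "l i = 0" using l j by (cases "i = j") auto
        then show "l' i = k i" by (simp add: k_def)
      qed simp
      finally show "v1 * v2 \<le> (\<Prod>i\<in>insert j D. k i)" using j D by simp
      show "\<bar>c * c'\<bar> \<le> w * w'" using l single w by (auto simp: abs_mult intro!: mult_mono)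
    qed
    moreover have "(\<lambda>s f x. c * (c' * f (x + (\<chi> j. l j * s $ j) + (\<chi> j. l' j * s $ j))))
        = (\<lambda>s f x. (c * c') * f (x + (\<chi> i. k i * s $ i)))"
    proof (intro ext)
      fix s x and f :: "real ^ 'a \<Rightarrow> real"
      have "x + (\<chi> i. l i * s $ i) + (\<chi> i. l' i * s $ i) = x + (\<chi> i. k i * s $ i)"
        by (simp add: vec_eq_iff k_def distrib_right)
      then show "c * (c' * f (x + (\<chi> j. l j * s $ j) + (\<chi> j. l' j * s $ j))) = (c * c') * f (x + (\<chi> i. k i * s $ i))"
        by (simp only: mult.assoc)
    qed
    ultimately show ?case by simp
  next
    case (add w1 P w2 Q)
    then show ?case using shift_op.add[OF add.IH] by (simp add: distrib_left)
  qed
next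
  case (add w1 A w2 B)
  then show ?case using shift_op.add[OF add.IH] by (simp add: distrib_right)
qed

lemma diff_op_power_expand:
  "(diff_op u j ^^ m) f x = (\<Sum>a\<le>m. (- 1) ^ (m - a) * real (m choose a) * f (x + (real a * u) *\<^sub>R axis j 1))"
proof (induction m arbitrary: x)
  case (Suc m)
  define e :: "real ^ 'a" where "e = axis j 1"
  define F where "F a = f (x + (real a * u) *\<^sub>R e)" for a
  have "(diff_op u j ^^ Suc m) f x = (diff_op u j ^^ m) f (x + u *\<^sub>R e) - (diff_op u j ^^ m) f x"
    by (simp add: diff_op_def e_def)
  also have "\<dots> = (\<Sum>a\<le>m. (- 1) ^ (m - a) * real (m choose a) * F (Suc a))
      + (\<Sum>a\<le>m. (- 1) ^ (Suc m - a) * real (m choose a) * F a)"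
  proof -
    have "x + u *\<^sub>R e + (real a * u) *\<^sub>R e = x + (real (Suc a) * u) *\<^sub>R e" for a
      by (simp add: algebra_simps)
    then have "(diff_op u j ^^ m) f (x + u *\<^sub>R e) = (\<Sum>a\<le>m. (- 1) ^ (m - a) * real (m choose a) * F (Suc a))"
      unfolding Suc.IH e_def[symmetric] F_def by (simp only:)
    moreover have "- (diff_op u j ^^ m) f x = (\<Sum>a\<le>m. (- 1) ^ (Suc m - a) * real (m choose a) * F a)"
      unfolding Suc.IH e_def[symmetric] F_def by (simp add: Suc_diff_le sum_negf)
    ultimately show ?thesis by simp
  qed
  also have "(\<Sum>a\<le>m. (- 1) ^ (Suc m - a) * real (m choose a) * F a)
      = (\<Sum>a\<le>Suc m. (- 1) ^ (Suc m - a) * real (m choose a) * F a)" by simp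
  also have "\<dots> = (- 1) ^ Suc m * F 0 + (\<Sum>a\<le>m. (- 1) ^ (m - a) * real (m choose Suc a) * F (Suc a))"
    by (subst sum.atMost_Suc_shift) simp
  also have "(\<Sum>a\<le>m. (- 1) ^ (m - a) * real (m choose a) * F (Suc a)) + \<dots>
      = (- 1) ^ Suc m * F 0 + (\<Sum>a\<le>m. (- 1) ^ (m - a) * real (Suc m choose Suc a) * F (Suc a))"
    by (simp add: sum.distrib algebra_simps)
  also have "\<dots> = (\<Sum>a\<le>Suc m. (- 1) ^ (Suc m - a) * real (Suc m choose a) * F a)"
    by (subst sum.atMost_Suc_shift) simp
  finally show ?case by (simp only: F_def e_def)
qed simp

text \<open>The unshifted terms cancel, so every remaining translate has a positive factor in front
  of s_j, as \<open>shift_op\<close> demands.\<close>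

lemma smooth_op_expand:
  "smooth_op j m i s f x = (\<Sum>a\<in>{1..m}. (- ((- 1) ^ m * (- 1) ^ (m - a) * real (m choose a))) *
      f (x + (\<chi> l. (if l = j then real a / 2 ^ i else 0) * s $ l)))"
proof -
  have v: "(real a * (s $ j / 2 ^ i)) *\<^sub>R axis j 1 = (\<chi> l. (if l = j then real a / 2 ^ i else 0) * s $ l)" for a
    by (simp add: vec_eq_iff axis_def)
  have "{..m} = insert 0 {1..m}" by auto
  then have "(diff_op (s $ j / 2 ^ i) j ^^ m) f x = (- 1) ^ m * f x +
     (\<Sum>a\<in>{1..m}. (- 1) ^ (m - a) * real (m choose a) * f (x + (real a * (s $ j / 2 ^ i)) *\<^sub>R axis j 1))"
    unfolding diff_op_power_expand by simp
  then show ?thesis unfolding smooth_op_def v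
    by (simp add: distrib_left sum_distrib_left mult.assoc[symmetric] sum_negf power_add[symmetric] flip: mult_2)
qed

lemma shift_op_smooth_op:
  assumes "0 < m"
  shows "shift_op {j} (1 / 2 ^ i) (2 ^ m) (smooth_op j m i)"
proof -
  have "shift_op {j} (1 / 2 ^ i) (\<Sum>a\<in>{1..m}. real (m choose a)) (\<lambda>s f x. \<Sum>a\<in>{1..m}.
     (- ((- 1) ^ m * (- 1) ^ (m - a) * real (m choose a))) *
      f (x + (\<chi> l. (if l = j then real a / 2 ^ i else 0) * s $ l)))"
  proof (intro shift_op_sum shift_op.single)
    fix a assume "a \<in> {1..m}"
    then show "1 / 2 ^ i \<le> (\<Prod>l\<in>{j}. if l = j then real a / 2 ^ i else 0)" by (simp add: divide_right_mono)
  qed (use assms in \<open>auto simp: abs_mult power_abs\<close>)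
  moreover have "(\<Sum>a\<in>{1..m}. real (m choose a)) \<le> 2 ^ m"
  proof -
    have "(\<Sum>a\<in>{1..m}. (m choose a)) \<le> (\<Sum>a\<le>m. (m choose a))" by (intro sum_mono2) auto
    also have "\<dots> = 2 ^ m" by (rule choose_row_sum)
    finally show ?thesis by (metis of_nat_le_iff of_nat_numeral of_nat_power of_nat_sum)
  qed
  ultimately show ?thesis
    unfolding smooth_op_expand[abs_def] by (rule shift_op_weaken) simp
qed

text \<open>The coarser level i - 1 has the longer shifts, so the lower bound 2^(-i) covers both
  levels.\<close>

lemma shift_op_detail_op:
  assumes "0 < m"
  shows "shift_op {j} (1 / 2 ^ i) (2 * 2 ^ m) (detail_op j m i)"
proof (cases "i = 0")
  case True
  then show ?thesis using shift_op_weaken[OF shift_op_smooth_op[OF assms, of j 0], of "2 * 2 ^ m" 1]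
    by (simp add: detail_op_def[abs_def])
next
  case False
  have "shift_op {j} (1 / 2 ^ i) (2 ^ m) (smooth_op j m (i - 1))"
    by (rule shift_op_weaken[OF shift_op_smooth_op[OF assms]]) (auto intro!: divide_left_mono power_increasing)
  from shift_op_cmult[OF this, of "- 1"]
  have "shift_op {j} (1 / 2 ^ i) (2 ^ m + 2 ^ m) (\<lambda>s f x. smooth_op j m i s f x + - 1 * smooth_op j m (i - 1) s f x)"
    by (intro shift_op.add shift_op_smooth_op assms) simp
  then show ?thesis using False by (simp add: detail_op_def[abs_def])
qed

text \<open>The product of the shift lengths is at least 2^(-J) however the levels are distributed:
  2^(-i) for one coordinate times 2^(-(J - i)) for the others. Up to powers of J, the cross thus
  costs no more variance than a single box of volume 2^(-J).\<close>

lemma shift_op_cross_op: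
  assumes "distinct ds" "\<And>j. 0 < m j"
  shows "shift_op (set ds) (1 / 2 ^ J) ((\<Prod>j\<leftarrow>ds. 2 * 2 ^ m j) * (real J + 1) ^ length ds) (cross_op m ds J)"
  using assms(1)
proof (induction ds arbitrary: J)
  case Nil
  have "shift_op {} (1 / 2 ^ J) 1 (\<lambda>s f x. 1 * f (x + (\<chi> j. (\<lambda>_. 0) j * s $ j)))"
    by (rule shift_op.single) (auto simp: power_increasing field_simps)
  then show ?case by (simp add: cross_op.simps(1)[abs_def] flip: zero_vec_def)
next
  case (Cons j ds)
  define c where "c = (\<Prod>j\<leftarrow>ds. 2 * (2 :: real) ^ m j)"
  have c: "0 \<le> c" unfolding c_def by (induction ds) auto
  have "shift_op (insert j (set ds)) (1 / 2 ^ J) (2 * 2 ^ m j * (c * (real J + 1) ^ length ds))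
      (\<lambda>s f. detail_op j (m j) i s (cross_op m ds (J - i) s f))" if "i \<le> J" for i
  proof -
    have "shift_op (set ds) (1 / 2 ^ (J - i)) (c * (real J + 1) ^ length ds) (cross_op m ds (J - i))"
    proof (rule shift_op_weaken)
      show "shift_op (set ds) (1 / 2 ^ (J - i)) (c * (real (J - i) + 1) ^ length ds) (cross_op m ds (J - i))"
        using Cons unfolding c_def by simp
      show "c * (real (J - i) + 1) ^ length ds \<le> c * (real J + 1) ^ length ds"
        using c by (intro mult_left_mono power_mono) auto
    qed simp
    then have "shift_op (insert j (set ds)) (1 / 2 ^ i * (1 / 2 ^ (J - i))) (2 * 2 ^ m j * (c * (real J + 1) ^ length ds))
      (\<lambda>s f. detail_op j (m j) i s (cross_op m ds (J - i) s f))"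
      using Cons.prems assms(2) by (intro shift_op_comp shift_op_detail_op) auto
    then show ?thesis using that by (simp flip: power_add)
  qed
  then have "shift_op (insert j (set ds)) (1 / 2 ^ J) (\<Sum>i\<in>{..J}. 2 * 2 ^ m j * (c * (real J + 1) ^ length ds))
      (\<lambda>s f x. \<Sum>i\<in>{..J}. detail_op j (m j) i s (cross_op m ds (J - i) s f) x)"
    by (intro shift_op_sum) auto
  moreover have "(\<Sum>i\<in>{..J}. 2 * 2 ^ m j * (c * (real J + 1) ^ length ds))
      = (\<Prod>j\<leftarrow>j # ds. 2 * 2 ^ m j) * (real J + 1) ^ length (j # ds)"
    by (simp add: c_def algebra_simps)
  ultimately have "shift_op (insert j (set ds)) (1 / 2 ^ J) ((\<Prod>j\<leftarrow>j # ds. 2 * 2 ^ m j) * (real J + 1) ^ length (j # ds))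
      (\<lambda>s f x. \<Sum>i\<in>{..J}. detail_op j (m j) i s (cross_op m ds (J - i) s f) x)" by (simp only:)
  then show ?case by (simp add: cross_op.simps(2)[abs_def])
qed

subsection \<open>A quadratic estimator of the norm\<close>

text \<open>The mixed moments of the centred variables vanish. The bound K secures integrability and
  does not enter the estimate.\<close>

lemma (in prob_space) sample_mean_variance:
  fixes g :: "'a \<Rightarrow> real" and I :: "'i set"
  assumes I: "finite I" "I \<noteq> {}" and [measurable]: "g \<in> borel_measurable M" and K: "\<And>x. \<bar>g x\<bar> \<le> K"
  shows "(\<integral>\<^sup>+x. ennreal (((\<Sum>i\<in>I. g (x i)) / card I - expectation g)\<^sup>2) \<partial>Pi\<^sub>M I (\<lambda>_. M))
    \<le> ennreal (1 / card I) * (\<integral>\<^sup>+x. ennreal ((g x)\<^sup>2) \<partial>M)"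
proof -
  interpret PI: prob_space "Pi\<^sub>M I (\<lambda>_. M)" by (intro prob_space_PiM prob_space_axioms)
  interpret P: product_sigma_finite "\<lambda>_ :: 'i. M" by unfold_locales
  define \<mu> where "\<mu> = expectation g"
  define \<phi> where "\<phi> = (\<lambda>x. g x - \<mu>)"
  have [measurable]: "\<phi> \<in> borel_measurable M" by (simp add: \<phi>_def)
  have g: "integrable M g" by (rule integrable_const_bound[of _ K]) (use K in auto)
  have "0 \<le> K" using K[of undefined] by (meson abs_ge_zero order_trans)
  have \<phi>K: "\<bar>\<phi> x\<bar> \<le> K + \<bar>\<mu>\<bar>" for x using K[of x] by (auto simp: \<phi>_def)
  have \<phi>: "integrable M \<phi>" using g by (simp add: \<phi>_def)
  have \<phi>0: "expectation \<phi> = 0" using g by (simp add: \<phi>_def \<mu>_def prob_space)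
  have g2: "integrable M (\<lambda>x. (g x)\<^sup>2)"
  proof (rule integrable_const_bound[of _ "K\<^sup>2"])
    show "AE x in M. norm ((g x)\<^sup>2) \<le> K\<^sup>2"
      using power_mono[OF K abs_ge_zero, of _ 2] by simp
  qed simp
  have \<phi>2: "integrable M (\<lambda>x. (\<phi> x)\<^sup>2)"
    unfolding \<phi>_def power2_diff using g g2 by auto
  have cross: "(\<integral>x. \<phi> (x i) * \<phi> (x j) \<partial>Pi\<^sub>M I (\<lambda>_. M)) = (if i = j then \<integral>x. (\<phi> x)\<^sup>2 \<partial>M else 0)"
    if ij: "i \<in> I" "j \<in> I" for i j
  proof (cases "i = j")
    case True
    \<comment> \<open>Putting the constant 1 in all other places writes the moment as a product over
      the whole index set.\<close>
    define F where "F k = (if k = i then (\<lambda>x. (\<phi> x)\<^sup>2) else (\<lambda>_. 1))" for k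
    have "(\<integral>x. (\<Prod>k\<in>I. F k (x k)) \<partial>Pi\<^sub>M I (\<lambda>_. M)) = (\<Prod>k\<in>I. expectation (F k))"
      using I \<phi>2 by (intro P.product_integral_prod) (auto simp: F_def)
    also have "(\<lambda>x. \<Prod>k\<in>I. F k (x k)) = (\<lambda>x. \<phi> (x i) * \<phi> (x j))"
    proof
      fix x
      have "(\<Prod>k\<in>I. F k (x k)) = F i (x i) * (\<Prod>k\<in>I - {i}. F k (x k))" by (rule prod.remove) (use I ij in auto)
      also have "(\<Prod>k\<in>I - {i}. F k (x k)) = 1" by (rule prod.neutral) (auto simp: F_def)
      finally show "(\<Prod>k\<in>I. F k (x k)) = \<phi> (x i) * \<phi> (x j)" using True by (simp add: F_def power2_eq_square)
    qed
    also have "(\<Prod>k\<in>I. expectation (F k)) = expectation (F i) * (\<Prod>k\<in>I - {i}. expectation (F k))"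
      by (rule prod.remove) (use I ij in auto)
    also have "(\<Prod>k\<in>I - {i}. expectation (F k)) = 1" by (rule prod.neutral) (auto simp: F_def prob_space)
    finally show ?thesis using True by (simp add: F_def)
  next
    case False
    define F where "F k = (if k = i \<or> k = j then \<phi> else (\<lambda>_. 1))" for k
    have "(\<integral>x. (\<Prod>k\<in>I. F k (x k)) \<partial>Pi\<^sub>M I (\<lambda>_. M)) = (\<Prod>k\<in>I. expectation (F k))"
      using I \<phi> by (intro P.product_integral_prod) (auto simp: F_def)
    also have "(\<lambda>x. \<Prod>k\<in>I. F k (x k)) = (\<lambda>x. \<phi> (x i) * \<phi> (x j))"
    proof
      fix x
      have "(\<Prod>k\<in>I. F k (x k)) = (\<Prod>k\<in>{i, j}. F k (x k))"
        by (rule prod.mono_neutral_right) (use I ij in \<open>auto simp: F_def\<close>)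
      then show "(\<Prod>k\<in>I. F k (x k)) = \<phi> (x i) * \<phi> (x j)" using False by (simp add: F_def)
    qed
    also have "(\<Prod>k\<in>I. expectation (F k)) = 0"
      using I ij \<phi>0 by (intro prod_zero) (auto simp: F_def intro!: bexI[of _ i])
    finally show ?thesis using False by simp
  qed
  have int: "integrable (Pi\<^sub>M I (\<lambda>_. M)) (\<lambda>x. \<phi> (x i) * \<phi> (x j))" if "i \<in> I" "j \<in> I" for i j
  proof (rule PI.integrable_const_bound[of _ "(K + \<bar>\<mu>\<bar>) * (K + \<bar>\<mu>\<bar>)"])
    show "AE x in Pi\<^sub>M I (\<lambda>_. M). norm (\<phi> (x i) * \<phi> (x j)) \<le> (K + \<bar>\<mu>\<bar>) * (K + \<bar>\<mu>\<bar>)"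
      using \<phi>K \<open>0 \<le> K\<close> by (intro AE_I2) (auto simp: abs_mult intro!: mult_mono)
  qed (use that in measurable)
  define N where "N = real (card I)"
  have N: "0 < N" using I by (simp add: N_def card_gt_0_iff)
  have eq: "((\<Sum>i\<in>I. g (x i)) / card I - expectation g)\<^sup>2 = (\<Sum>i\<in>I. \<Sum>j\<in>I. \<phi> (x i) * \<phi> (x j)) / N\<^sup>2" for x
  proof -
    have "(\<Sum>i\<in>I. g (x i)) / card I - expectation g = (\<Sum>i\<in>I. \<phi> (x i)) / N"
      using N by (simp add: \<phi>_def sum_subtractf N_def[symmetric] \<mu>_def[symmetric] field_simps)
    then show ?thesis by (simp add: power_divide power2_eq_square sum_product)
  qed
  have "(\<integral>x. ((\<Sum>i\<in>I. g (x i)) / card I - expectation g)\<^sup>2 \<partial>Pi\<^sub>M I (\<lambda>_. M))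
      = (\<Sum>i\<in>I. \<Sum>j\<in>I. \<integral>x. \<phi> (x i) * \<phi> (x j) \<partial>Pi\<^sub>M I (\<lambda>_. M)) / N\<^sup>2"
    unfolding eq using int by (simp add: Bochner_Integration.integral_sum)
  also have "\<dots> = (\<Sum>i\<in>I. \<Sum>j\<in>I. if i = j then \<integral>x. (\<phi> x)\<^sup>2 \<partial>M else 0) / N\<^sup>2"
    by (simp add: cross)
  also have "\<dots> = 1 / N * (\<integral>x. (\<phi> x)\<^sup>2 \<partial>M)"
    using I N by (simp add: N_def[symmetric] power2_eq_square)
  also have "\<dots> \<le> 1 / N * (\<integral>x. (g x)\<^sup>2 \<partial>M)"
  proof -
    have "(\<integral>x. (\<phi> x)\<^sup>2 \<partial>M) = (\<integral>x. (g x)\<^sup>2 - 2 * \<mu> * g x + \<mu>\<^sup>2 \<partial>M)"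
      by (rule Bochner_Integration.integral_cong) (auto simp: \<phi>_def power2_diff)
    also have "\<dots> = (\<integral>x. (g x)\<^sup>2 \<partial>M) - \<mu>\<^sup>2"
      using g g2 by (simp add: prob_space \<mu>_def[symmetric] power2_eq_square)
    finally show ?thesis using N by (intro mult_left_mono) auto
  qed
  finally have le: "(\<integral>x. ((\<Sum>i\<in>I. g (x i)) / card I - expectation g)\<^sup>2 \<partial>Pi\<^sub>M I (\<lambda>_. M))
     \<le> 1 / N * (\<integral>x. (g x)\<^sup>2 \<partial>M)" .
  have "(\<integral>\<^sup>+x. ennreal (((\<Sum>i\<in>I. g (x i)) / card I - expectation g)\<^sup>2) \<partial>Pi\<^sub>M I (\<lambda>_. M))
      = ennreal (\<integral>x. ((\<Sum>i\<in>I. g (x i)) / card I - expectation g)\<^sup>2 \<partial>Pi\<^sub>M I (\<lambda>_. M))"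
  proof (rule nn_integral_eq_integral)
    show "integrable (Pi\<^sub>M I (\<lambda>_. M)) (\<lambda>x. ((\<Sum>i\<in>I. g (x i)) / card I - expectation g)\<^sup>2)"
      unfolding eq using int by auto
  qed auto
  also have "\<dots> \<le> ennreal (1 / N * (\<integral>x. (g x)\<^sup>2 \<partial>M))" using le by (rule ennreal_leI)
  also have "\<dots> = ennreal (1 / N) * (\<integral>\<^sup>+x. ennreal ((g x)\<^sup>2) \<partial>M)"
    using N g2 by (subst nn_integral_eq_integral) (auto simp: ennreal_mult[symmetric])
  finally show ?thesis by (simp add: N_def)
qed

lemma square_sum_le: "((a :: real) + b)\<^sup>2 \<le> 2 * a\<^sup>2 + 2 * b\<^sup>2"
  using sum_squares_bound[of a b] by (simp add: power2_sum)

text \<open>With the first half fixed, \<open>sample_mean_variance\<close> applies to the second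
  half; it is then applied to the first half, once for the conditional means and once for each fixed
  y. The factors 2 and 4 come from (a + b)^2 <= 2 a^2 + 2 b^2. Disjoint index sets exclude diagonal
  terms.\<close>

lemma (in prob_space) two_sample_variance:
  fixes h :: "'a \<Rightarrow> 'a \<Rightarrow> real" and I J :: "'i set"
  assumes I: "finite I" "I \<noteq> {}" and J: "finite J" "J \<noteq> {}" and IJ: "I \<inter> J = {}"
    and h[measurable]: "(\<lambda>(x, y). h x y) \<in> borel_measurable (M \<Otimes>\<^sub>M M)" and K: "\<And>x y. \<bar>h x y\<bar> \<le> K"
  shows "(\<integral>\<^sup>+X. ennreal (((\<Sum>i\<in>I. \<Sum>j\<in>J. h (X i) (X j)) / (real (card I) * real (card J))
           - (\<integral>x. \<integral>y. h x y \<partial>M \<partial>M))\<^sup>2) \<partial>Pi\<^sub>M (I \<union> J) (\<lambda>_. M))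
    \<le> ennreal (2 / card I) * (\<integral>\<^sup>+x. ennreal ((\<integral>y. h x y \<partial>M)\<^sup>2) \<partial>M)
      + ennreal (4 / (real (card I) * real (card J))) * (\<integral>\<^sup>+y. \<integral>\<^sup>+x. ennreal ((h x y)\<^sup>2) \<partial>M \<partial>M)
      + ennreal (4 / card J) * (\<integral>\<^sup>+y. ennreal ((\<integral>x. h x y \<partial>M)\<^sup>2) \<partial>M)"
    (is "?L \<le> ?A + ?B + ?C")
proof -
  interpret P: product_sigma_finite "\<lambda>_ :: 'i. M" by unfold_locales
  interpret PI: prob_space "Pi\<^sub>M I (\<lambda>_. M)" by (intro prob_space_PiM prob_space_axioms)
  interpret PJ: prob_space "Pi\<^sub>M J (\<lambda>_. M)" by (intro prob_space_PiM prob_space_axioms)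
  interpret PIM: pair_sigma_finite "Pi\<^sub>M I (\<lambda>_. M)" M by unfold_locales
  define \<mu> where "\<mu> = (\<integral>x. \<integral>y. h x y \<partial>M \<partial>M)"
  define H where "H = (\<lambda>x. \<integral>y. h x y \<partial>M)"
  define H' where "H' = (\<lambda>y. \<integral>x. h x y \<partial>M)"
  define N1 where "N1 = real (card I)"
  define N2 where "N2 = real (card J)"
  have N: "0 < N1" "0 < N2" using I J by (auto simp: N1_def N2_def card_gt_0_iff)
  have hx[measurable]: "(\<lambda>x. h x y) \<in> borel_measurable M" if "y \<in> space M" for y
    using measurable_compose[OF measurable_Pair2'[OF that, of M] h] by simp
  have hy[measurable]: "(\<lambda>y. h x y) \<in> borel_measurable M" if "x \<in> space M" for x
    using measurable_compose[OF measurable_Pair1'[OF that, of M] h] by simp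
  have [measurable]: "H \<in> borel_measurable M" "H' \<in> borel_measurable M"
    unfolding H_def H'_def by measurable
  have K0: "0 \<le> K" using K[of undefined undefined] by (meson abs_ge_zero order_trans)
  have HK: "\<bar>H x\<bar> \<le> K" for x
  proof -
    have "\<bar>H x\<bar> \<le> (\<integral>y. \<bar>h x y\<bar> \<partial>M)" unfolding H_def by (rule integral_abs_bound)
    also have "\<dots> \<le> K"
    proof (cases "integrable M (\<lambda>y. \<bar>h x y\<bar>)")
      case True
      then show ?thesis by (rule integral_le_const) (simp add: K)
    next
      case False
      then show ?thesis using K0 by (simp add: not_integrable_integral_eq)
    qed
    finally show ?thesis .
  qed
  define a where "a = (\<lambda>x y. (\<Sum>i\<in>I. h (x i) y) / N1)"
  have [measurable]: "(\<lambda>(x, y). a x y) \<in> borel_measurable (Pi\<^sub>M I (\<lambda>_. M) \<Otimes>\<^sub>M M)"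
    unfolding a_def by measurable
  have aK: "\<bar>a x y\<bar> \<le> K" for x y
  proof -
    have "\<bar>\<Sum>i\<in>I. h (x i) y\<bar> \<le> (\<Sum>i\<in>I. K)" by (rule order_trans[OF sum_abs sum_mono]) (rule K)
    then show ?thesis using N by (simp add: a_def field_simps N1_def[symmetric])
  qed
  have ay: "(\<lambda>y. a x y) \<in> borel_measurable M" if "x \<in> space (Pi\<^sub>M I (\<lambda>_. M))" for x
    using that by measurable
  have Ea: "(\<integral>y. a x y \<partial>M) = (\<Sum>i\<in>I. H (x i)) / N1" if "x \<in> space (Pi\<^sub>M I (\<lambda>_. M))" for x
  proof -
    have "integrable M (\<lambda>y. h (x i) y)" if "i \<in> I" for i
    proof (rule integrable_const_bound[of _ K])
      have "x i \<in> space M" using \<open>x \<in> space _\<close> that by (auto simp: space_PiM)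
      then show "(\<lambda>y. h (x i) y) \<in> borel_measurable M" by (rule hy)
    qed (use K in auto)
    then show ?thesis by (simp add: a_def H_def)
  qed
  have inner: "(\<integral>\<^sup>+y. ennreal (((\<Sum>j\<in>J. a x (y j)) / N2 - \<mu>)\<^sup>2) \<partial>Pi\<^sub>M J (\<lambda>_. M))
      \<le> ennreal (2 / N2) * (\<integral>\<^sup>+y. ennreal ((a x y)\<^sup>2) \<partial>M) + ennreal (2 * ((\<Sum>i\<in>I. H (x i)) / N1 - \<mu>)\<^sup>2)"
    if x: "x \<in> space (Pi\<^sub>M I (\<lambda>_. M))" for x
  proof -
    have [measurable]: "a x \<in> borel_measurable M" using ay[OF x] .
    have "(\<integral>\<^sup>+y. ennreal (((\<Sum>j\<in>J. a x (y j)) / N2 - \<mu>)\<^sup>2) \<partial>Pi\<^sub>M J (\<lambda>_. M))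
      \<le> (\<integral>\<^sup>+y. 2 * ennreal (((\<Sum>j\<in>J. a x (y j)) / N2 - expectation (a x))\<^sup>2)
            + ennreal (2 * ((\<Sum>i\<in>I. H (x i)) / N1 - \<mu>)\<^sup>2) \<partial>Pi\<^sub>M J (\<lambda>_. M))"
    proof (rule nn_integral_mono)
      fix y
      show "ennreal (((\<Sum>j\<in>J. a x (y j)) / N2 - \<mu>)\<^sup>2) \<le> 2 * ennreal (((\<Sum>j\<in>J. a x (y j)) / N2 - expectation (a x))\<^sup>2)
            + ennreal (2 * ((\<Sum>i\<in>I. H (x i)) / N1 - \<mu>)\<^sup>2)"
        using square_sum_le[of "(\<Sum>j\<in>J. a x (y j)) / N2 - expectation (a x)" "expectation (a x) - \<mu>"]
        by (simp add: Ea[OF x] ennreal_mult'[symmetric] ennreal_plus[symmetric] ennreal_numeral[symmetric] ennreal_leI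
            del: ennreal_plus ennreal_numeral)
    qed
    also have "\<dots> = 2 * (\<integral>\<^sup>+y. ennreal (((\<Sum>j\<in>J. a x (y j)) / N2 - expectation (a x))\<^sup>2) \<partial>Pi\<^sub>M J (\<lambda>_. M))
        + ennreal (2 * ((\<Sum>i\<in>I. H (x i)) / N1 - \<mu>)\<^sup>2)"
      by (subst nn_integral_add) (auto simp: nn_integral_cmult PJ.emeasure_space_1)
    also have "\<dots> \<le> 2 * (ennreal (1 / N2) * (\<integral>\<^sup>+y. ennreal ((a x y)\<^sup>2) \<partial>M))
        + ennreal (2 * ((\<Sum>i\<in>I. H (x i)) / N1 - \<mu>)\<^sup>2)"
      using sample_mean_variance[OF J, of "a x" K] aK unfolding N2_def
      by (intro add_right_mono mult_left_mono) auto
    also have "2 * (ennreal (1 / N2) * (\<integral>\<^sup>+y. ennreal ((a x y)\<^sup>2) \<partial>M)) = ennreal (2 / N2) * (\<integral>\<^sup>+y. ennreal ((a x y)\<^sup>2) \<partial>M)"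
      using N by (simp add: mult.assoc[symmetric] ennreal_mult'[symmetric] ennreal_numeral[symmetric] del: ennreal_numeral)
    finally show ?thesis .
  qed
  have "?L = (\<integral>\<^sup>+x. \<integral>\<^sup>+y. ennreal (((\<Sum>i\<in>I. \<Sum>j\<in>J. h (merge I J (x, y) i) (merge I J (x, y) j)) / (N1 * N2) - \<mu>)\<^sup>2)
      \<partial>Pi\<^sub>M J (\<lambda>_. M) \<partial>Pi\<^sub>M I (\<lambda>_. M))"
    unfolding N1_def N2_def \<mu>_def by (rule P.product_nn_integral_fold[OF IJ I(1) J(1)]) measurable
  also have "\<dots> = (\<integral>\<^sup>+x. \<integral>\<^sup>+y. ennreal (((\<Sum>j\<in>J. a x (y j)) / N2 - \<mu>)\<^sup>2) \<partial>Pi\<^sub>M J (\<lambda>_. M) \<partial>Pi\<^sub>M I (\<lambda>_. M))"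
  proof (intro nn_integral_cong)
    fix x y
    have "(\<Sum>i\<in>I. \<Sum>j\<in>J. h (merge I J (x, y) i) (merge I J (x, y) j)) = (\<Sum>i\<in>I. \<Sum>j\<in>J. h (x i) (y j))"
      using IJ by (intro sum.cong refl) (auto simp: merge_def)
    also have "\<dots> = (\<Sum>j\<in>J. \<Sum>i\<in>I. h (x i) (y j))" by (rule sum.swap)
    finally show "ennreal (((\<Sum>i\<in>I. \<Sum>j\<in>J. h (merge I J (x, y) i) (merge I J (x, y) j)) / (N1 * N2) - \<mu>)\<^sup>2)
        = ennreal (((\<Sum>j\<in>J. a x (y j)) / N2 - \<mu>)\<^sup>2)"
      by (simp add: a_def sum_divide_distrib[symmetric])
  qed
  also have "\<dots> \<le> (\<integral>\<^sup>+x. ennreal (2 / N2) * (\<integral>\<^sup>+y. ennreal ((a x y)\<^sup>2) \<partial>M)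
      + 2 * ennreal (((\<Sum>i\<in>I. H (x i)) / N1 - \<mu>)\<^sup>2) \<partial>Pi\<^sub>M I (\<lambda>_. M))"
    using inner by (intro nn_integral_mono) (simp add: ennreal_mult')
  also have "\<dots> = ennreal (2 / N2) * (\<integral>\<^sup>+x. \<integral>\<^sup>+y. ennreal ((a x y)\<^sup>2) \<partial>M \<partial>Pi\<^sub>M I (\<lambda>_. M))
      + 2 * (\<integral>\<^sup>+x. ennreal (((\<Sum>i\<in>I. H (x i)) / N1 - \<mu>)\<^sup>2) \<partial>Pi\<^sub>M I (\<lambda>_. M))"
    by (subst nn_integral_add) (auto simp: nn_integral_cmult)
  also have "(\<integral>\<^sup>+x. \<integral>\<^sup>+y. ennreal ((a x y)\<^sup>2) \<partial>M \<partial>Pi\<^sub>M I (\<lambda>_. M)) = (\<integral>\<^sup>+y. \<integral>\<^sup>+x. ennreal ((a x y)\<^sup>2) \<partial>Pi\<^sub>M I (\<lambda>_. M) \<partial>M)"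
    by (rule PIM.Fubini'[symmetric]) measurable
  also have "ennreal (2 / N2) * \<dots> + 2 * (\<integral>\<^sup>+x. ennreal (((\<Sum>i\<in>I. H (x i)) / N1 - \<mu>)\<^sup>2) \<partial>Pi\<^sub>M I (\<lambda>_. M))
     \<le> ennreal (2 / N2) * (\<integral>\<^sup>+y. ennreal (2 / N1) * (\<integral>\<^sup>+x. ennreal ((h x y)\<^sup>2) \<partial>M) + ennreal (2 * (H' y)\<^sup>2) \<partial>M)
       + 2 * (ennreal (1 / N1) * (\<integral>\<^sup>+x. ennreal ((H x)\<^sup>2) \<partial>M))"
  proof (intro add_mono mult_left_mono nn_integral_mono)
    show "(\<integral>\<^sup>+x. ennreal (((\<Sum>i\<in>I. H (x i)) / N1 - \<mu>)\<^sup>2) \<partial>Pi\<^sub>M I (\<lambda>_. M)) \<le> ennreal (1 / N1) * (\<integral>\<^sup>+x. ennreal ((H x)\<^sup>2) \<partial>M)"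
      using sample_mean_variance[OF I, of H K] HK unfolding N1_def \<mu>_def H_def[symmetric] by simp
  next
    fix y assume y: "y \<in> space M"
    note [measurable] = hx[OF y]
    have "(\<integral>\<^sup>+x. ennreal ((a x y)\<^sup>2) \<partial>Pi\<^sub>M I (\<lambda>_. M))
      \<le> (\<integral>\<^sup>+x. 2 * ennreal (((\<Sum>i\<in>I. h (x i) y) / N1 - expectation (\<lambda>x. h x y))\<^sup>2) + ennreal (2 * (H' y)\<^sup>2) \<partial>Pi\<^sub>M I (\<lambda>_. M))"
    proof (rule nn_integral_mono)
      fix x
      show "ennreal ((a x y)\<^sup>2) \<le> 2 * ennreal (((\<Sum>i\<in>I. h (x i) y) / N1 - expectation (\<lambda>x. h x y))\<^sup>2) + ennreal (2 * (H' y)\<^sup>2)"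
        using square_sum_le[of "a x y - H' y" "H' y"]
        by (simp add: a_def H'_def ennreal_mult'[symmetric] ennreal_plus[symmetric] ennreal_numeral[symmetric] ennreal_leI
            del: ennreal_plus ennreal_numeral)
    qed
    also have "\<dots> = 2 * (\<integral>\<^sup>+x. ennreal (((\<Sum>i\<in>I. h (x i) y) / N1 - expectation (\<lambda>x. h x y))\<^sup>2) \<partial>Pi\<^sub>M I (\<lambda>_. M))
        + ennreal (2 * (H' y)\<^sup>2)"
      by (subst nn_integral_add) (auto simp: nn_integral_cmult PI.emeasure_space_1)
    also have "\<dots> \<le> 2 * (ennreal (1 / N1) * (\<integral>\<^sup>+x. ennreal ((h x y)\<^sup>2) \<partial>M)) + ennreal (2 * (H' y)\<^sup>2)"
      using sample_mean_variance[OF I, of "\<lambda>x. h x y" K] K unfolding N1_def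
      by (intro add_right_mono mult_left_mono) auto
    also have "2 * (ennreal (1 / N1) * (\<integral>\<^sup>+x. ennreal ((h x y)\<^sup>2) \<partial>M)) = ennreal (2 / N1) * (\<integral>\<^sup>+x. ennreal ((h x y)\<^sup>2) \<partial>M)"
      using N by (simp add: mult.assoc[symmetric] ennreal_mult'[symmetric] ennreal_numeral[symmetric] del: ennreal_numeral)
    finally show "(\<integral>\<^sup>+x. ennreal ((a x y)\<^sup>2) \<partial>Pi\<^sub>M I (\<lambda>_. M))
      \<le> ennreal (2 / N1) * (\<integral>\<^sup>+x. ennreal ((h x y)\<^sup>2) \<partial>M) + ennreal (2 * (H' y)\<^sup>2)" .
  qed auto
  also have "(\<integral>\<^sup>+y. ennreal (2 / N1) * (\<integral>\<^sup>+x. ennreal ((h x y)\<^sup>2) \<partial>M) + ennreal (2 * (H' y)\<^sup>2) \<partial>M)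
      = ennreal (2 / N1) * (\<integral>\<^sup>+y. \<integral>\<^sup>+x. ennreal ((h x y)\<^sup>2) \<partial>M \<partial>M) + 2 * (\<integral>\<^sup>+y. ennreal ((H' y)\<^sup>2) \<partial>M)"
    by (subst nn_integral_add) (auto simp: nn_integral_cmult ennreal_mult')
  also have "ennreal (2 / N2) * \<dots> + 2 * (ennreal (1 / N1) * (\<integral>\<^sup>+x. ennreal ((H x)\<^sup>2) \<partial>M)) = ?A + ?B + ?C"
  proof -
    have e: "ennreal (2 / N2) * ennreal (2 / N1) = ennreal (4 / (N1 * N2))" "ennreal (2 / N2) * 2 = ennreal (4 / N2)"
      "2 * ennreal (1 / N1) = ennreal (2 / N1)"
      using N by (simp_all add: ennreal_mult'[symmetric] ennreal_numeral[symmetric] mult.commute del: ennreal_numeral)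
    show ?thesis
      unfolding distrib_left mult.assoc[symmetric] e by (simp add: H_def H'_def N1_def N2_def add_ac)
  qed
  finally show ?thesis .
qed

section \<open>Averaged translates as kernels\<close>

abbreviation unit_cube :: "(real ^ 'd) set" where
  "unit_cube \<equiv> cbox 0 One"

lemma Basis_cart: "(Basis :: (real ^ 'd) set) = range (\<lambda>i. axis i 1)"
  by (auto simp: Basis_vec_def)

lemma prod_Basis_cart: "(\<Prod>b\<in>(Basis :: (real ^ 'd) set). h b) = (\<Prod>i\<in>UNIV. h (axis i 1))"
  unfolding Basis_cart by (subst prod.reindex) (auto simp: inj_on_def axis_eq_axis)

lemma mem_unit_cube: "s \<in> unit_cube \<longleftrightarrow> (\<forall>j. 0 \<le> s $ j \<and> s $ j \<le> 1)"
proof -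
  have "s \<in> unit_cube \<longleftrightarrow> (\<forall>b\<in>Basis. 0 \<le> s \<bullet> b \<and> s \<bullet> b \<le> 1)" by (simp add: mem_box)
  also have "\<dots> \<longleftrightarrow> (\<forall>j. 0 \<le> s $ j \<and> s $ j \<le> 1)" unfolding Basis_cart by (simp add: inner_axis)
  finally show ?thesis .
qed

lemma emeasure_unit_cube: "emeasure lborel (unit_cube :: (real ^ 'd) set) = 1"
  by (subst emeasure_lborel_cbox) auto

definition scale_vec :: "('d \<Rightarrow> real) \<Rightarrow> real ^ 'd \<Rightarrow> real ^ 'd" where
  "scale_vec l s = (\<chi> j. l j * s $ j)"

lemma scale_vec_measurable [measurable]: "scale_vec l \<in> borel_measurable borel"
proof -
  have "continuous_on UNIV (scale_vec l)"
    unfolding scale_vec_def by (intro continuous_intros)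
  then show ?thesis by (rule borel_measurable_continuous_onI)
qed

lemma scale_vec_inverse:
  assumes "\<And>j. 0 < l j"
  shows "scale_vec (\<lambda>j. 1 / l j) (scale_vec l s) = s"
proof -
  have "l j \<noteq> 0" for j using assms[of j] by simp
  then show ?thesis by (simp add: scale_vec_def vec_eq_iff)
qed

lemma lborel_scale_vec:
  fixes l :: "'d::finite \<Rightarrow> real"
  assumes l: "\<And>j. 0 < l j"
  shows "(lborel :: (real ^ 'd) measure) = density (distr lborel borel (scale_vec l)) (\<lambda>_. ennreal (\<Prod>j\<in>UNIV. l j))"
proof -
  define c :: "real ^ 'd \<Rightarrow> real" where "c b = (\<chi> j. l j) \<bullet> b" for b
  have c: "c (axis i 1) = l i" for i by (simp add: c_def inner_axis)
  have T: "0 + (\<Sum>b\<in>Basis. (c b * (x \<bullet> b)) *\<^sub>R b) = scale_vec l x" for x :: "real ^ 'd"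
  proof -
    have "(\<Sum>b\<in>Basis. (c b * (x \<bullet> b)) *\<^sub>R b) \<bullet> axis i 1 = scale_vec l x \<bullet> axis i 1" for i
    proof -
      have "axis i 1 \<in> (Basis :: (real ^ 'd) set)" by (simp add: Basis_cart)
      then show ?thesis by (simp add: inner_sum_left_Basis c) (simp add: inner_axis scale_vec_def)
    qed
    then show ?thesis by (simp add: inner_axis vec_eq_iff)
  qed
  have "lborel = density (distr lborel borel (\<lambda>x. 0 + (\<Sum>b\<in>Basis. (c b * (x \<bullet> b)) *\<^sub>R b))) (\<lambda>_. \<Prod>b\<in>Basis. \<bar>c b\<bar>)"
  proof (rule lborel_affine_euclidean)
    fix b :: "real ^ 'd" assume "b \<in> Basis"
    then obtain i where "b = axis i 1" by (auto simp: Basis_cart)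
    then show "c b \<noteq> 0" using l[of i] by (simp add: c)
  qed
  moreover have "(\<Prod>b\<in>Basis. \<bar>c b\<bar>) = (\<Prod>j\<in>UNIV. l j)"
    using l by (simp add: prod_Basis_cart c less_imp_le)
  ultimately show ?thesis unfolding T by simp
qed

lemma nn_integral_scale_vec:
  fixes l :: "'d::finite \<Rightarrow> real" and g :: "real ^ 'd \<Rightarrow> ennreal"
  assumes l: "\<And>j. 0 < l j" and [measurable]: "g \<in> borel_measurable borel"
  shows "(\<integral>\<^sup>+x. g x \<partial>lborel) = ennreal (\<Prod>j\<in>UNIV. l j) * (\<integral>\<^sup>+x. g (scale_vec l x) \<partial>lborel)"
  by (subst lborel_scale_vec[where l = l, OF l])
     (simp add: nn_integral_density nn_integral_distr nn_integral_cmult)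

lemma integrable_scale_vec:
  fixes l :: "'d::finite \<Rightarrow> real" and g :: "real ^ 'd \<Rightarrow> real"
  assumes l: "\<And>j. 0 < l j" and g: "integrable lborel g"
  shows "integrable lborel (\<lambda>x. g (scale_vec l x))"
    and "(\<integral>x. g (scale_vec l x) \<partial>lborel) = (\<integral>x. g x \<partial>lborel) / (\<Prod>j\<in>UNIV. l j)"
proof -
  have [measurable]: "g \<in> borel_measurable borel" using g by auto
  have l0: "l a \<noteq> 0" for a using l[of a] by simp
  have V: "0 < (\<Prod>j\<in>UNIV. l j)" using l by (simp add: prod_pos)
  have "integrable (density (distr lborel borel (scale_vec l)) (\<lambda>_. ennreal (\<Prod>j\<in>UNIV. l j))) g"
    using g lborel_scale_vec[where l = l, OF l] by simp
  then show "integrable lborel (\<lambda>x. g (scale_vec l x))"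
    using V l0 by (simp add: integrable_density integrable_distr_eq)
  have "(\<integral>x. g x \<partial>lborel) = (\<integral>x. g x \<partial>density (distr lborel borel (scale_vec l)) (\<lambda>_. ennreal (\<Prod>j\<in>UNIV. l j)))"
    using lborel_scale_vec[where l = l, OF l] by simp
  also have "\<dots> = (\<Prod>j\<in>UNIV. l j) * (\<integral>x. g (scale_vec l x) \<partial>lborel)"
    using V l0 by (simp add: integral_density integral_distr)
  finally show "(\<integral>x. g (scale_vec l x) \<partial>lborel) = (\<integral>x. g x \<partial>lborel) / (\<Prod>j\<in>UNIV. l j)"
    using V l0 by simp
qed

lemma integrable_lborel_shift:
  fixes f :: "real ^ 'd \<Rightarrow> real"
  assumes "integrable lborel f"
  shows "integrable lborel (\<lambda>z. f (x + z))"
proof -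
  have "integrable (distr lborel borel ((+) x)) f" using assms by (simp add: lborel_distr_plus)
  then show ?thesis by (subst (asm) integrable_distr_eq) (use assms in auto)
qed

lemma integral_lborel_shift:
  fixes f :: "real ^ 'd \<Rightarrow> real"
  assumes [measurable]: "f \<in> borel_measurable borel"
  shows "(\<integral>z. f (x + z) \<partial>lborel) = (\<integral>z. f z \<partial>lborel)"
proof -
  have "(\<integral>z. f z \<partial>lborel) = (\<integral>z. f z \<partial>distr lborel borel ((+) x))" by (simp add: lborel_distr_plus)
  then show ?thesis by (simp add: integral_distr)
qed

text \<open>Substituting z_j = l_j s_j in the average over the cube turns a translate into smoothing
  with c / V times the indicator of a box of volume V >= v. Along sums, the bounds for the supremum
  and for the L_1 norm add up.\<close>

lemma shift_op_kernel:
  fixes P :: "real ^ 'd \<Rightarrow> (real ^ 'd \<Rightarrow> real) \<Rightarrow> real ^ 'd \<Rightarrow> real"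
  assumes "shift_op (UNIV :: 'd::finite set) v w P" and v: "0 < v"
  obtains k where "k \<in> borel_measurable borel" "\<And>z. \<bar>k z\<bar> \<le> w / v" "(\<integral>\<^sup>+z. ennreal \<bar>k z\<bar> \<partial>lborel) \<le> ennreal w" "0 \<le> w"
    "\<And>f x. integrable lborel f \<Longrightarrow> integrable lborel (\<lambda>s. indicator unit_cube s * P s f x)"
    "\<And>f x. integrable lborel f \<Longrightarrow>
       (\<integral>s. indicator unit_cube s * P s f x \<partial>lborel) = (\<integral>z. k z * f (x + z) \<partial>lborel)"
    "\<And>f. f \<in> borel_measurable borel \<Longrightarrow> (\<lambda>(s, x). P s f x) \<in> borel_measurable (borel \<Otimes>\<^sub>M borel)"
  using assms(1)
proof (induction arbitrary: thesis rule: shift_op.induct)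
  case (single l c w)
  have l: "0 < l j" for j using single by simp
  define V where "V = (\<Prod>j\<in>UNIV. l j)"
  have V: "0 < V" "v \<le> V" using l single by (auto simp: V_def prod_pos)
  define q :: "real ^ 'd \<Rightarrow> real" where "q z = indicator unit_cube (scale_vec (\<lambda>j. 1 / l j) z)" for z
  have [measurable]: "q \<in> borel_measurable borel" unfolding q_def by measurable
  have q_scale: "q (scale_vec l s) = indicator unit_cube s" for s
    by (simp add: q_def scale_vec_inverse[where l = l, OF l])
  have q01: "0 \<le> q z" "q z \<le> 1" for z by (auto simp: q_def split: split_indicator)
  define k where "k z = c / V * q z" for z
  have [measurable]: "k \<in> borel_measurable borel" unfolding k_def by measurable
  have F: "integrable lborel (\<lambda>z. q z * (c * f (x + z)))" if "integrable lborel f" for f x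
  proof (rule Bochner_Integration.integrable_bound)
    show "integrable lborel (\<lambda>z. c * f (x + z))" using integrable_lborel_shift[OF that] by simp
    show "AE z in lborel. norm (q z * (c * f (x + z))) \<le> norm (c * f (x + z))"
      using q01 by (intro AE_I2) (simp add: abs_mult mult_left_le_one_le)
    have "f \<in> borel_measurable borel" using that by auto
    then show "(\<lambda>z. q z * (c * f (x + z))) \<in> borel_measurable lborel" by measurable
  qed
  show ?case
  proof (rule single.prems)
    show "k \<in> borel_measurable borel" by measurable
    show "0 \<le> w" using single by simp
    fix z
    have "\<bar>c\<bar> / V \<le> w / v" using single v V by (intro frac_le) auto
    moreover have "\<bar>k z\<bar> \<le> \<bar>c\<bar> / V" using q01[of z] V by (auto simp: k_def abs_mult intro!: divide_right_mono mult_left_le)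
    ultimately show "\<bar>k z\<bar> \<le> w / v" by simp
  next
    have ks: "ennreal \<bar>k (scale_vec l s)\<bar> = ennreal (\<bar>c\<bar> / V) * indicator unit_cube s" for s
      using V by (auto simp: k_def q_scale split: split_indicator)
    have "(\<integral>\<^sup>+z. ennreal \<bar>k z\<bar> \<partial>lborel)
        = ennreal V * (\<integral>\<^sup>+s. ennreal (\<bar>c\<bar> / V) * indicator (unit_cube :: (real ^ 'd) set) s \<partial>lborel)"
      unfolding V_def by (subst nn_integral_scale_vec[where l = l, OF l]) (simp_all add: ks V_def)
    also have "\<dots> = ennreal \<bar>c\<bar>"
      using V by (simp add: nn_integral_cmult_indicator emeasure_unit_cube ennreal_mult'[symmetric])
    also have "\<dots> \<le> ennreal w" using single by (intro ennreal_leI) auto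
    finally show "(\<integral>\<^sup>+z. ennreal \<bar>k z\<bar> \<partial>lborel) \<le> ennreal w" .
  next
    fix f x assume f: "integrable lborel (f :: real ^ 'd \<Rightarrow> real)"
    have e: "indicator unit_cube s * (c * f (x + (\<chi> j. l j * s $ j))) = q (scale_vec l s) * (c * f (x + scale_vec l s))" for s
      by (simp add: q_scale) (simp add: scale_vec_def)
    show "integrable lborel (\<lambda>s. indicator unit_cube s * (c * f (x + (\<chi> j. l j * s $ j))))"
      unfolding e by (rule integrable_scale_vec(1)[where l = l, OF l F[OF f]])
    show "(\<integral>s. indicator unit_cube s * (c * f (x + (\<chi> j. l j * s $ j))) \<partial>lborel) = (\<integral>z. k z * f (x + z) \<partial>lborel)"
      unfolding e integrable_scale_vec(2)[where l = l, OF l F[OF f]] V_def[symmetric]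
    proof -
      have "k z * f (x + z) = q z * (c * f (x + z)) / V" for z by (simp add: k_def)
      then show "(\<integral>z. q z * (c * f (x + z)) \<partial>lborel) / V = (\<integral>z. k z * f (x + z) \<partial>lborel)"
        by (simp only: integral_divide_zero)
    qed
  next
    fix f :: "real ^ 'd \<Rightarrow> real" assume [measurable]: "f \<in> borel_measurable borel"
    have "(\<lambda>(s, x). c * f (x + scale_vec l s)) \<in> borel_measurable (borel \<Otimes>\<^sub>M borel)" by measurable
    then show "(\<lambda>(s, x). c * f (x + (\<chi> j. l j * s $ j))) \<in> borel_measurable (borel \<Otimes>\<^sub>M borel)"
      by (simp add: scale_vec_def)
  qed
next
  case (add w1 P w2 Q)
  obtain k1 where k1: "k1 \<in> borel_measurable borel" "\<And>z. \<bar>k1 z\<bar> \<le> w1 / v" "(\<integral>\<^sup>+z. ennreal \<bar>k1 z\<bar> \<partial>lborel) \<le> ennreal w1" "0 \<le> w1"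
    "\<And>f x. integrable lborel f \<Longrightarrow> integrable lborel (\<lambda>s. indicator unit_cube s * P s f x)"
    "\<And>f x. integrable lborel f \<Longrightarrow> (\<integral>s. indicator unit_cube s * P s f x \<partial>lborel) = (\<integral>z. k1 z * f (x + z) \<partial>lborel)"
    "\<And>f. f \<in> borel_measurable borel \<Longrightarrow> (\<lambda>(s, x). P s f x) \<in> borel_measurable (borel \<Otimes>\<^sub>M borel)"
    using add.IH(1) by blast
  obtain k2 where k2: "k2 \<in> borel_measurable borel" "\<And>z. \<bar>k2 z\<bar> \<le> w2 / v" "(\<integral>\<^sup>+z. ennreal \<bar>k2 z\<bar> \<partial>lborel) \<le> ennreal w2" "0 \<le> w2"
    "\<And>f x. integrable lborel f \<Longrightarrow> integrable lborel (\<lambda>s. indicator unit_cube s * Q s f x)"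
    "\<And>f x. integrable lborel f \<Longrightarrow> (\<integral>s. indicator unit_cube s * Q s f x \<partial>lborel) = (\<integral>z. k2 z * f (x + z) \<partial>lborel)"
    "\<And>f. f \<in> borel_measurable borel \<Longrightarrow> (\<lambda>(s, x). Q s f x) \<in> borel_measurable (borel \<Otimes>\<^sub>M borel)"
    using add.IH(2) by blast
  note [measurable] = k1(1,7) k2(1,7)
  have kf: "integrable lborel (\<lambda>z. k z * f (x + z))"
    if "k \<in> borel_measurable borel" "\<And>z. \<bar>k z\<bar> \<le> W" "integrable lborel f" for k f :: "real ^ 'd \<Rightarrow> real" and x W
  proof (rule Bochner_Integration.integrable_bound)
    show "integrable lborel (\<lambda>z. W * f (x + z))" using integrable_lborel_shift[OF that(3)] by simp
    have "0 \<le> W" using that(2)[of 0] by (meson abs_ge_zero order_trans)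
    then show "AE z in lborel. norm (k z * f (x + z)) \<le> norm (W * f (x + z))"
      using that(2) by (intro AE_I2) (auto simp: abs_mult intro!: mult_right_mono)
    have [measurable]: "f \<in> borel_measurable borel" using that by auto
    show "(\<lambda>z. k z * f (x + z)) \<in> borel_measurable lborel" using that(1) by measurable
  qed
  show ?case
  proof (rule add.prems[of "\<lambda>z. k1 z + k2 z"])
    show "\<bar>k1 z + k2 z\<bar> \<le> (w1 + w2) / v" for z
      using k1(2)[of z] k2(2)[of z] by (simp add: add_divide_distrib)
    have "(\<integral>\<^sup>+z. ennreal \<bar>k1 z + k2 z\<bar> \<partial>lborel) \<le> (\<integral>\<^sup>+z. ennreal \<bar>k1 z\<bar> + ennreal \<bar>k2 z\<bar> \<partial>lborel)"
      by (intro nn_integral_mono) (simp flip: ennreal_plus)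
    also have "\<dots> \<le> ennreal w1 + ennreal w2" using k1(3) k2(3) by (subst nn_integral_add) (auto intro: add_mono)
    finally show "(\<integral>\<^sup>+z. ennreal \<bar>k1 z + k2 z\<bar> \<partial>lborel) \<le> ennreal (w1 + w2)" using k1(4) k2(4) by simp
    fix f x assume f: "integrable lborel (f :: real ^ 'd \<Rightarrow> real)"
    show "integrable lborel (\<lambda>s. indicator unit_cube s * (P s f x + Q s f x))"
      using k1(5)[OF f, of x] k2(5)[OF f, of x] by (simp add: distrib_left)
    show "(\<integral>s. indicator unit_cube s * (P s f x + Q s f x) \<partial>lborel) = (\<integral>z. (k1 z + k2 z) * f (x + z) \<partial>lborel)"
      using k1(5,6)[OF f, of x] k2(5,6)[OF f, of x] kf[OF k1(1,2) f, of x] kf[OF k2(1,2) f, of x]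
      by (simp add: distrib_left distrib_right)
  qed (use k1(4) k2(4) in simp_all)
qed

text \<open>The cube has measure 1, and the integral of the squared deviation from the mean m is
  nonnegative.\<close>

lemma square_integral_unit_cube:
  fixes \<phi> :: "real ^ 'd \<Rightarrow> real"
  assumes int: "integrable lborel (\<lambda>s. indicator unit_cube s * \<phi> s)"
  shows "ennreal ((\<integral>s. indicator unit_cube s * \<phi> s \<partial>lborel)\<^sup>2) \<le> (\<integral>\<^sup>+s. indicator unit_cube s * ennreal ((\<phi> s)\<^sup>2) \<partial>lborel)"
proof (cases "(\<integral>\<^sup>+s. indicator unit_cube s * ennreal ((\<phi> s)\<^sup>2) \<partial>lborel) = \<top>")
  case False
  define \<psi> where "\<psi> s = indicator unit_cube s * \<phi> s" for s
  define m where "m = (\<integral>s. \<psi> s \<partial>lborel)"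
  have [measurable]: "\<psi> \<in> borel_measurable borel" using int by (auto simp: \<psi>_def[abs_def])
  have e: "(\<integral>\<^sup>+s. indicator unit_cube s * ennreal ((\<phi> s)\<^sup>2) \<partial>lborel) = (\<integral>\<^sup>+s. ennreal ((\<psi> s)\<^sup>2) \<partial>lborel)"
    by (rule nn_integral_cong) (auto simp: \<psi>_def split: split_indicator)
  have i2: "integrable lborel (\<lambda>s. (\<psi> s)\<^sup>2)"
    by (rule integrableI_nonneg) (use False e in \<open>auto simp: less_top\<close>)
  have i1: "integrable lborel \<psi>" using int by (simp add: \<psi>_def[abs_def])
  have i0: "integrable lborel (indicator unit_cube :: real ^ 'd \<Rightarrow> real)"
    by (rule integrable_real_indicator) (auto simp: emeasure_unit_cube)
  have "0 \<le> (\<integral>s. (\<psi> s)\<^sup>2 - 2 * m * \<psi> s + m\<^sup>2 * indicator unit_cube s \<partial>lborel)"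
  proof (rule integral_nonneg_AE, rule AE_I2)
    fix s
    show "0 \<le> (\<psi> s)\<^sup>2 - 2 * m * \<psi> s + m\<^sup>2 * indicator unit_cube s"
      using zero_le_power2[of "\<psi> s - m"] by (auto simp: power2_diff \<psi>_def mult_ac split: split_indicator)
  qed
  also have "\<dots> = (\<integral>s. (\<psi> s)\<^sup>2 \<partial>lborel) - 2 * m * m + m\<^sup>2 * measure lborel (unit_cube :: (real ^ 'd) set)"
    using i0 i1 i2 by (simp add: m_def)
  also have "measure lborel (unit_cube :: (real ^ 'd) set) = 1"
    by (simp add: measure_def emeasure_unit_cube)
  finally have "m\<^sup>2 \<le> (\<integral>s. (\<psi> s)\<^sup>2 \<partial>lborel)" by (simp add: power2_eq_square)
  then have "ennreal (m\<^sup>2) \<le> ennreal (\<integral>s. (\<psi> s)\<^sup>2 \<partial>lborel)" by (rule ennreal_leI)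
  also have "\<dots> = (\<integral>\<^sup>+s. ennreal ((\<psi> s)\<^sup>2) \<partial>lborel)" using i2 by (simp add: nn_integral_eq_integral)
  finally show ?thesis unfolding e by (simp add: m_def \<psi>_def[abs_def])
qed simp

lemma norm_le_2:
  assumes "0 \<le> B"
  shows "norm_le 2 f B \<longleftrightarrow> f \<in> borel_measurable borel \<and> (\<integral>\<^sup>+x. ennreal ((f x)\<^sup>2) \<partial>lborel) \<le> ennreal (B\<^sup>2)"
  using norm_le_finite[OF assms, of 2 f] assms by simp

text \<open>By the preceding inequality and Fubini, an averaged approximation is in L_2 no worse
  than the worst approximation for a single s.\<close>

lemma norm_le_2_kernel_bias:
  fixes P :: "real ^ 'd \<Rightarrow> (real ^ 'd \<Rightarrow> real) \<Rightarrow> real ^ 'd \<Rightarrow> real"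
  assumes f: "integrable lborel f" and B: "0 \<le> B" and [measurable]: "k \<in> borel_measurable borel"
    and int: "\<And>x. integrable lborel (\<lambda>s. indicator unit_cube s * P s f x)"
    and eq: "\<And>x. (\<integral>s. indicator unit_cube s * P s f x \<partial>lborel) = (\<integral>z. k z * f (x + z) \<partial>lborel)"
    and meas[measurable]: "(\<lambda>(s, x). P s f x) \<in> borel_measurable (borel \<Otimes>\<^sub>M borel)"
    and le: "\<And>s. s \<in> unit_cube \<Longrightarrow> norm_le 2 (\<lambda>x. f x - P s f x) B"
  shows "norm_le 2 (\<lambda>x. f x - (\<integral>z. k z * f (x + z) \<partial>lborel)) B"
proof -
  have [measurable]: "f \<in> borel_measurable borel" using f by auto
  have i0: "integrable lborel (indicator unit_cube :: real ^ 'd \<Rightarrow> real)"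
    by (rule integrable_real_indicator) (auto simp: emeasure_unit_cube)
  have m1: "measure lborel (unit_cube :: (real ^ 'd) set) = 1"
    by (simp add: measure_def emeasure_unit_cube)
  have pt: "ennreal ((f x - (\<integral>z. k z * f (x + z) \<partial>lborel))\<^sup>2)
      \<le> (\<integral>\<^sup>+s. indicator unit_cube s * ennreal ((f x - P s f x)\<^sup>2) \<partial>lborel)" for x
  proof -
    have i: "integrable lborel (\<lambda>s. indicator unit_cube s * (f x - P s f x))"
      using int[of x] i0 by (simp add: right_diff_distrib)
    have "(\<integral>s. indicator unit_cube s * (f x - P s f x) \<partial>lborel) = f x - (\<integral>z. k z * f (x + z) \<partial>lborel)"
      using int[of x] i0 by (simp add: right_diff_distrib eq m1)
    then show ?thesis using square_integral_unit_cube[OF i] by simp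
  qed
  have "(\<integral>\<^sup>+x. ennreal ((f x - (\<integral>z. k z * f (x + z) \<partial>lborel))\<^sup>2) \<partial>lborel)
      \<le> (\<integral>\<^sup>+x. \<integral>\<^sup>+s. indicator unit_cube s * ennreal ((f x - P s f x)\<^sup>2) \<partial>lborel \<partial>lborel)"
    by (intro nn_integral_mono pt)
  also have "\<dots> = (\<integral>\<^sup>+s. \<integral>\<^sup>+x. indicator unit_cube s * ennreal ((f x - P s f x)\<^sup>2) \<partial>lborel \<partial>lborel)"
    by (rule lborel_pair.Fubini') measurable
  also have "\<dots> \<le> (\<integral>\<^sup>+s. ennreal (B\<^sup>2) * indicator (unit_cube :: (real ^ 'd) set) s \<partial>lborel)"
  proof (rule nn_integral_mono)
    fix s :: "real ^ 'd"
    have "(\<lambda>x. P s f x) \<in> borel_measurable borel" by measurable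
    then show "(\<integral>\<^sup>+x. indicator unit_cube s * ennreal ((f x - P s f x)\<^sup>2) \<partial>lborel) \<le> ennreal (B\<^sup>2) * indicator unit_cube s"
      using le[of s] by (auto simp: norm_le_2[OF B] split: split_indicator)
  qed
  also have "\<dots> = ennreal (B\<^sup>2)"
    by (subst nn_integral_cmult_indicator) (auto simp: emeasure_unit_cube)
  finally show ?thesis using B by (subst norm_le_2) auto
qed

lemma lborel_distr_uminus_euclidean: "distr lborel borel uminus = (lborel :: 'a::euclidean_space measure)"
  by (subst lborel_affine[of "-1" 0]) (simp_all add: density_1 one_ennreal_def[symmetric])

lemma nn_integral_lborel_uminus:
  fixes g :: "real ^ 'd \<Rightarrow> ennreal"
  assumes [measurable]: "g \<in> borel_measurable borel"
  shows "(\<integral>\<^sup>+x. g (- x) \<partial>lborel) = (\<integral>\<^sup>+x. g x \<partial>lborel)"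
proof -
  have "(\<integral>\<^sup>+x. g x \<partial>lborel) = (\<integral>\<^sup>+x. g x \<partial>distr lborel borel uminus)"
    by (simp add: lborel_distr_uminus_euclidean)
  then show ?thesis by (simp add: nn_integral_distr)
qed

lemma ennreal_lincomb:
  assumes "0 \<le> a" "0 \<le> b" "0 \<le> x" "0 \<le> y"
  shows "ennreal a * ennreal x + ennreal b * ennreal y = ennreal (a * x + b * y)"
  using assms by (simp add: ennreal_mult'[symmetric])

lemma ennreal_le_lincomb:
  assumes "z \<le> a * x + b * y" "0 \<le> a" "0 \<le> b" "0 \<le> x" "0 \<le> y"
  shows "ennreal z \<le> ennreal a * ennreal x + ennreal b * ennreal y"
  unfolding ennreal_lincomb[OF assms(2-)] by (rule ennreal_leI[OF assms(1)])

lemma L2_densities_norm: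
  assumes "f \<in> L2_densities"
  shows "(\<integral>\<^sup>+x. ennreal ((f x)\<^sup>2) \<partial>lborel) = ennreal ((L2norm f)\<^sup>2)" "0 < L2norm f"
proof -
  have [measurable]: "f \<in> borel_measurable borel" and f0: "\<And>x. 0 \<le> f x"
    and f1: "(\<integral>\<^sup>+x. ennreal (f x) \<partial>lborel) = 1" and f2: "Lnorm 2 f < \<infinity>"
    using assms by (auto simp: L2_densities_def)
  define I where "I = (\<integral>\<^sup>+x. ennreal ((f x)\<^sup>2) \<partial>lborel)"
  have L: "Lnorm 2 f = epowr I (1 / 2)" by (simp add: Lnorm_def I_def)
  have "I \<noteq> \<top>" using f2 L by (auto simp: epowr_def)
  then obtain y where y: "I = ennreal y" "0 \<le> y" by (cases I) auto
  then have N: "L2norm f = sqrt y" by (simp add: L2norm_def L epowr_def powr_half_sqrt)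
  then show "(\<integral>\<^sup>+x. ennreal ((f x)\<^sup>2) \<partial>lborel) = ennreal ((L2norm f)\<^sup>2)" using y by (simp add: I_def)
  have "I \<noteq> 0"
  proof
    assume "I = 0"
    then have "AE x in lborel. ennreal ((f x)\<^sup>2) = 0" unfolding I_def by (subst (asm) nn_integral_0_iff_AE) auto
    then have "(\<integral>\<^sup>+x. ennreal (f x) \<partial>lborel) = (\<integral>\<^sup>+x. 0 \<partial>(lborel :: (real ^ 'a) measure))"
      by (intro nn_integral_cong_AE) (auto elim!: eventually_mono)
    then show False using f1 by simp
  qed
  then show "0 < L2norm f" using y N by (cases "y = 0") auto
qed

section \<open>Kernel bounds and the risk of the pair estimator\<close>

lemma young_powr:
  assumes "1 \<le> (p :: real)" "0 < t" "0 \<le> y"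
  shows "y \<le> t * (1 - 1 / p) + t powr (1 - p) * y powr p / p"
proof (cases "y = 0")
  case False
  then have y: "0 < y" using assms by simp
  define h where "h b = (if b then 1 else (y / t) powr p)" for b :: bool
  define u where "u b = (if b then 1 - 1 / p else 1 / p)" for b :: bool
  have "(\<Prod>b\<in>UNIV. h b powr u b) \<le> (\<Sum>b\<in>UNIV. u b * h b)"
    using assms y by (intro weighted_arith_geo_mean) (auto simp: h_def u_def UNIV_bool)
  then have "y / t \<le> (1 - 1 / p) + 1 / p * (y / t) powr p"
    using assms y by (simp add: UNIV_bool h_def u_def powr_powr)
  then have "t * (y / t) \<le> t * ((1 - 1 / p) + 1 / p * (y / t) powr p)"
    using assms by (intro mult_left_mono) auto
  then have "y \<le> t * (1 - 1 / p) + t * (y powr p / t powr p) / p"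
    using assms y by (simp add: powr_divide distrib_left mult_ac)
  moreover have eq: "t * (y powr p / t powr p) = t powr (1 - p) * y powr p"
    using assms by (simp add: powr_diff)
  ultimately show ?thesis by (simp only:)
qed (use assms in simp)

text \<open>Hoelder's inequality, with the conjugate norm of k interpolated between its supremum w /
  v and its L_1 norm w. It is carried out pointwise, by Young's inequality with a free scale
  t.\<close>

lemma kernel_sup_bound:
  fixes k f :: "real ^ 'd \<Rightarrow> real"
  assumes p: "1 \<le> p" and F: "0 < F" and f: "norm_le p f F" and f0: "\<And>x. 0 \<le> f x"
    and [measurable]: "k \<in> borel_measurable borel" and k: "\<And>z. \<bar>k z\<bar> \<le> w / v" "(\<integral>\<^sup>+z. ennreal \<bar>k z\<bar> \<partial>lborel) \<le> ennreal w"
    and v: "0 < v" and w: "0 \<le> w"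
  shows "(\<integral>\<^sup>+z. ennreal (\<bar>k z\<bar> * f (x + z)) \<partial>lborel) \<le> ennreal (w * F * v powr (- recip p))"
  using p
proof (cases rule: ge_one_finite_cases)
  case 1
  have [measurable]: "f \<in> borel_measurable borel" by (rule norm_le_measurable[OF f])
  have "AE z in lborel. \<bar>f z\<bar> \<le> F" using f F 1 by (simp add: norm_le_top)
  then have "AE z in lborel. \<bar>f (z + x)\<bar> \<le> F" by (rule AE_lborel_shift) measurable
  then have "(\<integral>\<^sup>+z. ennreal (\<bar>k z\<bar> * f (x + z)) \<partial>lborel) \<le> (\<integral>\<^sup>+z. ennreal F * ennreal \<bar>k z\<bar> \<partial>lborel)"
  proof (intro nn_integral_mono_AE, eventually_elim)
    case (elim z)
    then have "\<bar>k z\<bar> * f (x + z) \<le> \<bar>k z\<bar> * F" by (intro mult_left_mono) (auto simp: add.commute)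
    then show ?case using F by (simp add: ennreal_mult'[symmetric] ennreal_leI mult.commute)
  qed
  also have "\<dots> \<le> ennreal F * ennreal w" using k by (subst nn_integral_cmult) (auto intro: mult_left_mono)
  finally show ?thesis using 1 F v by (simp add: ennreal_mult'[symmetric] mult.commute)
next
  case 2
  define P where "P = enn2real p"
  have P: "1 \<le> P" using 2 by (simp add: P_def)
  have [measurable]: "f \<in> borel_measurable borel" by (rule norm_le_measurable[OF f])
  \<comment> \<open>The scale that balances Young's inequality: after integration the two terms are
    w t (1 - 1 / P) and w t / P.\<close>
  define t where "t = F * v powr (- 1 / P)"
  have t: "0 < t" using F v by (simp add: t_def)
  have "(\<integral>\<^sup>+z. ennreal (\<bar>k z\<bar> * f (x + z)) \<partial>lborel)
     \<le> (\<integral>\<^sup>+z. ennreal (t * (1 - 1 / P)) * ennreal \<bar>k z\<bar> + ennreal (t powr (1 - P) / P * (w / v)) * ennreal (f (x + z) powr P) \<partial>lborel)"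
  proof (rule nn_integral_mono)
    fix z
    have "\<bar>k z\<bar> * f (x + z) \<le> \<bar>k z\<bar> * (t * (1 - 1 / P) + t powr (1 - P) * f (x + z) powr P / P)"
      using young_powr[OF P t f0] by (intro mult_left_mono) auto
    also have "\<dots> = t * (1 - 1 / P) * \<bar>k z\<bar> + \<bar>k z\<bar> * (t powr (1 - P) * f (x + z) powr P / P)"
      by (simp add: algebra_simps)
    also have "\<dots> \<le> t * (1 - 1 / P) * \<bar>k z\<bar> + w / v * (t powr (1 - P) * f (x + z) powr P / P)"
      using P k(1) by (intro add_left_mono mult_right_mono) auto
    also have "\<dots> = t * (1 - 1 / P) * \<bar>k z\<bar> + (t powr (1 - P) / P * (w / v)) * f (x + z) powr P"
      by (simp add: mult_ac)
    finally show "ennreal (\<bar>k z\<bar> * f (x + z)) \<le> ennreal (t * (1 - 1 / P)) * ennreal \<bar>k z\<bar> + ennreal (t powr (1 - P) / P * (w / v)) * ennreal (f (x + z) powr P)"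
      using P t w v by (simp add: ennreal_mult'[symmetric] ennreal_plus[symmetric] ennreal_leI del: ennreal_plus)
  qed
  also have "\<dots> = ennreal (t * (1 - 1 / P)) * (\<integral>\<^sup>+z. ennreal \<bar>k z\<bar> \<partial>lborel)
      + ennreal (t powr (1 - P) / P * (w / v)) * (\<integral>\<^sup>+z. ennreal (f (x + z) powr P) \<partial>lborel)"
    by (subst nn_integral_add) (auto simp: nn_integral_cmult)
  also have "(\<integral>\<^sup>+z. ennreal (f (x + z) powr P) \<partial>lborel) = (\<integral>\<^sup>+z. ennreal (\<bar>f z\<bar> powr P) \<partial>lborel)"
    using nn_integral_lborel_shift[of "\<lambda>z. ennreal (f z powr P)" x] f0 by (simp add: add.commute)
  also have "ennreal (t * (1 - 1 / P)) * (\<integral>\<^sup>+z. ennreal \<bar>k z\<bar> \<partial>lborel)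
      + ennreal (t powr (1 - P) / P * (w / v)) * (\<integral>\<^sup>+z. ennreal (\<bar>f z\<bar> powr P) \<partial>lborel)
      \<le> ennreal (t * (1 - 1 / P)) * ennreal w + ennreal (t powr (1 - P) / P * (w / v)) * ennreal (F powr P)"
    using k(2) f F p 2 by (intro add_mono mult_left_mono) (auto simp: norm_le_finite P_def)
  also have "\<dots> = ennreal (t * (1 - 1 / P) * w + t powr (1 - P) / P * (w / v) * F powr P)"
    using P t w v by (simp add: ennreal_mult'[symmetric] ennreal_plus[symmetric] del: ennreal_plus)
  also have "t * (1 - 1 / P) * w + t powr (1 - P) / P * (w / v) * F powr P = w * F * v powr (- recip p)"
  proof -
    have "t powr P = F powr P * v powr (- 1 / P * P)" using F v by (simp add: t_def powr_mult powr_powr)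
    also have "- 1 / P * P = - 1" using P by simp
    finally have "t powr P = F powr P / v" using v by (simp add: powr_minus divide_inverse)
    then have "t powr (1 - P) * F powr P = t * v"
      using t F v by (simp add: powr_diff)
    then have "t powr (1 - P) / P * (w / v) * F powr P = t * w / P"
      using v by (simp add: field_simps)
    then have "t * (1 - 1 / P) * w + t powr (1 - P) / P * (w / v) * F powr P = w * t"
      using P by (simp add: field_simps)
    then show ?thesis using p 2 by (simp add: t_def recip_finite P_def)
  qed
  finally show ?thesis .
qed

text \<open>For every z, the product f(x) f(x + z) is at most half the sum of two squares with the
  same integral; then k is integrated out.\<close>

lemma kernel_form_bound:
  fixes k f :: "real ^ 'd \<Rightarrow> real"
  assumes f: "f \<in> L2_densities" and [measurable]: "k \<in> borel_measurable borel"
    and k: "(\<integral>\<^sup>+z. ennreal \<bar>k z\<bar> \<partial>lborel) \<le> ennreal w"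
  shows "(\<integral>\<^sup>+x. ennreal (f x) * (\<integral>\<^sup>+z. ennreal (\<bar>k z\<bar> * f (x + z)) \<partial>lborel) \<partial>lborel) \<le> ennreal (w * (L2norm f)\<^sup>2)"
proof -
  have [measurable]: "f \<in> borel_measurable borel" and f0: "\<And>x. 0 \<le> f x"
    using f by (auto simp: L2_densities_def)
  note a = L2_densities_norm[OF f]
  have "(\<integral>\<^sup>+x. ennreal (f x) * (\<integral>\<^sup>+z. ennreal (\<bar>k z\<bar> * f (x + z)) \<partial>lborel) \<partial>lborel)
      = (\<integral>\<^sup>+x. \<integral>\<^sup>+z. ennreal \<bar>k z\<bar> * ennreal (f x * f (x + z)) \<partial>lborel \<partial>lborel)"
    using f0 by (subst nn_integral_cmult[symmetric]) (auto simp: ennreal_mult'[symmetric] mult_ac intro!: nn_integral_cong)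
  also have "\<dots> = (\<integral>\<^sup>+z. \<integral>\<^sup>+x. ennreal \<bar>k z\<bar> * ennreal (f x * f (x + z)) \<partial>lborel \<partial>lborel)"
    by (rule lborel_pair.Fubini') measurable
  also have "\<dots> \<le> (\<integral>\<^sup>+z. ennreal ((L2norm f)\<^sup>2) * ennreal \<bar>k z\<bar> \<partial>lborel)"
  proof (rule nn_integral_mono)
    fix z :: "real ^ 'd"
    have "(\<integral>\<^sup>+x. ennreal (f x * f (x + z)) \<partial>lborel)
        \<le> (\<integral>\<^sup>+x. ennreal (1 / 2) * ennreal ((f x)\<^sup>2) + ennreal (1 / 2) * ennreal ((f (x + z))\<^sup>2) \<partial>lborel)"
    proof (rule nn_integral_mono)
      fix x
      have "f x * f (x + z) \<le> 1 / 2 * (f x)\<^sup>2 + 1 / 2 * (f (x + z))\<^sup>2"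
        using sum_squares_bound[of "f x" "f (x + z)"] by simp
      then show "ennreal (f x * f (x + z)) \<le> ennreal (1 / 2) * ennreal ((f x)\<^sup>2) + ennreal (1 / 2) * ennreal ((f (x + z))\<^sup>2)"
        by (intro ennreal_le_lincomb) auto
    qed
    also have "\<dots> = ennreal (1 / 2) * (\<integral>\<^sup>+x. ennreal ((f x)\<^sup>2) \<partial>lborel) + ennreal (1 / 2) * (\<integral>\<^sup>+x. ennreal ((f (x + z))\<^sup>2) \<partial>lborel)"
      by (subst nn_integral_add) (auto simp: nn_integral_cmult)
    also have "(\<integral>\<^sup>+x. ennreal ((f (x + z))\<^sup>2) \<partial>lborel) = (\<integral>\<^sup>+x. ennreal ((f x)\<^sup>2) \<partial>lborel)"
      using nn_integral_lborel_shift[of "\<lambda>x. ennreal ((f x)\<^sup>2)" z] by simp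
    also have "ennreal (1 / 2) * (\<integral>\<^sup>+x. ennreal ((f x)\<^sup>2) \<partial>lborel) + ennreal (1 / 2) * (\<integral>\<^sup>+x. ennreal ((f x)\<^sup>2) \<partial>lborel) = ennreal ((L2norm f)\<^sup>2)"
      unfolding a by (subst ennreal_lincomb) auto
    finally have "(\<integral>\<^sup>+x. ennreal (f x * f (x + z)) \<partial>lborel) \<le> ennreal ((L2norm f)\<^sup>2)" .
    then show "(\<integral>\<^sup>+x. ennreal \<bar>k z\<bar> * ennreal (f x * f (x + z)) \<partial>lborel) \<le> ennreal ((L2norm f)\<^sup>2) * ennreal \<bar>k z\<bar>"
      by (subst nn_integral_cmult) (auto simp: mult.commute intro: mult_left_mono)
  qed
  also have "\<dots> \<le> ennreal ((L2norm f)\<^sup>2) * ennreal w"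
    using k by (subst nn_integral_cmult) (auto intro: mult_left_mono)
  finally show ?thesis by (simp add: ennreal_mult''[symmetric] mult.commute)
qed

text \<open>The loss of 1 / a^2 is harmless, because the variance and the squared bias in
  \<open>pair_estimator_risk\<close> both carry the factor a^2.\<close>

lemma sqrt_error:
  assumes "0 < (a :: real)"
  shows "(sqrt (max 0 u) - a)\<^sup>2 \<le> (u - a\<^sup>2)\<^sup>2 / a\<^sup>2"
proof -
  define s where "s = sqrt (max 0 u)"
  have s: "0 \<le> s" "s\<^sup>2 = max 0 u" by (simp_all add: s_def)
  have "\<bar>s - a\<bar> * a \<le> \<bar>s - a\<bar> * (s + a)" using s by (intro mult_left_mono) auto
  also have "\<dots> = \<bar>s\<^sup>2 - a\<^sup>2\<bar>"
  proof -
    have "s\<^sup>2 - a\<^sup>2 = (s - a) * (s + a)" by (simp add: power2_eq_square algebra_simps)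
    then show ?thesis using s assms by (simp add: abs_mult)
  qed
  also have "\<dots> \<le> \<bar>u - a\<^sup>2\<bar>" unfolding s by (cases "0 \<le> u") (auto simp: abs_if not_le)
  finally have "(\<bar>s - a\<bar> * a)\<^sup>2 \<le> \<bar>u - a\<^sup>2\<bar>\<^sup>2" using assms by (intro power_mono) auto
  then show ?thesis using assms by (simp add: s_def power_mult_distrib field_simps)
qed

text \<open>Only pairs across the two halves of the sample are used, so the halves are independent
  and the conditioning of \<open>two_sample_variance\<close> applies.\<close>

definition pair_estimator :: "(real ^ 'd \<Rightarrow> real) \<Rightarrow> nat \<Rightarrow> (nat \<Rightarrow> real ^ 'd) \<Rightarrow> real" where
  "pair_estimator k n X = sqrt (max 0 ((\<Sum>i\<in>{..<n div 2}. \<Sum>j\<in>{n div 2..<n}. k (X j - X i))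
     / (real (card {..<n div 2}) * real (card {n div 2..<n}))))"

lemma pair_estimator_in_estimators:
  assumes [measurable]: "k \<in> borel_measurable borel"
  shows "pair_estimator k n \<in> estimators n"
proof -
  have "(\<lambda>X. k (X j - X i)) \<in> borel_measurable (Pi\<^sub>M {..<n} (\<lambda>_. borel))" if "i \<in> {..<n div 2}" "j \<in> {n div 2..<n}" for i j
  proof -
    have "i \<in> {..<n}" "j \<in> {..<n}" using that by auto
    then show ?thesis by measurable
  qed
  then show ?thesis unfolding estimators_def pair_estimator_def[abs_def] by measurable
qed

text \<open>The mean over pairs estimates the inner product of f with its smoothing by k, which
  misses the squared norm a^2 by at most B a. The three terms of the bound are the squared bias, the
  linear part of the variance, governed by the supremum of the smoothed f, and its quadratic part,
  governed by the supremum of k.\<close>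

lemma pair_estimator_risk:
  fixes k f :: "real ^ 'd \<Rightarrow> real"
  assumes f: "f \<in> L2_densities" and p: "1 \<le> p" and F: "0 < F" and fp: "norm_le p f F"
    and [measurable]: "k \<in> borel_measurable borel" and k: "\<And>z. \<bar>k z\<bar> \<le> w / v" "(\<integral>\<^sup>+z. ennreal \<bar>k z\<bar> \<partial>lborel) \<le> ennreal w"
    and v: "0 < v" and w: "0 \<le> w" and B: "0 < B"
    and bias: "norm_le 2 (\<lambda>x. f x - (\<integral>z. k z * f (x + z) \<partial>lborel)) B"
    and n: "2 \<le> n"
  shows "(\<integral>\<^sup>+X. ennreal ((pair_estimator k n X - L2norm f)\<^sup>2) \<partial>sample_law n f)
    \<le> ennreal (2 * B\<^sup>2 + 28 * w\<^sup>2 * F * v powr (- recip p) / n + 48 * w\<^sup>2 / (v * (real n)\<^sup>2))"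
proof -
  have fm[measurable]: "f \<in> borel_measurable borel" and f0: "\<And>x. 0 \<le> f x"
    and f1: "(\<integral>\<^sup>+x. ennreal (f x) \<partial>lborel) = 1"
    using f by (auto simp: L2_densities_def)
  define a where "a = L2norm f"
  have a: "(\<integral>\<^sup>+x. ennreal ((f x)\<^sup>2) \<partial>lborel) = ennreal (a\<^sup>2)" "0 < a"
    using L2_densities_norm[OF f] by (simp_all add: a_def)
  define M where "M = density lborel (\<lambda>x. ennreal (f x))"
  interpret M: prob_space M by (rule prob_spaceI) (simp add: M_def emeasure_density f1)
  have sets_M[measurable_cong]: "sets M = sets borel" by (simp add: M_def)
  have fint: "integrable lborel f"
    by (rule integrableI_nonneg) (use f0 f1 in auto)
  define G where "G x = (\<integral>z. k z * f (x + z) \<partial>lborel)" for x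
  define h where "h x y = k (y - x)" for x y
  define S where "S = w * F * v powr (- recip p)"
  have S0: "0 \<le> S" using w F by (simp add: S_def)
  have K0: "0 \<le> w / v" using w v by simp
  have hy: "(\<integral>y. h x y \<partial>M) = G x" for x
  proof -
    have "(\<integral>y. h x y \<partial>M) = (\<integral>y. f y * k (y - x) \<partial>lborel)"
      unfolding M_def h_def using f0 by (subst integral_density) auto
    also have "\<dots> = (\<integral>z. f (x + z) * k (x + z - x) \<partial>lborel)"
      by (rule integral_lborel_shift[symmetric]) simp
    finally show ?thesis by (simp add: G_def mult.commute)
  qed
  \<comment> \<open>Integrating over the first argument instead of the second reflects the
    kernel.\<close>
  define k' where "k' z = k (- z)" for z
  have [measurable]: "k' \<in> borel_measurable borel" unfolding k'_def by measurable
  have k': "\<And>z. \<bar>k' z\<bar> \<le> w / v" "(\<integral>\<^sup>+z. ennreal \<bar>k' z\<bar> \<partial>lborel) \<le> ennreal w"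
    using k nn_integral_lborel_uminus[of "\<lambda>z. ennreal \<bar>k z\<bar>"] by (auto simp: k'_def)
  define G' where "G' x = (\<integral>z. k' z * f (x + z) \<partial>lborel)" for x
  have hx: "(\<integral>x. h x y \<partial>M) = G' y" for y
  proof -
    have "(\<integral>x. h x y \<partial>M) = (\<integral>x. f x * k' (x - y) \<partial>lborel)"
      unfolding M_def h_def k'_def using f0 by (subst integral_density) auto
    also have "\<dots> = (\<integral>z. f (y + z) * k' (y + z - y) \<partial>lborel)"
      by (rule integral_lborel_shift[symmetric]) simp
    finally show ?thesis by (simp add: G'_def mult.commute)
  qed
  have square_form: "(\<integral>\<^sup>+x. ennreal ((\<integral>z. \<kappa> z * f (x + z) \<partial>lborel)\<^sup>2) \<partial>M) \<le> ennreal (S * (w * a\<^sup>2))"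
    if [measurable]: "\<kappa> \<in> borel_measurable borel" and \<kappa>: "\<And>z. \<bar>\<kappa> z\<bar> \<le> w / v" "(\<integral>\<^sup>+z. ennreal \<bar>\<kappa> z\<bar> \<partial>lborel) \<le> ennreal w"
    for \<kappa> :: "real ^ 'd \<Rightarrow> real"
  proof -
    define g where "g x = (\<integral>\<^sup>+z. ennreal (\<bar>\<kappa> z\<bar> * f (x + z)) \<partial>lborel)" for x
    have [measurable]: "g \<in> borel_measurable borel" unfolding g_def by measurable
    have gS: "g x \<le> ennreal S" for x
      unfolding g_def S_def by (rule kernel_sup_bound[OF p F fp f0 that v w])
    have le: "ennreal \<bar>\<integral>z. \<kappa> z * f (x + z) \<partial>lborel\<bar> \<le> g x" for x
    proof -
      have "ennreal \<bar>\<integral>z. \<kappa> z * f (x + z) \<partial>lborel\<bar> \<le> (\<integral>\<^sup>+z. ennreal (norm (\<kappa> z * f (x + z))) \<partial>lborel)"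
        using integral_norm_bound_ennreal[of lborel "\<lambda>z. \<kappa> z * f (x + z)"]
        by (cases "integrable lborel (\<lambda>z. \<kappa> z * f (x + z))") (auto simp: not_integrable_integral_eq)
      then show ?thesis using f0 by (simp add: g_def abs_mult)
    qed
    have "(\<integral>\<^sup>+x. ennreal ((\<integral>z. \<kappa> z * f (x + z) \<partial>lborel)\<^sup>2) \<partial>M)
        = (\<integral>\<^sup>+x. ennreal (f x) * ennreal ((\<integral>z. \<kappa> z * f (x + z) \<partial>lborel)\<^sup>2) \<partial>lborel)"
      unfolding M_def by (subst nn_integral_density) auto
    \<comment> \<open>One factor of the square is bounded by its supremum S; the other is kept and
      yields the quadratic form of f.\<close>
    also have "\<dots> \<le> (\<integral>\<^sup>+x. ennreal S * (ennreal (f x) * g x) \<partial>lborel)"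
    proof (rule nn_integral_mono)
      fix x
      have "ennreal ((\<integral>z. \<kappa> z * f (x + z) \<partial>lborel)\<^sup>2)
          = ennreal \<bar>\<integral>z. \<kappa> z * f (x + z) \<partial>lborel\<bar> * ennreal \<bar>\<integral>z. \<kappa> z * f (x + z) \<partial>lborel\<bar>"
        by (simp add: ennreal_mult'[symmetric] power2_eq_square abs_mult_self_eq)
      also have "\<dots> \<le> ennreal S * g x" using le[of x] gS[of x] by (intro mult_mono) (auto intro: order_trans)
      finally show "ennreal (f x) * ennreal ((\<integral>z. \<kappa> z * f (x + z) \<partial>lborel)\<^sup>2) \<le> ennreal S * (ennreal (f x) * g x)"
        by (metis mult.left_commute mult_left_mono zero_le)
    qed
    also have "\<dots> = ennreal S * (\<integral>\<^sup>+x. ennreal (f x) * g x \<partial>lborel)" by (rule nn_integral_cmult) measurable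
    also have "\<dots> \<le> ennreal S * ennreal (w * a\<^sup>2)"
      unfolding g_def a_def by (intro mult_left_mono kernel_form_bound[OF f _ \<kappa>(2)]) auto
    finally show ?thesis using S0 by (simp add: ennreal_mult')
  qed
  have A: "(\<integral>\<^sup>+x. ennreal ((\<integral>y. h x y \<partial>M)\<^sup>2) \<partial>M) \<le> ennreal (S * (w * a\<^sup>2))"
    unfolding hy G_def by (rule square_form) (use k in auto)
  have C: "(\<integral>\<^sup>+y. ennreal ((\<integral>x. h x y \<partial>M)\<^sup>2) \<partial>M) \<le> ennreal (S * (w * a\<^sup>2))"
    unfolding hx G'_def by (rule square_form) (use k' in auto)
  have D: "(\<integral>\<^sup>+y. \<integral>\<^sup>+x. ennreal ((h x y)\<^sup>2) \<partial>M \<partial>M) \<le> ennreal (w / v * (w * a\<^sup>2))"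
  proof -
    have "(\<integral>\<^sup>+x. ennreal ((h x y)\<^sup>2) \<partial>M) \<le> ennreal (w / v) * (\<integral>\<^sup>+z. ennreal (\<bar>k' z\<bar> * f (y + z)) \<partial>lborel)" for y
    proof -
      have "(\<integral>\<^sup>+x. ennreal ((h x y)\<^sup>2) \<partial>M) = (\<integral>\<^sup>+x. ennreal (f x) * ennreal ((h x y)\<^sup>2) \<partial>lborel)"
        unfolding M_def h_def by (subst nn_integral_density) auto
      also have "\<dots> \<le> (\<integral>\<^sup>+x. ennreal (w / v) * ennreal (\<bar>k' (x - y)\<bar> * f x) \<partial>lborel)"
      proof (rule nn_integral_mono)
        fix x
        have "(h x y)\<^sup>2 = \<bar>k' (x - y)\<bar> * \<bar>k' (x - y)\<bar>" by (simp add: h_def k'_def power2_eq_square)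
        also have "\<dots> \<le> w / v * \<bar>k' (x - y)\<bar>" using k'(1) by (intro mult_right_mono) auto
        finally have "f x * (h x y)\<^sup>2 \<le> f x * (w / v * \<bar>k' (x - y)\<bar>)" using f0 by (intro mult_left_mono)
        then show "ennreal (f x) * ennreal ((h x y)\<^sup>2) \<le> ennreal (w / v) * ennreal (\<bar>k' (x - y)\<bar> * f x)"
          using f0 K0 by (simp add: ennreal_mult'[symmetric] ennreal_leI mult_ac)
      qed
      also have "\<dots> = ennreal (w / v) * (\<integral>\<^sup>+x. ennreal (\<bar>k' (x - y)\<bar> * f x) \<partial>lborel)"
        by (rule nn_integral_cmult) measurable
      also have "(\<integral>\<^sup>+x. ennreal (\<bar>k' (x - y)\<bar> * f x) \<partial>lborel) = (\<integral>\<^sup>+z. ennreal (\<bar>k' z\<bar> * f (y + z)) \<partial>lborel)"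
        using nn_integral_lborel_shift[of "\<lambda>x. ennreal (\<bar>k' (x - y)\<bar> * f x)" y] by (simp add: add.commute)
      finally show ?thesis .
    qed
    then have "(\<integral>\<^sup>+y. \<integral>\<^sup>+x. ennreal ((h x y)\<^sup>2) \<partial>M \<partial>M)
        \<le> (\<integral>\<^sup>+y. ennreal (w / v) * (\<integral>\<^sup>+z. ennreal (\<bar>k' z\<bar> * f (y + z)) \<partial>lborel) \<partial>M)"
      by (intro nn_integral_mono)
    also have "\<dots> = ennreal (w / v) * (\<integral>\<^sup>+y. ennreal (f y) * (\<integral>\<^sup>+z. ennreal (\<bar>k' z\<bar> * f (y + z)) \<partial>lborel) \<partial>lborel)"
    proof -
      have [measurable]: "(\<lambda>y. \<integral>\<^sup>+z. ennreal (\<bar>k' z\<bar> * f (y + z)) \<partial>lborel) \<in> borel_measurable borel" by measurable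
      show ?thesis unfolding M_def by (subst nn_integral_cmult) (simp_all add: nn_integral_density)
    qed
    also have "\<dots> \<le> ennreal (w / v) * ennreal (w * a\<^sup>2)"
      unfolding a_def by (intro mult_left_mono kernel_form_bound[OF f _ k'(2)]) auto
    finally show ?thesis using K0 by (simp only: ennreal_mult')
  qed
  define \<mu> where "\<mu> = (\<integral>x. \<integral>y. h x y \<partial>M \<partial>M)"
  have \<mu>: "\<bar>\<mu> - a\<^sup>2\<bar> \<le> B * a"
  proof -
    define g where "g x = f x - G x" for x
    have [measurable]: "G \<in> borel_measurable borel" unfolding G_def by measurable
    have g2: "(\<integral>\<^sup>+x. ennreal ((g x)\<^sup>2) \<partial>lborel) \<le> ennreal (B\<^sup>2)"
      using bias B by (simp add: norm_le_2 g_def G_def)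
    have GS: "\<bar>G x\<bar> \<le> S" for x
    proof -
      have "ennreal \<bar>G x\<bar> \<le> (\<integral>\<^sup>+z. ennreal (norm (k z * f (x + z))) \<partial>lborel)"
        using integral_norm_bound_ennreal[of lborel "\<lambda>z. k z * f (x + z)"]
        by (cases "integrable lborel (\<lambda>z. k z * f (x + z))") (auto simp: not_integrable_integral_eq G_def)
      also have "\<dots> = (\<integral>\<^sup>+z. ennreal (\<bar>k z\<bar> * f (x + z)) \<partial>lborel)" using f0 by (simp add: abs_mult)
      also have "\<dots> \<le> ennreal S" unfolding S_def by (rule kernel_sup_bound[OF p F fp f0 _ k v w]) measurable
      finally show ?thesis using S0 by simp
    qed
    have if2: "integrable lborel (\<lambda>x. (f x)\<^sup>2)" by (rule integrableI_nonneg) (use a in auto)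
    have fa: "(\<integral>x. (f x)\<^sup>2 \<partial>lborel) = a\<^sup>2"
      using a by (subst integral_eq_nn_integral) auto
    have ifG: "integrable lborel (\<lambda>x. f x * G x)"
    proof (rule Bochner_Integration.integrable_bound)
      show "integrable lborel (\<lambda>x. S * f x)" using fint by simp
      show "AE x in lborel. norm (f x * G x) \<le> norm (S * f x)"
        using GS f0 S0 by (intro AE_I2) (auto simp: abs_mult mult.commute[of S] intro!: mult_left_mono)
    qed measurable
    have "\<mu> = (\<integral>x. f x * G x \<partial>lborel)"
      unfolding \<mu>_def hy unfolding M_def using f0 by (subst integral_density) auto
    then have "a\<^sup>2 - \<mu> = (\<integral>x. f x * g x \<partial>lborel)"
      using if2 ifG fa by (simp add: g_def right_diff_distrib power2_eq_square)
    then have "ennreal \<bar>\<mu> - a\<^sup>2\<bar> \<le> (\<integral>\<^sup>+x. ennreal (norm (f x * g x)) \<partial>lborel)"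
    proof -
      have "integrable lborel (\<lambda>x. f x * g x)"
        using if2 ifG by (simp add: g_def right_diff_distrib power2_eq_square)
      from integral_norm_bound_ennreal[OF this] show ?thesis
        using \<open>a\<^sup>2 - \<mu> = _\<close> by (simp add: abs_minus_commute[of \<mu>])
    qed
    \<comment> \<open>Weighting the squares of f and g by B / a and a / B makes both parts
      contribute B a / 2.\<close>
    also have "\<dots> \<le> (\<integral>\<^sup>+x. ennreal (B / (2 * a)) * ennreal ((f x)\<^sup>2) + ennreal (a / (2 * B)) * ennreal ((g x)\<^sup>2) \<partial>lborel)"
    proof (rule nn_integral_mono)
      fix x
      define c where "c = sqrt (B / a)"
      have c: "0 < c" "c\<^sup>2 = B / a" using a B by (auto simp: c_def)
      have "2 * (c * \<bar>f x\<bar>) * (\<bar>g x\<bar> / c) \<le> (c * \<bar>f x\<bar>)\<^sup>2 + (\<bar>g x\<bar> / c)\<^sup>2" by (rule sum_squares_bound)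
      then have "\<bar>f x * g x\<bar> \<le> (c * \<bar>f x\<bar>)\<^sup>2 / 2 + (\<bar>g x\<bar> / c)\<^sup>2 / 2"
        using c by (simp add: abs_mult)
      also have "(c * \<bar>f x\<bar>)\<^sup>2 / 2 = B / (2 * a) * (f x)\<^sup>2" using c by (simp add: power_mult_distrib)
      also have "(\<bar>g x\<bar> / c)\<^sup>2 / 2 = a / (2 * B) * (g x)\<^sup>2" using c a B by (simp add: power_divide mult_ac)
      finally have "\<bar>f x * g x\<bar> \<le> B / (2 * a) * (f x)\<^sup>2 + a / (2 * B) * (g x)\<^sup>2" .
      then show "ennreal (norm (f x * g x)) \<le> ennreal (B / (2 * a)) * ennreal ((f x)\<^sup>2) + ennreal (a / (2 * B)) * ennreal ((g x)\<^sup>2)"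
        using a B by (simp add: ennreal_mult'[symmetric] ennreal_plus[symmetric] ennreal_leI del: ennreal_plus)
    qed
    also have "\<dots> = ennreal (B / (2 * a)) * (\<integral>\<^sup>+x. ennreal ((f x)\<^sup>2) \<partial>lborel) + ennreal (a / (2 * B)) * (\<integral>\<^sup>+x. ennreal ((g x)\<^sup>2) \<partial>lborel)"
      unfolding g_def by (subst nn_integral_add) (auto simp: nn_integral_cmult)
    also have "\<dots> \<le> ennreal (B / (2 * a)) * ennreal (a\<^sup>2) + ennreal (a / (2 * B)) * ennreal (B\<^sup>2)"
      using a g2 by (intro add_mono mult_left_mono) auto
    also have "\<dots> = ennreal (B * a)"
      using a B by (simp add: ennreal_mult'[symmetric] ennreal_plus[symmetric] power2_eq_square del: ennreal_plus)
    finally show ?thesis using a B by (subst (asm) ennreal_le_iff) auto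
  qed
  define m1 m2 where "m1 = real (card {..<n div 2})" and "m2 = real (card {n div 2..<n})"
  have m: "0 < m1" "0 < m2" "real n / 3 \<le> m1" "real n / 2 \<le> m2"
  proof -
    \<comment> \<open>The smaller half contains at least a third of the sample, the extreme case
      being n = 3.\<close>
    have i: "n \<le> 3 * (n div 2)" "n \<le> 2 * (n - n div 2)" using n by linarith+
    have "real n \<le> 3 * m1" "real n \<le> 2 * m2"
      using i[THEN of_nat_mono[where 'a = real]] unfolding m1_def m2_def by simp_all
    then show "0 < m1" "0 < m2" "real n / 3 \<le> m1" "real n / 2 \<le> m2" using n by auto
  qed
  define U where "U X = (\<Sum>i\<in>{..<n div 2}. \<Sum>j\<in>{n div 2..<n}. h (X i) (X j)) / (m1 * m2)" for X
  have U: "pair_estimator k n X = sqrt (max 0 (U X))" for X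
    by (simp add: pair_estimator_def U_def h_def m1_def m2_def)
  have law: "sample_law n f = Pi\<^sub>M ({..<n div 2} \<union> {n div 2..<n}) (\<lambda>_. M)"
  proof -
    have "{..<n div 2} \<union> {n div 2..<n} = {..<n}" by auto
    then show ?thesis by (simp add: sample_law_def M_def)
  qed
  have var: "(\<integral>\<^sup>+X. ennreal ((U X - \<mu>)\<^sup>2) \<partial>sample_law n f)
      \<le> ennreal (2 / m1 * (S * (w * a\<^sup>2)) + 4 / (m1 * m2) * (w / v * (w * a\<^sup>2)) + 4 / m2 * (S * (w * a\<^sup>2)))"
  proof -
    have "(\<integral>\<^sup>+X. ennreal ((U X - \<mu>)\<^sup>2) \<partial>sample_law n f)
      \<le> ennreal (2 / m1) * (\<integral>\<^sup>+x. ennreal ((\<integral>y. h x y \<partial>M)\<^sup>2) \<partial>M)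
      + ennreal (4 / (m1 * m2)) * (\<integral>\<^sup>+y. \<integral>\<^sup>+x. ennreal ((h x y)\<^sup>2) \<partial>M \<partial>M)
      + ennreal (4 / m2) * (\<integral>\<^sup>+y. ennreal ((\<integral>x. h x y \<partial>M)\<^sup>2) \<partial>M)"
      unfolding law U_def m1_def m2_def \<mu>_def
    proof (rule M.two_sample_variance[where K = "w / v"])
      show "(\<lambda>(x, y). h x y) \<in> borel_measurable (M \<Otimes>\<^sub>M M)" unfolding h_def by measurable
      show "\<bar>h x y\<bar> \<le> w / v" for x y using k(1) by (simp add: h_def)
      have "0 \<in> {..<n div 2}" "n div 2 \<in> {n div 2..<n}" using n by auto
      then show "{..<n div 2} \<noteq> {}" "{n div 2..<n} \<noteq> {}" by blast+
    qed auto
    also have "\<dots> \<le> ennreal (2 / m1) * ennreal (S * (w * a\<^sup>2)) + ennreal (4 / (m1 * m2)) * ennreal (w / v * (w * a\<^sup>2))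
      + ennreal (4 / m2) * ennreal (S * (w * a\<^sup>2))"
      by (intro add_mono mult_left_mono A C D) auto
    also have "\<dots> = ennreal (2 / m1 * (S * (w * a\<^sup>2)) + 4 / (m1 * m2) * (w / v * (w * a\<^sup>2)) + 4 / m2 * (S * (w * a\<^sup>2)))"
      using m S0 w v by (simp add: ennreal_mult'[symmetric] ennreal_plus[symmetric] del: ennreal_plus)
    finally show ?thesis .
  qed
  have Umeas[measurable]: "U \<in> borel_measurable (sample_law n f)"
    unfolding law U_def[abs_def] h_def by measurable
  interpret SL: prob_space "sample_law n f" unfolding law by (intro prob_space_PiM M.prob_space_axioms)
  have "(\<integral>\<^sup>+X. ennreal ((pair_estimator k n X - L2norm f)\<^sup>2) \<partial>sample_law n f)
      \<le> (\<integral>\<^sup>+X. ennreal (2 / a\<^sup>2) * ennreal ((U X - \<mu>)\<^sup>2) + ennreal (2 * B\<^sup>2) \<partial>sample_law n f)"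
  proof (rule nn_integral_mono)
    fix X
    have "(pair_estimator k n X - L2norm f)\<^sup>2 \<le> (U X - a\<^sup>2)\<^sup>2 / a\<^sup>2"
      unfolding U a_def[symmetric] by (rule sqrt_error[OF a(2)])
    also have "\<dots> \<le> (2 * (U X - \<mu>)\<^sup>2 + 2 * (B * a)\<^sup>2) / a\<^sup>2"
    proof (intro divide_right_mono)
      have "(\<mu> - a\<^sup>2)\<^sup>2 \<le> (B * a)\<^sup>2" using power_mono[OF \<mu>, of 2] by simp
      then show "(U X - a\<^sup>2)\<^sup>2 \<le> 2 * (U X - \<mu>)\<^sup>2 + 2 * (B * a)\<^sup>2"
        using square_sum_le[of "U X - \<mu>" "\<mu> - a\<^sup>2"] by simp
    qed simp
    also have "\<dots> = 2 / a\<^sup>2 * (U X - \<mu>)\<^sup>2 + 2 * B\<^sup>2"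
      using a by (simp add: add_divide_distrib power_mult_distrib)
    finally show "ennreal ((pair_estimator k n X - L2norm f)\<^sup>2)
        \<le> ennreal (2 / a\<^sup>2) * ennreal ((U X - \<mu>)\<^sup>2) + ennreal (2 * B\<^sup>2)"
      by (simp add: ennreal_mult'[symmetric] ennreal_plus[symmetric] ennreal_leI del: ennreal_plus)
  qed
  also have "\<dots> = ennreal (2 / a\<^sup>2) * (\<integral>\<^sup>+X. ennreal ((U X - \<mu>)\<^sup>2) \<partial>sample_law n f) + ennreal (2 * B\<^sup>2)"
    by (subst nn_integral_add) (auto simp: nn_integral_cmult SL.emeasure_space_1)
  also have "\<dots> \<le> ennreal (2 / a\<^sup>2) * ennreal (2 / m1 * (S * (w * a\<^sup>2)) + 4 / (m1 * m2) * (w / v * (w * a\<^sup>2)) + 4 / m2 * (S * (w * a\<^sup>2)))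
      + ennreal (2 * B\<^sup>2)"
    by (intro add_right_mono mult_left_mono var) auto
  also have "\<dots> = ennreal (2 / a\<^sup>2 * (2 / m1 * (S * (w * a\<^sup>2)) + 4 / (m1 * m2) * (w / v * (w * a\<^sup>2)) + 4 / m2 * (S * (w * a\<^sup>2))) + 2 * B\<^sup>2)"
    using m S0 w v by (subst ennreal_mult'[symmetric]) (auto simp: ennreal_plus[symmetric] simp del: ennreal_plus)
  also have "\<dots> \<le> ennreal (2 * B\<^sup>2 + 28 * w\<^sup>2 * F * v powr (- recip p) / n + 48 * w\<^sup>2 / (v * (real n)\<^sup>2))"
  proof (rule ennreal_leI)
    have n0: "0 < real n" using n by simp
    have "2 / a\<^sup>2 * (2 / m1 * (S * (w * a\<^sup>2)) + 4 / (m1 * m2) * (w / v * (w * a\<^sup>2)) + 4 / m2 * (S * (w * a\<^sup>2)))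
        = (4 * (1 / m1) + 8 * (1 / m2)) * (S * w) + 8 * (1 / m1 * (1 / m2)) * (w * w / v)"
      using a(2) by (simp add: field_simps)
    also have "\<dots> \<le> (4 * (3 / n) + 8 * (2 / n)) * (S * w) + 8 * (3 / n * (2 / n)) * (w * w / v)"
    proof -
      have i: "1 / m1 \<le> 3 / n" "1 / m2 \<le> 2 / n" using m n0 by (auto simp: field_simps)
      show ?thesis
        using i m n0 S0 w v
        by (intro add_mono mult_right_mono mult_left_mono mult_mono) (auto intro!: mult_nonneg_nonneg)
    qed
    also have "\<dots> = 28 * w\<^sup>2 * F * v powr (- recip p) / n + 48 * w\<^sup>2 / (v * (real n)\<^sup>2)"
      by (simp add: S_def power2_eq_square field_simps)
    finally show "2 / a\<^sup>2 * (2 / m1 * (S * (w * a\<^sup>2)) + 4 / (m1 * m2) * (w / v * (w * a\<^sup>2)) + 4 / m2 * (S * (w * a\<^sup>2))) + 2 * B\<^sup>2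
        \<le> 2 * B\<^sup>2 + 28 * w\<^sup>2 * F * v powr (- recip p) / n + 48 * w\<^sup>2 / (v * (real n)\<^sup>2)" by simp
  qed
  finally show ?thesis .
qed

section \<open>Classes with an index r_j above q\<close>

lemma diff_op_power_measurable [measurable]:
  assumes [measurable]: "f \<in> borel_measurable borel"
  shows "(diff_op u j ^^ k) f \<in> borel_measurable borel"
proof (induction k)
  case (Suc k)
  note [measurable] = this
  show ?case unfolding funpow.simps comp_def diff_op_def[of u j "(diff_op u j ^^ k) f"] by measurable
qed simp

lemma norm_le_Lnorm: "f \<in> borel_measurable borel \<Longrightarrow> norm_le r f B \<longleftrightarrow> Lnorm r f \<le> ennreal B"
  by (simp add: norm_le_def)

text \<open>The order k_j in the definition of the class depends on f. The uniform comparison of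
  differences replaces it by one order m_j per coordinate and one constant A for the whole
  class.\<close>

lemma nikolskii_cross_class:
  fixes \<beta> :: "'d::finite \<Rightarrow> real" and r :: "'d \<Rightarrow> ennreal"
  assumes \<beta>: "\<And>j. 0 < \<beta> j" and r: "\<And>j. 1 \<le> r j" and L: "\<And>j. 0 < L j"
  obtains m A where "\<And>j. 0 < m j" "0 < A"
    "\<And>f j0. f \<in> nikolskii r \<beta> L \<Longrightarrow> cross_class \<beta> r (r j0) m UNIV (\<lambda>_. 0) A f"
proof -
  have "\<exists>m C. 0 < C \<and> 0 < m \<and> (\<forall>(f :: real ^ 'd \<Rightarrow> real) r j A B K u. 1 \<le> r \<longrightarrow> 0 \<le> A \<longrightarrow> 0 \<le> B \<longrightarrow> norm_le r f B \<longrightarrow>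
       (\<forall>u. norm_le r ((diff_op u j ^^ K) f) (A * \<bar>u\<bar> powr \<beta> l))
       \<longrightarrow> norm_le r ((diff_op u j ^^ m) f) (C * A * \<bar>u\<bar> powr \<beta> l))" for l
    using uniform_marchaud[OF \<beta>[of l], where ?'d = 'd] by metis
  then obtain m C where C: "\<And>l. 0 < C l" and m: "\<And>l. 0 < m l"
    and marchaud: "\<And>l (f :: real ^ 'd \<Rightarrow> real) r j A B K u. 1 \<le> r \<Longrightarrow> 0 \<le> A \<Longrightarrow> 0 \<le> B \<Longrightarrow> norm_le r f B \<Longrightarrow>
       (\<forall>u. norm_le r ((diff_op u j ^^ K) f) (A * \<bar>u\<bar> powr \<beta> l))
       \<Longrightarrow> norm_le r ((diff_op u j ^^ m l) f) (C l * A * \<bar>u\<bar> powr \<beta> l)" by metis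
  define A where "A = 1 + (\<Sum>j\<in>UNIV. L j + C j * L j)"
  have A: "L j \<le> A" "C j * L j \<le> A" for j
  proof -
    have "L j + C j * L j \<le> (\<Sum>j\<in>UNIV. L j + C j * L j)"
      using C L by (intro member_le_sum) (auto simp: less_imp_le)
    moreover have "0 \<le> L j" "0 \<le> C j * L j" using C L by (simp_all add: less_imp_le)
    ultimately show "L j \<le> A" "C j * L j \<le> A" by (auto simp: A_def)
  qed
  show thesis
  proof (rule that[of m A])
    show "0 < A" unfolding A_def using C L by (intro add_pos_nonneg sum_nonneg) (auto simp: less_imp_le)
    fix f :: "real ^ 'd \<Rightarrow> real" and j0 assume f: "f \<in> nikolskii r \<beta> L"
    then have [measurable]: "f \<in> borel_measurable borel" by (simp add: nikolskii_def)
    have fL: "norm_le (r j) f (L j)" for j using f by (simp add: nikolskii_def norm_le_Lnorm)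
    obtain k where k: "\<And>j u. Lnorm (r j) ((diff_op u j ^^ k j) f) \<le> ennreal (L j * \<bar>u\<bar> powr \<beta> j)"
      using f by (auto simp: nikolskii_def)
    have "norm_le (r j) ((diff_op u j ^^ m j) f) (C j * L j * \<bar>u\<bar> powr \<beta> j)" for j u
      by (rule marchaud[where B = "L j" and K = "k j"]) (use r L fL k in \<open>auto simp: norm_le_Lnorm less_imp_le\<close>)
    moreover have "C j * L j * \<bar>u\<bar> powr \<beta> j \<le> A * \<bar>u\<bar> powr \<beta> j" for j u
      using A by (intro mult_right_mono) auto
    ultimately have "norm_le (r j) ((diff_op u j ^^ m j) f) (A * \<bar>u\<bar> powr \<beta> j)" for j u
      by (rule norm_le_weaken)
    then show "cross_class \<beta> r (r j0) m UNIV (\<lambda>_. 0) A f"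
      unfolding cross_class_def using norm_le_weaken[OF fL A(1)] by simp
  qed (rule m)
qed

lemma epowr_half_le:
  assumes "x \<le> ennreal R" "0 \<le> R"
  shows "epowr x (1 / 2) \<le> ennreal (sqrt R)"
  using assms by (subst epowr_le_iff) auto

lemma liminf_eq_0:
  fixes X :: "nat \<Rightarrow> ennreal"
  assumes "eventually (\<lambda>n. X n \<le> ennreal (Y n)) sequentially" "Y \<longlonglongrightarrow> 0"
  shows "liminf X = 0"
proof -
  have "(\<lambda>n. ennreal (Y n)) \<longlonglongrightarrow> ennreal 0" using assms(2) by (rule tendsto_ennrealI)
  then have "liminf (\<lambda>n. ennreal (Y n)) = 0" using lim_imp_Liminf[OF trivial_limit_sequentially] by simp
  then show ?thesis using Liminf_mono[OF assms(1)] by simp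
qed

lemma rate_exp_sparse:
  assumes "((\<beta>, r), q) \<in> Theta''"
  shows "rate_exp ((\<beta>, r), q) = (1 - 2 * recip q) / (1 - 2 * recip q + (inv_omega (\<beta>, r) - inv_beta (\<beta>, r) * recip q))"
  using assms by (auto simp: Theta''_def tau_def algebra_simps)

lemma recip_2: "recip 2 = 1 / 2"
  using recip_finite[of 2] by simp

lemma Theta''_exponents:
  assumes "((\<beta>, r), q) \<in> Theta''"
  shows "\<And>j. 0 < \<beta> j" "\<And>j. 1 \<le> r j" "2 \<le> q" "0 < inv_beta (\<beta>, r)"
    "inv_beta (\<beta>, r) / 2 < inv_omega (\<beta>, r)" "1 < inv_omega (\<beta>, r) - inv_beta (\<beta>, r) * recip q"
    "recip q \<le> 1 / 2"
proof -
  show \<beta>: "0 < \<beta> j" and "1 \<le> r j" and q: "2 \<le> q" for j using assms by (auto simp: Theta''_def Theta_r_def)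
  show "0 < inv_beta (\<beta>, r)" using \<beta> by (auto intro!: sum_pos)
  show "inv_beta (\<beta>, r) / 2 < inv_omega (\<beta>, r)"
    using assms by (simp add: Theta''_def tau_def recip_2)
  show "1 < inv_omega (\<beta>, r) - inv_beta (\<beta>, r) * recip q"
    using assms by (simp add: Theta''_def tau_def)
  show "recip q \<le> 1 / 2" using recip_antimono[OF _ q] by (simp add: recip_2)
qed

text \<open>If some \<open>r j\<close> exceeds \<open>q\<close>, then the class lies in a ball of \<open>L\<^sub>p\<close> with \<open>p = r j > q\<close>, and the
  estimator built from the hyperbolic cross attains the strictly better rate that belongs to \<open>p\<close>.\<close>

lemma not_has_minimax_rate:
  fixes \<beta> :: "'d::finite \<Rightarrow> real" and r :: "'d \<Rightarrow> ennreal"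
  assumes \<theta>: "((\<beta>, r), q) \<in> Theta''" and c: "(L, Q) \<in> Theta_c" and j0: "q < r j0"
  shows "\<not> has_minimax_rate (((\<beta>, r), q), (L, Q))"
proof
  assume minimax: "has_minimax_rate (((\<beta>, r), q), (L, Q))"
  note \<beta> = Theta''_exponents(1)[OF \<theta>] and r = Theta''_exponents(2)[OF \<theta>]
  have L: "0 < L j" for j using c by (auto simp: Theta_c_def)
  define p where "p = r j0"
  have p1: "1 \<le> p" using r by (simp add: p_def)
  define a b iw ib where "a = recip p" and "b = recip q" and "iw = inv_omega (\<beta>, r)" and "ib = inv_beta (\<beta>, r)"
  have q1: "1 \<le> q" using order_trans[OF one_le_numeral Theta''_exponents(3)[OF \<theta>]] .
  have ab: "a < b" "0 \<le> a" "b \<le> 1 / 2"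
    using recip_strict_antimono[OF q1 j0] Theta''_exponents(7)[OF \<theta>] by (auto simp: a_def b_def p_def recip_nonneg)
  have ib: "0 < ib" "ib / 2 < iw" "1 < iw - ib * b"
    using Theta''_exponents(4-6)[OF \<theta>] by (auto simp: ib_def iw_def b_def)
  have "ib * a \<le> ib * b" using ab ib by (intro mult_left_mono) auto
  with ib(3) have da: "1 < iw - ib * a" by linarith
  define \<kappa> where "\<kappa> = (1 / 2 - a) / (iw - ib * a)"
  have \<kappa>0: "0 < \<kappa>" using ab da by (simp add: \<kappa>_def)
  \<comment> \<open>The weight left for L_p is nonnegative because ib / 2 < iw, which is the
    condition tau(2) < 1.\<close>
  have \<kappa>1: "\<kappa> * ib \<le> 1" using ab da ib by (simp add: \<kappa>_def field_simps)
  have \<kappa>2: "\<kappa> * iw + (1 - \<kappa> * ib) * a = 1 / 2"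
  proof -
    have "\<kappa> * (iw - ib * a) = 1 / 2 - a" using da by (simp add: \<kappa>_def)
    then show ?thesis by (simp add: algebra_simps)
  qed
  define D where "D = 1 - 2 * a + (iw - ib * a)"
  define zp where "zp = (1 - 2 * a) / D"
  define z where "z = rate_exp ((\<beta>, r), q)"
  have D: "0 < D" using ab da by (simp add: D_def)
  have z: "z = (1 - 2 * b) / (1 - 2 * b + (iw - ib * b))"
    using rate_exp_sparse[OF \<theta>] by (simp only: z_def b_def iw_def ib_def)
  have zz: "z < zp"
  proof -
    have pos: "0 < 1 - 2 * b + (iw - ib * b)" using ab ib by simp
    \<comment> \<open>After clearing denominators, the difference of the exponents has the sign of
      (b - a) (2 iw - ib), which is positive since p > q and tau(2) < 1.\<close>
    have "0 < (b - a) * (2 * iw - ib)" using ab ib by (intro mult_pos_pos) auto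
    then have "(1 - 2 * b) * D < (1 - 2 * a) * (1 - 2 * b + (iw - ib * b))"
      by (simp add: D_def algebra_simps)
    then show ?thesis using pos D by (simp add: z zp_def divide_less_eq less_divide_eq mult.commute)
  qed
  \<comment> \<open>The level J will be about x log2 n. The squared bias 2^(-2 \<kappa> J) and the
    quadratic part 2^J / n^2 of the variance then both become n^(-2 zp).\<close>
  define x where "x = 2 * (iw - ib * a) / D"
  have x0: "0 < x" using da D by (simp add: x_def)
  have x2: "x - 2 = - 2 * zp" using D by (simp add: x_def zp_def D_def field_simps)
  have x\<kappa>: "\<kappa> * x = zp" using da D by (simp add: x_def zp_def \<kappa>_def field_simps)
  \<comment> \<open>The linear part 2^(J a) / n of the variance is of no larger order because iw -
    ib a > 1, that is, tau(p) < 0.\<close>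
  have xa: "x * a - 1 \<le> - 2 * zp"
  proof -
    have "(1 - 2 * a) * (iw - ib * a - 1) \<ge> 0" using ab da by simp
    then have "2 * (iw - ib * a) * a + 2 * (1 - 2 * a) \<le> D" by (simp add: D_def algebra_simps)
    then have "(2 * (iw - ib * a) * a + 2 * (1 - 2 * a)) / D \<le> 1" using D by simp
    moreover have "(2 * (iw - ib * a) * a + 2 * (1 - 2 * a)) / D = x * a + 2 * zp"
      by (simp only: x_def zp_def add_divide_distrib times_divide_eq_left times_divide_eq_right)
    ultimately show ?thesis by linarith
  qed
  obtain m A where m: "\<And>j. 0 < m j" and A: "0 < A"
    and cross: "\<And>f j0. f \<in> nikolskii r \<beta> L \<Longrightarrow> cross_class \<beta> r (r j0) m UNIV (\<lambda>_. 0) A f"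
    by (rule nikolskii_cross_class[where \<beta> = \<beta> and r = r and L = L, OF \<beta> r L]) (rule that)
  obtain ds :: "'d list" where ds: "set ds = UNIV" "distinct ds" using finite_distinct_list[of "UNIV :: 'd set"] by auto
  define d where "d = length ds"
  have K: "\<kappa> * (\<Sum>l\<in>UNIV. 1 / \<beta> l) \<le> 1"
    "\<kappa> * (\<Sum>l\<in>UNIV. 1 / \<beta> l * recip (r l)) + (1 - \<kappa> * (\<Sum>l\<in>UNIV. 1 / \<beta> l)) * recip p = 1 / 2"
    using \<kappa>1 \<kappa>2 by (simp_all add: iw_def ib_def a_def)
  obtain C where C: "0 < C" and error: "\<And>J \<iota> A g s. \<lbrakk>cross_class \<beta> r p m (set ds) \<iota> A g; 0 < A;
      \<And>j. 0 \<le> s $ j; \<And>j. s $ j \<le> 1\<rbrakk> \<Longrightarrow>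
     norm_le 2 (\<lambda>x. g x - cross_op m ds J s g x)
       (C * (real J + 1) ^ length ds * A * 2 powr (- \<kappa> * (real J + (\<Sum>l\<in>UNIV. real (\<iota> l)))))"
    by (rule cross_op_error[where \<beta> = \<beta> and r = r and m = m, OF \<beta> r p1 less_imp_le[OF \<kappa>0] K ds(2)]) (rule that, assumption, blast)
  define W where "W = (\<Prod>j\<leftarrow>ds. 2 * (2 :: real) ^ m j)"
  define w where "w J = W * (real J + 1) ^ d" for J
  define B where "B J = C * (real J + 1) ^ d * A * 2 powr (- \<kappa> * real J)" for J
  have B0: "0 < B J" for J using C A by (simp add: B_def)
  define R where "R n J = 2 * (B J)\<^sup>2 + 28 * (w J)\<^sup>2 * A * (1 / 2 ^ J) powr (- a) / real n
      + 48 * (w J)\<^sup>2 / (1 / 2 ^ J * (real n)\<^sup>2)" for n J :: nat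
  have est: "\<exists>N\<in>estimators n. risk n N (class_F (((\<beta>, r), q), (L, Q))) \<le> ennreal (sqrt (R n J))" if n: "2 \<le> n" for n J
  proof -
    have sh: "shift_op (UNIV :: 'd set) (1 / 2 ^ J) (w J) (cross_op m ds J)"
      using shift_op_cross_op[OF ds(2) m, of J] by (simp add: ds(1) w_def W_def d_def)
    obtain k where k: "k \<in> borel_measurable borel" "\<And>z. \<bar>k z\<bar> \<le> w J / (1 / 2 ^ J)"
      "(\<integral>\<^sup>+z. ennreal \<bar>k z\<bar> \<partial>lborel) \<le> ennreal (w J)" "0 \<le> w J"
      "\<And>f x. integrable lborel f \<Longrightarrow> integrable lborel (\<lambda>s. indicator unit_cube s * cross_op m ds J s f x)"
      "\<And>f x. integrable lborel f \<Longrightarrow>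
         (\<integral>s. indicator unit_cube s * cross_op m ds J s f x \<partial>lborel) = (\<integral>z. k z * f (x + z) \<partial>lborel)"
      "\<And>f. f \<in> borel_measurable borel \<Longrightarrow> (\<lambda>(s, x). cross_op m ds J s f x) \<in> borel_measurable (borel \<Otimes>\<^sub>M borel)"
      by (rule shift_op_kernel[OF sh]) auto
    have R0: "0 \<le> R n J" unfolding R_def using A by (intro add_nonneg_nonneg divide_nonneg_nonneg mult_nonneg_nonneg) auto
    have "risk n (pair_estimator k n) (class_F (((\<beta>, r), q), (L, Q))) \<le> ennreal (sqrt (R n J))"
      unfolding risk_def
    proof (rule SUP_least)
      fix f assume f: "f \<in> class_F (((\<beta>, r), q), (L, Q)) \<inter> L2_densities"
      then have f2: "f \<in> L2_densities" and fN: "f \<in> nikolskii r \<beta> L" by auto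
      have fm: "f \<in> borel_measurable borel" and f0: "\<And>x. 0 \<le> f x" and f1: "(\<integral>\<^sup>+x. ennreal (f x) \<partial>lborel) = 1"
        using f2 by (auto simp: L2_densities_def)
      have fint: "integrable lborel f" by (rule integrableI_nonneg) (use fm f0 f1 in auto)
      have cl: "cross_class \<beta> r p m (set ds) (\<lambda>_. 0) A f" unfolding p_def ds(1) by (rule cross[OF fN])
      have bias: "norm_le 2 (\<lambda>x. f x - (\<integral>z. k z * f (x + z) \<partial>lborel)) (B J)"
      proof (rule norm_le_2_kernel_bias[where P = "cross_op m ds J" and k = k and f = f and B = "B J", OF fint less_imp_le[OF B0] k(1) k(5,6)[OF fint] k(7)[OF fm]])
        fix s :: "real ^ 'd" assume "s \<in> unit_cube"
        then have "0 \<le> s $ j" "s $ j \<le> 1" for j unfolding mem_unit_cube by auto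
        then show "norm_le 2 (\<lambda>x. f x - cross_op m ds J s f x) (B J)"
          using error[OF cl A, of s J] by (simp add: B_def d_def)
      qed
      have "(\<integral>\<^sup>+X. ennreal ((pair_estimator k n X - L2norm f)\<^sup>2) \<partial>sample_law n f) \<le> ennreal (R n J)"
        unfolding R_def a_def
        by (rule pair_estimator_risk[OF f2 p1 A _ k(1-3) _ k(4) B0 bias n])
           (use cl in \<open>auto simp: cross_class_def\<close>)
      then show "epowr (\<integral>\<^sup>+X. ennreal ((pair_estimator k n X - L2norm f)\<^sup>2) \<partial>sample_law n f) (1 / 2) \<le> ennreal (sqrt (R n J))"
        using R0 by (rule epowr_half_le)
    qed
    then show ?thesis using pair_estimator_in_estimators[OF k(1)] by blast
  qed
  define J where "J n = nat \<lfloor>x * log 2 (real n)\<rfloor>" for n :: nat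
  \<comment> \<open>Of the margin zp - z, the share 2 d \<delta> absorbs the factor (J + 1)^(2 d),
    and a further \<delta> forces the limit 0.\<close>
  define \<delta> where "\<delta> = (zp - z) / (2 * real d + 1)"
  have \<delta>: "0 < \<delta>" using zz by (simp add: \<delta>_def)
  have J: "2 ^ J n \<le> real n powr x" "2 powr (- \<kappa> * real (J n)) \<le> 2 powr \<kappa> * real n powr (- zp)"
    "real (J n) + 1 \<le> x * log 2 (real n) + 1" if n: "2 \<le> n" for n
  proof -
    have "0 \<le> log 2 (real n)" using n by simp
    then have l0: "0 \<le> x * log 2 (real n)" using x0 by simp
    then have "real (J n) = of_int \<lfloor>x * log 2 (real n)\<rfloor>" unfolding J_def by simp
    then have le: "real (J n) \<le> x * log 2 (real n)" and ge: "x * log 2 (real n) - 1 \<le> real (J n)"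
      by linarith+
    have nx: "2 powr (c * (x * log 2 (real n))) = real n powr (c * x)" for c
    proof -
      have "2 powr (c * (x * log 2 (real n))) = (2 powr (log 2 (real n))) powr (c * x)"
        by (subst powr_powr) (simp add: mult_ac)
      also have "2 powr (log 2 (real n)) = real n" using n by (intro powr_log_cancel) auto
      finally show ?thesis .
    qed
    have "(2 :: real) ^ J n = 2 powr real (J n)" by (simp add: powr_realpow)
    also have "\<dots> \<le> 2 powr (x * log 2 (real n))" using le by simp
    finally show "2 ^ J n \<le> real n powr x" using nx[of 1] by simp
    have "2 powr (- \<kappa> * real (J n)) \<le> 2 powr (\<kappa> + (- \<kappa>) * (x * log 2 (real n)))"
      using mult_left_mono[OF ge, of \<kappa>] \<kappa>0 by (simp add: algebra_simps)
    also have "\<dots> = 2 powr \<kappa> * real n powr (- zp)" by (simp only: powr_add nx) (simp add: x\<kappa>)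
    finally show "2 powr (- \<kappa> * real (J n)) \<le> 2 powr \<kappa> * real n powr (- zp)" .
    show "real (J n) + 1 \<le> x * log 2 (real n) + 1" using le by simp
  qed
  define E where "E = 2 * (C * A * 2 powr \<kappa>)\<^sup>2 + 28 * W\<^sup>2 * A + 48 * W\<^sup>2"
  have E0: "0 \<le> E" using A by (simp add: E_def)
  have Rbound: "R n (J n) \<le> E * (real (J n) + 1) ^ (2 * d) * real n powr (- 2 * zp)" if n: "2 \<le> n" for n
  proof -
    define j where "j = (real (J n) + 1) ^ d"
    define t where "t = real n powr (- 2 * zp)"
    have n0: "1 \<le> real n" "0 < real n" using n by auto
    have t: "(real n powr (- zp))\<^sup>2 = t" unfolding t_def using n0
      by (simp add: powr_powr mult.commute flip: powr_numeral)
    have "B (J n) \<le> C * j * A * (2 powr \<kappa> * real n powr (- zp))"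
      unfolding B_def j_def using C A J(2)[OF n] by (intro mult_left_mono) auto
    then have "(B (J n))\<^sup>2 \<le> (C * j * A * (2 powr \<kappa> * real n powr (- zp)))\<^sup>2"
      using B0[of "J n"] by (intro power_mono) auto
    also have "\<dots> = (C * A * 2 powr \<kappa>)\<^sup>2 * j\<^sup>2 * t" by (simp add: power_mult_distrib t mult_ac)
    finally have 1: "(B (J n))\<^sup>2 \<le> (C * A * 2 powr \<kappa>)\<^sup>2 * j\<^sup>2 * t" .
    have "(1 / 2 ^ J n) powr (- a) / real n = (2 ^ J n) powr a / real n" by (simp add: powr_divide powr_minus field_simps)
    also have "\<dots> \<le> (real n powr x) powr a / real n"
      using J(1)[OF n] ab n0 by (intro divide_right_mono powr_mono2) auto
    also have "\<dots> = real n powr (x * a - 1)" using n0 by (simp add: powr_powr powr_diff)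
    also have "\<dots> \<le> t" unfolding t_def using xa n0 by (intro powr_mono) auto
    finally have 2: "28 * (w (J n))\<^sup>2 * A * ((1 / 2 ^ J n) powr (- a) / real n) \<le> 28 * (w (J n))\<^sup>2 * A * t"
      using A by (intro mult_left_mono) auto
    have "1 / (1 / 2 ^ J n * (real n)\<^sup>2) = 2 ^ J n / (real n)\<^sup>2" by simp
    also have "\<dots> \<le> real n powr x / (real n)\<^sup>2" using J(1)[OF n] by (intro divide_right_mono) auto
    also have "\<dots> = real n powr (x - 2)" using n0 by (simp add: powr_diff)
    also have "\<dots> = t" by (simp only: t_def x2)
    finally have 3: "48 * (w (J n))\<^sup>2 * (1 / (1 / 2 ^ J n * (real n)\<^sup>2)) \<le> 48 * (w (J n))\<^sup>2 * t"
      by (intro mult_left_mono) auto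
    have "R n (J n) = 2 * (B (J n))\<^sup>2 + 28 * (w (J n))\<^sup>2 * A * ((1 / 2 ^ J n) powr (- a) / real n)
      + 48 * (w (J n))\<^sup>2 * (1 / (1 / 2 ^ J n * (real n)\<^sup>2))" by (simp add: R_def)
    also have "\<dots> \<le> 2 * ((C * A * 2 powr \<kappa>)\<^sup>2 * j\<^sup>2 * t) + 28 * (w (J n))\<^sup>2 * A * t + 48 * (w (J n))\<^sup>2 * t"
      using 1 2 3 by linarith
    also have "\<dots> = E * j\<^sup>2 * t"
    proof -
      have "w (J n) = W * j" by (simp only: w_def j_def)
      then show ?thesis by (simp add: E_def power_mult_distrib algebra_simps)
    qed
    also have "j\<^sup>2 = (real (J n) + 1) ^ (2 * d)" by (simp add: j_def mult.commute flip: power_mult)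
    finally show ?thesis by (simp add: t_def)
  qed
  have "eventually (\<lambda>n :: nat. x * log 2 (real n) + 1 \<le> real n powr \<delta>) sequentially"
    using x0 \<delta> by real_asymp
  then have "eventually (\<lambda>n. ennreal (real n powr z) * (INF N\<in>estimators n. risk n N (class_F (((\<beta>, r), q), (L, Q))))
      \<le> ennreal (sqrt E * real n powr (- \<delta> / 2))) sequentially"
    using eventually_ge_at_top[of 2]
  proof eventually_elim
    case (elim n)
    have n0: "1 \<le> real n" "0 < real n" using elim by auto
    obtain N where N: "N \<in> estimators n" "risk n N (class_F (((\<beta>, r), q), (L, Q))) \<le> ennreal (sqrt (R n (J n)))"
      using est[of n "J n"] elim by blast
    have "R n (J n) \<le> E * (real n powr \<delta>) ^ (2 * d) * real n powr (- 2 * zp)"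
      using Rbound[OF elim(2)] J(3)[OF elim(2)] elim(1) E0
      by (meson mult_left_mono mult_right_mono order_trans power_mono powr_ge_zero add_nonneg_nonneg of_nat_0_le_iff zero_le_one)
    also have "\<dots> = E * real n powr (\<delta> * real (2 * d) - 2 * zp)"
      using n0 by (simp add: powr_realpow[symmetric] powr_powr powr_add[symmetric])
    also have "\<delta> * real (2 * d) - 2 * zp = - \<delta> - (zp + z)"
    proof -
      have "\<delta> * (2 * real d + 1) = zp - z" by (simp add: \<delta>_def)
      then show ?thesis by (simp add: algebra_simps)
    qed
    also have "E * real n powr (- \<delta> - (zp + z)) \<le> E * real n powr (- \<delta> - 2 * z)"
      using zz n0 E0 by (intro mult_left_mono powr_mono) auto
    finally have "sqrt (R n (J n)) \<le> sqrt (E * real n powr (- \<delta> - 2 * z))" by simp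
    also have "\<dots> = sqrt E * real n powr ((- \<delta> - 2 * z) / 2)"
      using n0 by (simp add: real_sqrt_mult powr_half_sqrt[symmetric] powr_powr)
    finally have s: "real n powr z * sqrt (R n (J n)) \<le> real n powr z * (sqrt E * real n powr ((- \<delta> - 2 * z) / 2))"
      by (intro mult_left_mono) auto
    have "real n powr z * (sqrt E * real n powr ((- \<delta> - 2 * z) / 2)) = sqrt E * real n powr (z + (- \<delta> - 2 * z) / 2)"
      using n0 by (simp add: powr_add)
    also have "z + (- \<delta> - 2 * z) / 2 = - \<delta> / 2" by (simp add: field_simps)
    finally have s': "real n powr z * sqrt (R n (J n)) \<le> sqrt E * real n powr (- \<delta> / 2)" using s by (simp only:)
    have "ennreal (real n powr z) * (INF N\<in>estimators n. risk n N (class_F (((\<beta>, r), q), (L, Q))))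
        \<le> ennreal (real n powr z) * ennreal (sqrt (R n (J n)))"
      using N by (intro mult_left_mono INF_lower2[of N]) auto
    also have "\<dots> = ennreal (real n powr z * sqrt (R n (J n)))" by (simp add: ennreal_mult')
    also have "\<dots> \<le> ennreal (sqrt E * real n powr (- \<delta> / 2))" using s' by (rule ennreal_leI)
    finally show ?case .
  qed
  moreover have "(\<lambda>n :: nat. sqrt E * real n powr (- \<delta> / 2)) \<longlonglongrightarrow> 0"
    using \<delta> by real_asymp
  ultimately have "liminf (\<lambda>n. ennreal (real n powr z) * (INF N\<in>estimators n. risk n N (class_F (((\<beta>, r), q), (L, Q))))) = 0"
    by (rule liminf_eq_0)
  then show False using minimax by (simp add: has_minimax_rate_def z_def)
qed

subsection \<open>Lower bounds by mixtures\<close>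

text \<open>This makes the law of a sample from a perturbed density absolutely continuous with
  respect to the null law, the likelihood ratio being the product over the observations.\<close>

lemma PiM_density:
  fixes \<l> :: "'a \<Rightarrow> ennreal"
  assumes M: "prob_space M" and I: "finite I" and [measurable]: "\<l> \<in> borel_measurable M" and N: "prob_space (density M \<l>)"
  shows "Pi\<^sub>M I (\<lambda>_. density M \<l>) = density (Pi\<^sub>M I (\<lambda>_. M)) (\<lambda>X. \<Prod>i\<in>I. \<l> (X i))"
proof -
  interpret M: prob_space M by fact
  interpret N: prob_space "density M \<l>" by fact
  interpret PM: product_sigma_finite "\<lambda>_. M" by unfold_locales
  interpret PN: product_sigma_finite "\<lambda>_. density M \<l>" by unfold_locales
  show ?thesis
  proof (rule PN.PiM_eqI[OF I, symmetric])
    show "sets (density (Pi\<^sub>M I (\<lambda>_. M)) (\<lambda>X. \<Prod>i\<in>I. \<l> (X i))) = sets (Pi\<^sub>M I (\<lambda>_. density M \<l>))"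
      by (simp cong: sets_PiM_cong)
    fix A assume A: "\<And>i. i \<in> I \<Longrightarrow> A i \<in> sets (density M \<l>)"
    then have A': "\<And>i. i \<in> I \<Longrightarrow> A i \<in> sets M" by simp
    have "emeasure (density (Pi\<^sub>M I (\<lambda>_. M)) (\<lambda>X. \<Prod>i\<in>I. \<l> (X i))) (Pi\<^sub>E I A)
        = (\<integral>\<^sup>+X. (\<Prod>i\<in>I. \<l> (X i)) * indicator (Pi\<^sub>E I A) X \<partial>Pi\<^sub>M I (\<lambda>_. M))"
      using A' I by (intro emeasure_density) (auto intro!: sets_PiM_I_finite)
    also have "\<dots> = (\<integral>\<^sup>+X. (\<Prod>i\<in>I. \<l> (X i) * indicator (A i) (X i)) \<partial>Pi\<^sub>M I (\<lambda>_. M))"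
    proof (rule nn_integral_cong)
      fix X assume X: "X \<in> space (Pi\<^sub>M I (\<lambda>_. M))"
      have "indicator (Pi\<^sub>E I A) X = (\<Prod>i\<in>I. indicator (A i) (X i) :: ennreal)"
      proof (cases "X \<in> Pi\<^sub>E I A")
        case False
        then obtain i where "i \<in> I" "X i \<notin> A i" using X by (auto simp: space_PiM PiE_def)
        then have "(\<Prod>i\<in>I. indicator (A i) (X i) :: ennreal) = 0" using I by (intro prod_zero) (auto intro!: bexI[of _ i])
        then show ?thesis using False by simp
      next
        case True
        then have "(\<Prod>i\<in>I. indicator (A i) (X i) :: ennreal) = 1" by (intro prod.neutral) (auto simp: PiE_iff)
        then show ?thesis using True by simp
      qed
      then show "(\<Prod>i\<in>I. \<l> (X i)) * indicator (Pi\<^sub>E I A) X = (\<Prod>i\<in>I. \<l> (X i) * indicator (A i) (X i))"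
        by (simp add: prod.distrib)
    qed
    also have "\<dots> = (\<Prod>i\<in>I. \<integral>\<^sup>+x. \<l> x * indicator (A i) x \<partial>M)"
      using I A' by (intro PM.product_nn_integral_prod) auto
    also have "\<dots> = (\<Prod>i\<in>I. emeasure (density M \<l>) (A i))"
      using A' by (intro prod.cong) (auto simp: emeasure_density)
    finally show "emeasure (density (Pi\<^sub>M I (\<lambda>_. M)) (\<lambda>X. \<Prod>i\<in>I. \<l> (X i))) (Pi\<^sub>E I A) = (\<Prod>i\<in>I. emeasure (density M \<l>) (A i))" .
  qed
qed

text \<open>The sharp exponent is x^2 / 2; the constant is immaterial for the lower bound, and x^2
  follows from elementary bounds on exp.\<close>

lemma cosh_le_exp_square: "(exp (x :: real) + exp (- x)) / 2 \<le> exp (x\<^sup>2)"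
proof -
  have *: "(exp x + exp (- x)) / 2 \<le> exp (x\<^sup>2)" if x: "0 \<le> x" for x :: real
  proof (cases "x \<le> 1")
    case True
    have 1: "exp x \<le> 1 + x + x\<^sup>2" by (rule exp_bound[OF x True])
    have "1 / exp x \<le> 1 / (1 + x)" using x exp_ge_add_one_self[of x] by (intro divide_left_mono) auto
    also have "\<dots> \<le> 1 - x + x\<^sup>2"
    proof -
      have "(1 - x + x\<^sup>2) * (1 + x) = 1 + x ^ 3" by (simp add: algebra_simps power2_eq_square power3_eq_cube)
      then have "1 \<le> (1 - x + x\<^sup>2) * (1 + x)" using x by simp
      then show ?thesis using x by (simp add: divide_le_eq)
    qed
    finally have "exp (- x) \<le> 1 - x + x\<^sup>2" by (simp add: exp_minus inverse_eq_divide)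
    then have "(exp x + exp (- x)) / 2 \<le> 1 + x\<^sup>2" using 1 by simp
    also have "\<dots> \<le> exp (x\<^sup>2)" by (rule exp_ge_add_one_self)
    finally show ?thesis .
  next
    case False
    then have "1 * x \<le> x\<^sup>2" unfolding power2_eq_square by (intro mult_right_mono) auto
    then have "exp x \<le> exp (x\<^sup>2)" "exp (- x) \<le> exp (x\<^sup>2)" using False by auto
    then have "exp x + exp (- x) \<le> exp (x\<^sup>2) + exp (x\<^sup>2)" by (rule add_mono)
    then show ?thesis by (subst pos_divide_le_eq) simp_all
  qed
  show ?thesis using *[of x] *[of "- x"] by (cases "0 \<le> x") (auto simp: add.commute)
qed

text \<open>For fixed w the products w_i w'_i run through all sign vectors again, so the inner sum
  factorises into terms 2 cosh c.\<close>

lemma sum_exp_signs: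
  assumes I: "finite (I :: 'i set)"
  shows "(\<Sum>w\<in>I \<rightarrow>\<^sub>E {1, - 1 :: real}. \<Sum>w'\<in>I \<rightarrow>\<^sub>E {1, - 1}. exp (c * (\<Sum>i\<in>I. w i * w' i)))
    \<le> (real (card (I \<rightarrow>\<^sub>E {1, - 1 :: real})))\<^sup>2 * exp (real (card I) * c\<^sup>2)"
proof -
  define S where "S = I \<rightarrow>\<^sub>E {1, - 1 :: real}"
  have card_S: "real (card S) = 2 ^ card I" using I by (simp add: S_def card_PiE)
  have inner: "(\<Sum>w'\<in>S. exp (c * (\<Sum>i\<in>I. w i * w' i))) \<le> real (card S) * exp (real (card I) * c\<^sup>2)" if w: "w \<in> S" for w
  proof -
    have "(\<Sum>w'\<in>S. exp (c * (\<Sum>i\<in>I. w i * w' i))) = (\<Sum>w'\<in>S. \<Prod>i\<in>I. exp (c * (w i * w' i)))"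
      using I by (simp add: exp_sum sum_distrib_left)
    also have "\<dots> = (\<Prod>i\<in>I. \<Sum>s\<in>{1, - 1}. exp (c * (w i * s)))"
      unfolding S_def using I by (subst prod_sum_PiE) auto
    also have "\<dots> \<le> (\<Prod>i\<in>I. 2 * exp (c\<^sup>2))"
    proof (rule prod_mono)
      fix i assume "i \<in> I"
      then have "w i = 1 \<or> w i = - 1" using w by (auto simp: S_def PiE_iff)
      then show "0 \<le> (\<Sum>s\<in>{1, - 1}. exp (c * (w i * s))) \<and> (\<Sum>s\<in>{1, - 1}. exp (c * (w i * s))) \<le> 2 * exp (c\<^sup>2)"
        using cosh_le_exp_square[of c] by auto
    qed
    also have "\<dots> = real (card S) * exp (real (card I) * c\<^sup>2)"
      by (simp add: card_S power_mult_distrib exp_of_nat_mult[symmetric])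
    finally show ?thesis .
  qed
  have "(\<Sum>w\<in>S. \<Sum>w'\<in>S. exp (c * (\<Sum>i\<in>I. w i * w' i))) \<le> (\<Sum>w\<in>S. real (card S) * exp (real (card I) * c\<^sup>2))"
    by (rule sum_mono) (rule inner)
  then show ?thesis by (simp add: S_def power2_eq_square mult.assoc)
qed

text \<open>Here x is the value of the estimator and l the likelihood ratio of the mixture. An x
  left of the midpoint is far from b; an x right of it is far from a, and there l is replaced by K +
  l^2 / (2 K). If l has mean 1 and second moment at most K, integration leaves B (b - a)^2 / 4 on
  the left and at most half of it in the last term. Since A exceeds B by the factor K, no bound on K
  itself is required.\<close>

lemma two_point_inequality:
  fixes x a b :: real
  assumes "a < b" "0 < K" "0 \<le> B" "B * K \<le> A" "0 \<le> l"
  shows "B * (b - a)\<^sup>2 / 4 * l \<le> A * (x - a)\<^sup>2 + B * (l * (x - b)\<^sup>2) + B * (b - a)\<^sup>2 / (8 * K) * l\<^sup>2"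
proof -
  define D where "D = (b - a)\<^sup>2 / 4"
  have D: "0 \<le> D" "D = ((b - a) / 2)\<^sup>2" by (simp_all add: D_def power_divide)
  have "0 \<le> B * K" using assms by simp
  then have "0 \<le> A" using assms(4) by linarith
  have "B * D * l \<le> A * (x - a)\<^sup>2 + B * (l * (x - b)\<^sup>2) + B * D / (2 * K) * l\<^sup>2"
  proof (cases "x \<le> (a + b) / 2")
    case True
    have "(b - a) / 2 \<le> \<bar>x - b\<bar>" using True assms(1) by (simp add: field_simps)
    then have "D \<le> (x - b)\<^sup>2" unfolding D(2) using assms(1) by (intro abs_le_square_iff[THEN iffD1]) auto
    then have "B * l * D \<le> B * l * (x - b)\<^sup>2" using assms by (intro mult_left_mono) auto
    moreover have "0 \<le> B * D / (2 * K) * l\<^sup>2" using assms D by auto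
    moreover have "0 \<le> A * (x - a)\<^sup>2" using \<open>0 \<le> A\<close> by simp
    ultimately show ?thesis by (simp add: mult_ac)
  next
    case False
    have "(b - a) / 2 \<le> x - a" using False by (simp add: field_simps)
    then have "(b - a) / 2 \<le> \<bar>x - a\<bar>" by linarith
    then have "D \<le> (x - a)\<^sup>2" unfolding D(2) using assms(1) by (intro abs_le_square_iff[THEN iffD1]) auto
    then have "B * K * D \<le> A * (x - a)\<^sup>2" using assms D by (intro mult_mono) (use \<open>0 \<le> A\<close> in auto)
    moreover have "B * D * l \<le> B * D * (K + l\<^sup>2 / (2 * K))"
    proof (intro mult_left_mono)
      have "0 \<le> (K - l)\<^sup>2 + K\<^sup>2" by simp
      then have "2 * K * l \<le> 2 * K * K + l\<^sup>2" by (simp add: power2_eq_square algebra_simps)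
      then show "l \<le> K + l\<^sup>2 / (2 * K)" using assms by (simp add: field_simps power2_eq_square)
    qed (use assms D in auto)
    moreover have "0 \<le> B * (l * (x - b)\<^sup>2)" using assms by simp
    ultimately show ?thesis by (simp add: algebra_simps)
  qed
  then show ?thesis by (simp add: D_def)
qed

lemma epowr_half_square: "(epowr x (1 / 2))\<^sup>2 = x"
  by (cases x) (auto simp: epowr_def powr_half_sqrt ennreal_mult'[symmetric] ennreal_top_mult power2_eq_square)

lemma risk_square_ge:
  assumes "f \<in> F" "f \<in> L2_densities"
  shows "(\<integral>\<^sup>+X. ennreal ((N X - L2norm f)\<^sup>2) \<partial>sample_law n f) \<le> (risk n N F)\<^sup>2"
proof -
  have "epowr (\<integral>\<^sup>+X. ennreal ((N X - L2norm f)\<^sup>2) \<partial>sample_law n f) (1 / 2) \<le> risk n N F"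
    unfolding risk_def by (rule SUP_upper) (use assms in auto)
  then have "(epowr (\<integral>\<^sup>+X. ennreal ((N X - L2norm f)\<^sup>2) \<partial>sample_law n f) (1 / 2))\<^sup>2 \<le> (risk n N F)\<^sup>2"
    by (intro power_mono) auto
  then show ?thesis by (simp only: epowr_half_square)
qed

text \<open>The least favourable prior puts independent uniform signs \<open>w\<close> on disjoint bumps \<open>G i\<close>, each
  supported where the null density \<open>f0\<close> equals the constant \<open>h\<close>.\<close>

lemma mixture_lower_bound:
  fixes f0 :: "real ^ 'd \<Rightarrow> real" and G :: "'i \<Rightarrow> real ^ 'd \<Rightarrow> real" and I :: "'i set"
  assumes I: "finite I" and h: "0 < h"
    and f0: "f0 \<in> L2_densities" "f0 \<in> F'" "L2norm f0 = a"
    and G[measurable]: "\<And>i. i \<in> I \<Longrightarrow> G i \<in> borel_measurable borel"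
    and Gh: "\<And>i x. i \<in> I \<Longrightarrow> \<bar>G i x\<bar> \<le> h"
    and Gf: "\<And>i x. i \<in> I \<Longrightarrow> G i x \<noteq> 0 \<Longrightarrow> f0 x = h"
    and disj: "\<And>i j x. i \<in> I \<Longrightarrow> j \<in> I \<Longrightarrow> i \<noteq> j \<Longrightarrow> G i x * G j x = 0"
    and G1: "\<And>i. i \<in> I \<Longrightarrow> (\<integral>x. G i x \<partial>lborel) = 0"
    and G2: "\<And>i. i \<in> I \<Longrightarrow> (\<integral>x. (G i x)\<^sup>2 \<partial>lborel) = W"
    and fw: "\<And>w. w \<in> I \<rightarrow>\<^sub>E {1, - 1} \<Longrightarrow> (\<lambda>x. f0 x + (\<Sum>i\<in>I. w i * G i x)) \<in> L2_densities"
      "\<And>w. w \<in> I \<rightarrow>\<^sub>E {1, - 1} \<Longrightarrow> (\<lambda>x. f0 x + (\<Sum>i\<in>I. w i * G i x)) \<in> F"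
      "\<And>w. w \<in> I \<rightarrow>\<^sub>E {1, - 1} \<Longrightarrow> L2norm (\<lambda>x. f0 x + (\<Sum>i\<in>I. w i * G i x)) = b"
    and ab: "a < b" and B: "0 \<le> B" and AB: "B * exp (real (card I) * (real n * (W / h))\<^sup>2) \<le> A"
    and N: "N \<in> estimators n"
  shows "ennreal (B * (b - a)\<^sup>2 / 8) \<le> ennreal A * (risk n N F')\<^sup>2 + ennreal B * (risk n N F)\<^sup>2"
proof -
  define S where "S = I \<rightarrow>\<^sub>E {1, - 1 :: real}"
  have fin_S: "finite S" using I by (simp add: S_def finite_PiE)
  have card_S: "0 < real (card S)" using I by (simp add: S_def card_PiE)
  have f0m[measurable]: "f0 \<in> borel_measurable borel" and f0p: "\<And>x. 0 \<le> f0 x"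
    and f01: "(\<integral>\<^sup>+x. ennreal (f0 x) \<partial>lborel) = 1"
    using f0 by (auto simp: L2_densities_def)
  define M where "M = density lborel (\<lambda>x. ennreal (f0 x))"
  interpret M: prob_space M by (rule prob_spaceI) (simp add: M_def emeasure_density f01)
  have sets_M[measurable_cong]: "sets M = sets borel" by (simp add: M_def)
  interpret PM: product_sigma_finite "\<lambda>_ :: nat. M" by unfold_locales
  define P0 where "P0 = Pi\<^sub>M {..<n} (\<lambda>_. M)"
  have P0: "sample_law n f0 = P0" by (simp add: sample_law_def P0_def M_def)
  interpret P0: prob_space P0 unfolding P0_def by (intro prob_space_PiM M.prob_space_axioms)
  have sets_P0[measurable_cong]: "sets P0 = sets (Pi\<^sub>M {..<n} (\<lambda>_. borel))"
    unfolding P0_def by (intro sets_PiM_cong) (simp_all add: sets_M)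
  have Nm[measurable]: "N \<in> borel_measurable P0"
    using N unfolding estimators_def by (simp cong: measurable_cong_sets add: sets_P0)
  \<comment> \<open>The likelihood ratio of one observation: f0 equals h wherever a bump is nonzero,
    so division by the constant h is enough.\<close>
  define l where "l w x = 1 + (\<Sum>i\<in>I. w i * G i x) / h" for w x
  have lm[measurable]: "l w \<in> borel_measurable borel" for w
    unfolding l_def[abs_def] by measurable
  have single: "(\<Sum>i\<in>I. w i * G i x) = 0 \<or> (\<exists>i\<in>I. (\<Sum>i\<in>I. w i * G i x) = w i * G i x \<and> f0 x = h)" for w x
  proof (cases "\<exists>i\<in>I. G i x \<noteq> 0")
    case True
    then obtain i where i: "i \<in> I" "G i x \<noteq> 0" by blast
    have "(\<Sum>i\<in>I. w i * G i x) = w i * G i x + (\<Sum>j\<in>I - {i}. w j * G j x)" by (rule sum.remove[OF I i(1)])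
    also have "(\<Sum>j\<in>I - {i}. w j * G j x) = 0"
      by (rule sum.neutral) (use disj[OF i(1)] i in force)
    finally show ?thesis using i Gf by auto
  qed auto
  have sgn: "\<bar>w i\<bar> = 1" if "w \<in> S" "i \<in> I" for w i
    using that by (fastforce simp: S_def PiE_iff)
  have fl: "f0 x * l w x = f0 x + (\<Sum>i\<in>I. w i * G i x)" for w x
    using single[of w x] h by (auto simp: l_def distrib_left)
  have l0: "0 \<le> l w x" if "w \<in> S" for w x
    using single[of w x]
  proof (elim disjE bexE conjE)
    fix i assume i: "i \<in> I" "(\<Sum>i\<in>I. w i * G i x) = w i * G i x"
    have "\<bar>w i * G i x\<bar> \<le> h" using sgn[OF that i(1)] Gh[OF i(1)] by (simp add: abs_mult)
    then show ?thesis using h by (simp add: l_def i(2) field_simps)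
  qed (simp add: l_def)
  have f0int: "integrable lborel f0" by (rule integrableI_nonneg) (use f0p f01 in auto)
  have Gint: "integrable lborel (G i)" "integrable lborel (\<lambda>x. (G i x)\<^sup>2)" if "i \<in> I" for i
  proof -
    show "integrable lborel (G i)"
    proof (rule Bochner_Integration.integrable_bound[OF f0int])
      show "AE x in lborel. norm (G i x) \<le> norm (f0 x)"
        using Gh[OF that] Gf[OF that] f0p by (intro AE_I2) (metis abs_of_nonneg norm_zero real_norm_def abs_ge_zero)
    qed (use that in simp)
    show "integrable lborel (\<lambda>x. (G i x)\<^sup>2)"
    proof (rule Bochner_Integration.integrable_bound)
      show "integrable lborel (\<lambda>x. h * f0 x)" using f0int by simp
      show "AE x in lborel. norm ((G i x)\<^sup>2) \<le> norm (h * f0 x)"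
      proof (rule AE_I2)
        fix x
        show "norm ((G i x)\<^sup>2) \<le> norm (h * f0 x)"
        proof (cases "G i x = 0")
          case False
          have "\<bar>G i x\<bar>\<^sup>2 \<le> h\<^sup>2" using Gh[OF that] by (intro power_mono) auto
          then show ?thesis using Gf[OF that False] by (simp add: power2_eq_square)
        qed simp
      qed
    qed (use that in measurable)
  qed
  define dens where "dens w = density M (\<lambda>x. ennreal (l w x))" for w
  have dens: "dens w = density lborel (\<lambda>x. ennreal (f0 x + (\<Sum>i\<in>I. w i * G i x)))" if "w \<in> S" for w
    unfolding dens_def M_def using f0p l0[OF that]
    by (subst density_density_eq) (auto simp: fl[symmetric] ennreal_mult')
  have dens_prob: "prob_space (dens w)" if "w \<in> S" for w
  proof (rule prob_spaceI)
    have "(\<integral>\<^sup>+x. ennreal (f0 x + (\<Sum>i\<in>I. w i * G i x)) \<partial>lborel) = 1"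
      using fw(1)[of w] that by (simp add: L2_densities_def S_def)
    then show "emeasure (dens w) (space (dens w)) = 1"
      unfolding dens[OF that] by (simp add: emeasure_density)
  qed
  define Lw where "Lw w X = (\<Prod>i\<in>{..<n}. l w (X i))" for w X
  have Lw0: "0 \<le> Lw w X" if "w \<in> S" for w X using l0[OF that] by (auto simp: Lw_def intro: prod_nonneg)
  have Lwm[measurable]: "Lw w \<in> borel_measurable P0" for w
    unfolding Lw_def[abs_def] by measurable
  have law: "sample_law n (\<lambda>x. f0 x + (\<Sum>i\<in>I. w i * G i x)) = density P0 (\<lambda>X. ennreal (Lw w X))" if "w \<in> S" for w
  proof -
    have "sample_law n (\<lambda>x. f0 x + (\<Sum>i\<in>I. w i * G i x)) = Pi\<^sub>M {..<n} (\<lambda>_. dens w)"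
      by (simp add: sample_law_def dens[OF that])
    also have "\<dots> = density P0 (\<lambda>X. \<Prod>i\<in>{..<n}. ennreal (l w (X i)))"
      unfolding P0_def dens_def by (rule PiM_density) (use dens_prob[OF that] in \<open>auto simp: dens_def M.prob_space_axioms\<close>)
    finally show ?thesis using l0[OF that] by (simp add: Lw_def prod_ennreal)
  qed
  define Lbar where "Lbar X = (\<Sum>w\<in>S. Lw w X) / real (card S)" for X
  have Lbar0: "0 \<le> Lbar X" for X using Lw0 by (auto simp: Lbar_def intro!: divide_nonneg_nonneg sum_nonneg)
  have Lbarm[measurable]: "Lbar \<in> borel_measurable P0" unfolding Lbar_def[abs_def] by measurable
  have Lbar_integral: "(\<integral>\<^sup>+X. ennreal (Lbar X) * g X \<partial>P0)
      = ennreal (1 / card S) * (\<Sum>w\<in>S. \<integral>\<^sup>+X. ennreal (Lw w X) * g X \<partial>P0)"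
    if [measurable]: "g \<in> borel_measurable P0" for g
  proof -
    have "ennreal (Lbar X) * g X = ennreal (1 / card S) * (\<Sum>w\<in>S. ennreal (Lw w X) * g X)" for X
    proof -
      have "ennreal (Lbar X) = ennreal (1 / card S) * (\<Sum>w\<in>S. ennreal (Lw w X))"
        using Lw0 by (simp add: Lbar_def sum_ennreal ennreal_mult''[symmetric] sum_nonneg)
      then show ?thesis by (simp add: sum_distrib_right mult.assoc)
    qed
    then show ?thesis by (simp add: nn_integral_cmult nn_integral_sum)
  qed
  have L1: "(\<integral>\<^sup>+X. ennreal (Lw w X) \<partial>P0) = 1" if "w \<in> S" for w
  proof -
    interpret D: prob_space "dens w" by (rule dens_prob[OF that])
    interpret Q: prob_space "sample_law n (\<lambda>x. f0 x + (\<Sum>i\<in>I. w i * G i x))"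
      unfolding sample_law_def dens[OF that, symmetric] by (intro prob_space_PiM D.prob_space_axioms)
    show ?thesis using Q.emeasure_space_1 by (simp add: law[OF that] emeasure_density)
  qed
  have mean: "(\<integral>\<^sup>+X. ennreal (Lbar X) \<partial>P0) = 1"
    using Lbar_integral[of "\<lambda>_. 1"] L1 card_S by (simp add: ennreal_of_nat_eq_real_of_nat ennreal_mult'[symmetric])
  define v where "v = W / h"
  have pair: "(\<integral>\<^sup>+X. ennreal (Lw w X) * ennreal (Lw w' X) \<partial>P0) \<le> ennreal (exp (real n * v * (\<Sum>i\<in>I. w i * w' i)))"
    if w: "w \<in> S" "w' \<in> S" for w w'
  proof -
    have "(\<integral>\<^sup>+x. ennreal (l w x * l w' x) \<partial>M) = (\<integral>\<^sup>+x. ennreal (f0 x * (l w x * l w' x)) \<partial>lborel)"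
      unfolding M_def using f0p l0 w by (subst nn_integral_density) (auto simp: ennreal_mult')
    also have "\<dots> = ennreal (\<integral>x. f0 x + (\<Sum>i\<in>I. w i * G i x) + (\<Sum>i\<in>I. w' i * G i x) + (\<Sum>i\<in>I. w i * w' i * (G i x)\<^sup>2) / h \<partial>lborel)"
    proof -
      \<comment> \<open>Disjoint supports leave only the diagonal products. The linear terms
        integrate to 0 by \<open>G1\<close>, and each square contributes W.\<close>
      have eq: "f0 x * (l w x * l w' x) = f0 x + (\<Sum>i\<in>I. w i * G i x) + (\<Sum>i\<in>I. w' i * G i x) + (\<Sum>i\<in>I. w i * w' i * (G i x)\<^sup>2) / h" for x
      proof (cases "\<exists>i\<in>I. G i x \<noteq> 0")
        case True
        then obtain i where i: "i \<in> I" "G i x \<noteq> 0" by blast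
        have s: "(\<Sum>k\<in>I. c k * e k) = c i * e i" if "\<And>k. k \<in> I - {i} \<Longrightarrow> e k = 0" for c e :: "'i \<Rightarrow> real"
          using that by (subst sum.remove[OF I i(1)]) auto
        have z: "G k x = 0" if "k \<in> I - {i}" for k using disj[OF i(1), of k x] i that by auto
        have "(\<Sum>i\<in>I. w i * G i x) = w i * G i x" "(\<Sum>i\<in>I. w' i * G i x) = w' i * G i x"
          "(\<Sum>i\<in>I. w i * w' i * (G i x)\<^sup>2) = w i * w' i * (G i x)\<^sup>2"
          by (rule s; use z in simp)+
        then show ?thesis using Gf[OF i] h by (simp add: l_def field_simps power2_eq_square)
      qed (simp add: l_def)
      show ?thesis unfolding eq[symmetric]
      proof (rule nn_integral_eq_integral)
        show "integrable lborel (\<lambda>x. f0 x * (l w x * l w' x))" unfolding eq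
          by (intro Bochner_Integration.integrable_add integrable_divide_zero Bochner_Integration.integrable_sum
              integrable_mult_right f0int Gint)
      qed (use f0p l0 w in auto)
    qed
    also have "(\<integral>x. f0 x + (\<Sum>i\<in>I. w i * G i x) + (\<Sum>i\<in>I. w' i * G i x) + (\<Sum>i\<in>I. w i * w' i * (G i x)\<^sup>2) / h \<partial>lborel)
        = 1 + v * (\<Sum>i\<in>I. w i * w' i)"
    proof -
      have f0i: "(\<integral>x. f0 x \<partial>lborel) = 1" using f01 f0p by (subst integral_eq_nn_integral) auto
      have "(\<integral>x. f0 x + (\<Sum>i\<in>I. w i * G i x) + (\<Sum>i\<in>I. w' i * G i x) + (\<Sum>i\<in>I. w i * w' i * (G i x)\<^sup>2) / h \<partial>lborel)
        = (\<integral>x. f0 x \<partial>lborel) + (\<Sum>i\<in>I. w i * (\<integral>x. G i x \<partial>lborel)) + (\<Sum>i\<in>I. w' i * (\<integral>x. G i x \<partial>lborel))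
          + (\<Sum>i\<in>I. w i * w' i * (\<integral>x. (G i x)\<^sup>2 \<partial>lborel)) / h"
        using f0int Gint by simp
      also have "\<dots> = 1 + (\<Sum>i\<in>I. w i * w' i * W) / h" using f0i G1 G2 by simp
      finally show ?thesis by (simp add: v_def sum_distrib_right[symmetric])
    qed
    finally have one: "(\<integral>\<^sup>+x. ennreal (l w x * l w' x) \<partial>M) = ennreal (1 + v * (\<Sum>i\<in>I. w i * w' i))" .
    have "(\<integral>\<^sup>+X. ennreal (Lw w X) * ennreal (Lw w' X) \<partial>P0) = (\<integral>\<^sup>+X. (\<Prod>i\<in>{..<n}. ennreal (l w (X i) * l w' (X i))) \<partial>P0)"
      using l0[OF w(1)] l0[OF w(2)]
      by (intro nn_integral_cong) (simp add: Lw_def prod_ennreal ennreal_mult''[symmetric] prod_nonneg prod.distrib)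
    also have "\<dots> = (\<Prod>i\<in>{..<n}. \<integral>\<^sup>+x. ennreal (l w x * l w' x) \<partial>M)"
      unfolding P0_def by (rule PM.product_nn_integral_prod) auto
    also have "\<dots> = ennreal (1 + v * (\<Sum>i\<in>I. w i * w' i)) ^ n" by (simp add: one)
    \<comment> \<open>By 1 + x <= exp x, the n-th power becomes an exponential of the correlation of
      the two sign vectors, which \<open>sum_exp_signs\<close> averages.\<close>
    also have "\<dots> \<le> ennreal (exp (v * (\<Sum>i\<in>I. w i * w' i))) ^ n"
      by (intro power_mono ennreal_leI exp_ge_add_one_self) auto
    also have "\<dots> = ennreal (exp (real n * v * (\<Sum>i\<in>I. w i * w' i)))"
      by (simp add: ennreal_power exp_of_nat_mult[symmetric] mult.assoc)
    finally show ?thesis .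
  qed
  define K where "K = exp (real (card I) * (real n * v)\<^sup>2)"
  have K: "0 < K" by (simp add: K_def)
  have second: "(\<integral>\<^sup>+X. ennreal ((Lbar X)\<^sup>2) \<partial>P0) \<le> ennreal K"
  proof -
    have "(\<integral>\<^sup>+X. ennreal ((Lbar X)\<^sup>2) \<partial>P0) = (\<integral>\<^sup>+X. ennreal (Lbar X) * ennreal (Lbar X) \<partial>P0)"
      using Lbar0 by (simp add: power2_eq_square ennreal_mult')
    also have "\<dots> = ennreal (1 / card S) * (\<Sum>w\<in>S. \<integral>\<^sup>+X. ennreal (Lbar X) * ennreal (Lw w X) \<partial>P0)"
      by (subst Lbar_integral) (auto simp: mult.commute)
    also have "\<dots> = ennreal (1 / card S) * (\<Sum>w\<in>S. ennreal (1 / card S) * (\<Sum>w'\<in>S. \<integral>\<^sup>+X. ennreal (Lw w' X) * ennreal (Lw w X) \<partial>P0))"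
      by (subst Lbar_integral) auto
    also have "\<dots> \<le> ennreal (1 / card S) * (\<Sum>w\<in>S. ennreal (1 / card S) * (\<Sum>w'\<in>S. ennreal (exp (real n * v * (\<Sum>i\<in>I. w' i * w i)))))"
      by (intro mult_left_mono sum_mono pair) auto
    also have "\<dots> = ennreal (1 / card S * (1 / card S * (\<Sum>w\<in>S. \<Sum>w'\<in>S. exp (real n * v * (\<Sum>i\<in>I. w' i * w i)))))"
      by (simp add: sum_ennreal ennreal_mult''[symmetric] sum_nonneg sum_divide_distrib[symmetric])
    also have "\<dots> \<le> ennreal K"
    proof (rule ennreal_leI)
      have "(\<Sum>w\<in>S. \<Sum>w'\<in>S. exp (real n * v * (\<Sum>i\<in>I. w' i * w i))) \<le> (real (card S))\<^sup>2 * K"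
        using sum_exp_signs[OF I, of "real n * v"] by (simp add: S_def K_def mult.commute[of _ "_ :: real"])
      then show "1 / card S * (1 / card S * (\<Sum>w\<in>S. \<Sum>w'\<in>S. exp (real n * v * (\<Sum>i\<in>I. w' i * w i)))) \<le> K"
        using card_S by (simp add: divide_le_eq power2_eq_square mult_ac)
    qed
    finally show ?thesis .
  qed
  have riskF: "(\<integral>\<^sup>+X. ennreal (Lbar X) * ennreal ((N X - b)\<^sup>2) \<partial>P0) \<le> (risk n N F)\<^sup>2"
  proof -
    have each: "(\<integral>\<^sup>+X. ennreal (Lw w X) * ennreal ((N X - b)\<^sup>2) \<partial>P0) \<le> (risk n N F)\<^sup>2" if "w \<in> S" for w
      using risk_square_ge[where N = N and n = n, OF fw(2,1)[of w]] fw(3)[of w] that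
      by (simp add: law[OF that] nn_integral_density S_def)
    have "(\<integral>\<^sup>+X. ennreal (Lbar X) * ennreal ((N X - b)\<^sup>2) \<partial>P0) \<le> ennreal (1 / card S) * (\<Sum>w\<in>S. (risk n N F)\<^sup>2)"
      by (subst Lbar_integral) (auto intro!: mult_left_mono sum_bounded_above each)
    also have "\<dots> = (ennreal (1 / card S) * ennreal (card S)) * (risk n N F)\<^sup>2"
      by (simp add: ennreal_of_nat_eq_real_of_nat mult.assoc)
    also have "\<dots> = (risk n N F)\<^sup>2" using card_S by (simp add: ennreal_mult'[symmetric])
    finally show ?thesis .
  qed
  have riskF': "(\<integral>\<^sup>+X. ennreal ((N X - a)\<^sup>2) \<partial>P0) \<le> (risk n N F')\<^sup>2"
    using risk_square_ge[where N = N and n = n, OF f0(2,1)] f0(3) by (simp add: P0)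
  have "B * K \<le> A" using AB by (simp add: K_def v_def)
  moreover have "0 \<le> B * K" using B K by simp
  ultimately have A: "0 \<le> A" "B * K \<le> A" by linarith+
  define c where "c = B * (b - a)\<^sup>2"
  have c: "0 \<le> c" using B by (simp add: c_def)
  \<comment> \<open>The mixture ratio has mean 1, so the constant can be integrated against it; the
    term with the second moment then takes back half of it.\<close>
  have "ennreal (c / 4) = ennreal (c / 4) * (\<integral>\<^sup>+X. ennreal (Lbar X) \<partial>P0)" by (simp add: mean)
  also have "\<dots> = (\<integral>\<^sup>+X. ennreal (c / 4) * ennreal (Lbar X) \<partial>P0)" by (simp add: nn_integral_cmult)
  also have "\<dots> \<le> (\<integral>\<^sup>+X. ennreal A * ennreal ((N X - a)\<^sup>2) + ennreal B * (ennreal (Lbar X) * ennreal ((N X - b)\<^sup>2))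
      + ennreal (c / (8 * K)) * ennreal ((Lbar X)\<^sup>2) \<partial>P0)"
  proof (rule nn_integral_mono)
    fix X
    have "ennreal (c / 4 * Lbar X) \<le> ennreal (A * (N X - a)\<^sup>2 + B * (Lbar X * (N X - b)\<^sup>2) + c / (8 * K) * (Lbar X)\<^sup>2)"
      unfolding c_def by (intro ennreal_leI two_point_inequality ab K B A Lbar0)
    then show "ennreal (c / 4) * ennreal (Lbar X) \<le> ennreal A * ennreal ((N X - a)\<^sup>2) + ennreal B * (ennreal (Lbar X) * ennreal ((N X - b)\<^sup>2))
      + ennreal (c / (8 * K)) * ennreal ((Lbar X)\<^sup>2)"
      using A B Lbar0 c K by (simp add: ennreal_mult'[symmetric] ennreal_mult''[symmetric] ennreal_plus[symmetric] del: ennreal_plus)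
  qed
  also have "\<dots> = ennreal A * (\<integral>\<^sup>+X. ennreal ((N X - a)\<^sup>2) \<partial>P0) + ennreal B * (\<integral>\<^sup>+X. ennreal (Lbar X) * ennreal ((N X - b)\<^sup>2) \<partial>P0)
      + ennreal (c / (8 * K)) * (\<integral>\<^sup>+X. ennreal ((Lbar X)\<^sup>2) \<partial>P0)"
    by (simp add: nn_integral_add nn_integral_cmult)
  also have "\<dots> \<le> ennreal A * (risk n N F')\<^sup>2 + ennreal B * (risk n N F)\<^sup>2 + ennreal (c / (8 * K)) * ennreal K"
    by (intro add_mono mult_left_mono riskF riskF' second) auto
  also have "ennreal (c / (8 * K)) * ennreal K = ennreal (c / 8)"
    using K c by (simp add: ennreal_mult'[symmetric])
  also have "ennreal (c / 4) = ennreal (c / 8) + ennreal (c / 8)" using c by (simp add: ennreal_plus[symmetric] del: ennreal_plus)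
  finally have "ennreal (c / 8) + ennreal (c / 8) \<le> ennreal (c / 8) + (ennreal A * (risk n N F')\<^sup>2 + ennreal B * (risk n N F)\<^sup>2)"
    by (metis add.commute)
  then have "ennreal (c / 8) \<le> ennreal A * (risk n N F')\<^sup>2 + ennreal B * (risk n N F)\<^sup>2"
    by (subst (asm) ennreal_add_left_cancel_le) simp
  then show ?thesis by (simp add: c_def)
qed

lemma integral_lborel_prod:
  fixes f :: "'a::euclidean_space \<Rightarrow> real \<Rightarrow> real"
  assumes int: "\<And>b. b \<in> Basis \<Longrightarrow> integrable lborel (f b)"
  shows "(\<integral>x. (\<Prod>b\<in>Basis. f b (x \<bullet> b)) \<partial>lborel) = (\<Prod>b\<in>Basis. (\<integral>x. f b x \<partial>lborel))"
proof -
  interpret product_sigma_finite "\<lambda>_ :: 'a. lborel :: real measure" by unfold_locales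
  have [measurable]: "f b \<in> borel_measurable borel" if "b \<in> Basis" for b using int[OF that] by auto
  have "(\<integral>x. (\<Prod>b\<in>Basis. f b (x \<bullet> b)) \<partial>lborel)
      = (\<integral>x. (\<Prod>b\<in>Basis. f b ((\<Sum>b\<in>Basis. x b *\<^sub>R b) \<bullet> b)) \<partial>Pi\<^sub>M Basis (\<lambda>_. lborel))"
    by (subst lborel_eq) (subst integral_distr, simp_all)
  also have "\<dots> = (\<integral>x. (\<Prod>b\<in>Basis. f b (x b)) \<partial>Pi\<^sub>M Basis (\<lambda>_. lborel))"
    by (intro Bochner_Integration.integral_cong prod.cong) simp_all
  also have "\<dots> = (\<Prod>b\<in>Basis. (\<integral>x. f b x \<partial>lborel))"
    by (rule product_integral_prod) (use int in auto)
  finally show ?thesis .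
qed

subsection \<open>Smooth functions of one variable with compact support\<close>

text \<open>Polynomials on [0, 1], continued by constants. Smoothness of finite order is all that
  the classes require, and it is read off from the order to which the derivative vanishes at 0 and
  1.\<close>

definition clamped_poly :: "real poly \<Rightarrow> real \<Rightarrow> real" where
  "clamped_poly P x = poly P (max 0 (min 1 x))"

definition dif :: "real \<Rightarrow> (real \<Rightarrow> real) \<Rightarrow> real \<Rightarrow> real" where
  "dif u f = (\<lambda>x. f (x + u) - f x)"

lemma clamped_poly_measurable [measurable]: "clamped_poly P \<in> borel_measurable borel"
proof -
  have "continuous_on UNIV (\<lambda>x :: real. poly P (max 0 (min 1 x)))" by (intro continuous_intros)
  then show ?thesis unfolding clamped_poly_def[abs_def] by (rule borel_measurable_continuous_onI)
qed

lemma clamped_poly_bounded: "\<exists>C\<ge>0. \<forall>x. \<bar>clamped_poly P x\<bar> \<le> C"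
proof -
  have "compact ((\<lambda>x. poly P x) ` {0..1 :: real})" by (intro compact_continuous_image continuous_intros) auto
  then obtain C where C: "\<And>x. x \<in> {0..1} \<Longrightarrow> \<bar>poly P x\<bar> \<le> C"
    by (metis bounded_iff compact_imp_bounded imageI real_norm_def)
  then have "\<bar>clamped_poly P x\<bar> \<le> C" for x by (auto simp: clamped_poly_def)
  moreover have "0 \<le> C" using C[of 0] by auto
  ultimately show ?thesis by blast
qed

lemma clamped_poly_has_derivative:
  assumes "poly (pderiv P) 0 = 0" "poly (pderiv P) 1 = 0"
  shows "(clamped_poly P has_real_derivative clamped_poly (pderiv P) x) (at x)"
proof -
  have const: "((\<lambda>y. (clamped_poly P y - poly P a) / (y - a)) \<longlongrightarrow> 0) F"
    if "eventually (\<lambda>y. clamped_poly P y = poly P a) F" for F a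
    by (rule tendsto_eventually) (use that in \<open>auto elim!: eventually_mono\<close>)
  have quot: "((\<lambda>y. (clamped_poly P y - poly P a) / (y - a)) \<longlongrightarrow> poly (pderiv P) a) F"
    if "F \<le> at a" "eventually (\<lambda>y. clamped_poly P y = poly P y) F" for F a
  proof -
    have "((\<lambda>y. (poly P y - poly P a) / (y - a)) \<longlongrightarrow> poly (pderiv P) a) (at a)"
      using poly_DERIV[of P a] by (simp add: has_field_derivative_iff)
    then have "((\<lambda>y. (poly P y - poly P a) / (y - a)) \<longlongrightarrow> poly (pderiv P) a) F"
      using that(1) by (rule filterlim_mono[OF _ order_refl])
    then show ?thesis
      by (rule Lim_transform_eventually) (use that(2) in \<open>auto elim!: eventually_mono\<close>)
  qed
  consider "x < 0" | "x = 0" | "0 < x" "x < 1" | "x = 1" | "1 < x" by linarith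
  then show ?thesis
  proof cases
    case 1
    have "eventually (\<lambda>y. y < 0) (at x)" using 1 order_tendstoD(2)[OF tendsto_ident_at] by blast
    then have "eventually (\<lambda>y. clamped_poly P y = poly P 0) (nhds x)"
      using 1 by (auto simp: eventually_at_filter clamped_poly_def elim!: eventually_mono)
    then have "(clamped_poly P has_real_derivative 0) (at x)"
      by (subst DERIV_cong_ev[OF refl _ refl]) auto
    then show ?thesis using 1 assms by (simp add: clamped_poly_def)
  next
    case 2
    have "((\<lambda>y. (clamped_poly P y - poly P 0) / (y - 0)) \<longlongrightarrow> 0) (at 0)"
    proof (rule filterlim_split_at)
      show "((\<lambda>y. (clamped_poly P y - poly P 0) / (y - 0)) \<longlongrightarrow> 0) (at_left 0)"
        by (rule const) (auto simp: eventually_at_filter clamped_poly_def)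
      have "eventually (\<lambda>y. y \<in> {0<..<1}) (at_right (0 :: real))" by (rule eventually_at_right_real) simp
      then have "eventually (\<lambda>y. clamped_poly P y = poly P y) (at_right 0)"
        by eventually_elim (auto simp: clamped_poly_def)
      then show "((\<lambda>y. (clamped_poly P y - poly P 0) / (y - 0)) \<longlongrightarrow> 0) (at_right 0)"
        using quot[of "at_right 0" 0] assms by (simp add: at_le)
    qed
    then show ?thesis using 2 assms by (simp add: has_field_derivative_iff clamped_poly_def)
  next
    case 3
    have "eventually (\<lambda>y. y \<in> {0<..<1}) (nhds x)" using 3 by (intro eventually_nhds_in_open) auto
    then have "eventually (\<lambda>y. clamped_poly P y = poly P y) (nhds x)"
      by eventually_elim (auto simp: clamped_poly_def)
    then have "(clamped_poly P has_real_derivative poly (pderiv P) x) (at x)"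
      by (subst DERIV_cong_ev[OF refl _ refl]) (auto intro: poly_DERIV)
    then show ?thesis using 3 by (simp add: clamped_poly_def)
  next
    case 4
    have "((\<lambda>y. (clamped_poly P y - poly P 1) / (y - 1)) \<longlongrightarrow> 0) (at 1)"
    proof (rule filterlim_split_at)
      show "((\<lambda>y. (clamped_poly P y - poly P 1) / (y - 1)) \<longlongrightarrow> 0) (at_right 1)"
        by (rule const) (auto simp: eventually_at_filter clamped_poly_def)
      have "eventually (\<lambda>y. y \<in> {0<..<1}) (at_left (1 :: real))" by (rule eventually_at_left_real) simp
      then have "eventually (\<lambda>y. clamped_poly P y = poly P y) (at_left 1)"
        by eventually_elim (auto simp: clamped_poly_def)
      then show "((\<lambda>y. (clamped_poly P y - poly P 1) / (y - 1)) \<longlongrightarrow> 0) (at_left 1)"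
        using quot[of "at_left 1" 1] assms by (simp add: at_le)
    qed
    then show ?thesis using 4 assms by (simp add: has_field_derivative_iff clamped_poly_def)
  next
    case 5
    have "eventually (\<lambda>y. y \<in> {1<..}) (nhds x)" using 5 by (intro eventually_nhds_in_open) auto
    then have "eventually (\<lambda>y. clamped_poly P y = poly P 1) (nhds x)"
      by eventually_elim (auto simp: clamped_poly_def)
    then have "(clamped_poly P has_real_derivative 0) (at x)"
      by (subst DERIV_cong_ev[OF refl _ refl]) auto
    then show ?thesis using 5 assms by (simp add: clamped_poly_def)
  qed
qed

lemma dif_power_has_derivative:
  assumes "\<And>x. (f has_real_derivative f' x) (at x)"
  shows "((dif u ^^ k) f has_real_derivative (dif u ^^ k) f' x) (at x)"
proof (induction k arbitrary: x)
  case (Suc k)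
  have "((\<lambda>x. (dif u ^^ k) f (x + u)) has_real_derivative (dif u ^^ k) f' (x + u)) (at x)"
    using Suc.IH[of "x + u"] by (subst (asm) DERIV_shift)
  from DERIV_diff[OF this Suc.IH] show ?case
    by (simp add: dif_def[of u "(dif u ^^ k) f"] dif_def[of u "(dif u ^^ k) f'"])
qed (simp add: assms)

text \<open>Stands in for a bounded k-th derivative, in the form in which the classes ask for
  it.\<close>

definition smooth_to :: "nat \<Rightarrow> (real \<Rightarrow> real) \<Rightarrow> bool" where
  "smooth_to k f \<longleftrightarrow> (\<exists>C\<ge>0. \<forall>u x. \<bar>(dif u ^^ k) f x\<bar> \<le> C * \<bar>u\<bar> ^ k)"

text \<open>Mean value inequality for the k-th difference of f, whose derivative is the k-th
  difference of f'.\<close>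

lemma smooth_to_Suc:
  assumes f: "\<And>x. (f has_real_derivative f' x) (at x)" and f': "smooth_to k f'"
  shows "smooth_to (Suc k) f"
proof -
  obtain C where C: "0 \<le> C" "\<And>u x. \<bar>(dif u ^^ k) f' x\<bar> \<le> C * \<bar>u\<bar> ^ k"
    using f' by (auto simp: smooth_to_def)
  have "\<bar>(dif u ^^ Suc k) f x\<bar> \<le> C * \<bar>u\<bar> ^ Suc k" for u x
  proof -
    have "norm ((dif u ^^ k) f (x + u) - (dif u ^^ k) f x) \<le> (C * \<bar>u\<bar> ^ k) * norm (x + u - x)"
    proof (rule field_differentiable_bound[of UNIV])
      show "((dif u ^^ k) f has_field_derivative (dif u ^^ k) f' z) (at z within UNIV)" for z
        using dif_power_has_derivative[OF f] by simp
    qed (use C in auto)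
    then show ?thesis by (simp add: dif_def mult_ac)
  qed
  then show ?thesis using C(1) unfolding smooth_to_def by blast
qed

abbreviation bump_poly :: "real poly" where
  "bump_poly \<equiv> [:0, 1, -1:]"

text \<open>Divisibility by (x (1 - x))^k says that the derivative vanishes to order k at both ends,
  and each differentiation uses up one power.\<close>

lemma smooth_to_clamped_poly: "bump_poly ^ k dvd pderiv P \<Longrightarrow> smooth_to k (clamped_poly P)"
proof (induction k arbitrary: P)
  case 0
  then show ?case using clamped_poly_bounded[of P] by (simp add: smooth_to_def)
next
  case (Suc k)
  obtain R where R: "pderiv P = bump_poly ^ Suc k * R" using Suc.prems by blast
  show ?case
  proof (rule smooth_to_Suc)
    show "(clamped_poly P has_real_derivative clamped_poly (pderiv P) x) (at x)" for x
      by (rule clamped_poly_has_derivative) (simp_all add: R)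
    have "pderiv (pderiv P) = bump_poly ^ k * (bump_poly * pderiv R + Polynomial.smult (of_nat (Suc k)) (pderiv bump_poly * R))"
      unfolding R pderiv_mult pderiv_power_Suc by (simp add: algebra_simps)
    then show "smooth_to k (clamped_poly (pderiv P))" by (intro Suc.IH) simp
  qed
qed

lemma pderiv_sum: "pderiv (\<Sum>i\<in>I. p i) = (\<Sum>i\<in>I. pderiv (p i))"
  by (induction I rule: infinite_finite_induct) (simp_all add: pderiv_add)

lemma pderiv_surj: "\<exists>P. pderiv P = (p :: real poly)"
proof
  have "pderiv (\<Sum>i\<le>degree p. monom (coeff p i / real (Suc i)) (Suc i)) = (\<Sum>i\<le>degree p. monom (coeff p i) i)"
    by (simp add: pderiv_sum pderiv_monom del: of_nat_Suc)
  then show "pderiv (\<Sum>i\<le>degree p. monom (coeff p i / real (Suc i)) (Suc i)) = p"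
    by (simp add: poly_as_sum_of_monoms)
qed

lemma dif_linear: "dif u (\<lambda>x. a * f x + b * g x) = (\<lambda>x. a * dif u f x + b * dif u g x)"
  by (rule ext) (simp add: dif_def algebra_simps)

lemma dif_power_linear: "(dif u ^^ k) (\<lambda>x. a * f x + b * g x) = (\<lambda>x. a * (dif u ^^ k) f x + b * (dif u ^^ k) g x)"
  by (induction k) (simp_all add: dif_linear)

lemma dif_power_affine:
  "(dif u ^^ k) (\<lambda>x. f ((x - c) / s)) = (\<lambda>x. (dif (u / s) ^^ k) f ((x - c) / s))"
proof (induction k)
  case (Suc k)
  then show ?case by (auto simp: dif_def add_divide_distrib diff_divide_distrib algebra_simps fun_eq_iff)
qed simp

lemma smooth_to_linear:
  assumes "smooth_to k f" "smooth_to k g"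
  shows "smooth_to k (\<lambda>x. a * f x + b * g x)"
proof -
  obtain C D where C: "0 \<le> C" "\<And>u x. \<bar>(dif u ^^ k) f x\<bar> \<le> C * \<bar>u\<bar> ^ k"
    and D: "0 \<le> D" "\<And>u x. \<bar>(dif u ^^ k) g x\<bar> \<le> D * \<bar>u\<bar> ^ k"
    using assms by (auto simp: smooth_to_def)
  have "\<bar>a * (dif u ^^ k) f x + b * (dif u ^^ k) g x\<bar> \<le> (\<bar>a\<bar> * C + \<bar>b\<bar> * D) * \<bar>u\<bar> ^ k" for u x
  proof -
    have "\<bar>a * (dif u ^^ k) f x + b * (dif u ^^ k) g x\<bar> \<le> \<bar>a\<bar> * \<bar>(dif u ^^ k) f x\<bar> + \<bar>b\<bar> * \<bar>(dif u ^^ k) g x\<bar>"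
      by (metis abs_mult abs_triangle_ineq)
    also have "\<dots> \<le> \<bar>a\<bar> * (C * \<bar>u\<bar> ^ k) + \<bar>b\<bar> * (D * \<bar>u\<bar> ^ k)"
      by (intro add_mono mult_left_mono C D) auto
    finally show ?thesis by (simp add: algebra_simps)
  qed
  moreover have "0 \<le> \<bar>a\<bar> * C + \<bar>b\<bar> * D" using C D by simp
  ultimately show ?thesis unfolding smooth_to_def dif_power_linear by blast
qed

lemma smooth_to_shift:
  assumes "smooth_to k f"
  shows "smooth_to k (\<lambda>x. f (x - c))"
proof -
  have "(dif u ^^ k) (\<lambda>x. f (x - c)) = (\<lambda>x. (dif u ^^ k) f (x - c))" for u
    using dif_power_affine[where u = u and k = k and f = f and c = c and s = 1] by simp
  then show ?thesis using assms unfolding smooth_to_def by auto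
qed

lemma integral_pos_continuous:
  fixes g :: "real \<Rightarrow> real"
  assumes cont: "continuous_on UNIV g" and g0: "\<And>x. 0 \<le> g x" and x0: "0 < g x0" and int: "integrable lborel g"
  shows "0 < (\<integral>x. g x \<partial>lborel)"
proof -
  have "open {x. g x0 / 2 < g x}" using cont by (intro open_Collect_less continuous_intros) auto
  moreover have "x0 \<in> {x. g x0 / 2 < g x}" using x0 by simp
  ultimately obtain e where e: "0 < e" "ball x0 e \<subseteq> {x. g x0 / 2 < g x}" by (meson open_contains_ball)
  have "integrable lborel (\<lambda>x. g x0 / 2 * indicator {x0 - e / 2..x0 + e / 2} x)"
    by (intro integrable_mult_right integrable_real_indicator) (auto simp: emeasure_lborel_Icc_eq)
  then have "(\<integral>x. g x0 / 2 * indicator {x0 - e / 2..x0 + e / 2} x \<partial>lborel) \<le> (\<integral>x. g x \<partial>lborel)"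
  proof (rule integral_mono[OF _ int])
    fix x
    have "x \<in> ball x0 e" if "x \<in> {x0 - e / 2..x0 + e / 2}" using that e(1) by (auto simp: dist_real_def abs_if)
    then show "g x0 / 2 * indicator {x0 - e / 2..x0 + e / 2} x \<le> g x"
      using e(2) g0[of x] by (auto split: split_indicator)
  qed
  moreover have "(\<integral>x. g x0 / 2 * indicator {x0 - e / 2..x0 + e / 2} x \<partial>lborel) = g x0 / 2 * e"
    using e(1) by simp
  ultimately show ?thesis using x0 e(1) by (smt (verit) divide_pos_pos mult_pos_pos)
qed

lemma clamped_poly_continuous: "continuous_on UNIV (clamped_poly P)"
  unfolding clamped_poly_def[abs_def] by (intro continuous_intros)

lemma clamped_poly_integrable:
  assumes "poly P 0 = 0" "poly P 1 = 0"
  shows "integrable lborel (clamped_poly P)"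
proof -
  obtain C where C: "0 \<le> C" "\<And>x. \<bar>clamped_poly P x\<bar> \<le> C" using clamped_poly_bounded by blast
  have "integrable lborel (\<lambda>x. C * indicator {0..1 :: real} x)" by simp
  then show ?thesis
  proof (rule Bochner_Integration.integrable_bound)
    show "AE x in lborel. norm (clamped_poly P x) \<le> norm (C * indicator {0..1} x)"
    proof (rule AE_I2)
      fix x
      show "norm (clamped_poly P x) \<le> norm (C * indicator {0..1} x)"
        using C(2)[of x] C(1) assms by (cases "x \<in> {0..1}") (auto simp: clamped_poly_def)
    qed
  qed simp
qed

lemma poly_bump_range: "0 \<le> x \<Longrightarrow> x \<le> 1 \<Longrightarrow> 0 \<le> poly (bump_poly ^ k) x \<and> poly (bump_poly ^ k) x \<le> (1 :: real)"
proof -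
  assume x: "0 \<le> x" "x \<le> 1"
  have "0 \<le> x * (1 - x)" "x * (1 - x) \<le> 1 * 1" using x by (simp, intro mult_mono) auto
  then show ?thesis by (simp add: poly_power power_le_one)
qed

text \<open>The power k + 1 of x (1 - x) has a derivative divisible by the k-th power.\<close>

lemma bump_exists:
  obtains g where "\<And>x. 0 \<le> g x" "\<And>x. g x \<le> 1" "\<And>x. g x \<noteq> 0 \<Longrightarrow> 0 < x \<and> x < 1" "smooth_to k g"
    "0 < (\<integral>x. g x \<partial>lborel)" "integrable lborel g" "g \<in> borel_measurable borel"
proof (rule that[of "clamped_poly (bump_poly ^ Suc k)"])
  have r: "0 \<le> max 0 (min 1 x)" "max 0 (min 1 x) \<le> (1 :: real)" for x by auto
  show g0: "0 \<le> clamped_poly (bump_poly ^ Suc k) x" "clamped_poly (bump_poly ^ Suc k) x \<le> 1" for x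
    using poly_bump_range[OF r[of x], of "Suc k"] by (auto simp only: clamped_poly_def)
  show "0 < x \<and> x < 1" if "clamped_poly (bump_poly ^ Suc k) x \<noteq> 0" for x
    using that by (auto simp: clamped_poly_def max_def min_def split: if_splits)
  show "smooth_to k (clamped_poly (bump_poly ^ Suc k))"
    by (rule smooth_to_clamped_poly) (unfold pderiv_power_Suc, intro dvd_mult2 dvd_smult dvd_refl)
  show int: "integrable lborel (clamped_poly (bump_poly ^ Suc k))"
    by (rule clamped_poly_integrable) simp_all
  show "0 < (\<integral>x. clamped_poly (bump_poly ^ Suc k) x \<partial>lborel)"
  proof (rule integral_pos_continuous[OF clamped_poly_continuous g0(1) _ int])
    show "0 < clamped_poly (bump_poly ^ Suc k) (1 / 2)" by (simp add: clamped_poly_def poly_power)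
  qed
qed simp

text \<open>The factor 1 - 2 x makes the bump odd about 1/2, hence of mean zero.\<close>

lemma mean_zero_bump_exists:
  obtains g where "\<And>x. \<bar>g x\<bar> \<le> 1" "\<And>x. g x \<noteq> 0 \<Longrightarrow> 0 < x \<and> x < 1" "smooth_to k g"
    "(\<integral>x. g x \<partial>lborel) = 0" "integrable lborel g" "0 < (\<integral>x. (g x)\<^sup>2 \<partial>lborel)" "g \<in> borel_measurable borel"
proof -
  define P where "P = bump_poly ^ Suc k * [:1, -2:]"
  have r: "0 \<le> max 0 (min 1 x)" "max 0 (min 1 x) \<le> (1 :: real)" for x by auto
  have Pint: "integrable lborel (clamped_poly P)"
    by (rule clamped_poly_integrable) (simp_all add: P_def)
  show thesis
  proof (rule that[of "clamped_poly P"])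
    show "\<bar>clamped_poly P x\<bar> \<le> 1" for x
    proof -
      define y where "y = max 0 (min 1 x)"
      have y: "0 \<le> y" "y \<le> 1" using r[of x] by (simp_all add: y_def)
      have "\<bar>poly (bump_poly ^ Suc k) y\<bar> * \<bar>1 - 2 * y\<bar> \<le> 1 * 1"
        using poly_bump_range[OF y, of "Suc k"] y by (intro mult_mono) auto
      moreover have "poly [:1, -2:] y = 1 - 2 * y" by simp
      ultimately show ?thesis by (simp only: clamped_poly_def y_def[symmetric] P_def abs_mult poly_mult)
    qed
    show "0 < x \<and> x < 1" if "clamped_poly P x \<noteq> 0" for x
      using that by (auto simp: clamped_poly_def P_def max_def min_def split: if_splits)
    have "pderiv P = bump_poly ^ k * (bump_poly * pderiv [:1, -2:] + Polynomial.smult (of_nat (Suc k)) (pderiv bump_poly * [:1, -2:]))"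
      unfolding P_def pderiv_mult pderiv_power_Suc by (simp add: algebra_simps)
    then show "smooth_to k (clamped_poly P)" by (intro smooth_to_clamped_poly) simp
    show "integrable lborel (clamped_poly P)" by (rule Pint)
    have "clamped_poly P (1 - x) = - clamped_poly P x" for x
    proof -
      define y where "y = max 0 (min 1 x)"
      have "max 0 (min 1 (1 - x)) = 1 - y" by (auto simp: y_def max_def min_def)
      moreover have "poly bump_poly (1 - y) = poly bump_poly y" by (simp add: algebra_simps)
      ultimately show ?thesis
        by (simp add: clamped_poly_def y_def[symmetric] P_def poly_power del: poly_pCons) (simp add: algebra_simps)
    qed
    then have "(\<integral>x. clamped_poly P x \<partial>lborel) = - (\<integral>x. clamped_poly P x \<partial>lborel)"
      using lborel_integral_real_affine[of "-1" "clamped_poly P" 1] by simp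
    then show "(\<integral>x. clamped_poly P x \<partial>lborel) = 0" by simp
    have sq: "(clamped_poly P x)\<^sup>2 = clamped_poly (P\<^sup>2) x" for x by (simp add: clamped_poly_def poly_power)
    show "0 < (\<integral>x. (clamped_poly P x)\<^sup>2 \<partial>lborel)" unfolding sq
    proof (rule integral_pos_continuous[OF clamped_poly_continuous])
      show "0 \<le> clamped_poly (P\<^sup>2) x" for x unfolding sq[symmetric] by simp
      show "0 < clamped_poly (P\<^sup>2) (1 / 4)" by (simp add: clamped_poly_def P_def poly_power)
      show "integrable lborel (clamped_poly (P\<^sup>2))" by (rule clamped_poly_integrable) (simp_all add: P_def poly_power)
    qed
  qed simp
qed

text \<open>An antiderivative of (x (1 - x))^k, continued by constants, is a smooth step. The
  plateau is the step that starts at -1 minus the step that starts at 1, divided by the height of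
  the step.\<close>

lemma plateau_exists:
  obtains g where "\<And>x. 0 \<le> g x" "\<And>x. g x \<le> 1" "\<And>x. g x \<noteq> 0 \<Longrightarrow> - 1 < x \<and> x < 2"
    "\<And>x. 0 \<le> x \<Longrightarrow> x \<le> 1 \<Longrightarrow> g x = 1" "smooth_to k g" "g \<in> borel_measurable borel"
proof -
  obtain P where P: "pderiv P = bump_poly ^ k" using pderiv_surj by blast
  have mono: "poly P x \<le> poly P y" if "0 \<le> x" "x \<le> y" "y \<le> 1" for x y
  proof (rule DERIV_nonneg_imp_nondecreasing[OF that(2)])
    fix z assume "x \<le> z" "z \<le> y"
    then have "0 \<le> poly (bump_poly ^ k) z" using poly_bump_range[of z k] that by auto
    then show "\<exists>d. (poly P has_real_derivative d) (at z) \<and> 0 \<le> d" using poly_DERIV[of P z] P by auto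
  qed
  have less: "poly P 0 < poly P 1"
  proof -
    have "poly P 0 < poly P 1"
    proof (rule DERIV_pos_imp_increasing_open[of 0 1])
      fix z :: real assume z: "0 < z" "z < 1"
      then have "0 < z * (1 - z)" by simp
      then have "0 < poly (bump_poly ^ k) z" by (simp add: poly_power)
      then show "\<exists>d. (poly P has_real_derivative d) (at z) \<and> 0 < d" using poly_DERIV[of P z] P by auto
    qed (auto intro: continuous_intros)
    then show ?thesis .
  qed
  define D where "D = poly P 1 - poly P 0"
  have D: "0 < D" using less by (simp add: D_def)
  define g where "g x = (1 / D) * clamped_poly P (x - - 1) + (- 1 / D) * clamped_poly P (x - 1)" for x
  have gD: "g x = (clamped_poly P (x + 1) - clamped_poly P (x - 1)) / D" for x
    by (simp add: g_def diff_divide_distrib)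
  have cp: "clamped_poly P x \<le> clamped_poly P y" if "x \<le> y" for x y
    unfolding clamped_poly_def using that by (intro mono) auto
  have cp01: "poly P 0 \<le> clamped_poly P x" "clamped_poly P x \<le> poly P 1" for x
    unfolding clamped_poly_def by (intro mono; simp)+
  show thesis
  proof (rule that[of g])
    show "0 \<le> g x" for x using cp[of "x - 1" "x + 1"] D by (simp add: gD)
    show "g x \<le> 1" for x using cp01(2)[of "x + 1"] cp01(1)[of "x - 1"] D by (simp add: gD D_def)
    show "- 1 < x \<and> x < 2" if "g x \<noteq> 0" for x
    proof (rule ccontr)
      assume "\<not> (- 1 < x \<and> x < 2)"
      then have "clamped_poly P (x + 1) = clamped_poly P (x - 1)" by (auto simp: clamped_poly_def)
      then show False using that by (simp add: gD)
    qed
    show "g x = 1" if "0 \<le> x" "x \<le> 1" for x using that D by (simp add: gD clamped_poly_def D_def)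
    show "smooth_to k g" unfolding g_def[abs_def]
      by (intro smooth_to_linear smooth_to_shift smooth_to_clamped_poly) (simp_all add: P)
    show "g \<in> borel_measurable borel" unfolding g_def[abs_def] by measurable
  qed
qed

section \<open>Products of one-variable functions and families of bumps\<close>

lemma integrable_lborel_prod:
  fixes f :: "'a::euclidean_space \<Rightarrow> real \<Rightarrow> real"
  assumes int: "\<And>b. b \<in> Basis \<Longrightarrow> integrable lborel (f b)"
  shows "integrable lborel (\<lambda>x. \<Prod>b\<in>Basis. f b (x \<bullet> b))"
proof -
  interpret product_sigma_finite "\<lambda>_ :: 'a. lborel :: real measure" by unfold_locales
  have [measurable]: "f b \<in> borel_measurable borel" if "b \<in> Basis" for b using int[OF that] by auto
  have "integrable (Pi\<^sub>M Basis (\<lambda>_. lborel)) (\<lambda>x. \<Prod>b\<in>Basis. f b (x b))"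
    by (rule product_integrable_prod) (use int in auto)
  also have "(\<lambda>x. \<Prod>b\<in>Basis. f b (x b)) = (\<lambda>x. \<Prod>b\<in>Basis. f b ((\<Sum>b\<in>Basis. x b *\<^sub>R b) \<bullet> b))"
    by (intro ext prod.cong) simp_all
  finally show ?thesis by (subst lborel_eq) (subst integrable_distr_eq, simp_all)
qed

lemma cart_prod:
  fixes \<phi> :: "'d::finite \<Rightarrow> real \<Rightarrow> real"
  assumes int: "\<And>l. integrable lborel (\<phi> l)"
  shows "integrable lborel (\<lambda>x :: real ^ 'd. \<Prod>l\<in>UNIV. \<phi> l (x $ l))"
    and "(\<integral>x. (\<Prod>l\<in>UNIV. \<phi> l ((x :: real ^ 'd) $ l)) \<partial>lborel) = (\<Prod>l\<in>UNIV. \<integral>y. \<phi> l y \<partial>lborel)"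
proof -
  define idx where "idx b = (THE l. b = (axis l 1 :: real ^ 'd))" for b
  have idx: "idx (axis l 1) = l" for l by (simp add: idx_def axis_eq_axis)
  have eq: "(\<Prod>b\<in>Basis. \<phi> (idx b) (x \<bullet> b)) = (\<Prod>l\<in>UNIV. \<phi> l (x $ l))" for x :: "real ^ 'd"
    by (simp add: prod_Basis_cart idx inner_axis)
  have "integrable lborel (\<lambda>x :: real ^ 'd. \<Prod>b\<in>Basis. \<phi> (idx b) (x \<bullet> b))"
    by (rule integrable_lborel_prod) (rule int)
  then show "integrable lborel (\<lambda>x :: real ^ 'd. \<Prod>l\<in>UNIV. \<phi> l (x $ l))" by (simp only: eq)
  have "(\<integral>x. (\<Prod>b\<in>Basis. \<phi> (idx b) ((x :: real ^ 'd) \<bullet> b)) \<partial>lborel) = (\<Prod>b\<in>(Basis :: (real ^ 'd) set). (\<integral>y. \<phi> (idx b) y \<partial>lborel))"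
    by (rule integral_lborel_prod) (rule int)
  then show "(\<integral>x. (\<Prod>l\<in>UNIV. \<phi> l ((x :: real ^ 'd) $ l)) \<partial>lborel) = (\<Prod>l\<in>UNIV. \<integral>y. \<phi> l y \<partial>lborel)"
    by (simp add: eq prod_Basis_cart idx)
qed

lemma integral_real_affine:
  fixes \<eta> :: "real \<Rightarrow> real"
  assumes s: "0 < s" and int: "integrable lborel \<eta>"
  shows "integrable lborel (\<lambda>y. \<eta> ((y - c) / s))" "(\<integral>y. \<eta> ((y - c) / s) \<partial>lborel) = s * (\<integral>y. \<eta> y \<partial>lborel)"
proof -
  have e: "(y - c) / s = - c / s + (1 / s) * y" for y using s by (simp add: field_simps)
  show "integrable lborel (\<lambda>y. \<eta> ((y - c) / s))"
    unfolding e by (rule lborel_integrable_real_affine[OF int]) (use s in simp)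
  have "(\<integral>y. \<eta> y \<partial>lborel) = \<bar>1 / s\<bar> *\<^sub>R (\<integral>y. \<eta> (- c / s + (1 / s) * y) \<partial>lborel)"
    by (rule lborel_integral_real_affine) (use s in simp)
  then show "(\<integral>y. \<eta> ((y - c) / s) \<partial>lborel) = s * (\<integral>y. \<eta> y \<partial>lborel)"
    unfolding e[symmetric] using s by simp
qed

definition prod_bump :: "(real \<Rightarrow> real) \<Rightarrow> ('d::finite \<Rightarrow> real) \<Rightarrow> ('d \<Rightarrow> real) \<Rightarrow> real ^ 'd \<Rightarrow> real" where
  "prod_bump \<eta> c \<sigma> x = (\<Prod>l\<in>UNIV. \<eta> ((x $ l - c l) / \<sigma> l))"

lemma prod_bump_measurable [measurable]:
  assumes [measurable]: "\<eta> \<in> borel_measurable borel"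
  shows "prod_bump \<eta> c \<sigma> \<in> borel_measurable borel"
  unfolding prod_bump_def[abs_def] by measurable

lemma prod_bump_integral:
  fixes \<sigma> :: "'d::finite \<Rightarrow> real"
  assumes "\<And>l. 0 < \<sigma> l" "integrable lborel \<eta>"
  shows "integrable lborel (prod_bump \<eta> c \<sigma>)"
    "(\<integral>x. prod_bump \<eta> c \<sigma> x \<partial>lborel) = (\<Prod>l\<in>UNIV. \<sigma> l) * (\<integral>y. \<eta> y \<partial>lborel) ^ CARD('d)"
proof -
  note i = integral_real_affine[OF assms(1) assms(2)]
  show "integrable lborel (prod_bump \<eta> c \<sigma>)"
    unfolding prod_bump_def[abs_def] by (rule cart_prod(1)[of "\<lambda>l y. \<eta> ((y - c l) / \<sigma> l)"]) (rule i(1))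
  have "(\<integral>x. prod_bump \<eta> c \<sigma> x \<partial>lborel) = (\<Prod>l\<in>UNIV. \<integral>y. \<eta> ((y - c l) / \<sigma> l) \<partial>lborel)"
    unfolding prod_bump_def by (rule cart_prod(2)[of "\<lambda>l y. \<eta> ((y - c l) / \<sigma> l)"]) (rule i(1))
  then show "(\<integral>x. prod_bump \<eta> c \<sigma> x \<partial>lborel) = (\<Prod>l\<in>UNIV. \<sigma> l) * (\<integral>y. \<eta> y \<partial>lborel) ^ CARD('d)"
    by (simp add: i(2) prod.distrib)
qed

lemma prod_bump_abs_le: "(\<And>y. \<bar>\<eta> y\<bar> \<le> 1) \<Longrightarrow> \<bar>prod_bump \<eta> c \<sigma> x\<bar> \<le> 1"
  unfolding prod_bump_def abs_prod by (intro prod_le_1) auto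

lemma prod_bump_square: "(prod_bump \<eta> c \<sigma> x)\<^sup>2 = prod_bump (\<lambda>y. (\<eta> y)\<^sup>2) c \<sigma> x"
  by (simp add: prod_bump_def prod_power_distrib)

lemma prod_bump_nonzero: "prod_bump \<eta> c \<sigma> x \<noteq> 0 \<Longrightarrow> \<eta> ((x $ l - c l) / \<sigma> l) \<noteq> 0"
  by (auto simp: prod_bump_def)

lemma diff_op_power_factor:
  fixes R :: "real ^ 'd \<Rightarrow> real"
  assumes "\<And>x. R (x + u *\<^sub>R axis j 1) = R x"
  shows "(diff_op u j ^^ k) (\<lambda>x. \<phi> (x $ j) * R x) x = (dif u ^^ k) \<phi> (x $ j) * R x"
proof (induction k arbitrary: x)
  case (Suc k)
  have "(diff_op u j ^^ Suc k) (\<lambda>x. \<phi> (x $ j) * R x) x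
      = (dif u ^^ k) \<phi> ((x + u *\<^sub>R axis j 1) $ j) * R (x + u *\<^sub>R axis j 1) - (dif u ^^ k) \<phi> (x $ j) * R x"
    by (simp only: funpow.simps comp_def diff_op_def Suc.IH)
  also have "\<dots> = (dif u ^^ Suc k) \<phi> (x $ j) * R x"
    by (simp add: assms dif_def axis_nth algebra_simps)
  finally show ?case .
qed simp

lemma diff_op_power_prod_bump:
  "(diff_op u j ^^ k) (prod_bump \<eta> c \<sigma>) x =
     (dif (u / \<sigma> j) ^^ k) \<eta> ((x $ j - c j) / \<sigma> j) * (\<Prod>l\<in>UNIV - {j}. \<eta> ((x $ l - c l) / \<sigma> l))"
proof -
  have "prod_bump \<eta> c \<sigma> = (\<lambda>x. (\<lambda>y. \<eta> ((y - c j) / \<sigma> j)) (x $ j) * (\<Prod>l\<in>UNIV - {j}. \<eta> ((x $ l - c l) / \<sigma> l)))"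
    by (rule ext) (simp add: prod_bump_def prod.remove[of UNIV j])
  then have "(diff_op u j ^^ k) (prod_bump \<eta> c \<sigma>) x
      = (dif u ^^ k) (\<lambda>y. \<eta> ((y - c j) / \<sigma> j)) (x $ j) * (\<Prod>l\<in>UNIV - {j}. \<eta> ((x $ l - c l) / \<sigma> l))"
    by (simp only:) (rule diff_op_power_factor, auto intro!: prod.cong simp: axis_def)
  then show ?thesis by (simp add: dif_power_affine)
qed

lemma dif_power_abs_le:
  assumes "\<And>y. \<bar>\<eta> y\<bar> \<le> 1"
  shows "\<bar>(dif u ^^ k) \<eta> y\<bar> \<le> 2 ^ k"
proof (induction k arbitrary: y)
  case (Suc k)
  show ?case using Suc.IH[of "y + u"] Suc.IH[of y] by (simp add: dif_def)
qed (simp add: assms)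

lemma emeasure_lborel_shift:
  fixes E :: "(real ^ 'd) set"
  assumes [measurable]: "E \<in> sets borel"
  shows "emeasure lborel {x. x + c \<in> E} = emeasure lborel E"
proof -
  have [measurable]: "{x. x + c \<in> E} \<in> sets borel" by measurable
  have "emeasure lborel {x. x + c \<in> E} = (\<integral>\<^sup>+x. indicator E (x + c) \<partial>lborel)"
  proof -
    have "indicator E (x + c) = (indicator {x. x + c \<in> E} x :: ennreal)" for x by (auto split: split_indicator)
    then show ?thesis by simp
  qed
  also have "\<dots> = emeasure lborel E" by (subst nn_integral_lborel_shift) auto
  finally show ?thesis .
qed

text \<open>At every point at most \<open>k + 1\<close> of the \<open>k\<close>-th differences of functions with disjoint supports
  are nonzero, so the bounds do not depend on the number of bumps.\<close>

lemma bump_family: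
  fixes \<eta> :: "real \<Rightarrow> real" and c :: "'i \<Rightarrow> 'd::finite \<Rightarrow> real" and \<sigma> :: "'d \<Rightarrow> real" and I :: "'i set" and w :: "'i \<Rightarrow> real"
  defines "f \<equiv> \<lambda>x. \<Sum>i\<in>I. w i * prod_bump \<eta> (c i) \<sigma> x"
  assumes I: "finite I" and \<sigma>: "\<And>l. 0 < \<sigma> l" and [measurable]: "\<eta> \<in> borel_measurable borel"
    and \<eta>1: "\<And>y. \<bar>\<eta> y\<bar> \<le> 1" and C: "\<And>u y. \<bar>(dif u ^^ k) \<eta> y\<bar> \<le> C * \<bar>u\<bar> ^ k" "2 ^ k \<le> C"
    and disj: "\<And>i i' x. i \<in> I \<Longrightarrow> i' \<in> I \<Longrightarrow> i \<noteq> i' \<Longrightarrow> prod_bump \<eta> (c i) \<sigma> x * prod_bump \<eta> (c i') \<sigma> x = 0"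
    and E[measurable]: "E \<in> sets borel" and V: "emeasure lborel E \<le> ennreal V" "0 \<le> V"
    and supp: "\<And>i x. i \<in> I \<Longrightarrow> prod_bump \<eta> (c i) \<sigma> x \<noteq> 0 \<Longrightarrow> x \<in> E"
    and w: "\<And>i. i \<in> I \<Longrightarrow> \<bar>w i\<bar> \<le> 1" and r: "1 \<le> r"
  shows "norm_le r f (V powr recip r)"
    and "0 < \<beta> \<Longrightarrow> \<beta> \<le> real k \<Longrightarrow>
      norm_le r ((diff_op u j ^^ k) f) ((real k + 1)\<^sup>2 * C * V powr recip r * (\<bar>u\<bar> / \<sigma> j) powr \<beta>)"
proof -
  define G where "G i = prod_bump \<eta> (c i) \<sigma>" for i
  have [measurable]: "G i \<in> borel_measurable borel" for i unfolding G_def by measurable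
  have G1: "\<bar>G i x\<bar> \<le> 1" for i x unfolding G_def by (rule prod_bump_abs_le[OF \<eta>1])
  have fm[measurable]: "f \<in> borel_measurable borel" unfolding f_def by measurable
  show "norm_le r f (V powr recip r)"
  proof -
    have "\<bar>f x\<bar> \<le> 1 * indicator E x" for x
    proof (cases "\<exists>i\<in>I. G i x \<noteq> 0")
      case True
      then obtain i where i: "i \<in> I" "G i x \<noteq> 0" by blast
      have "f x = w i * G i x + (\<Sum>j\<in>I - {i}. w j * G j x)"
        unfolding f_def G_def by (rule sum.remove[OF I i(1)])
      also have "(\<Sum>j\<in>I - {i}. w j * G j x) = 0"
        by (rule sum.neutral) (use disj[OF i(1)] i in \<open>force simp: G_def\<close>)
      finally have "\<bar>f x\<bar> \<le> 1 * 1" using w[OF i(1)] G1[of i x] unfolding add_0_right abs_mult by (metis abs_ge_zero mult_mono zero_le_one abs_mult)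
      then show ?thesis using supp[OF i(1)] i by (simp add: G_def)
    next
      case False
      then have "f x = 0" unfolding f_def G_def[symmetric] by (intro sum.neutral) auto
      then show ?thesis by simp
    qed
    then have "norm_le r f (1 * V powr recip r)" by (intro norm_le_bounded_support[OF r _ V(2) fm E V(1)]) auto
    then show ?thesis by simp
  qed
  assume \<beta>: "0 < \<beta>" "\<beta> \<le> real k"
  define t where "t = \<bar>u\<bar> / \<sigma> j"
  have t0: "0 \<le> t" using \<sigma>[of j] by (simp add: t_def)
  have C0: "0 < C" using C(2) by (rule less_le_trans[rotated]) simp
  have D1: "\<bar>(diff_op u j ^^ k) (G i) x\<bar> \<le> C * t powr \<beta>" for i x
  proof -
    have "\<bar>(diff_op u j ^^ k) (G i) x\<bar> \<le> \<bar>(dif (u / \<sigma> j) ^^ k) \<eta> ((x $ j - c i j) / \<sigma> j)\<bar> * 1"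
      unfolding G_def diff_op_power_prod_bump abs_mult abs_prod
      by (intro mult_left_mono prod_le_1) (auto simp: \<eta>1)
    moreover have "\<dots> \<le> C * t powr \<beta>"
    \<comment> \<open>For small steps the smoothness of order k >= \<beta> is used, for large ones
      the trivial bound 2^k.\<close>
    proof (cases "t \<le> 1")
      case True
      have "t ^ k \<le> t powr \<beta>"
      proof (cases "t = 0")
        case True
        have "0 < k" using \<beta> by (cases k) auto
        then show ?thesis using True by (simp add: zero_power)
      next
        case False
        then have "t powr real k \<le> t powr \<beta>" using t0 \<open>t \<le> 1\<close> \<beta> by (intro powr_mono') auto
        then show ?thesis using False t0 by (simp add: powr_realpow)
      qed
      then have "C * t ^ k \<le> C * t powr \<beta>" using C0 by simp
      moreover have "\<bar>u / \<sigma> j\<bar> = t" using \<sigma>[of j] by (simp add: t_def)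
      ultimately show ?thesis using C(1)[of "u / \<sigma> j"] by (metis mult.right_neutral order_trans)
    next
      case False
      have "1 \<le> t powr \<beta>" using False \<beta> by (intro ge_one_powr_ge_zero) auto
      then have "C * 1 \<le> C * t powr \<beta>" using C0 by (intro mult_left_mono) auto
      moreover have "\<bar>(dif (u / \<sigma> j) ^^ k) \<eta> ((x $ j - c i j) / \<sigma> j)\<bar> \<le> 2 ^ k" by (rule dif_power_abs_le[OF \<eta>1])
      ultimately show ?thesis using C(2) by linarith
    qed
    ultimately show ?thesis by linarith
  qed
  have touch: "\<exists>a\<le>k. G i (x + (real a * u) *\<^sub>R axis j 1) \<noteq> 0" if "(diff_op u j ^^ k) (G i) x \<noteq> 0" for i x
  proof (rule ccontr)
    assume "\<not> (\<exists>a\<le>k. G i (x + (real a * u) *\<^sub>R axis j 1) \<noteq> 0)"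
    then have "(diff_op u j ^^ k) (G i) x = 0" unfolding diff_op_power_expand by (intro sum.neutral) auto
    then show False using that by simp
  qed
  \<comment> \<open>A k-th difference is supported on k + 1 translates of E.\<close>
  define E' where "E' = (\<Union>a\<le>k. {x. x + (real a * u) *\<^sub>R axis j 1 \<in> E})"
  have E'm[measurable]: "E' \<in> sets borel" unfolding E'_def by (intro sets.finite_UN) auto
  have E': "emeasure lborel E' \<le> ennreal ((real k + 1) * V)"
  proof -
    have "emeasure lborel E' \<le> (\<Sum>a\<le>k. emeasure lborel {x. x + (real a * u) *\<^sub>R axis j 1 \<in> E})"
      unfolding E'_def by (rule emeasure_subadditive_finite) auto
    also have "\<dots> = (\<Sum>a\<le>k. emeasure lborel E)" by (simp add: emeasure_lborel_shift)
    also have "\<dots> \<le> (\<Sum>a\<le>k. ennreal V)" by (intro sum_mono V)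
    also have "\<dots> = ennreal (\<Sum>a\<le>k. V)" using V(2) by (subst sum_ennreal) auto
    also have "(\<Sum>a\<le>k. V) = (real k + 1) * V" by (simp add: algebra_simps)
    finally show ?thesis .
  qed
  have expand: "(diff_op u j ^^ k) f x = (\<Sum>i\<in>I. w i * (diff_op u j ^^ k) (G i) x)" for x
  proof -
    have "(diff_op u j ^^ k) (\<lambda>x. \<Sum>i\<in>I. w i * G i x) = (\<lambda>x. \<Sum>i\<in>I. w i * (diff_op u j ^^ k) (G i) x)"
      using I
    proof (induction I rule: finite_induct)
      case empty
      show ?case by (rule ext, subst diff_op_power_expand) simp
    next
      case (insert i I)
      then show ?case
        using shift_linear_combination[where T = "diff_op u j ^^ k" and a = "w i" and f = "G i" and b = 1
            and g = "\<lambda>x. \<Sum>i\<in>I. w i * G i x", OF shift_linear_diff_op_power] by simp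
    qed
    then show ?thesis by (simp add: f_def G_def)
  qed
  have "\<bar>(diff_op u j ^^ k) f x\<bar> \<le> ((real k + 1) * (C * t powr \<beta>)) * indicator E' x" for x
  proof -
    define S where "S = {i \<in> I. (diff_op u j ^^ k) (G i) x \<noteq> 0}"
    have finS: "finite S" using I by (simp add: S_def)
    \<comment> \<open>To each bump with a nonzero difference at x belongs a translate of x at which
      the bump itself is nonzero. Distinct bumps have disjoint supports, so they choose distinct
      translates, and there are only k + 1 of these.\<close>
    define a where "a i = (SOME a. a \<le> k \<and> G i (x + (real a * u) *\<^sub>R axis j 1) \<noteq> 0)" for i
    have a: "a i \<le> k" "G i (x + (real (a i) * u) *\<^sub>R axis j 1) \<noteq> 0" if "i \<in> S" for i
      using someI_ex[OF touch[of i x]] that by (auto simp: a_def S_def)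
    have "inj_on a S"
    proof (rule inj_onI)
      fix i i' assume i: "i \<in> S" "i' \<in> S" "a i = a i'"
      show "i = i'"
      proof (rule ccontr)
        assume "i \<noteq> i'"
        then have "G i (x + (real (a i) * u) *\<^sub>R axis j 1) * G i' (x + (real (a i) * u) *\<^sub>R axis j 1) = 0"
          using i unfolding G_def by (intro disj) (auto simp: S_def)
        then show False using a(2)[OF i(1)] a(2)[OF i(2)] i(3) by simp
      qed
    qed
    moreover have "a ` S \<subseteq> {..k}" using a by auto
    ultimately have "card S \<le> card {..k}" by (intro card_inj_on_le) auto
    then have cS: "real (card S) \<le> real k + 1" by simp
    have "\<bar>(diff_op u j ^^ k) f x\<bar> \<le> (\<Sum>i\<in>S. \<bar>w i * (diff_op u j ^^ k) (G i) x\<bar>)"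
    proof -
      have "(diff_op u j ^^ k) f x = (\<Sum>i\<in>S. w i * (diff_op u j ^^ k) (G i) x)"
        unfolding expand by (rule sum.mono_neutral_right[OF I]) (auto simp: S_def)
      then show ?thesis by (simp only: sum_abs)
    qed
    also have "\<dots> \<le> (\<Sum>i\<in>S. 1 * (C * t powr \<beta>))"
      unfolding abs_mult by (intro sum_mono mult_mono w D1) (auto simp: S_def)
    also have "\<dots> = real (card S) * (C * t powr \<beta>)" by simp
    finally have le: "\<bar>(diff_op u j ^^ k) f x\<bar> \<le> real (card S) * (C * t powr \<beta>)" .
    show ?thesis
    proof (cases "S = {}")
      case True
      then show ?thesis using le C0 by simp
    next
      case False
      then obtain i where "i \<in> S" by blast
      then have "x \<in> E'" using a[of i] supp[of i] unfolding E'_def G_def by (auto simp: S_def)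
      moreover have "real (card S) * (C * t powr \<beta>) \<le> (real k + 1) * (C * t powr \<beta>)"
        using cS C0 by (intro mult_right_mono) auto
      ultimately show ?thesis using le by simp
    qed
  qed
  then have "norm_le r ((diff_op u j ^^ k) f) ((real k + 1) * (C * t powr \<beta>) * ((real k + 1) * V) powr recip r)"
    using C0 V by (intro norm_le_bounded_support[OF r _ _ _ E'm E']) auto
  moreover have "((real k + 1) * V) powr recip r \<le> (real k + 1) * V powr recip r"
  proof -
    have "(real k + 1) powr recip r \<le> (real k + 1) powr 1" using recip_le_one[OF r] by (intro powr_mono) auto
    then show ?thesis using V by (simp add: powr_mult mult_right_mono)
  qed
  then have "(real k + 1) * (C * t powr \<beta>) * ((real k + 1) * V) powr recip r
      \<le> (real k + 1) * (C * t powr \<beta>) * ((real k + 1) * V powr recip r)"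
    using C0 by (intro mult_left_mono) auto
  ultimately show "norm_le r ((diff_op u j ^^ k) f) ((real k + 1)\<^sup>2 * C * V powr recip r * (\<bar>u\<bar> / \<sigma> j) powr \<beta>)"
    by (auto simp: t_def power2_eq_square mult_ac intro: norm_le_weaken)
qed

subsection \<open>The perturbed densities\<close>

lemma emeasure_cbox_cart:
  fixes u v :: "'d::finite \<Rightarrow> real"
  assumes "\<And>l. u l \<le> v l"
  shows "emeasure lborel (cbox (\<chi> l. u l) (\<chi> l. v l) :: (real ^ 'd) set) = ennreal (\<Prod>l\<in>UNIV. v l - u l)"
proof -
  have "emeasure lborel (cbox (\<chi> l. u l) (\<chi> l. v l) :: (real ^ 'd) set)
      = ennreal (\<Prod>b\<in>Basis. ((\<chi> l. v l) - (\<chi> l. u l) :: real ^ 'd) \<bullet> b)"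
    by (subst emeasure_lborel_cbox) (use assms in \<open>auto simp: Basis_cart inner_axis\<close>)
  then show ?thesis by (simp add: prod_Basis_cart inner_axis)
qed

lemma density_norm_le_1:
  assumes "f \<in> L2_densities"
  shows "norm_le 1 f 1"
proof -
  have "f \<in> borel_measurable borel" "\<And>x. 0 \<le> f x" "(\<integral>\<^sup>+x. ennreal (f x) \<partial>lborel) = 1"
    using assms by (auto simp: L2_densities_def)
  then show ?thesis by (subst norm_le_finite) auto
qed

text \<open>At r_j = 1 the norm condition is met by the density property itself, the norm being 1 <=
  L_j; smallness of the summands is asked only for the other indices. The difference condition is
  split into thirds for all indices.\<close>

lemma nikolskii_three:
  fixes f :: "real ^ 'd::finite \<Rightarrow> real"
  assumes f: "f = (\<lambda>x. p1 x + p2 x + p3 x)" "f \<in> L2_densities"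
    and r: "\<And>j. 1 \<le> r j" and L: "\<And>j. 0 < L j" "\<And>j. r j = 1 \<Longrightarrow> 1 \<le> L j" and k: "\<And>j. \<beta> j < real k"
    and small: "\<And>j p. p \<in> {p1, p2, p3} \<Longrightarrow> r j \<noteq> 1 \<Longrightarrow> norm_le (r j) p (L j / 3)"
    and diff: "\<And>j p u. p \<in> {p1, p2, p3} \<Longrightarrow> norm_le (r j) ((diff_op u j ^^ k) p) (L j / 3 * \<bar>u\<bar> powr \<beta> j)"
  shows "f \<in> nikolskii r \<beta> L"
proof -
  have fm: "f \<in> borel_measurable borel" using f(2) by (simp add: L2_densities_def)
  have three: "norm_le q (\<lambda>x. g1 x + g2 x + g3 x) B"
    if "1 \<le> q" "0 \<le> B" "norm_le q g1 (B / 3)" "norm_le q g2 (B / 3)" "norm_le q g3 (B / 3)" for q B and g1 g2 g3 :: "real ^ 'd \<Rightarrow> real"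
  proof -
    have "norm_le q (\<lambda>x. (g1 x + g2 x) + g3 x) ((B / 3 + B / 3) + B / 3)"
      using that by (intro norm_le_add) auto
    then show ?thesis by simp
  qed
  have "norm_le (r j) f (L j)" for j
  proof (cases "r j = 1")
    case True
    then show ?thesis using norm_le_weaken[OF density_norm_le_1[OF f(2)] L(2)[OF True]] by simp
  next
    case False
    then show ?thesis unfolding f(1) using L[of j] by (intro three r small) auto
  qed
  moreover have "norm_le (r j) ((diff_op u j ^^ k) f) (L j * \<bar>u\<bar> powr \<beta> j)" for j u
  proof -
    have "(diff_op u j ^^ k) f = (\<lambda>x. (diff_op u j ^^ k) p1 x + (diff_op u j ^^ k) p2 x + (diff_op u j ^^ k) p3 x)"
      using shift_linear_combination[where T = "diff_op u j ^^ k" and a = 1 and f = "\<lambda>x. p1 x + p2 x" and b = 1 and g = p3, OF shift_linear_diff_op_power]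
        shift_linear_combination[where T = "diff_op u j ^^ k" and a = 1 and f = p1 and b = 1 and g = p2, OF shift_linear_diff_op_power] by (simp add: f(1))
    then show ?thesis using L[of j] diff[of _ j u] by (simp add: three r)
  qed
  ultimately show ?thesis using fm k unfolding nikolskii_def by (auto simp: norm_le_def intro!: exI[of _ "\<lambda>_. k"])
qed

lemma diff_op_power_cmult: "(diff_op u j ^^ k) (\<lambda>x. a * f x) = (\<lambda>x. a * (diff_op u j ^^ k) f x)"
  using shift_linear_combination[where T = "diff_op u j ^^ k" and a = a and f = f and b = 0 and g = f, OF shift_linear_diff_op_power]
  by simp

text \<open>Mass 1 on a cube of side N, at height of order N^(-d). Its L_r norm is of order N^(-d (1
  - 1/r)), small for r > 1 only; differences gain a further N^(-\<beta>) and are small even for r =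
  1. The cube lies at coordinates above 2, clear of the box and of the plateau built on it.\<close>

lemma spread_density:
  fixes k :: nat and R :: "ennreal set" and X :: "(ennreal \<times> real) set"
  assumes R: "finite R" "\<And>r. r \<in> R \<Longrightarrow> 1 < r" and X: "finite X" "\<And>r \<beta>. (r, \<beta>) \<in> X \<Longrightarrow> 1 \<le> r \<and> 0 < \<beta> \<and> \<beta> \<le> real k"
    and \<delta>: "0 < \<delta>"
  obtains p :: "real ^ 'd::finite \<Rightarrow> real" where "\<And>x. 0 \<le> p x" "integrable lborel p" "(\<integral>x. p x \<partial>lborel) = 1"
    "\<And>x l. p x \<noteq> 0 \<Longrightarrow> 2 < x $ l" "\<And>r. r \<in> R \<Longrightarrow> norm_le r p \<delta>"
    "\<And>r \<beta> j u. (r, \<beta>) \<in> X \<Longrightarrow> norm_le r ((diff_op u j ^^ k) p) (\<delta> * \<bar>u\<bar> powr \<beta>)"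
proof -
  obtain g where g: "\<And>x. 0 \<le> g x" "\<And>x. g x \<le> 1" "\<And>x. g x \<noteq> 0 \<Longrightarrow> 0 < x \<and> x < 1" "smooth_to k g"
    "0 < (\<integral>x. g x \<partial>lborel)" "integrable lborel g" and gm[measurable]: "g \<in> borel_measurable borel"
    by (rule bump_exists[of k]) blast
  obtain C0 where C0: "0 \<le> C0" "\<And>u x. \<bar>(dif u ^^ k) g x\<bar> \<le> C0 * \<bar>u\<bar> ^ k" using g(4) by (auto simp: smooth_to_def)
  define C where "C = C0 + 2 ^ k"
  have C: "\<bar>(dif u ^^ k) g x\<bar> \<le> C * \<bar>u\<bar> ^ k" "2 ^ k \<le> C" for u x
    using C0(2)[of u x] C0(1) by (auto simp: C_def distrib_right intro: order_trans)
  define d where "d = real CARD('d)"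
  have d: "0 < d" by (simp add: d_def)
  define m where "m = (\<integral>x. g x \<partial>lborel) ^ CARD('d)"
  have m: "0 < m" using g(5) by (simp add: m_def)
  define K where "K = (real k + 1)\<^sup>2 * C"
  have K: "1 \<le> K"
  proof -
    have "1 \<le> (2 :: real) ^ k" by simp
    then have "1 \<le> C" using C(2) by linarith
    then have "1 * 1 \<le> (real k + 1)\<^sup>2 * C" by (intro mult_mono one_le_power) auto
    then show ?thesis by (simp add: K_def)
  qed
  have ev: "eventually (\<lambda>N. K / m * N powr (- e) \<le> \<delta>) at_top" if "0 < e" for e
  proof -
    have "((\<lambda>N. K / m * N powr (- e)) \<longlongrightarrow> K / m * 0) at_top"
      by (intro tendsto_mult tendsto_const tendsto_neg_powr filterlim_ident) (use that in auto)
    then have "eventually (\<lambda>N. K / m * N powr (- e) < \<delta>) at_top" using \<delta> by (intro order_tendstoD(2)) auto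
    then show ?thesis by eventually_elim simp
  qed
  have rR: "0 < d * (1 - recip r)" if "r \<in> R" for r
    using recip_strict_antimono[of 1 r] R(2)[OF that] recip_finite[of 1] d by simp
  have "eventually (\<lambda>N. \<forall>r\<in>R. K / m * N powr (- (d * (1 - recip r))) \<le> \<delta>) at_top"
    by (rule eventually_ball_finite[OF R(1)]) (intro ballI ev rR)
  moreover have "eventually (\<lambda>N. \<forall>a\<in>X. K / m * N powr (- snd a) \<le> \<delta>) at_top"
    by (rule eventually_ball_finite[OF X(1)]) (intro ballI ev, use X(2) in \<open>metis prod.collapse\<close>)
  ultimately have "eventually (\<lambda>N. 1 \<le> N \<and> (\<forall>r\<in>R. K / m * N powr (- (d * (1 - recip r))) \<le> \<delta>)
      \<and> (\<forall>a\<in>X. K / m * N powr (- snd a) \<le> \<delta>)) at_top"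
    using eventually_ge_at_top[of 1] by eventually_elim auto
  from eventually_happens'[OF trivial_limit_at_top_linorder this] obtain N :: real where N': "1 \<le> N"
    "\<forall>r\<in>R. K / m * N powr (- (d * (1 - recip r))) \<le> \<delta>" "\<forall>a\<in>X. K / m * N powr (- snd a) \<le> \<delta>"
    by blast
  have N: "1 \<le> N" "\<And>r. r \<in> R \<Longrightarrow> K / m * N powr (- (d * (1 - recip r))) \<le> \<delta>"
    "\<And>r \<beta>. (r, \<beta>) \<in> X \<Longrightarrow> K / m * N powr (- \<beta>) \<le> \<delta>"
    using N' by (blast, blast, metis snd_conv)
  have N0: "0 < N" using N by simp
  define a where "a = 1 / (m * N powr d)"
  have a: "0 < a" using m N0 by (simp add: a_def)
  define G where "G = (\<lambda>x :: real ^ 'd. \<Sum>i\<in>{()}. 1 * prod_bump g (\<lambda>_. 2) (\<lambda>_. N) x)"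
  have G: "G = prod_bump g (\<lambda>_. 2) (\<lambda>_. N)" by (simp add: G_def)
  define E where "E = (cbox (\<chi> l. 2) (\<chi> l. N + 2) :: (real ^ 'd) set)"
  have E: "emeasure lborel E \<le> ennreal (N powr d)"
    unfolding E_def using N0 by (subst emeasure_cbox_cart) (auto simp: d_def powr_realpow)
  have supp: "2 < x $ l" "x $ l < N + 2" if "prod_bump g (\<lambda>_. 2) (\<lambda>_. N) x \<noteq> 0" for x :: "real ^ 'd" and l
    using g(3)[OF prod_bump_nonzero[OF that, of l]] N0 by (auto simp: field_simps)
  have inE: "x \<in> E" if "prod_bump g (\<lambda>_. 2) (\<lambda>_. N) x \<noteq> 0" for x :: "real ^ 'd"
    using supp[OF that] by (auto simp: E_def mem_box_cart less_imp_le)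
  have g1: "\<bar>g y\<bar> \<le> 1" for y using g(1,2)[of y] by simp
  note fam = bump_family[where \<eta> = g and c = "\<lambda>_ _. 2" and \<sigma> = "\<lambda>_. N" and I = "{()}" and w = "\<lambda>_. 1" and k = k and C = C
      and E = E and V = "N powr d", folded G_def]
  have nG: "norm_le r G ((N powr d) powr recip r)" if "1 \<le> r" for r
    by (rule fam(1)) (use N0 C E inE g1 gm that in \<open>auto simp: E_def\<close>)
  have dG: "norm_le r ((diff_op u j ^^ k) G) (K * (N powr d) powr recip r * (\<bar>u\<bar> / N) powr \<beta>)"
    if "1 \<le> r" "0 < \<beta>" "\<beta> \<le> real k" for r \<beta> u j
    unfolding K_def by (rule fam(2)) (use N0 C E inE g1 gm that in \<open>auto simp: E_def\<close>)
  have Nr: "a * ((N powr d) powr recip r) = 1 / m * N powr (- (d * (1 - recip r)))" for r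
  proof -
    have "- (d * (1 - recip r)) = d * recip r - d" by (simp add: algebra_simps)
    then show ?thesis using N0 by (simp add: a_def powr_powr powr_diff)
  qed
  have int: "integrable lborel (prod_bump g (\<lambda>_. 2) (\<lambda>_. N) :: real ^ 'd \<Rightarrow> real)"
    "(\<integral>x. prod_bump g (\<lambda>_. 2) (\<lambda>_. N) (x :: real ^ 'd) \<partial>lborel) = N powr d * m"
    using prod_bump_integral[of "\<lambda>_ :: 'd. N" g "\<lambda>_. 2"] g(6) N0 by (auto simp: m_def d_def powr_realpow)
  show thesis
  proof (rule that[of "\<lambda>x. a * G x"])
    show "0 \<le> a * G x" for x
      using a g(1) unfolding G prod_bump_def by (intro mult_nonneg_nonneg prod_nonneg) auto
    show "integrable lborel (\<lambda>x. a * G x)" "(\<integral>x. a * G x \<partial>lborel) = 1"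
      using int m N0 by (simp_all add: G a_def)
    show "2 < x $ l" if "a * G x \<noteq> 0" for x l using supp(1) that by (auto simp: G)
    show "norm_le r (\<lambda>x. a * G x) \<delta>" if "r \<in> R" for r
    proof -
      have r: "1 \<le> r" using R(2)[OF that] by simp
      have "norm_le r (\<lambda>x. a * G x) (\<bar>a\<bar> * ((N powr d) powr recip r))" by (rule norm_le_cmult[OF r _ nG[OF r]]) simp
      moreover have "\<bar>a\<bar> * ((N powr d) powr recip r) \<le> \<delta>"
      proof -
        have "1 / m * N powr (- (d * (1 - recip r))) \<le> K / m * N powr (- (d * (1 - recip r)))"
          using K m by (intro mult_right_mono divide_right_mono) auto
        then show ?thesis using N(2)[OF that] a Nr by simp
      qed
      ultimately show ?thesis by (rule norm_le_weaken)
    qed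
    show "norm_le r ((diff_op u j ^^ k) (\<lambda>x. a * G x)) (\<delta> * \<bar>u\<bar> powr \<beta>)" if "(r, \<beta>) \<in> X" for r \<beta> j u
    proof -
      have r: "1 \<le> r" "0 < \<beta>" "\<beta> \<le> real k" using X(2)[OF that] by auto
      have "norm_le r (\<lambda>x. a * (diff_op u j ^^ k) G x) (\<bar>a\<bar> * (K * (N powr d) powr recip r * (\<bar>u\<bar> / N) powr \<beta>))"
        by (rule norm_le_cmult[OF r(1) _ dG[OF r]]) (use K in simp)
      moreover have "(diff_op u j ^^ k) (\<lambda>x. a * G x) = (\<lambda>x. a * (diff_op u j ^^ k) G x)"
        by (rule diff_op_power_cmult)
      moreover have "\<bar>a\<bar> * (K * (N powr d) powr recip r * (\<bar>u\<bar> / N) powr \<beta>) \<le> \<delta> * \<bar>u\<bar> powr \<beta>"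
      proof -
        have "N powr (- (d * (1 - recip r))) \<le> 1"
          using powr_mono[of "- (d * (1 - recip r))" 0 N] N(1) d recip_le_one[OF r(1)] by simp
        have "a * ((N powr d) powr recip r) \<le> 1 / m"
          unfolding Nr using \<open>N powr (- (d * (1 - recip r))) \<le> 1\<close> m by (intro mult_left_le) auto
        then have "a * ((N powr d) powr recip r) * (K * (\<bar>u\<bar> / N) powr \<beta>) \<le> 1 / m * (K * (\<bar>u\<bar> / N) powr \<beta>)"
          using K by (intro mult_right_mono) auto
        also have "\<dots> = K / m * N powr (- \<beta>) * \<bar>u\<bar> powr \<beta>"
          using N0 by (simp add: powr_divide powr_minus field_simps)
        also have "\<dots> \<le> \<delta> * \<bar>u\<bar> powr \<beta>" using N(3)[OF that] by (intro mult_right_mono) auto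
        finally show ?thesis using a by (simp add: mult_ac)
      qed
      ultimately show ?thesis by (auto intro: norm_le_weaken)
    qed
  qed
qed

lemma norm_le_1_integrable:
  assumes "norm_le 1 f B" "0 \<le> B"
  shows "integrable lborel f" "(\<integral>x. \<bar>f x\<bar> \<partial>lborel) \<le> B"
proof -
  have [measurable]: "f \<in> borel_measurable borel" and I: "(\<integral>\<^sup>+x. ennreal \<bar>f x\<bar> \<partial>lborel) \<le> ennreal B"
    using assms by (auto simp: norm_le_finite)
  show int: "integrable lborel f"
    by (rule integrableI_bounded) (use I in \<open>auto simp: less_top[symmetric] top_unique\<close>)
  have "ennreal (\<integral>x. \<bar>f x\<bar> \<partial>lborel) = (\<integral>\<^sup>+x. ennreal \<bar>f x\<bar> \<partial>lborel)"
    using int by (intro nn_integral_eq_integral[symmetric]) auto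
  then show "(\<integral>x. \<bar>f x\<bar> \<partial>lborel) \<le> B" using I assms(2) by (metis ennreal_le_iff)
qed

lemma L2norm_le: "norm_le 2 f B \<Longrightarrow> 0 \<le> B \<Longrightarrow> L2norm f \<le> B"
  unfolding norm_le_def L2norm_def by (metis enn2real_ennreal enn2real_mono ennreal_less_top)

lemma L2_densities_square_integral:
  assumes "f \<in> L2_densities"
  shows "integrable lborel (\<lambda>x. (f x)\<^sup>2)" "(\<integral>x. (f x)\<^sup>2 \<partial>lborel) = (L2norm f)\<^sup>2"
proof -
  have [measurable]: "f \<in> borel_measurable borel" using assms by (simp add: L2_densities_def)
  note n = L2_densities_norm[OF assms]
  show "integrable lborel (\<lambda>x. (f x)\<^sup>2)" by (rule integrableI_nonneg) (use n in auto)
  show "(\<integral>x. (f x)\<^sup>2 \<partial>lborel) = (L2norm f)\<^sup>2" using n by (subst integral_eq_nn_integral) auto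
qed

lemma L2_densitiesI:
  assumes "\<And>x. 0 \<le> f x" "integrable lborel f" "(\<integral>x. f x \<partial>lborel) = 1" "norm_le 2 f B"
  shows "f \<in> L2_densities"
proof -
  have "f \<in> borel_measurable borel" using assms(2) by auto
  moreover have "(\<integral>\<^sup>+x. ennreal (f x) \<partial>lborel) = 1" using assms by (simp add: nn_integral_eq_integral)
  moreover have "Lnorm 2 f < \<infinity>" using assms(4) by (auto simp: norm_le_def intro: le_less_trans)
  ultimately show ?thesis using assms(1) by (simp add: L2_densities_def)
qed

lemma exists_nat_above:
  assumes "finite (A :: real set)"
  obtains k :: nat where "\<And>x. x \<in> A \<Longrightarrow> x < real k"
proof -
  obtain k :: nat where "Max (insert 0 A) < real k" using reals_Archimedean2 by blast
  then have "x < real k" if "x \<in> A" for x using Max_ge[of "insert 0 A" x] assms that by auto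
  then show ?thesis by (rule that)
qed

text \<open>Everything is expressed through the volume S, so that its choice for given n is left to
  \<open>calibration\<close>. The factor exp(c1 n^2 S^(1 - 2b + E)) bounds the second moment of the
  likelihood ratio, and S^(1 - 2b) is the order of the squared distance between the two
  norms.\<close>

lemma class_lower_bound:
  fixes \<beta> \<gamma> :: "'d::finite \<Rightarrow> real" and r s :: "'d \<Rightarrow> ennreal"
  assumes \<theta>: "((\<beta>, r), q) \<in> Theta''" and \<theta>': "((\<gamma>, s), q') \<in> Theta''"
    and rq: "\<And>j. r j \<le> q" and sq: "\<And>j. s j \<le> q'" and qq: "q' \<le> q" "2 < q'"
    and \<rho>: "1 \<le> rho ((\<beta>, r), q) ((\<gamma>, s), q')"
    and L: "\<And>j. 0 < L j" "\<And>j. r j = 1 \<Longrightarrow> 1 \<le> L j" and Q: "0 < Q"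
    and L': "\<And>j. 0 < L' j" "\<And>j. s j = 1 \<Longrightarrow> 1 \<le> L' j" and Q': "0 < Q'"
  defines "b \<equiv> recip q" and "E \<equiv> inv_omega (\<beta>, r) - inv_beta (\<beta>, r) * recip q"
  obtains c1 c2 where "0 < c1" "0 < c2"
    "\<And>S n N A B. \<lbrakk>0 < S; S \<le> 1; 0 \<le> B; B * exp (c1 * (real n)\<^sup>2 * S powr (1 - 2 * b + E)) \<le> A; N \<in> estimators n\<rbrakk> \<Longrightarrow>
       ennreal (B * c2 * S powr (1 - 2 * b)) \<le> ennreal A * (risk n N (class_F (((\<gamma>, s), q'), (L', Q'))))\<^sup>2
         + ennreal B * (risk n N (class_F (((\<beta>, r), q), (L, Q))))\<^sup>2"
proof -
  note \<beta> = Theta''_exponents(1)[OF \<theta>] and r = Theta''_exponents(2)[OF \<theta>]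
  note \<gamma> = Theta''_exponents(1)[OF \<theta>'] and s = Theta''_exponents(2)[OF \<theta>']
  have q: "2 < q" using qq by simp
  have "(1 :: ennreal) < 2" using ennreal_less_iff[of 1 2] by simp
  then have "1 < q'" "1 < q" using qq(2) q by (blast intro: less_trans)+
  then have q1: "1 \<le> q" "1 \<le> q'" "1 < q" "1 < q'" by auto
  have b: "0 \<le> b" "b < 1 / 2"
    using recip_nonneg recip_strict_antimono[OF _ q] by (auto simp: b_def recip_2)
  define b' where "b' = recip q'"
  have bb': "b \<le> b'" unfolding b_def b'_def by (rule recip_antimono[OF q1(2) qq(1)])
  have rb: "b \<le> recip (r j)" for j unfolding b_def by (rule recip_antimono[OF r rq])
  have sb': "b' \<le> recip (s j)" for j unfolding b'_def by (rule recip_antimono[OF s sq])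
  define d where "d = CARD('d)"
  obtain k where k: "\<And>x. x \<in> range \<beta> \<union> range \<gamma> \<Longrightarrow> x < real k"
    by (rule exists_nat_above[of "range \<beta> \<union> range \<gamma>"]) auto
  have k\<beta>: "\<beta> j < real k" and k\<gamma>: "\<gamma> j < real k" for j by (auto intro: k)
  obtain \<psi> where \<psi>: "\<And>x. \<bar>\<psi> x\<bar> \<le> 1" "\<And>x. \<psi> x \<noteq> 0 \<Longrightarrow> 0 < x \<and> x < 1" "smooth_to k \<psi>"
    "(\<integral>x. \<psi> x \<partial>lborel) = 0" "integrable lborel \<psi>" "0 < (\<integral>x. (\<psi> x)\<^sup>2 \<partial>lborel)" and \<psi>m[measurable]: "\<psi> \<in> borel_measurable borel"
    by (rule mean_zero_bump_exists[of k]) blast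
  obtain \<phi> where \<phi>: "\<And>x. 0 \<le> \<phi> x" "\<And>x. \<phi> x \<le> 1" "\<And>x. \<phi> x \<noteq> 0 \<Longrightarrow> - 1 < x \<and> x < 2"
    "\<And>x. 0 \<le> x \<Longrightarrow> x \<le> 1 \<Longrightarrow> \<phi> x = 1" "smooth_to k \<phi>" and \<phi>m[measurable]: "\<phi> \<in> borel_measurable borel"
    by (rule plateau_exists[of k]) blast
  have \<phi>1: "\<bar>\<phi> y\<bar> \<le> 1" for y using \<phi>(1,2)[of y] by simp
  obtain C1 where C1: "0 \<le> C1" "\<And>u x. \<bar>(dif u ^^ k) \<psi> x\<bar> \<le> C1 * \<bar>u\<bar> ^ k" using \<psi>(3) by (auto simp: smooth_to_def)
  obtain C2 where C2: "0 \<le> C2" "\<And>u x. \<bar>(dif u ^^ k) \<phi> x\<bar> \<le> C2 * \<bar>u\<bar> ^ k" using \<phi>(5) by (auto simp: smooth_to_def)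
  define C where "C = C1 + C2 + 2 ^ k"
  have C: "\<bar>(dif u ^^ k) \<psi> x\<bar> \<le> C * \<bar>u\<bar> ^ k" "\<bar>(dif u ^^ k) \<phi> x\<bar> \<le> C * \<bar>u\<bar> ^ k" "2 ^ k \<le> C" for u x
  proof -
    have "C1 * \<bar>u\<bar> ^ k \<le> C * \<bar>u\<bar> ^ k" "C2 * \<bar>u\<bar> ^ k \<le> C * \<bar>u\<bar> ^ k"
      using C1(1) C2(1) by (intro mult_right_mono; simp add: C_def)+
    then show "\<bar>(dif u ^^ k) \<psi> x\<bar> \<le> C * \<bar>u\<bar> ^ k" "\<bar>(dif u ^^ k) \<phi> x\<bar> \<le> C * \<bar>u\<bar> ^ k"
      using C1(2)[of u x] C2(2)[of u x] by linarith+
    show "2 ^ k \<le> C" using C1(1) C2(1) by (simp add: C_def)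
  qed
  define K where "K = (real k + 1)\<^sup>2 * C"
  have K: "1 \<le> K"
  proof -
    have "1 \<le> (2 :: real) ^ k" by simp
    then have "1 \<le> C" using C(3) by linarith
    then have "1 * 1 \<le> (real k + 1)\<^sup>2 * C" by (intro mult_mono one_le_power) auto
    then show ?thesis by (simp add: K_def)
  qed
  define v where "v = (\<integral>x. (\<psi> x)\<^sup>2 \<partial>lborel)"
  have \<psi>2int: "integrable lborel (\<lambda>x. (\<psi> x)\<^sup>2)"
  proof (rule Bochner_Integration.integrable_bound[OF \<psi>(5)])
    have "(\<psi> x)\<^sup>2 \<le> \<bar>\<psi> x\<bar>" for x
      using mult_left_le[of "\<bar>\<psi> x\<bar>" "\<bar>\<psi> x\<bar>"] \<psi>(1)[of x] by (simp add: power2_eq_square)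
    then show "AE x in lborel. norm ((\<psi> x)\<^sup>2) \<le> norm (\<psi> x)" by auto
  qed simp
  have v: "0 < v" "v \<le> 1"
  proof -
    show "0 < v" using \<psi>(6) by (simp add: v_def)
    have "v \<le> (\<integral>x. indicator {0..1 :: real} x \<partial>lborel)" unfolding v_def
    proof (rule integral_mono[OF \<psi>2int])
      show "integrable lborel (indicator {0..1 :: real} :: real \<Rightarrow> real)" by (rule integrable_real_indicator) (auto simp: emeasure_lborel_Icc_eq)
      fix x :: real
      have "(\<psi> x)\<^sup>2 \<le> 1" using \<psi>(1)[of x] by (simp add: abs_square_le_1)
      then show "(\<psi> x)\<^sup>2 \<le> indicator {0..1} x" using \<psi>(2)[of x] by (cases "\<psi> x = 0") (auto split: split_indicator)
    qed
    then show "v \<le> 1" by simp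
  qed
  \<comment> \<open>A single m0 <= 1 below all radii of both classes; each of the three summands of
    a density receives a third of it.\<close>
  define Ls where "Ls = range L \<union> range L' \<union> {Q, Q', 1}"
  define m0 where "m0 = Min Ls"
  have m0: "0 < m0" "m0 \<le> x" if "x \<in> Ls" for x
  proof -
    have fin: "finite Ls" by (simp add: Ls_def)
    show "m0 \<le> x" unfolding m0_def using fin that by (rule Min_le)
    show "0 < m0" unfolding m0_def
      by (subst Min_gr_iff[OF fin]) (use L(1) Q L'(1) Q' in \<open>auto simp: Ls_def\<close>)
  qed
  have m0': "0 < m0" "m0 \<le> 1" "\<And>j. m0 \<le> L j" "\<And>j. m0 \<le> L' j" "m0 \<le> Q" "m0 \<le> Q'"
    using m0(1)[of 1] by (auto intro!: m0(2) simp: Ls_def)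
  \<comment> \<open>3^d is the volume of the support of the plateau, which extends from -t_l to 2
    t_l, relative to the box; K is the loss of \<open>bump_family\<close> for differences.\<close>
  define c where "c = m0 / (6 * 3 ^ d * K)"
  have c: "0 < c" "c * K * 3 ^ d = m0 / 6" using m0' K by (auto simp: c_def)
  have cle: "c * 3 ^ d \<le> m0 / 6" "c \<le> m0 / 6"
  proof -
    have "c * 3 ^ d * 1 \<le> c * 3 ^ d * K" using c(1) K by (intro mult_left_mono) auto
    then show "c * 3 ^ d \<le> m0 / 6" using c(2) by (simp add: mult_ac)
    moreover have "c * 1 \<le> c * 3 ^ d" using c(1) by (intro mult_left_mono) auto
    ultimately show "c \<le> m0 / 6" by simp
  qed
  have cK: "c * K \<le> m0 / 6"
  proof -
    have "c * K * 1 \<le> c * K * 3 ^ d" using c(1) K by (intro mult_left_mono) auto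
    then show ?thesis using c(2) by simp
  qed
  \<comment> \<open>v^d is the square integral of a normalised bump, 2^d is lost by rounding the
    number of bumps, and 5 3^d bounds the sum of the two norms in units of h sqrt S.\<close>
  define x0 where "x0 = v ^ d * c / (2 ^ d * (5 * 3 ^ d))"
  have x0: "0 < x0" using v c by (simp add: x0_def)
  show thesis
  proof (rule that[of "c\<^sup>2" "x0\<^sup>2 / 8"])
    show "0 < c\<^sup>2" "0 < x0\<^sup>2 / 8" using c x0 by auto
    fix S A B :: real and n and N :: "(nat \<Rightarrow> real ^ 'd) \<Rightarrow> real"
    assume S: "0 < S" "S \<le> 1" and B: "0 \<le> B" and AB: "B * exp (c\<^sup>2 * (real n)\<^sup>2 * S powr (1 - 2 * b + E)) \<le> A"
      and N: "N \<in> estimators n"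
    \<comment> \<open>Up to the constant, the largest height that an L_q ball permits on a set of
      volume S. Since S <= 1, the quantity h S^(1/\<tau>) is at most c whenever 1/\<tau> >=
      b.\<close>
    define h where "h = c * S powr (- b)"
    have h: "0 < h" using c S by (simp add: h_def)
    have hS: "h * S powr x = c * S powr (x - b)" for x
      using S by (simp add: h_def powr_diff powr_minus field_simps)
    have S1: "S powr x \<le> 1" if "0 \<le> x" for x using S that by (intro powr_le1) auto
    define a where "a l = 1 / \<beta> l * (recip (r l) - b)" for l
    define e where "e l = min (a l) (1 / \<gamma> l * (recip (s l) - b'))" for l
    define \<rho>' where "\<rho>' = (\<Sum>l\<in>UNIV. e l)"
    have \<rho>': "1 \<le> \<rho>'" using \<rho> by (simp add: \<rho>'_def e_def a_def b_def b'_def)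
    have a0: "0 \<le> a l" and e0: "0 \<le> e l" for l
      using rb[of l] sb'[of l] \<beta>[of l] \<gamma>[of l] by (auto simp: a_def e_def)
    \<comment> \<open>Dividing the exponents by \<rho>' gives the box the volume S. As S <= 1 and
      \<rho>' >= 1, this only lengthens the sides, so \<sigma>_l <= t_l and the edge is flat enough
      for both classes.\<close>
    define t where "t l = S powr (e l / \<rho>')" for l
    define \<sigma> where "\<sigma> l = S powr a l" for l
    have t: "0 < t l" "t l \<le> 1" and \<sigma>: "0 < \<sigma> l" for l
      using S e0[of l] \<rho>' by (auto simp: t_def \<sigma>_def intro!: S1)
    have e\<rho>: "e l / \<rho>' \<le> e l" for l
      using e0[of l] \<rho>' mult_left_mono[of 1 \<rho>' "e l"] by (simp add: divide_le_eq)
    have \<sigma>t: "\<sigma> l \<le> t l" for l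
    proof -
      have "e l \<le> a l" by (simp add: e_def)
      then show ?thesis using e\<rho>[of l] S unfolding \<sigma>_def t_def by (intro powr_mono') auto
    qed
    have prod_t: "(\<Prod>l\<in>UNIV. t l) = S"
      unfolding t_def using S \<rho>' by (subst powr_sum[symmetric]) (auto simp: \<rho>'_def[symmetric] sum_divide_distrib[symmetric])
    have prod_\<sigma>: "(\<Prod>l\<in>UNIV. \<sigma> l) = S powr E"
    proof -
      have "(\<Sum>l\<in>UNIV. a l) = E"
        by (simp add: a_def E_def b_def right_diff_distrib sum_subtractf sum_distrib_right)
      then show ?thesis unfolding \<sigma>_def using S by (subst powr_sum[symmetric]) auto
    qed
    have \<sigma>\<beta>: "\<sigma> l powr \<beta> l = S powr (recip (r l) - b)" for l
      using \<beta>[of l] by (simp add: \<sigma>_def powr_powr a_def)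
    have t\<beta>: "S powr (recip (r l) - b) \<le> t l powr \<beta> l" for l
      unfolding \<sigma>\<beta>[symmetric] using \<sigma>[of l] \<sigma>t[of l] \<beta>[of l] by (intro powr_mono2) auto
    \<comment> \<open>Here b <= b' enters: the sides are made for height S^(-b') in the second
      class, and S^(-b) is lower.\<close>
    have t\<gamma>: "S powr (recip (s l) - b) \<le> t l powr \<gamma> l" for l
    proof -
      have "e l / \<rho>' * \<gamma> l \<le> (1 / \<gamma> l * (recip (s l) - b')) * \<gamma> l"
        using e\<rho>[of l] \<gamma>[of l] by (intro mult_right_mono) (auto simp: e_def)
      then have "e l / \<rho>' * \<gamma> l \<le> recip (s l) - b" using \<gamma>[of l] bb' by simp
      then show ?thesis using S by (auto simp: t_def powr_powr intro!: powr_mono')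
    qed
    \<comment> \<open>At least one bump fits along each side, so rounding down loses at most a
      factor 2 per coordinate.\<close>
    define M where "M l = nat \<lfloor>t l / \<sigma> l\<rfloor>" for l
    have M: "real (M l) * \<sigma> l \<le> t l" "t l / (2 * \<sigma> l) \<le> real (M l)" for l
    proof -
      have 1: "1 \<le> t l / \<sigma> l" using \<sigma>t[of l] \<sigma>[of l] by simp
      then have Mf: "real (M l) = of_int \<lfloor>t l / \<sigma> l\<rfloor>" by (simp add: M_def)
      then have "real (M l) \<le> t l / \<sigma> l" "t l / \<sigma> l < real (M l) + 1" by linarith+
      moreover have "1 \<le> real (M l)" unfolding Mf using 1 by simp
      ultimately have "real (M l) \<le> t l / \<sigma> l" "t l / \<sigma> l \<le> 2 * real (M l)" by linarith+
      then show "real (M l) * \<sigma> l \<le> t l" "t l / (2 * \<sigma> l) \<le> real (M l)"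
        using \<sigma>[of l] by (simp_all add: pos_le_divide_eq pos_divide_le_eq mult_ac)
    qed
    define I where "I = (\<Pi>\<^sub>E l\<in>(UNIV :: 'd set). {..<M l})"
    have I: "finite I" unfolding I_def by (intro finite_PiE) auto
    have memI: "m l < M l" if "m \<in> I" for m l using that by (auto simp: I_def PiE_iff)
    have cardI: "real (card I) = (\<Prod>l\<in>UNIV. real (M l))" by (simp add: I_def card_PiE)
    have cardI_le: "real (card I) * S powr E \<le> S"
    proof -
      have "real (card I) * S powr E = (\<Prod>l\<in>UNIV. real (M l) * \<sigma> l)"
        unfolding cardI prod_\<sigma>[symmetric] by (simp add: prod.distrib)
      also have "\<dots> \<le> (\<Prod>l\<in>UNIV. t l)" using M(1) \<sigma> by (intro prod_mono) (auto simp: less_imp_le)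
      finally show ?thesis by (simp add: prod_t)
    qed
    have cardI_ge: "S / 2 ^ d \<le> real (card I) * S powr E"
    proof -
      have "S / 2 ^ d = (\<Prod>l\<in>UNIV. t l / 2)" by (simp add: prod_dividef prod_t d_def)
      also have "\<dots> \<le> (\<Prod>l\<in>UNIV. real (M l) * \<sigma> l)"
      proof (rule prod_mono)
        fix l
        have "t l / 2 \<le> real (M l) * \<sigma> l" using M(2)[of l] \<sigma>[of l] by (simp add: field_simps)
        then show "0 \<le> t l / 2 \<and> t l / 2 \<le> real (M l) * \<sigma> l" using t[of l] by simp
      qed
      also have "\<dots> = real (card I) * S powr E" unfolding cardI prod_\<sigma>[symmetric] by (simp add: prod.distrib)
      finally show ?thesis .
    qed
    define cell where "cell m l = \<sigma> l * real (m l)" for m and l :: 'd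
    define pb where "pb m = prod_bump \<psi> (cell m) \<sigma>" for m
    have [measurable]: "pb m \<in> borel_measurable borel" for m unfolding pb_def by measurable
    have pb_cell: "real (m l) < x $ l / \<sigma> l" "x $ l / \<sigma> l < real (m l) + 1" if "pb m x \<noteq> 0" for m x l
      using \<psi>(2)[OF prod_bump_nonzero[OF that[unfolded pb_def], of l]] \<sigma>[of l] by (auto simp: cell_def field_simps)
    have pb_box: "0 < x $ l" "x $ l < t l" if "m \<in> I" "pb m x \<noteq> 0" for m x l
    proof -
      have "real (m l) + 1 \<le> real (M l)" using memI[OF that(1), of l] by linarith
      then have "x $ l / \<sigma> l < real (M l)" using pb_cell(2)[OF that(2), of l] by linarith
      then show "x $ l < t l" using M(1)[of l] \<sigma>[of l] by (simp add: divide_less_eq)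
      have "0 < x $ l / \<sigma> l" using pb_cell(1)[OF that(2), of l] by linarith
      then show "0 < x $ l" using \<sigma>[of l] by (simp add: zero_less_divide_iff)
    qed
    have disj: "pb m x * pb m' x = 0" if "m \<noteq> m'" for m m' x
    proof (rule ccontr)
      assume "pb m x * pb m' x \<noteq> 0"
      then have nz: "pb m x \<noteq> 0" "pb m' x \<noteq> 0" by auto
      obtain l where "m l \<noteq> m' l" using \<open>m \<noteq> m'\<close> by auto
      then show False using pb_cell[OF nz(1), of l] pb_cell[OF nz(2), of l] by linarith
    qed
    define F3 where "F3 w = (\<lambda>x. \<Sum>m\<in>I. w m * pb m x)" for w :: "('d \<Rightarrow> nat) \<Rightarrow> real"
    define E3 where "E3 = (cbox (\<chi> l. 0) (\<chi> l. t l) :: (real ^ 'd) set)"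
    have E3: "emeasure lborel E3 \<le> ennreal S"
      unfolding E3_def using t(1) by (subst emeasure_cbox_cart) (auto simp: less_imp_le prod_t)
    have inE3: "x \<in> E3" if "m \<in> I" "pb m x \<noteq> 0" for m x
      using pb_box[OF that] by (auto simp: E3_def mem_box_cart less_imp_le)
    note fam3 = bump_family[where \<eta> = \<psi> and c = cell and \<sigma> = \<sigma> and I = I and k = k and C = C and E = E3 and V = S,
        folded pb_def, folded F3_def]
    have F3: "norm_le \<tau> (F3 w) (S powr recip \<tau>)" if "1 \<le> \<tau>" "\<And>m. m \<in> I \<Longrightarrow> \<bar>w m\<bar> \<le> 1" for \<tau> w
      using that S by (intro fam3(1) I \<sigma> \<psi>m \<psi>(1) C disj E3 inE3) (auto simp: E3_def)
    have F3d: "norm_le \<tau> ((diff_op u j ^^ k) (F3 w)) (K * S powr recip \<tau> * (\<bar>u\<bar> / \<sigma> j) powr \<alpha>)"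
      if "1 \<le> \<tau>" "\<And>m. m \<in> I \<Longrightarrow> \<bar>w m\<bar> \<le> 1" "0 < \<alpha>" "\<alpha> \<le> real k" for \<tau> w \<alpha> u j
      using that S unfolding K_def by (intro fam3(2) I \<sigma> \<psi>m \<psi>(1) C disj E3 inE3) (auto simp: E3_def)
    define F2 where "F2 = (\<lambda>x :: real ^ 'd. \<Sum>i\<in>{()}. 1 * prod_bump \<phi> (\<lambda>_. 0) t x)"
    have F2e: "F2 x = prod_bump \<phi> (\<lambda>_. 0) t x" for x by (simp add: F2_def)
    define E2 where "E2 = (cbox (\<chi> l. - t l) (\<chi> l. 2 * t l) :: (real ^ 'd) set)"
    have E2: "emeasure lborel E2 \<le> ennreal (3 ^ d * S)"
    proof -
      have "(\<Prod>l\<in>UNIV. 2 * t l - - t l) = 3 ^ d * S" by (simp add: prod.distrib d_def prod_t[symmetric])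
      moreover have "- t l \<le> 2 * t l" for l using t(1)[of l] by simp
      ultimately show ?thesis unfolding E2_def by (subst emeasure_cbox_cart) auto
    qed
    have F2_supp: "- t l < x $ l" "x $ l < 2 * t l" if "F2 x \<noteq> 0" for x l
      using \<phi>(3)[OF prod_bump_nonzero[OF that[unfolded F2e], of l]] t(1)[of l] by (auto simp: field_simps)
    have inE2: "x \<in> E2" if "prod_bump \<phi> (\<lambda>_. 0) t x \<noteq> 0" for x
      using F2_supp[of x] that by (auto simp: E2_def mem_box_cart less_imp_le F2e)
    note fam2 = bump_family[where \<eta> = \<phi> and c = "\<lambda>_ _. 0" and \<sigma> = t and I = "{()}" and w = "\<lambda>_. 1" and k = k and C = C
        and E = E2 and V = "3 ^ d * S", folded F2_def]
    have V2: "(3 ^ d * S) powr recip \<tau> \<le> 3 ^ d * S powr recip \<tau>" if "1 \<le> \<tau>" for \<tau>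
    proof -
      have "(3 ^ d :: real) powr recip \<tau> \<le> (3 ^ d) powr 1" using recip_le_one[OF that] by (intro powr_mono) auto
      then show ?thesis using S by (simp add: powr_mult mult_right_mono)
    qed
    have F2: "norm_le \<tau> F2 (3 ^ d * S powr recip \<tau>)" if "1 \<le> \<tau>" for \<tau>
    proof (rule norm_le_weaken[OF _ V2[OF that]])
      show "norm_le \<tau> F2 ((3 ^ d * S) powr recip \<tau>)"
        using that S by (intro fam2(1) t(1) \<phi>m \<phi>1 C E2 inE2) (auto simp: E2_def)
    qed
    have F2d: "norm_le \<tau> ((diff_op u j ^^ k) F2) (K * (3 ^ d * S powr recip \<tau>) * (\<bar>u\<bar> / t j) powr \<alpha>)"
      if "1 \<le> \<tau>" "0 < \<alpha>" "\<alpha> \<le> real k" for \<tau> \<alpha> u j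
    proof (rule norm_le_weaken)
      show "norm_le \<tau> ((diff_op u j ^^ k) F2) (K * (3 ^ d * S) powr recip \<tau> * (\<bar>u\<bar> / t j) powr \<alpha>)"
        using that S unfolding K_def by (intro fam2(2) t(1) \<phi>m \<phi>1 C E2 inE2) (auto simp: E2_def)
      show "K * (3 ^ d * S) powr recip \<tau> * (\<bar>u\<bar> / t j) powr \<alpha> \<le> K * (3 ^ d * S powr recip \<tau>) * (\<bar>u\<bar> / t j) powr \<alpha>"
        using V2[OF that(1)] K by (intro mult_right_mono mult_left_mono) auto
    qed
    \<comment> \<open>The bound h sqrt S keeps the spread part from dominating the L_2 norm; a large
      common part would turn the same difference of squared norms into a smaller difference of
      norms.\<close>
    define \<delta> where "\<delta> = min (m0 / 3) (h * sqrt S)"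
    have \<delta>: "0 < \<delta>" using m0' h S by (simp add: \<delta>_def)
    \<comment> \<open>Index 1 is left out, since the spread part has norm 1 there.\<close>
    define R where "R = {2, q, q'} \<union> (range r \<union> range s - {1})"
    obtain p where p: "\<And>x. 0 \<le> p x" "integrable lborel p" "(\<integral>x. p x \<partial>lborel) = 1"
      "\<And>x l. p (x :: real ^ 'd) \<noteq> 0 \<Longrightarrow> 2 < x $ l" "\<And>\<tau>. \<tau> \<in> R \<Longrightarrow> norm_le \<tau> p \<delta>"
      "\<And>\<tau> \<alpha> j u. (\<tau>, \<alpha>) \<in> range (\<lambda>j. (r j, \<beta> j)) \<union> range (\<lambda>j. (s j, \<gamma> j)) \<Longrightarrow> norm_le \<tau> ((diff_op u j ^^ k) p) (\<delta> * \<bar>u\<bar> powr \<alpha>)"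
    proof (rule spread_density[of R "range (\<lambda>j. (r j, \<beta> j)) \<union> range (\<lambda>j. (s j, \<gamma> j))" k \<delta>])
      show "finite R" by (simp add: R_def)
      show "1 < \<tau>" if "\<tau> \<in> R" for \<tau> using that q1 r s by (auto simp: R_def less_le)
      show "1 \<le> \<tau> \<and> 0 < \<alpha> \<and> \<alpha> \<le> real k" if "(\<tau>, \<alpha>) \<in> range (\<lambda>j. (r j, \<beta> j)) \<union> range (\<lambda>j. (s j, \<gamma> j))" for \<tau> \<alpha>
        using that r s \<beta> \<gamma> k\<beta> k\<gamma> by (auto intro: less_imp_le)
    qed (use \<delta> in auto)
    \<comment> \<open>The mass of the plateau; the spread part receives the remaining 1 -
      \<mu>.\<close>
    define \<mu> where "\<mu> = h * (\<integral>x. F2 x \<partial>lborel)"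
    have F20: "0 \<le> F2 x" for x unfolding F2e prod_bump_def by (intro prod_nonneg) (auto simp: \<phi>(1))
    have recip1: "recip 1 = 1" using recip_finite[of 1] by simp
    have F2int: "integrable lborel F2" "(\<integral>x. F2 x \<partial>lborel) \<le> 3 ^ d * S"
      using norm_le_1_integrable[OF F2[of 1]] F20 S by (auto simp: recip1)
    have \<mu>: "0 \<le> \<mu>" "\<mu> \<le> 1"
    proof -
      show "0 \<le> \<mu>" using h F20 by (simp add: \<mu>_def integral_nonneg_AE)
      have "\<mu> \<le> h * (3 ^ d * S)" unfolding \<mu>_def using F2int(2) h by (intro mult_left_mono) auto
      also have "\<dots> = 3 ^ d * (c * S powr (1 - b))" using hS[of 1] S by simp
      also have "\<dots> \<le> 3 ^ d * (c * 1)" using b c S1[of "1 - b"] by (intro mult_left_mono) auto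
      finally show "\<mu> \<le> 1" using cle m0' by (simp add: mult.commute)
    qed
    define p1 where "p1 = (\<lambda>x. (1 - \<mu>) * p x)"
    define p2 where "p2 = (\<lambda>x. h * F2 x)"
    define p3 where "p3 w = (\<lambda>x. h * F3 w x)" for w
    \<comment> \<open>Fills the place of the perturbation when \<open>nikolskii_three\<close> is
      applied to the null density.\<close>
    define zero where "zero = (\<lambda>x :: real ^ 'd. 0 :: real)"
    have scale: "\<bar>1 - \<mu>\<bar> * X \<le> X" if "0 \<le> X" for X using \<mu> that by (intro mult_left_le_one_le) auto
    have p1n: "norm_le \<tau> p1 \<delta>" if "\<tau> \<in> R" for \<tau>
    proof -
      have "1 \<le> \<tau>" using that q1 r s by (auto simp: R_def)
      from norm_le_cmult[OF this _ p(5)[OF that], of "1 - \<mu>"] \<delta> scale[of \<delta>] show ?thesis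
        unfolding p1_def by (auto intro: norm_le_weaken)
    qed
    have p1d: "norm_le \<tau> ((diff_op u j ^^ k) p1) (\<delta> * \<bar>u\<bar> powr \<alpha>)"
      if "(\<tau>, \<alpha>) \<in> range (\<lambda>j. (r j, \<beta> j)) \<union> range (\<lambda>j. (s j, \<gamma> j))" for \<tau> \<alpha> j u
    proof -
      have "1 \<le> \<tau>" using that r s by auto
      from norm_le_cmult[OF this _ p(6)[OF that, of u j], of "1 - \<mu>"] \<delta> scale[of "\<delta> * \<bar>u\<bar> powr \<alpha>"] show ?thesis
        unfolding p1_def diff_op_power_cmult by (auto intro: norm_le_weaken)
    qed
    have hb: "h * S powr recip \<tau> \<le> c" if "b \<le> recip \<tau>" for \<tau>
      unfolding hS using S1[of "recip \<tau> - b"] that c by (intro mult_left_le) auto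
    have p2n: "norm_le \<tau> p2 (m0 / 3)" if "1 \<le> \<tau>" "b \<le> recip \<tau>" for \<tau>
    proof (rule norm_le_weaken)
      show "norm_le \<tau> p2 (\<bar>h\<bar> * (3 ^ d * S powr recip \<tau>))" unfolding p2_def by (rule norm_le_cmult[OF that(1) _ F2[OF that(1)]]) simp
      have "3 ^ d * (h * S powr recip \<tau>) \<le> 3 ^ d * c" using hb[OF that(2)] by (intro mult_left_mono) auto
      also have "\<dots> = c * 3 ^ d" by simp
      also have "\<dots> \<le> m0 / 3" using cle(1) m0'(1) by linarith
      finally show "\<bar>h\<bar> * (3 ^ d * S powr recip \<tau>) \<le> m0 / 3" using h by (simp add: mult_ac)
    qed
    have p3n: "norm_le \<tau> (p3 w) (m0 / 3)" if "1 \<le> \<tau>" "b \<le> recip \<tau>" "\<And>m. m \<in> I \<Longrightarrow> \<bar>w m\<bar> \<le> 1" for \<tau> w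
    proof (rule norm_le_weaken)
      show "norm_le \<tau> (p3 w) (\<bar>h\<bar> * S powr recip \<tau>)" unfolding p3_def by (rule norm_le_cmult[OF that(1) _ F3[OF that(1,3)]]) simp_all
      show "\<bar>h\<bar> * S powr recip \<tau> \<le> m0 / 3" using hb[OF that(2)] h cle m0' by simp
    qed
    \<comment> \<open>The common estimate for plateau and perturbation: a difference at width y
      costs y^(-\<alpha>), and the width is large enough for this to be compensated by S^(1/\<tau> -
      b).\<close>
    have quot: "h * S powr recip \<tau> * (\<bar>u\<bar> / y) powr \<alpha> \<le> c * \<bar>u\<bar> powr \<alpha>" if "0 < y" "S powr (recip \<tau> - b) \<le> y powr \<alpha>" for \<tau> u y \<alpha>
    proof -
      have "h * S powr recip \<tau> * (\<bar>u\<bar> / y) powr \<alpha> = c * (S powr (recip \<tau> - b) / y powr \<alpha>) * \<bar>u\<bar> powr \<alpha>"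
        unfolding hS using that(1) by (simp add: powr_divide)
      also have "\<dots> \<le> c * 1 * \<bar>u\<bar> powr \<alpha>"
        using that c by (intro mult_right_mono mult_left_mono) (auto simp: divide_le_eq)
      finally show ?thesis by simp
    qed
    have p2d: "norm_le \<tau> ((diff_op u j ^^ k) p2) (m0 / 3 * \<bar>u\<bar> powr \<alpha>)"
      if \<tau>: "1 \<le> \<tau>" "0 < \<alpha>" "\<alpha> \<le> real k" "S powr (recip \<tau> - b) \<le> t j powr \<alpha>" for \<tau> \<alpha> u j
    proof (rule norm_le_weaken)
      show "norm_le \<tau> ((diff_op u j ^^ k) p2) (\<bar>h\<bar> * (K * (3 ^ d * S powr recip \<tau>) * (\<bar>u\<bar> / t j) powr \<alpha>))"
        unfolding p2_def diff_op_power_cmult by (rule norm_le_cmult[OF \<tau>(1) _ F2d[OF \<tau>(1-3)]]) (use K in simp)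
      have "K * 3 ^ d * (h * S powr recip \<tau> * (\<bar>u\<bar> / t j) powr \<alpha>) \<le> K * 3 ^ d * (c * \<bar>u\<bar> powr \<alpha>)"
        using K by (intro mult_left_mono quot t(1) \<tau>(4)) auto
      also have "\<dots> = m0 / 6 * \<bar>u\<bar> powr \<alpha>" unfolding c(2)[symmetric] by simp
      also have "\<dots> \<le> m0 / 3 * \<bar>u\<bar> powr \<alpha>" using m0' by (intro mult_right_mono) auto
      finally show "\<bar>h\<bar> * (K * (3 ^ d * S powr recip \<tau>) * (\<bar>u\<bar> / t j) powr \<alpha>) \<le> m0 / 3 * \<bar>u\<bar> powr \<alpha>"
        using h by (simp add: mult_ac)
    qed
    have p3d: "norm_le (r j) ((diff_op u j ^^ k) (p3 w)) (m0 / 3 * \<bar>u\<bar> powr \<beta> j)"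
      if w: "\<And>m. m \<in> I \<Longrightarrow> \<bar>w m\<bar> \<le> 1" for u j w
    proof (rule norm_le_weaken)
      show "norm_le (r j) ((diff_op u j ^^ k) (p3 w)) (\<bar>h\<bar> * (K * S powr recip (r j) * (\<bar>u\<bar> / \<sigma> j) powr \<beta> j))"
        unfolding p3_def diff_op_power_cmult
        by (rule norm_le_cmult[OF r _ F3d[OF r w \<beta> less_imp_le[OF k\<beta>]]]) (use K in simp_all)
      have "K * (h * S powr recip (r j) * (\<bar>u\<bar> / \<sigma> j) powr \<beta> j) \<le> K * (c * \<bar>u\<bar> powr \<beta> j)"
        using K by (intro mult_left_mono quot \<sigma>) (auto simp: \<sigma>\<beta>)
      also have "\<dots> = c * K * \<bar>u\<bar> powr \<beta> j" by simp
      also have "\<dots> \<le> m0 / 3 * \<bar>u\<bar> powr \<beta> j" using m0' cK by (intro mult_right_mono) auto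
      finally show "\<bar>h\<bar> * (K * S powr recip (r j) * (\<bar>u\<bar> / \<sigma> j) powr \<beta> j) \<le> m0 / 3 * \<bar>u\<bar> powr \<beta> j"
        using h by (simp add: mult_ac)
    qed
    have \<delta>3: "\<delta> \<le> m0 / 3" by (simp add: \<delta>_def)
    define f0 where "f0 = (\<lambda>x. p1 x + p2 x)"
    define fw where "fw w = (\<lambda>x. p1 x + p2 x + p3 w x)" for w
    define G where "G m = (\<lambda>x. h * pb m x)" for m
    have fw_eq: "(\<lambda>x. f0 x + (\<Sum>m\<in>I. w m * G m x)) = fw w" for w
      by (rule ext) (simp add: f0_def fw_def p3_def F3_def G_def sum_distrib_left mult.left_commute)
    have pb1: "\<bar>pb m x\<bar> \<le> 1" for m x unfolding pb_def by (rule prod_bump_abs_le[OF \<psi>(1)])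
    have Gh: "\<bar>G m x\<bar> \<le> h" for m x using pb1[of m x] h by (simp add: G_def abs_mult mult_left_le)
    have Gf: "f0 x = h" if "m \<in> I" "G m x \<noteq> 0" for m x
    proof -
      have nz: "pb m x \<noteq> 0" using that(2) by (auto simp: G_def)
      note box = pb_box[OF that(1) nz]
      have "p x = 0"
      proof (rule ccontr)
        assume "p x \<noteq> 0"
        then have "2 < x $ undefined" by (rule p(4))
        then show False using box(2)[of undefined] t(2)[of undefined] by linarith
      qed
      moreover have "F2 x = 1" unfolding F2e prod_bump_def
        using box t(1) by (intro prod.neutral) (auto intro!: \<phi>(4) simp: less_imp_le)
      ultimately show ?thesis by (simp add: f0_def p1_def p2_def)
    qed
    have f00: "0 \<le> f0 x" for x using p(1) \<mu> h F20 by (simp add: f0_def p1_def p2_def)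
    have f0int: "integrable lborel f0" "(\<integral>x. f0 x \<partial>lborel) = 1"
      using p(2,3) F2int by (simp_all add: f0_def p1_def p2_def \<mu>_def)
    have R2: "2 \<in> R" "q \<in> R" "q' \<in> R" by (auto simp: R_def)
    have \<delta>h: "\<delta> \<le> h * sqrt S" by (simp add: \<delta>_def)
    have p1_2: "norm_le 2 p1 (h * sqrt S)" by (rule norm_le_weaken[OF p1n[OF R2(1)] \<delta>h])
    have p2_2: "norm_le 2 p2 (h * (3 ^ d * sqrt S))"
      using norm_le_cmult[OF _ _ F2[of 2], of h] h S by (simp add: p2_def recip_2 powr_half_sqrt)
    have p3_2: "norm_le 2 (p3 w) (h * sqrt S)" if "\<And>m. m \<in> I \<Longrightarrow> \<bar>w m\<bar> \<le> 1" for w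
      using norm_le_cmult[OF _ _ F3[of 2 w], of h] h S that by (simp add: p3_def recip_2 powr_half_sqrt)
    have f0_2: "norm_le 2 f0 (h * sqrt S + h * (3 ^ d * sqrt S))"
      unfolding f0_def using h S by (intro norm_le_add p1_2 p2_2) auto
    have f0L: "f0 \<in> L2_densities" by (rule L2_densitiesI[OF f00 f0int f0_2])
    have Gint: "integrable lborel (G m)" "(\<integral>x. G m x \<partial>lborel) = 0" "(\<integral>x. (G m x)\<^sup>2 \<partial>lborel) = h\<^sup>2 * (S powr E * v ^ d)" for m
    proof -
      have "0 < d" by (simp add: d_def)
      then show "integrable lborel (G m)" "(\<integral>x. G m x \<partial>lborel) = 0"
        using prod_bump_integral[of \<sigma> \<psi> "cell m", OF \<sigma> \<psi>(5)] \<psi>(4) by (auto simp: G_def pb_def d_def zero_power)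
      show "(\<integral>x. (G m x)\<^sup>2 \<partial>lborel) = h\<^sup>2 * (S powr E * v ^ d)"
        using prod_bump_integral(2)[of \<sigma> "\<lambda>y. (\<psi> y)\<^sup>2" "cell m", OF \<sigma> \<psi>2int]
        by (simp add: G_def pb_def power_mult_distrib prod_bump_square prod_\<sigma> v_def d_def)
    qed
    define W where "W = h\<^sup>2 * (S powr E * v ^ d)"
    have pt: "(\<exists>m\<in>I. pb m x \<noteq> 0 \<and> F3 w x = w m * pb m x \<and> (\<Sum>m\<in>I. (G m x)\<^sup>2) = (G m x)\<^sup>2) \<or> (\<forall>m\<in>I. pb m x = 0)" for w x
    proof (cases "\<forall>m\<in>I. pb m x = 0")
      case False
      then obtain m where m: "m \<in> I" "pb m x \<noteq> 0" by blast
      have z: "pb m' x = 0" if "m' \<in> I - {m}" for m' using disj[of m m' x] m that by auto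
      have "F3 w x = w m * pb m x" unfolding F3_def by (subst sum.remove[OF I m(1)]) (simp add: z)
      moreover have "(\<Sum>m\<in>I. (G m x)\<^sup>2) = (G m x)\<^sup>2" by (subst sum.remove[OF I m(1)]) (simp add: z G_def)
      ultimately show ?thesis using m by blast
    qed simp
    have fw_facts: "fw w \<in> L2_densities" "fw w \<in> class_F (((\<beta>, r), q), (L, Q))" "(L2norm (fw w))\<^sup>2 = (L2norm f0)\<^sup>2 + real (card I) * W"
      "L2norm (fw w) \<le> h * sqrt S + h * (3 ^ d * sqrt S) + h * sqrt S"
      if w: "w \<in> I \<rightarrow>\<^sub>E {1, - 1}" for w
    proof -
      have w1: "\<bar>w m\<bar> = 1" "(w m)\<^sup>2 = 1" if "m \<in> I" for m using w that by (fastforce simp: PiE_iff)+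
      have w1': "\<bar>w m\<bar> \<le> 1" if "m \<in> I" for m using w1[OF that] by simp
      have fw0: "0 \<le> fw w x" for x
        using pt[of x w]
      proof (elim disjE bexE conjE)
        fix m assume m: "m \<in> I" "pb m x \<noteq> 0" "F3 w x = w m * pb m x"
        have "f0 x = h" using Gf[OF m(1), of x] m(2) h by (simp add: G_def)
        moreover have "\<bar>w m * pb m x\<bar> \<le> 1" using w1(1)[OF m(1)] pb1[of m x] by (simp add: abs_mult)
        then have "- 1 \<le> w m * pb m x" by linarith
        then have "h * (- 1) \<le> h * (w m * pb m x)" using h by (intro mult_left_mono) auto
        ultimately show ?thesis using m(3) by (simp add: fw_def f0_def p3_def)
      next
        assume "\<forall>m\<in>I. pb m x = 0"
        then show ?thesis using f00[of x] by (simp add: fw_def f0_def p3_def F3_def)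
      qed
      have int: "integrable lborel (fw w)" "(\<integral>x. fw w x \<partial>lborel) = 1"
        unfolding fw_eq[symmetric] using f0int Gint by simp_all
      have n2: "norm_le 2 (fw w) (h * sqrt S + h * (3 ^ d * sqrt S) + h * sqrt S)"
        unfolding fw_def using h S w1' by (intro norm_le_add p1_2 p2_2 p3_2) auto
      show dens: "fw w \<in> L2_densities" by (rule L2_densitiesI[OF fw0 int n2])
      show "L2norm (fw w) \<le> h * sqrt S + h * (3 ^ d * sqrt S) + h * sqrt S"
        using h S by (intro L2norm_le[OF n2]) auto
      have "fw w \<in> nikolskii r \<beta> L"
      proof (rule nikolskii_three[OF _ dens r L k\<beta>])
        show "fw w = (\<lambda>x. p1 x + p2 x + p3 w x)" by (simp add: fw_def)
        fix j g u assume g: "g \<in> {p1, p2, p3 w}"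
        have mL: "m0 / 3 \<le> L j / 3" using m0'(3)[of j] by simp
        show "norm_le (r j) g (L j / 3)" if "r j \<noteq> 1"
        proof -
          have "r j \<in> R" using that by (auto simp: R_def)
          then have "norm_le (r j) g (m0 / 3)"
            using g norm_le_weaken[OF p1n \<delta>3] p2n[OF r rb] p3n[OF r rb w1'] by auto
          then show ?thesis using mL by (rule norm_le_weaken)
        qed
        have "norm_le (r j) ((diff_op u j ^^ k) p1) (m0 / 3 * \<bar>u\<bar> powr \<beta> j)"
          by (rule norm_le_weaken[OF p1d[of "r j" "\<beta> j"] mult_right_mono[OF \<delta>3]]) auto
        then have "norm_le (r j) ((diff_op u j ^^ k) g) (m0 / 3 * \<bar>u\<bar> powr \<beta> j)"
          using g p2d[OF r \<beta> less_imp_le[OF k\<beta>] t\<beta>] p3d[OF w1'] by auto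
        then show "norm_le (r j) ((diff_op u j ^^ k) g) (L j / 3 * \<bar>u\<bar> powr \<beta> j)"
          by (rule norm_le_weaken) (use mL in \<open>intro mult_right_mono; simp\<close>)
      qed
      moreover have "norm_le q (fw w) (m0 / 3 + m0 / 3 + m0 / 3)"
        unfolding fw_def using m0' q1 w1' p2n[OF q1(1)] p3n[OF q1(1)] norm_le_weaken[OF p1n[OF R2(2)] \<delta>3]
        by (intro norm_le_add) (auto simp: b_def)
      then have "norm_le q (fw w) Q" by (rule norm_le_weaken) (use m0' in simp)
      ultimately show "fw w \<in> class_F (((\<beta>, r), q), (L, Q))" by (simp add: Lball_def norm_le_def)
      \<comment> \<open>On the support of a bump f0 is the constant h, so the mixed term is linear
        in the bumps and integrates to 0. The norm is therefore the same for all sign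
        vectors.\<close>
      have sq: "(fw w x)\<^sup>2 = (f0 x)\<^sup>2 + 2 * h * (\<Sum>m\<in>I. w m * G m x) + (\<Sum>m\<in>I. (G m x)\<^sup>2)" for x
        using pt[of x w]
      proof (elim disjE bexE conjE)
        fix m assume m: "m \<in> I" "pb m x \<noteq> 0" "F3 w x = w m * pb m x" "(\<Sum>m\<in>I. (G m x)\<^sup>2) = (G m x)\<^sup>2"
        have f: "f0 x = h" using Gf[OF m(1), of x] m(2) h by (simp add: G_def)
        have s: "(\<Sum>m\<in>I. w m * G m x) = h * F3 w x" by (simp add: F3_def G_def sum_distrib_left mult.left_commute)
        have "(h * F3 w x)\<^sup>2 = (G m x)\<^sup>2" using w1(2)[OF m(1)] by (simp add: m(3) G_def power_mult_distrib)
        then show ?thesis unfolding fw_eq[symmetric] s m(4) f by (simp add: power2_sum)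
      next
        assume "\<forall>m\<in>I. pb m x = 0"
        then show ?thesis unfolding fw_eq[symmetric] by (simp add: G_def)
      qed
      \<comment> \<open>The integral of a function that is not integrable is 0 by convention, so the
        positive value in \<open>Gint\<close> already shows integrability.\<close>
      have G2int: "integrable lborel (\<lambda>x. (G m x)\<^sup>2)" for m
      proof (rule ccontr)
        assume "\<not> integrable lborel (\<lambda>x. (G m x)\<^sup>2)"
        then have "(\<integral>x. (G m x)\<^sup>2 \<partial>lborel) = 0" by (simp add: not_integrable_integral_eq)
        then show False using Gint(3)[of m] h S v by simp
      qed
      have "(L2norm (fw w))\<^sup>2 = (\<integral>x. (f0 x)\<^sup>2 + 2 * h * (\<Sum>m\<in>I. w m * G m x) + (\<Sum>m\<in>I. (G m x)\<^sup>2) \<partial>lborel)"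
        unfolding L2_densities_square_integral(2)[OF dens, symmetric] sq ..
      also have "\<dots> = (L2norm f0)\<^sup>2 + real (card I) * W"
        using L2_densities_square_integral[OF f0L] Gint G2int by (simp add: W_def)
      finally show "(L2norm (fw w))\<^sup>2 = (L2norm f0)\<^sup>2 + real (card I) * W" .
    qed
    have f0F: "f0 \<in> class_F (((\<gamma>, s), q'), (L', Q'))"
    proof -
      have zd: "(diff_op u j ^^ k) zero = zero" for u j
        unfolding zero_def by (rule ext, subst diff_op_power_expand) simp
      have sb: "b \<le> recip (s j)" for j using bb' sb'[of j] by simp
      have "f0 \<in> nikolskii s \<gamma> L'"
      proof (rule nikolskii_three[OF _ f0L s L' k\<gamma>])
        show "f0 = (\<lambda>x. p1 x + p2 x + zero x)" by (simp add: f0_def zero_def)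
        fix j g u assume g: "g \<in> {p1, p2, zero}"
        have mL: "m0 / 3 \<le> L' j / 3" using m0'(4)[of j] by simp
        show "norm_le (s j) g (L' j / 3)" if "s j \<noteq> 1"
        proof -
          have "s j \<in> R" using that by (auto simp: R_def)
          then have "norm_le (s j) g (m0 / 3)"
            using g norm_le_weaken[OF p1n \<delta>3] p2n[OF s sb] norm_le_zero[OF s, of "m0 / 3"] m0' by (auto simp: zero_def)
          then show ?thesis using mL by (rule norm_le_weaken)
        qed
        have "norm_le (s j) ((diff_op u j ^^ k) p1) (m0 / 3 * \<bar>u\<bar> powr \<gamma> j)"
          by (rule norm_le_weaken[OF p1d[of "s j" "\<gamma> j"] mult_right_mono[OF \<delta>3]]) auto
        then have "norm_le (s j) ((diff_op u j ^^ k) g) (m0 / 3 * \<bar>u\<bar> powr \<gamma> j)"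
          using g p2d[OF s \<gamma> less_imp_le[OF k\<gamma>] t\<gamma>] norm_le_zero[OF s, of "m0 / 3 * \<bar>u\<bar> powr \<gamma> j"] m0'
          by (auto simp: zd) (simp add: zero_def)
        then show "norm_le (s j) ((diff_op u j ^^ k) g) (L' j / 3 * \<bar>u\<bar> powr \<gamma> j)"
          by (rule norm_le_weaken) (use mL in \<open>intro mult_right_mono; simp\<close>)
      qed
      moreover have "norm_le q' f0 (m0 / 3 + m0 / 3)"
        unfolding f0_def using m0' q1 p2n[OF q1(2)] norm_le_weaken[OF p1n[OF R2(3)] \<delta>3] bb'
        by (intro norm_le_add) (auto simp: b'_def)
      then have "norm_le q' f0 Q'" by (rule norm_le_weaken) (use m0' in simp)
      ultimately show ?thesis by (simp add: Lball_def norm_le_def)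
    qed
    define bw where "bw = sqrt ((L2norm f0)\<^sup>2 + real (card I) * W)"
    have cardW: "S / 2 ^ d * (h\<^sup>2 * v ^ d) \<le> real (card I) * W"
    proof -
      have "S / 2 ^ d * (h\<^sup>2 * v ^ d) \<le> (real (card I) * S powr E) * (h\<^sup>2 * v ^ d)"
        using cardI_ge v by (intro mult_right_mono) auto
      then show ?thesis by (simp add: W_def mult_ac)
    qed
    have L2f0: "0 < L2norm f0" by (rule L2_densities_norm(2)[OF f0L])
    have bw_eq: "L2norm (fw w) = bw" if "w \<in> I \<rightarrow>\<^sub>E {1, - 1}" for w
      using fw_facts(3)[OF that] L2_densities_norm(2)[OF fw_facts(1)[OF that]] unfolding bw_def
      by (metis less_imp_le real_sqrt_abs abs_of_nonneg)
    have hs: "0 < h * sqrt S" using h S by simp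
    have three: "(1 :: real) \<le> 3 ^ d" by simp
    \<comment> \<open>The difference of the squared norms is at least of order S h^2, and the sum of
      the norms is at most of order h sqrt S; the quotient is of order h sqrt S = c S^(1/2 -
      b).\<close>
    have gap: "x0 * S powr (1 / 2 - b) \<le> bw - L2norm f0"
    proof -
      have "(\<lambda>m. if m \<in> I then 1 else undefined) \<in> I \<rightarrow>\<^sub>E {1, - 1 :: real}" by auto
      from fw_facts(4)[OF this] have bw_le: "bw \<le> h * sqrt S + h * (3 ^ d * sqrt S) + h * sqrt S"
        unfolding bw_eq[OF \<open>_ \<in> I \<rightarrow>\<^sub>E {1, - 1 :: real}\<close>] .
      have a_le: "L2norm f0 \<le> h * sqrt S + h * (3 ^ d * sqrt S)" using h S by (intro L2norm_le[OF f0_2]) auto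
      have sum_le: "bw + L2norm f0 \<le> 5 * 3 ^ d * (h * sqrt S)"
        using bw_le a_le mult_right_mono[OF three less_imp_le[OF hs]] by (simp add: algebra_simps)
      have W0: "0 \<le> real (card I) * W" using S v by (simp add: W_def)
      have "(bw - L2norm f0) * (bw + L2norm f0) = real (card I) * W"
        using W0 by (simp add: bw_def power2_eq_square algebra_simps flip: real_sqrt_mult)
      moreover have "0 \<le> bw - L2norm f0" unfolding bw_def using W0 L2f0 by (simp add: real_le_rsqrt)
      ultimately have "real (card I) * W \<le> (bw - L2norm f0) * (5 * 3 ^ d * (h * sqrt S))"
        using sum_le by (metis mult_left_mono)
      with cardW have "S / 2 ^ d * (h\<^sup>2 * v ^ d) \<le> (bw - L2norm f0) * (5 * 3 ^ d * (h * sqrt S))" by linarith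
      moreover have "S / 2 ^ d * (h\<^sup>2 * v ^ d) = (h * sqrt S * v ^ d / (2 ^ d * (5 * 3 ^ d))) * (5 * 3 ^ d * (h * sqrt S))"
        using S by (simp add: power2_eq_square)
      ultimately have "(h * sqrt S * v ^ d / (2 ^ d * (5 * 3 ^ d))) * (5 * 3 ^ d * (h * sqrt S))
          \<le> (bw - L2norm f0) * (5 * 3 ^ d * (h * sqrt S))" by (simp only:)
      then have "h * sqrt S * v ^ d / (2 ^ d * (5 * 3 ^ d)) \<le> bw - L2norm f0"
        by (rule mult_right_le_imp_le) (use hs in simp)
      moreover have "h * sqrt S = c * S powr (1 / 2 - b)" using hS[of "1 / 2"] S by (simp add: powr_half_sqrt)
      ultimately show ?thesis by (simp add: x0_def mult_ac)
    qed
    have gap0: "0 < x0 * S powr (1 / 2 - b)" using x0 S by simp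
    have "ennreal (B * (bw - L2norm f0)\<^sup>2 / 8) \<le> ennreal A * (risk n N (class_F (((\<gamma>, s), q'), (L', Q'))))\<^sup>2
         + ennreal B * (risk n N (class_F (((\<beta>, r), q), (L, Q))))\<^sup>2"
    proof (rule mixture_lower_bound[OF I h f0L f0F refl, where G = G and W = W])
      show "G i \<in> borel_measurable borel" for i unfolding G_def by measurable
      show "G i x * G j x = 0" if "i \<noteq> j" for i j x using disj[OF that, of x] by (auto simp: G_def)
      show "L2norm f0 < bw" using gap gap0 by linarith
      show "B * exp (real (card I) * (real n * (W / h))\<^sup>2) \<le> A"
      proof -
        \<comment> \<open>The number of bumps is at most S / S^E, and each has W / h at most h S^E;
          together this gives S h^2 S^E with h^2 = c^2 S^(-2b).\<close>
        have "real (card I) * (W / h)\<^sup>2 = (real (card I) * S powr E) * (h\<^sup>2 * S powr E * (v ^ d)\<^sup>2)"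
          using h by (simp add: W_def power2_eq_square)
        also have "\<dots> \<le> S * (h\<^sup>2 * S powr E * 1)"
          using cardI_le v S by (intro mult_mono mult_left_mono power_le_one) auto
        also have "\<dots> = c\<^sup>2 * S powr (1 - 2 * b + E)"
          using S by (simp add: h_def power_mult_distrib powr_add powr_diff powr_minus powr_powr field_simps flip: powr_numeral)
        finally have "(real n)\<^sup>2 * (real (card I) * (W / h)\<^sup>2) \<le> (real n)\<^sup>2 * (c\<^sup>2 * S powr (1 - 2 * b + E))"
          by (rule mult_left_mono) simp
        moreover have "real (card I) * (real n * (W / h))\<^sup>2 = (real n)\<^sup>2 * (real (card I) * (W / h)\<^sup>2)"
          by (simp only: power_mult_distrib mult.left_commute)
        moreover have "c\<^sup>2 * (real n)\<^sup>2 * S powr (1 - 2 * b + E) = (real n)\<^sup>2 * (c\<^sup>2 * S powr (1 - 2 * b + E))"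
          by (simp only: mult_ac)
        ultimately have "exp (real (card I) * (real n * (W / h))\<^sup>2) \<le> exp (c\<^sup>2 * (real n)\<^sup>2 * S powr (1 - 2 * b + E))"
          by (simp only: exp_le_cancel_iff)
        then show ?thesis using AB B by (meson mult_left_mono order_trans)
      qed
      show "(\<integral>x. (G i x)\<^sup>2 \<partial>lborel) = W" for i by (simp only: Gint(3) W_def)
      show "(\<lambda>x. f0 x + (\<Sum>i\<in>I. w i * G i x)) \<in> L2_densities" if "w \<in> I \<rightarrow>\<^sub>E {1, - 1}" for w
        unfolding fw_eq by (rule fw_facts(1)[OF that])
      show "(\<lambda>x. f0 x + (\<Sum>i\<in>I. w i * G i x)) \<in> class_F (((\<beta>, r), q), (L, Q))" if "w \<in> I \<rightarrow>\<^sub>E {1, - 1}" for w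
        unfolding fw_eq by (rule fw_facts(2)[OF that])
      show "L2norm (\<lambda>x. f0 x + (\<Sum>i\<in>I. w i * G i x)) = bw" if "w \<in> I \<rightarrow>\<^sub>E {1, - 1}" for w
        unfolding fw_eq by (rule bw_eq[OF that])
    qed (use Gh Gf Gint(2) B N in auto)
    moreover have "ennreal (B * (x0\<^sup>2 / 8) * S powr (1 - 2 * b)) \<le> ennreal (B * (bw - L2norm f0)\<^sup>2 / 8)"
    proof (rule ennreal_leI)
      have "(x0 * S powr (1 / 2 - b))\<^sup>2 \<le> (bw - L2norm f0)\<^sup>2" using gap gap0 by (intro power_mono) auto
      moreover have "(x0 * S powr (1 / 2 - b))\<^sup>2 = x0\<^sup>2 * S powr (1 - 2 * b)"
        using S by (simp add: power_mult_distrib powr_powr algebra_simps flip: powr_numeral)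
      ultimately show "B * (x0\<^sup>2 / 8) * S powr (1 - 2 * b) \<le> B * (bw - L2norm f0)\<^sup>2 / 8"
        using B mult_left_mono[of "x0\<^sup>2 * S powr (1 - 2 * b)" "(bw - L2norm f0)\<^sup>2" B] by simp
    qed
    ultimately show "ennreal (B * (x0\<^sup>2 / 8) * S powr (1 - 2 * b)) \<le> ennreal A * (risk n N (class_F (((\<gamma>, s), q'), (L', Q'))))\<^sup>2
         + ennreal B * (risk n N (class_F (((\<beta>, r), q), (L, Q))))\<^sup>2"
      by (rule order_trans[rotated])
  qed
qed

section \<open>Non-emptiness of the classes and the choice of the volume S\<close>

text \<open>For an empty class every risk is 0, being a supremum over the empty set. Since
  estimators exist, the infimum over them is 0 as well, against the lower bound on the minimax
  risk.\<close>

lemma has_minimax_rate_nonempty: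
  fixes \<theta> :: "'d::finite param"
  assumes "has_minimax_rate (\<theta>, \<eta>)"
  obtains f where "f \<in> class_F (\<theta>, \<eta>)" "f \<in> L2_densities"
proof (rule ccontr)
  assume "\<not> thesis"
  then have e: "class_F (\<theta>, \<eta>) \<inter> L2_densities = {}" using that by blast
  have "risk n N (class_F (\<theta>, \<eta>)) = 0" for n N by (simp add: risk_def e bot_ennreal)
  moreover have "(estimators n :: ((nat \<Rightarrow> real ^ 'd) \<Rightarrow> real) set) \<noteq> {}" for n
    using assms by (auto simp: has_minimax_rate_def)
  ultimately show False using assms by (simp add: has_minimax_rate_def Liminf_const)
qed

text \<open>A density has L_1 norm 1, and the assumption on the minimax risk puts some density into
  the class.\<close>

lemma radius_ge_1:
  fixes \<beta> :: "'d::finite \<Rightarrow> real"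
  assumes "has_minimax_rate (((\<beta>, r), q), (L, Q))" "0 < L j" "r j = 1"
  shows "1 \<le> L j"
proof -
  obtain f where f: "f \<in> class_F (((\<beta>, r), q), (L, Q))" "f \<in> L2_densities"
    by (rule has_minimax_rate_nonempty[OF assms(1)])
  have "f \<in> nikolskii r \<beta> L" using f(1) by simp
  then have "f \<in> borel_measurable borel" "Lnorm (r j) f \<le> ennreal (L j)" unfolding nikolskii_def by blast+
  then have "norm_le 1 f (L j)" by (simp add: norm_le_def assms(3))
  then have "(\<integral>\<^sup>+x. ennreal \<bar>f x\<bar> \<partial>lborel) \<le> ennreal (L j)" using assms(2) by (auto simp: norm_le_finite)
  moreover have "(\<integral>\<^sup>+x. ennreal \<bar>f x\<bar> \<partial>lborel) = 1" using f(2) by (simp add: L2_densities_def)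
  ultimately show ?thesis by simp
qed

text \<open>S solves c n^2 S^w = 2 (\<alpha> - z) ln n. The exponential is then n^(2 (\<alpha> -
  z)), and the normalising factor is at most n^(2 z) as soon as ln n >= 1; their product stays below
  n^(2 \<alpha>). With x = sqrt(ln n) / n the equation reads S^w = \<kappa> x^2, so S^(z w) cancels
  the normalising factor up to a constant.\<close>

lemma calibration:
  fixes w z \<alpha> c :: real
  assumes "0 < w" "0 \<le> z" "z < \<alpha>" "0 < c"
  defines "\<kappa> \<equiv> 2 * (\<alpha> - z) / c"
  shows "\<forall>\<^sub>F n :: nat in sequentially. \<exists>S. 0 < S \<and> S \<le> 1
    \<and> (sqrt (ln (real n)) / real n) powr (- 2 * z) * exp (c * (real n)\<^sup>2 * S powr w) \<le> real n powr (2 * \<alpha>)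
    \<and> (sqrt (ln (real n)) / real n) powr (- 2 * z) * S powr (z * w) = \<kappa> powr z"
proof -
  have \<kappa>: "0 < \<kappa>" using assms by (simp add: \<kappa>_def)
  have "\<forall>\<^sub>F n :: nat in sequentially. \<kappa> * ln (real n) / (real n)\<^sup>2 \<le> 1" using \<kappa> by real_asymp
  moreover have "\<forall>\<^sub>F n :: nat in sequentially. 1 \<le> ln (real n)" by real_asymp
  ultimately show ?thesis using eventually_gt_at_top[of 0]
  proof eventually_elim
    case (elim n)
    define x where "x = sqrt (ln (real n)) / real n"
    have n: "0 < real n" using elim(3) by simp
    have ln: "0 < ln (real n)" using elim(2) by linarith
    have x: "1 / real n \<le> x" "0 < x" using elim(2) n divide_pos_pos[OF real_sqrt_gt_zero[OF ln] n] by (simp_all only: x_def) (simp add: divide_right_mono)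
    define y where "y = \<kappa> * ln (real n) / (real n)\<^sup>2"
    have yx: "y = \<kappa> * x powr 2" using elim(2) n x(2) by (simp add: y_def x_def power_divide)
    have y: "0 < y" "y \<le> 1"
      using elim(1) \<kappa> x(2) by (simp add: yx, simp only: y_def)
    define S where "S = y powr (1 / w)"
    have S: "0 < S" "S \<le> 1" using y assms(1) by (auto simp: S_def intro!: powr_le1)
    have Sw: "S powr w = y" "S powr (z * w) = y powr z" using y assms(1) by (simp_all add: S_def powr_powr)
    have "c * (real n)\<^sup>2 * S powr w = 2 * (\<alpha> - z) * ln (real n)"
      unfolding Sw y_def \<kappa>_def using n assms(4) by simp
    then have "exp (c * (real n)\<^sup>2 * S powr w) = real n powr (2 * (\<alpha> - z))"
      using n by (simp only:) (simp add: powr_def)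
    moreover have "x powr (- 2 * z) \<le> real n powr (2 * z)"
    proof -
      have "x powr (- 2 * z) \<le> (1 / real n) powr (- 2 * z)" using x n assms(2) by (intro powr_mono2') auto
      also have "\<dots> = real n powr (2 * z)" using n by (simp add: powr_divide powr_minus)
      finally show ?thesis .
    qed
    ultimately have "x powr (- 2 * z) * exp (c * (real n)\<^sup>2 * S powr w) \<le> real n powr (2 * z) * real n powr (2 * (\<alpha> - z))"
      by (simp add: mult_right_mono)
    also have "\<dots> = real n powr (2 * \<alpha>)" by (simp add: powr_add[symmetric] algebra_simps)
    finally have 1: "x powr (- 2 * z) * exp (c * (real n)\<^sup>2 * S powr w) \<le> real n powr (2 * \<alpha>)" .
    have "x powr (- 2 * z) * S powr (z * w) = \<kappa> powr z * (x powr (- 2 * z) * x powr (2 * z))"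
      using \<kappa> x(2) by (simp add: Sw yx powr_mult powr_powr del: powr_numeral)
    also have "\<dots> = \<kappa> powr z" using x(2) by (simp add: powr_add[symmetric])
    finally show ?case using S 1 unfolding x_def by blast
  qed
qed

theorem proposition2:
  fixes \<theta> \<theta>' :: "'d::finite param" and \<eta> \<eta>' :: "'d radii" and \<alpha> :: real
  assumes "\<theta> \<in> Theta''" and "\<theta>' \<in> Theta''_at \<theta>"
    and "\<alpha> \<in> {rate_exp \<theta> <..< rate_exp \<theta>'}"
    and "\<eta> \<in> Theta_c" and "\<eta>' \<in> Theta_c"
    and "has_minimax_rate (\<theta>, \<eta>)" and "has_minimax_rate (\<theta>', \<eta>')"
  shows "0 < liminf (\<lambda>n. INF N\<in>estimators n.
      ennreal (real n powr (2 * \<alpha>)) * (risk n N (class_F (\<theta>', \<eta>')))\<^sup>2 +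
      ennreal ((sqrt (ln (real n)) / real n) powr (- 2 * rate_exp \<theta>)) *
        (risk n N (class_F (\<theta>, \<eta>)))\<^sup>2)"
proof -
  obtain \<beta> r q where \<theta>: "\<theta> = ((\<beta>, r), q)" by (metis surj_pair)
  obtain \<gamma> s q' where \<theta>': "\<theta>' = ((\<gamma>, s), q')" by (metis surj_pair)
  obtain L Q where \<eta>: "\<eta> = (L, Q)" by (metis surj_pair)
  obtain L' Q' where \<eta>': "\<eta>' = (L', Q')" by (metis surj_pair)
  have T: "((\<beta>, r), q) \<in> Theta''" using assms(1) by (simp only: \<theta>)
  have T': "((\<gamma>, s), q') \<in> Theta''" and \<rho>: "1 \<le> rho ((\<beta>, r), q) ((\<gamma>, s), q')" and qq: "q' \<le> q"
    using assms(2) unfolding Theta''_at_def \<theta> \<theta>' by (auto simp del: rho.simps rate_exp.simps)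
  have L: "0 < L j" "0 < Q" and L': "0 < L' j" "0 < Q'" for j
    using assms(4,5) by (auto simp: \<eta> \<eta>' Theta_c_def)
  have mm: "has_minimax_rate (((\<beta>, r), q), (L, Q))" and mm': "has_minimax_rate (((\<gamma>, s), q'), (L', Q'))"
    using assms(6,7) by (simp_all only: \<theta> \<theta>' \<eta> \<eta>')
  have rq: "r j \<le> q" for j
    using not_has_minimax_rate[OF T, of L Q j] assms(4) mm by (force simp: \<eta> not_less[symmetric])
  have sq: "s j \<le> q'" for j
    using not_has_minimax_rate[OF T', of L' Q' j] assms(5) mm' by (force simp: \<eta>' not_less[symmetric])
  define b where "b = recip q"
  define E where "E = inv_omega (\<beta>, r) - inv_beta (\<beta>, r) * recip q"
  define z where "z = rate_exp \<theta>"
  have bE: "b \<le> 1 / 2" "1 < E" using Theta''_exponents(6,7)[OF T] by (auto simp: b_def E_def)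
  have z: "z = (1 - 2 * b) / (1 - 2 * b + E)"
    unfolding z_def \<theta> rate_exp_sparse[OF T] b_def E_def by simp
  have z0: "0 \<le> z" using bE by (simp add: z)
  have z\<alpha>: "z < \<alpha>" "\<alpha> < rate_exp \<theta>'" using assms(3) by (auto simp: z_def)
  \<comment> \<open>For q' = 2 the exponent of the second class would be 0, but it exceeds \<alpha>
    > z >= 0.\<close>
  have q': "2 < q'"
  proof -
    have "0 < rate_exp ((\<gamma>, s), q')" using z0 z\<alpha> by (simp only: \<theta>')
    then have "q' \<noteq> 2" unfolding rate_exp_sparse[OF T'] by (auto simp: recip_2)
    then show ?thesis using Theta''_exponents(3)[OF T'] by (simp add: less_le)
  qed
  show ?thesis
  proof (rule class_lower_bound[OF T T' rq sq qq q' \<rho> L(1) radius_ge_1[OF mm L(1)] L(2) L'(1) radius_ge_1[OF mm' L'(1)] L'(2),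
        folded b_def E_def])
    fix c1 c2 :: real assume c: "0 < c1" "0 < c2"
    and bound: "\<And>S n N A B. \<lbrakk>0 < S; S \<le> 1; 0 \<le> B; B * exp (c1 * (real n)\<^sup>2 * S powr (1 - 2 * b + E)) \<le> A; N \<in> estimators n\<rbrakk> \<Longrightarrow>
       ennreal (B * c2 * S powr (1 - 2 * b)) \<le> ennreal A * (risk n N (class_F (((\<gamma>, s), q'), (L', Q'))))\<^sup>2
         + ennreal B * (risk n N (class_F (((\<beta>, r), q), (L, Q))))\<^sup>2"
    define w where "w = 1 - 2 * b + E"
    \<comment> \<open>The relation z w = 1 - 2b identifies S^(z w) in \<open>calibration\<close>
      with the squared distance of the norms in the lower bound; it is the formula for z in the
      sparse zone.\<close>
    have w: "0 < w" "z * w = 1 - 2 * b" using bE by (auto simp: w_def z)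
    define \<kappa> where "\<kappa> = (2 * (\<alpha> - z) / c1) powr z"
    have \<kappa>: "0 < \<kappa>" using z\<alpha> c by (simp add: \<kappa>_def)
    have "\<forall>\<^sub>F n in sequentially. ennreal (c2 * \<kappa>) \<le> (INF N\<in>estimators n.
        ennreal (real n powr (2 * \<alpha>)) * (risk n N (class_F (\<theta>', \<eta>')))\<^sup>2 +
        ennreal ((sqrt (ln (real n)) / real n) powr (- 2 * rate_exp \<theta>)) * (risk n N (class_F (\<theta>, \<eta>)))\<^sup>2)"
      using calibration[OF w(1) z0 z\<alpha>(1) c(1)]
    proof eventually_elim
      case (elim n)
      define B where "B = (sqrt (ln (real n)) / real n) powr (- 2 * z)"
      from elim obtain S where S: "0 < S" "S \<le> 1" "B * exp (c1 * (real n)\<^sup>2 * S powr w) \<le> real n powr (2 * \<alpha>)"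
        "B * S powr (1 - 2 * b) = \<kappa>" unfolding B_def[symmetric] \<kappa>_def[symmetric] w(2) by blast
      have B: "0 \<le> B" by (simp add: B_def)
      have eq: "B * c2 * S powr (1 - 2 * b) = c2 * \<kappa>" using S(4) by (metis mult.assoc mult.commute)
      show ?case unfolding z_def[symmetric] unfolding B_def[symmetric] unfolding \<theta> \<theta>' \<eta> \<eta>'
        by (rule INF_greatest) (use bound[OF S(1,2) B S(3)[unfolded w_def]] in \<open>simp only: eq\<close>)
    qed
    then have "ennreal (c2 * \<kappa>) \<le> liminf (\<lambda>n. INF N\<in>estimators n.
        ennreal (real n powr (2 * \<alpha>)) * (risk n N (class_F (\<theta>', \<eta>')))\<^sup>2 +
        ennreal ((sqrt (ln (real n)) / real n) powr (- 2 * rate_exp \<theta>)) * (risk n N (class_F (\<theta>, \<eta>)))\<^sup>2)"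
      by (rule Liminf_bounded)
    moreover have "0 < ennreal (c2 * \<kappa>)" using c \<kappa> by simp
    ultimately show ?thesis by (rule order.strict_trans2[rotated])
  qed
qed

end
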